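(* Let $g$ be a Lorentzian metric of class $C^2$ on $M$. Given a null hypersurface $H\subset M$ of class $C^2$ and a global null-geodesic vector field $L$ of class $C^1$ on $H$, there exists a unique measure $\mathrm{vol}_L$ on $H$ such that, for every space-like local cross-section $S\subset H$ of class $C^2$, $$\widetilde{\mathrm{vol}}_L^S=\mathrm{vol}_L\llcorner_{\Omega_S}.$$
   Context: $M$ is a smooth time-oriented manifold of dimension $n\ge3$ with metric $g$ of signature $(-,+,\dots,+)$. A hypersurface $H\subset M$ is null if $g|_{TH}$ is degenerate; then $\mathscr N H=\{v\in TM|_H: g(v,w)=0\ \forall w\in TH\}$ is a line sub-bundle of $TH$. A null-geodesic vector field on $H$ is a nowhere vanishing future-directed section $L$ of $\mathscr NH$ with $\nabla_LL=0$. A space-like local cross-section is an $(n-2)$-dimensional submanifold $S\subset H$ on which $g$ is positive definite. $\Psi_L(z,t)=\exp_z(tL(z))$ whenever this is defined and lies in $H$. For a local cross-section $S$, let $\overline{L^S}$ be the unique vector field along $S$ with $g(\overline{L^S},X)=0$ for all $X\in TS$, $g(\overline{L^S},L)=-1$, $g(\overline{L^S},\overline{L^S})=0$, extended by parallel transport along the curves $t\mapsto\Psi_L(z,t)$, $z\in S$. Let $\mathcal V\subset S\times\mathbb R$ be an open set containing $S\times\{0\}$, with $\{t:(z,t)\in\mathcal V\}$ an interval for each $z$, on which $\Psi_L$ is a diffeomorphism onto its open image $\Omega_S\subset H$. On $\Omega_S$ put $\alpha(v)=-g(\overline{L^S},v)$ for $v\in TH$; then $\tilde g_L^S=g|_{TH}+\alpha\otimes\alpha$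 is a Riemannian metric on $\Omega_S$ (the rigged metric), and $\widetilde{\mathrm{vol}}_L^S$ denotes its Riemannian volume measure. *)

theory Defs
  imports "HOL-Analysis.Analysis"
begin

section \<open>Functions of class C^k on open sets\<close>

text \<open>Only used on open sets \<open>S\<close>, where \<open>frechet_derivative f (at x)\<close> is the derivative of
  the restriction of \<open>f\<close> to \<open>S\<close>.\<close>

primrec Ck_on ::
  "nat \<Rightarrow> 'x::real_normed_vector set \<Rightarrow> ('x \<Rightarrow> 'y::real_normed_vector) \<Rightarrow> bool" where
  "Ck_on 0 S f \<longleftrightarrow> continuous_on S f"
| "Ck_on (Suc k) S f \<longleftrightarrow>
     (\<forall>x\<in>S. f differentiable (at x)) \<and>
     (\<forall>u. Ck_on k S (\<lambda>x. frechet_derivative f (at x) u))"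


section \<open>Smooth manifolds and tangent vectors\<close>

text \<open>The manifold is the whole type \<open>'a\<close> (Hausdorff and second countable in the theorem), with a
  smooth atlas \<open>A\<close>; a chart is a pair of a domain and a coordinate map.\<close>

type_synonym ('a, 'n) chart = "'a set \<times> ('a \<Rightarrow> real ^ 'n)"

definition chart_inv :: "('a, 'n::finite) chart \<Rightarrow> real ^ 'n \<Rightarrow> 'a" where
  "chart_inv c = inv_into (fst c) (snd c)"

definition smooth_atlas :: "('a::topological_space, 'n::finite) chart set \<Rightarrow> bool" where
  "smooth_atlas A \<longleftrightarrow>
     (\<Union>c\<in>A. fst c) = UNIV \<and>
     (\<forall>c\<in>A. open (fst c) \<and> open (snd c ` fst c) \<and>
        homeomorphism (fst c) (snd c ` fst c) (snd c) (chart_inv c)) \<and>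
     (\<forall>c\<in>A. \<forall>d\<in>A. \<forall>k. Ck_on k (snd c ` (fst c \<inter> fst d)) (snd d \<circ> chart_inv c))"

text \<open>A tangent vector is the family of its components in all charts around its base point
  (and 0 in all other charts), related by the Jacobians of the coordinate changes.\<close>

type_synonym ('a, 'n) tvec = "('a, 'n) chart \<Rightarrow> real ^ 'n"

definition tspace :: "('a, 'n::finite) chart set \<Rightarrow> 'a \<Rightarrow> ('a, 'n) tvec set" where
  "tspace A p =
     {v. (\<forall>c. \<not> (c \<in> A \<and> p \<in> fst c) \<longrightarrow> v c = 0) \<and>
         (\<forall>c\<in>A. \<forall>d\<in>A. p \<in> fst c \<and> p \<in> fst d \<longrightarrow>
            v d = frechet_derivative (snd d \<circ> chart_inv c) (at (snd c p)) (v c))}"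

abbreviation zero_tvec :: "('a, 'n::finite) tvec" where
  "zero_tvec \<equiv> (\<lambda>_. 0)"

definition scale_tvec :: "real \<Rightarrow> ('a, 'n::finite) tvec \<Rightarrow> ('a, 'n) tvec" where
  "scale_tvec t v = (\<lambda>c. t *\<^sub>R v c)"

text \<open>\<open>tmap A f x u\<close> is the differential at \<open>x\<close>, in direction \<open>u\<close>, of a map \<open>f\<close> from an open subset
  of a normed space to the manifold. For a curve \<open>f\<close>, \<open>tmap A f t 1\<close> is its velocity at \<open>t\<close>.\<close>

definition tmap ::
  "('a, 'n::finite) chart set \<Rightarrow> ('x::real_normed_vector \<Rightarrow> 'a) \<Rightarrow> 'x \<Rightarrow> 'x \<Rightarrow> ('a, 'n) tvec" where
  "tmap A f x u =
     (\<lambda>c. if c \<in> A \<and> f x \<in> fst c then frechet_derivative (snd c \<circ> f) (at x) u else 0)"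

definition Ck_map ::
  "('a::topological_space, 'n::finite) chart set \<Rightarrow> nat \<Rightarrow> 'x::real_normed_vector set \<Rightarrow>
   ('x \<Rightarrow> 'a) \<Rightarrow> bool" where
  "Ck_map A k W f \<longleftrightarrow>
     continuous_on W f \<and> (\<forall>c\<in>A. Ck_on k (W \<inter> f -` fst c) (snd c \<circ> f))"


section \<open>Submanifolds of class C^k\<close>

text \<open>A local parametrization of \<open>N\<close> is a C^k immersion of an open set \<open>W\<close> of Euclidean space which
  is a homeomorphism onto a relatively open subset of \<open>N\<close>.\<close>

definition params ::
  "('a::topological_space, 'n::finite) chart set \<Rightarrow> nat \<Rightarrow> 'a set \<Rightarrow>
   ((real ^ 'm::finite) set \<times> (real ^ 'm \<Rightarrow> 'a)) set" where
  "params A k N =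
     {(W, \<psi>). open W \<and> openin (top_of_set N) (\<psi> ` W) \<and>
        homeomorphism W (\<psi> ` W) \<psi> (inv_into W \<psi>) \<and>
        Ck_map A k W \<psi> \<and>
        (\<forall>x\<in>W. \<forall>u. tmap A \<psi> x u = zero_tvec \<longrightarrow> u = 0)}"

definition submanifold ::
  "'m::finite itself \<Rightarrow> ('a::topological_space, 'n::finite) chart set \<Rightarrow> nat \<Rightarrow> 'a set \<Rightarrow> bool" where
  "submanifold TYPE('m) A k N \<longleftrightarrow>
     (\<forall>p\<in>N. \<exists>(W, \<psi>::real ^ 'm \<Rightarrow> 'a) \<in> params A k N. p \<in> \<psi> ` W)"

text \<open>Hypersurfaces and cross-sections are of class C^2, so C^2 parametrizations are used for the
  tangent spaces, and below for the volume measure.\<close>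

definition sub_tspace ::
  "'m::finite itself \<Rightarrow> ('a::topological_space, 'n::finite) chart set \<Rightarrow> 'a set \<Rightarrow> 'a \<Rightarrow>
   ('a, 'n) tvec set" where
  "sub_tspace TYPE('m) A N p =
     {v. \<exists>W (\<psi>::real ^ 'm \<Rightarrow> 'a) x u. (W, \<psi>) \<in> params A 2 N \<and> x \<in> W \<and> \<psi> x = p \<and> v = tmap A \<psi> x u}"

definition Ck_field_along ::
  "'m::finite itself \<Rightarrow> ('a::topological_space, 'n::finite) chart set \<Rightarrow> nat \<Rightarrow> 'a set \<Rightarrow>
   ('a \<Rightarrow> ('a, 'n) tvec) \<Rightarrow> bool" where
  "Ck_field_along TYPE('m) A k N X \<longleftrightarrow>
     (\<forall>p\<in>N. X p \<in> tspace A p) \<and>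
     (\<forall>(W, \<psi>::real ^ 'm \<Rightarrow> 'a) \<in> params A (Suc k) N. \<forall>c\<in>A.
        Ck_on k (W \<inter> \<psi> -` fst c) (\<lambda>x. X (\<psi> x) c))"


section \<open>Lorentzian metrics and the Levi-Civita connection\<close>

text \<open>A (0,2)-tensor is only meaningful on pairs of elements of \<open>tspace A p\<close>.\<close>

type_synonym ('a, 'n) tensor2 = "'a \<Rightarrow> ('a, 'n) tvec \<Rightarrow> ('a, 'n) tvec \<Rightarrow> real"

text \<open>The coordinate expression of \<open>g\<close> in the chart \<open>c\<close> at the coordinate point \<open>x\<close>.\<close>

definition metric_in ::
  "('a, 'n::finite) chart set \<Rightarrow> ('a, 'n) tensor2 \<Rightarrow> ('a, 'n) chart \<Rightarrow> real ^ 'n \<Rightarrow>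
   real ^ 'n \<Rightarrow> real ^ 'n \<Rightarrow> real" where
  "metric_in A g c x u v =
     g (chart_inv c x) (tmap A (chart_inv c) x u) (tmap A (chart_inv c) x v)"

definition lorentzian_metric ::
  "('a, 'n::finite) chart set \<Rightarrow> nat \<Rightarrow> ('a, 'n) tensor2 \<Rightarrow> bool" where
  "lorentzian_metric A k g \<longleftrightarrow>
     (\<forall>c\<in>A.
        (\<forall>x \<in> snd c ` fst c.
           bilinear (metric_in A g c x) \<and>
           (\<forall>u v. metric_in A g c x u v = metric_in A g c x v u) \<and>
           (\<exists>(E::'n \<Rightarrow> real ^ 'n) i0. \<forall>i j.
              metric_in A g c x (E i) (E j) =
                (if i \<noteq> j then 0 else if i = i0 then - 1 else 1))) \<and>
        (\<forall>u v. Ck_on k (snd c ` fst c) (\<lambda>x. metric_in A g c x u v)))"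

text \<open>A time-orientation is given by a continuous time-like vector field \<open>T\<close>.\<close>

definition time_orientation ::
  "('a::topological_space, 'n::finite) chart set \<Rightarrow> ('a, 'n) tensor2 \<Rightarrow>
   ('a \<Rightarrow> ('a, 'n) tvec) \<Rightarrow> bool" where
  "time_orientation A g T \<longleftrightarrow>
     (\<forall>p. T p \<in> tspace A p \<and> g p (T p) (T p) < 0) \<and>
     (\<forall>c\<in>A. continuous_on (fst c) (\<lambda>p. T p c))"

definition future_directed ::
  "('a, 'n::finite) tensor2 \<Rightarrow> ('a \<Rightarrow> ('a, 'n) tvec) \<Rightarrow> 'a \<Rightarrow> ('a, 'n) tvec \<Rightarrow> bool" where
  "future_directed g T p v \<longleftrightarrow> v \<noteq> zero_tvec \<and> g p v v \<le> 0 \<and> g p (T p) v < 0"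

text \<open>The vector with components
  \<open>\<Sum>i j. \<Gamma>\<^sup>k\<^sub>i\<^sub>j u\<^sup>i v\<^sup>j = (\<Sum>l. g\<^sup>k\<^sup>l (D\<^sub>u g(v, e\<^sub>l) + D\<^sub>v g(u, e\<^sub>l) - D\<^sub>l g(u, v))) / 2\<close>.\<close>

definition christoffel ::
  "('a, 'n::finite) chart set \<Rightarrow> ('a, 'n) tensor2 \<Rightarrow> ('a, 'n) chart \<Rightarrow> real ^ 'n \<Rightarrow>
   real ^ 'n \<Rightarrow> real ^ 'n \<Rightarrow> real ^ 'n" where
  "christoffel A g c x u v =
     matrix_inv (\<chi> i j. metric_in A g c x (axis i 1) (axis j 1)) *v
     (\<chi> l. (frechet_derivative (\<lambda>y. metric_in A g c y v (axis l 1)) (at x) u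
            + frechet_derivative (\<lambda>y. metric_in A g c y u (axis l 1)) (at x) v
            - frechet_derivative (\<lambda>y. metric_in A g c y u v) (at x) (axis l 1)) / 2)"

text \<open>The components in the chart \<open>c\<close> of the covariant derivative at \<open>x\<close>, in direction \<open>u\<close>, of a
  vector field \<open>X\<close> along the map \<open>f\<close>.\<close>

definition cov_deriv ::
  "('a, 'n::finite) chart set \<Rightarrow> ('a, 'n) tensor2 \<Rightarrow> ('a, 'n) chart \<Rightarrow>
   ('x::real_normed_vector \<Rightarrow> 'a) \<Rightarrow> ('x \<Rightarrow> ('a, 'n) tvec) \<Rightarrow> 'x \<Rightarrow> 'x \<Rightarrow> real ^ 'n" where
  "cov_deriv A g c f X x u =
     frechet_derivative (\<lambda>y. X y c) (at x) u
     + christoffel A g c (snd c (f x)) (frechet_derivative (snd c \<circ> f) (at x) u) (X x c)"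

definition parallel_along ::
  "('a, 'n::finite) chart set \<Rightarrow> ('a, 'n) tensor2 \<Rightarrow> real set \<Rightarrow> (real \<Rightarrow> 'a) \<Rightarrow>
   (real \<Rightarrow> ('a, 'n) tvec) \<Rightarrow> bool" where
  "parallel_along A g I \<gamma> X \<longleftrightarrow>
     (\<forall>t\<in>I. X t \<in> tspace A (\<gamma> t) \<and>
        (\<forall>c\<in>A. \<gamma> t \<in> fst c \<longrightarrow>
           (\<lambda>s. X s c) differentiable (at t) \<and> cov_deriv A g c \<gamma> X t 1 = 0))"

definition geodesic ::
  "('a::topological_space, 'n::finite) chart set \<Rightarrow> ('a, 'n) tensor2 \<Rightarrow> real set \<Rightarrow>
   (real \<Rightarrow> 'a) \<Rightarrow> bool" where
  "geodesic A g I \<gamma> \<longleftrightarrow>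
     open I \<and> is_interval I \<and> Ck_map A 2 I \<gamma> \<and> parallel_along A g I \<gamma> (\<lambda>t. tmap A \<gamma> t 1)"

definition exp_rel ::
  "('a::topological_space, 'n::finite) chart set \<Rightarrow> ('a, 'n) tensor2 \<Rightarrow> 'a \<Rightarrow> ('a, 'n) tvec \<Rightarrow>
   'a \<Rightarrow> bool" where
  "exp_rel A g z v q \<longleftrightarrow>
     (\<exists>I \<gamma>. geodesic A g I \<gamma> \<and> 0 \<in> I \<and> 1 \<in> I \<and> \<gamma> 0 = z \<and> tmap A \<gamma> 0 1 = v \<and> \<gamma> 1 = q)"

definition exp_defined ::
  "('a::topological_space, 'n::finite) chart set \<Rightarrow> ('a, 'n) tensor2 \<Rightarrow> 'a \<Rightarrow> ('a, 'n) tvec \<Rightarrow>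
   bool" where
  "exp_defined A g z v \<longleftrightarrow> (\<exists>q. exp_rel A g z v q)"

definition exp_map ::
  "('a::topological_space, 'n::finite) chart set \<Rightarrow> ('a, 'n) tensor2 \<Rightarrow> 'a \<Rightarrow> ('a, 'n) tvec \<Rightarrow>
   'a" where
  "exp_map A g z v = (THE q. exp_rel A g z v q)"


section \<open>Null hypersurfaces, null-geodesic vector fields and cross-sections\<close>

definition null_hypersurface ::
  "'m::finite itself \<Rightarrow> ('a::topological_space, 'n::finite) chart set \<Rightarrow> nat \<Rightarrow>
   ('a, 'n) tensor2 \<Rightarrow> 'a set \<Rightarrow> bool" where
  "null_hypersurface TYPE('m) A k g H \<longleftrightarrow>
     CARD('m) + 1 = CARD('n) \<and> submanifold TYPE('m) A k H \<and>
     (\<forall>p\<in>H. \<exists>v \<in> sub_tspace TYPE('m) A H p.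
        v \<noteq> zero_tvec \<and> (\<forall>w \<in> sub_tspace TYPE('m) A H p. g p v w = 0))"

definition normal_space ::
  "'m::finite itself \<Rightarrow> ('a::topological_space, 'n::finite) chart set \<Rightarrow>
   ('a, 'n) tensor2 \<Rightarrow> 'a set \<Rightarrow> 'a \<Rightarrow> ('a, 'n) tvec set" where
  "normal_space TYPE('m) A g H p =
     {v \<in> tspace A p. \<forall>w \<in> sub_tspace TYPE('m) A H p. g p v w = 0}"

text \<open>As \<open>L\<close> is tangent to \<open>H\<close> but only defined on \<open>H\<close>, \<open>\<nabla>\<^sub>L L\<close> is computed as the covariant derivative
  of \<open>L \<circ> \<psi>\<close> along a local parametrization \<open>\<psi>\<close> of \<open>H\<close>.\<close>

definition null_geodesic_field ::
  "'m::finite itself \<Rightarrow> ('a::topological_space, 'n::finite) chart set \<Rightarrow> ('a, 'n) tensor2 \<Rightarrow>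
   ('a \<Rightarrow> ('a, 'n) tvec) \<Rightarrow> 'a set \<Rightarrow> ('a \<Rightarrow> ('a, 'n) tvec) \<Rightarrow> bool" where
  "null_geodesic_field TYPE('m) A g T H L \<longleftrightarrow>
     Ck_field_along TYPE('m) A 1 H L \<and>
     (\<forall>p\<in>H. L p \<in> normal_space TYPE('m) A g H p \<and> L p \<noteq> zero_tvec \<and>
        future_directed g T p (L p)) \<and>
     (\<forall>(W, \<psi>::real ^ 'm \<Rightarrow> 'a) \<in> params A 2 H. \<forall>x\<in>W. \<forall>u. tmap A \<psi> x u = L (\<psi> x) \<longrightarrow>
        (\<forall>c\<in>A. \<psi> x \<in> fst c \<longrightarrow> cov_deriv A g c \<psi> (L \<circ> \<psi>) x u = 0))"

definition spacelike_cross_section ::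
  "'k::finite itself \<Rightarrow> ('a::topological_space, 'n::finite) chart set \<Rightarrow> nat \<Rightarrow>
   ('a, 'n) tensor2 \<Rightarrow> 'a set \<Rightarrow> 'a set \<Rightarrow> bool" where
  "spacelike_cross_section TYPE('k) A k g H S \<longleftrightarrow>
     CARD('k) + 2 = CARD('n) \<and> S \<subseteq> H \<and> submanifold TYPE('k) A k S \<and>
     (\<forall>z\<in>S. \<forall>v \<in> sub_tspace TYPE('k) A S z. v \<noteq> zero_tvec \<longrightarrow> g z v v > 0)"

definition null_flow ::
  "('a::topological_space, 'n::finite) chart set \<Rightarrow> ('a, 'n) tensor2 \<Rightarrow>
   ('a \<Rightarrow> ('a, 'n) tvec) \<Rightarrow> 'a \<times> real \<Rightarrow> 'a" where
  "null_flow A g L = (\<lambda>(z, t). exp_map A g z (scale_tvec t (L z)))"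

text \<open>\<open>F\<close> maps the open subset \<open>V\<close> of \<open>S \<times> \<real>\<close> onto the open subset \<open>F ` V\<close> of \<open>H\<close>, and \<open>F\<close> and its
  inverse are of class C^k in local parametrizations of \<open>S\<close> and \<open>H\<close>.\<close>

definition diffeo_onto_image ::
  "'k::finite itself \<Rightarrow> 'm::finite itself \<Rightarrow> ('a::topological_space, 'n::finite) chart set \<Rightarrow>
   nat \<Rightarrow> 'a set \<Rightarrow> 'a set \<Rightarrow> ('a \<times> real) set \<Rightarrow> ('a \<times> real \<Rightarrow> 'a) \<Rightarrow> bool" where
  "diffeo_onto_image TYPE('k) TYPE('m) A k S H V F \<longleftrightarrow>
     openin (top_of_set (S \<times> UNIV)) V \<and> openin (top_of_set H) (F ` V) \<and>
     homeomorphism V (F ` V) F (inv_into V F) \<and>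
     (\<forall>(W, \<sigma>::real ^ 'k \<Rightarrow> 'a) \<in> params A 2 S. \<forall>(U, \<psi>::real ^ 'm \<Rightarrow> 'a) \<in> params A 2 H.
        Ck_on k {(x, t). x \<in> W \<and> (\<sigma> x, t) \<in> V \<and> F (\<sigma> x, t) \<in> \<psi> ` U}
          (\<lambda>(x, t). inv_into U \<psi> (F (\<sigma> x, t))) \<and>
        Ck_on k {y \<in> U. \<psi> y \<in> F ` V \<and> fst (inv_into V F (\<psi> y)) \<in> \<sigma> ` W}
          (\<lambda>y. (inv_into W \<sigma> (fst (inv_into V F (\<psi> y))), snd (inv_into V F (\<psi> y)))))"

text \<open>The admissible open sets \<open>V \<subseteq> S \<times> \<real>\<close>. For a metric of class C^2 and \<open>L\<close> of class C^1 the
  flow map is of class C^1, and diffeomorphism is meant in this class.\<close>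

definition flow_domain ::
  "'k::finite itself \<Rightarrow> 'm::finite itself \<Rightarrow> ('a::topological_space, 'n::finite) chart set \<Rightarrow>
   ('a, 'n) tensor2 \<Rightarrow> 'a set \<Rightarrow> ('a \<Rightarrow> ('a, 'n) tvec) \<Rightarrow> 'a set \<Rightarrow> ('a \<times> real) set \<Rightarrow> bool" where
  "flow_domain TYPE('k) TYPE('m) A g H L S V \<longleftrightarrow>
     openin (top_of_set (S \<times> UNIV)) V \<and> S \<times> {0} \<subseteq> V \<and>
     (\<forall>z\<in>S. is_interval {t. (z, t) \<in> V}) \<and>
     (\<forall>(z, t)\<in>V. exp_defined A g z (scale_tvec t (L z)) \<and> null_flow A g L (z, t) \<in> H) \<and>
     diffeo_onto_image TYPE('k) TYPE('m) A 1 S H V (null_flow A g L)"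


section \<open>The rigged metric and its volume measure\<close>

text \<open>\<open>N\<close> is the transverse null field along \<open>S\<close>, extended to the image of \<open>V\<close> by parallel transport
  along the curves \<open>t \<mapsto> null_flow A g L (z, t)\<close>. These conditions determine \<open>N\<close> on that image.\<close>

definition rigging_field ::
  "'k::finite itself \<Rightarrow> ('a::topological_space, 'n::finite) chart set \<Rightarrow> ('a, 'n) tensor2 \<Rightarrow>
   ('a \<Rightarrow> ('a, 'n) tvec) \<Rightarrow> 'a set \<Rightarrow> ('a \<times> real) set \<Rightarrow> ('a \<Rightarrow> ('a, 'n) tvec) \<Rightarrow> bool" where
  "rigging_field TYPE('k) A g L S V N \<longleftrightarrow>
     (\<forall>z\<in>S. N z \<in> tspace A z \<and> (\<forall>v \<in> sub_tspace TYPE('k) A S z. g z (N z) v = 0) \<and>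
        g z (N z) (L z) = - 1 \<and> g z (N z) (N z) = 0) \<and>
     (\<forall>z\<in>S. parallel_along A g {t. (z, t) \<in> V}
        (\<lambda>t. null_flow A g L (z, t)) (\<lambda>t. N (null_flow A g L (z, t))))"

definition rigging_form ::
  "('a, 'n::finite) tensor2 \<Rightarrow> ('a \<Rightarrow> ('a, 'n) tvec) \<Rightarrow> 'a \<Rightarrow> ('a, 'n) tvec \<Rightarrow> real" where
  "rigging_form g N p v = - g p (N p) v"

definition rigged_metric ::
  "('a, 'n::finite) tensor2 \<Rightarrow> ('a \<Rightarrow> ('a, 'n) tvec) \<Rightarrow> ('a, 'n) tensor2" where
  "rigged_metric g N p v w = g p v w + rigging_form g N p v * rigging_form g N p w"

text \<open>The Riemannian volume measure of a Riemannian metric \<open>h\<close> on a submanifold \<open>D\<close> is the Borel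
  measure on \<open>D\<close> with density \<open>sqrt (det (h\<^sub>i\<^sub>j))\<close> in every local parametrization.\<close>

definition is_volume_measure ::
  "'m::finite itself \<Rightarrow> ('a::topological_space, 'n::finite) chart set \<Rightarrow> ('a, 'n) tensor2 \<Rightarrow>
   'a set \<Rightarrow> 'a measure \<Rightarrow> bool" where
  "is_volume_measure TYPE('m) A h D \<mu> \<longleftrightarrow>
     sets \<mu> = sets (restrict_space borel D) \<and>
     (\<forall>(W, \<psi>::real ^ 'm \<Rightarrow> 'a) \<in> params A 2 D. \<forall>B \<in> sets \<mu>. B \<subseteq> \<psi> ` W \<longrightarrow>
        emeasure \<mu> B =
          (\<integral>\<^sup>+ x \<in> W \<inter> \<psi> -` B.
             ennreal (sqrt (det (\<chi> i j. h (\<psi> x) (tmap A \<psi> x (axis i 1)) (tmap A \<psi> x (axis j 1)))))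
           \<partial>lborel))"

definition volume_measure ::
  "'m::finite itself \<Rightarrow> ('a::topological_space, 'n::finite) chart set \<Rightarrow> ('a, 'n) tensor2 \<Rightarrow>
   'a set \<Rightarrow> 'a measure" where
  "volume_measure TYPE('m) A h D = (THE \<mu>. is_volume_measure TYPE('m) A h D \<mu>)"

end

theory Submission imports Defs begin

text \<open>If \<open>a\<close> is a one-form with \<open>a(L) = 1\<close>, then the determinant of \<open>g\<^sub>i\<^sub>j + a\<^sub>i a\<^sub>j\<close> on \<open>TH\<close> does not depend on \<open>a\<close>,
  because \<open>L\<close> spans the kernel of \<open>g\<close> on \<open>TH\<close>. The form \<open>\<alpha>\<close> of a rigging satisfies \<open>\<alpha>(L) = 1\<close> on \<open>\<Omega>\<^sub>S\<close>: this
  holds on \<open>S\<close>, and both the rigging and \<open>L\<close> are parallel along the curves of the flow. Indeed, these are null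
  geodesics in \<open>H\<close>, so their velocities are multiples of \<open>L\<close>, and \<open>\<nabla>\<^sub>L L = 0\<close>. Hence all rigged volumes are
  restrictions of the volume of \<open>g + a \<otimes> a\<close> with \<open>a = g(T, \<cdot>) / g(T, L)\<close>, which is defined on all of \<open>H\<close>. For
  uniqueness, the geodesics starting in a small disc transversal to \<open>L\<close> are the integral curves of \<open>L\<close>, and it follows
  that the sets \<open>\<Omega>\<^sub>S\<close> cover \<open>H\<close>.\<close>

section \<open>Functions of class C^1\<close>

text \<open>Regularity is low throughout: the metric is C^2, \<open>L\<close> only C^1,
  \<open>T\<close> only continuous. Christoffel symbols, flow and changes of parametrization are
  therefore treated in class C^1, and maps given only implicitly are differentiated by
  \<open>implicit_derivative\<close>, which takes a continuous solution and a left inverse of a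
  partial derivative. Two notions are definite descriptions and carry no information until existence
  and uniqueness are known: \<open>exp_map\<close>, which needs uniqueness of geodesics, and
  \<open>volume_measure\<close>, which needs a measure glued from parametrizations and hence a
  change of variables. The condition on the measure also ranges over riggings \<open>N\<close>: a
  flow domain without any rigging would impose nothing, so uniqueness requires constructing a
  rigging on each domain of the cover by solving the equation of parallel transport. The comparison
  form is built from \<open>T\<close> because g(T, L) < 0 for a future-directed \<open>L\<close>, so
  the quotient is defined at every point and no cross-section enters it.\<close>

declare Ck_on.simps(2) [simp del] One_nat_def [simp del]

lemma Ck_on_1:
  "Ck_on 1 S f \<longleftrightarrow> (\<forall>x\<in>S. f differentiable (at x)) \<and>
     (\<forall>u. continuous_on S (\<lambda>x. frechet_derivative f (at x) u))"
  by (simp add: Ck_on.simps(2) One_nat_def)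

lemma C1_I:
  assumes "\<And>x. x \<in> S \<Longrightarrow> (f has_derivative f' x) (at x)"
    and "\<And>u. continuous_on S (\<lambda>x. f' x u)"
  shows "Ck_on 1 S f"
  unfolding Ck_on_1
proof (intro conjI ballI allI)
  fix x assume "x \<in> S" then show "f differentiable (at x)"
    using assms(1) by (auto simp: differentiable_def)
next
  fix u
  have "frechet_derivative f (at x) u = f' x u" if "x \<in> S" for x
    using frechet_derivative_at[OF assms(1)[OF that]] by simp
  then show "continuous_on S (\<lambda>x. frechet_derivative f (at x) u)"
    using assms(2)[of u] by (simp cong: continuous_on_cong)
qed

lemma C1_deriv:
  assumes "Ck_on 1 S f" "x \<in> S"
  shows "(f has_derivative frechet_derivative f (at x)) (at x)"
  using assms by (simp add: Ck_on_1 frechet_derivative_works)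

lemma C1_continuous_deriv:
  "Ck_on 1 S f \<Longrightarrow> continuous_on S (\<lambda>x. frechet_derivative f (at x) u)"
  by (simp add: Ck_on_1)

lemma C1_linear_deriv:
  "Ck_on 1 S f \<Longrightarrow> x \<in> S \<Longrightarrow> linear (frechet_derivative f (at x))"
  by (simp add: Ck_on_1 linear_frechet_derivative)

lemma Ck_on_continuous: "Ck_on k S f \<Longrightarrow> continuous_on S f"
  by (cases k) (auto simp: Ck_on.simps(2) intro!: differentiable_imp_continuous_on differentiable_at_imp_differentiable_on)

lemma Ck_on_subset: "Ck_on k S f \<Longrightarrow> T \<subseteq> S \<Longrightarrow> Ck_on k T f"
  by (induction k arbitrary: f) (auto simp: Ck_on.simps(2) intro: continuous_on_subset)

lemma Ck_on_Suc_D: "Ck_on (Suc k) S f \<Longrightarrow> Ck_on k S f"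
proof (induction k arbitrary: f)
  case 0 then show ?case using Ck_on_continuous[of "Suc 0"] by auto
next
  case (Suc k)
  then show ?case by (metis Ck_on.simps(2))
qed

lemma Ck_on_2_D: "Ck_on 2 S f \<Longrightarrow> Ck_on 1 S f"
  using Ck_on_Suc_D[of 1 S f] by (simp add: numeral_2_eq_2 One_nat_def)

lemma Ck_on_2_iff:
  "Ck_on 2 S f \<longleftrightarrow> (\<forall>x\<in>S. f differentiable (at x)) \<and>
     (\<forall>u. Ck_on 1 S (\<lambda>x. frechet_derivative f (at x) u))"
  by (simp add: numeral_2_eq_2 One_nat_def Ck_on.simps(2))

lemma frechet_derivative_cong_open:
  assumes "open S" "x \<in> S" "\<And>y. y \<in> S \<Longrightarrow> f y = g y"
  shows "frechet_derivative f (at x) = frechet_derivative g (at x)"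
proof -
  have *: "(f has_derivative F) (at x) \<longleftrightarrow> (g has_derivative F) (at x)" for F
    using assms has_derivative_transform_within_open[of f F x UNIV S g]
      has_derivative_transform_within_open[of g F x UNIV S f] by auto
  show ?thesis unfolding frechet_derivative_def * ..
qed

lemma differentiable_cong_open:
  assumes "open S" "x \<in> S" "\<And>y. y \<in> S \<Longrightarrow> f y = g y" "f differentiable (at x)"
  shows "g differentiable (at x)"
  using assms has_derivative_transform_within_open[of f _ x UNIV S g]
  unfolding differentiable_def by blast

text \<open>Openness of \<open>S\<close> enters because \<open>frechet_derivative\<close> at a point
  sees the values on a full neighbourhood.\<close>

lemma Ck_on_cong:
  assumes "open S" "\<And>y. y \<in> S \<Longrightarrow> f y = g y" "Ck_on k S f"
  shows "Ck_on k S g"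
  using assms(2,3)
proof (induction k arbitrary: f g)
  case 0 then show ?case by (simp cong: continuous_on_cong)
next
  case (Suc k)
  have "Ck_on k S (\<lambda>x. frechet_derivative g (at x) u)" for u
    using Suc.IH[of "\<lambda>x. frechet_derivative f (at x) u" "\<lambda>x. frechet_derivative g (at x) u"]
      frechet_derivative_cong_open[OF assms(1), of _ f g] Suc.prems by (simp add: Ck_on.simps(2))
  moreover have "g differentiable (at x)" if "x \<in> S" for x
    using differentiable_cong_open[OF assms(1) that, of f g] Suc.prems that by (simp add: Ck_on.simps(2))
  ultimately show ?case by (simp add: Ck_on.simps(2))
qed

lemma Ck_on_local:
  assumes "\<And>x. x \<in> S \<Longrightarrow> \<exists>U. open U \<and> x \<in> U \<and> Ck_on k U f"
  shows "Ck_on k S f"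
  using assms
proof (induction k arbitrary: f)
  case 0
  show ?case
    unfolding Ck_on.simps continuous_on_eq_continuous_within
  proof
    fix x assume "x \<in> S"
    from 0[OF this] obtain U where "open U" "x \<in> U" "continuous_on U f" by auto
    then show "continuous (at x within S) f"
      using continuous_on_eq_continuous_at continuous_at_imp_continuous_at_within by blast
  qed
next
  case (Suc k)
  have "Ck_on k S (\<lambda>x. frechet_derivative f (at x) u)" for u
    by (rule Suc.IH) (use Suc.prems in \<open>fastforce simp: Ck_on.simps(2)\<close>)
  moreover have "f differentiable (at x)" if "x \<in> S" for x
    using Suc.prems[OF that] by (auto simp: Ck_on.simps(2))
  ultimately show ?case by (simp add: Ck_on.simps(2))
qed

section \<open>Families of linear maps and the calculus of C^1 maps\<close>

lemma linear_family_expand: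
  fixes A :: "'b::euclidean_space \<Rightarrow> 'c::real_vector"
  assumes "linear A" shows "A v = (\<Sum>b\<in>Basis. (v \<bullet> b) *\<^sub>R A b)"
  by (metis (mono_tags, lifting) assms euclidean_representation linear_cmul linear_sum sum.cong)

text \<open>Expansion in a fixed basis with continuous coefficients. It bridges the gap between
  continuity in each fixed direction, which is all that \<open>Ck_on\<close> asks of a derivative,
  and evaluation at a moving vector.\<close>

lemma continuous_on_linear_family:
  fixes A :: "'x::topological_space \<Rightarrow> 'b::euclidean_space \<Rightarrow> 'c::real_normed_vector"
  assumes "\<And>x. x \<in> S \<Longrightarrow> linear (A x)"
    and "\<And>e. continuous_on S (\<lambda>x. A x e)" and "continuous_on S w"
  shows "continuous_on S (\<lambda>x. A x (w x))"
proof -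
  have "continuous_on S (\<lambda>x. \<Sum>b\<in>Basis. (w x \<bullet> b) *\<^sub>R A x b)"
    by (intro continuous_intros assms)
  then show ?thesis
    using linear_family_expand[OF assms(1)] by (simp cong: continuous_on_cong)
qed

text \<open>The chain rule evaluates the derivative of \<open>g\<close> in the moving direction
  \<open>frechet_derivative f (at x) u\<close>. The finite dimension of the middle space enters
  there, through \<open>continuous_on_linear_family\<close>.\<close>

lemma C1_compose:
  fixes f :: "'a::real_normed_vector \<Rightarrow> 'b::euclidean_space"
    and g :: "'b \<Rightarrow> 'c::real_normed_vector"
  assumes f: "Ck_on 1 S f" and g: "Ck_on 1 T g" and sub: "f ` S \<subseteq> T"
  shows "Ck_on 1 S (g \<circ> f)"
proof (rule C1_I)
  show "((g \<circ> f) has_derivative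
      frechet_derivative g (at (f x)) \<circ> frechet_derivative f (at x)) (at x)" if "x \<in> S" for x
    using diff_chain_at[OF C1_deriv[OF f that] C1_deriv[OF g, of "f x"]] sub that by auto
  have *: "continuous_on S (\<lambda>x. frechet_derivative g (at (f x)) v)" for v
    using continuous_on_compose2[OF C1_continuous_deriv[OF g] Ck_on_continuous[OF f] sub] .
  show "continuous_on S (\<lambda>x. (frechet_derivative g (at (f x)) \<circ> frechet_derivative f (at x)) u)" for u
    unfolding o_def
    by (rule continuous_on_linear_family[OF _ * C1_continuous_deriv[OF f]])
      (use C1_linear_deriv[OF g] sub in auto)
qed

lemma C1_compose':
  fixes f :: "'a::real_normed_vector \<Rightarrow> 'b::euclidean_space"
    and g :: "'b \<Rightarrow> 'c::real_normed_vector"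
  assumes "Ck_on 1 S f" "Ck_on 1 T g" "f ` S \<subseteq> T"
  shows "Ck_on 1 S (\<lambda>x. g (f x))"
  using C1_compose[OF assms] by (simp add: o_def)

lemma C1_const: "Ck_on 1 S (\<lambda>x. c)"
  by (rule C1_I[where f' = "\<lambda>x h. 0"]) auto

lemma C1_bounded_linear:
  assumes "bounded_linear h" "Ck_on 1 S f"
  shows "Ck_on 1 S (\<lambda>x. h (f x))"
proof (rule C1_I)
  show "((\<lambda>x. h (f x)) has_derivative (\<lambda>v. h (frechet_derivative f (at x) v))) (at x)"
    if "x \<in> S" for x
    by (rule bounded_linear.has_derivative[OF assms(1) C1_deriv[OF assms(2) that]])
  show "continuous_on S (\<lambda>x. h (frechet_derivative f (at x) u))" for u
    by (rule bounded_linear.continuous_on[OF assms(1) C1_continuous_deriv[OF assms(2)]])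
qed

lemma C1_id: "Ck_on 1 S (\<lambda>x. x)"
  by (rule C1_I[where f' = "\<lambda>x h. h"]) auto

lemma C1_linear: "bounded_linear h \<Longrightarrow> Ck_on 1 S h"
  using C1_bounded_linear[OF _ C1_id] .

lemma C1_add: "Ck_on 1 S f \<Longrightarrow> Ck_on 1 S g \<Longrightarrow> Ck_on 1 S (\<lambda>x. f x + g x)"
  by (rule C1_I, rule has_derivative_add[OF C1_deriv C1_deriv])
    (auto intro!: continuous_intros C1_continuous_deriv)

lemma C1_diff: "Ck_on 1 S f \<Longrightarrow> Ck_on 1 S g \<Longrightarrow> Ck_on 1 S (\<lambda>x. f x - g x)"
  by (rule C1_I, rule has_derivative_diff[OF C1_deriv C1_deriv])
    (auto intro!: continuous_intros C1_continuous_deriv)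

lemma C1_sum: "(\<And>i. i \<in> I \<Longrightarrow> Ck_on 1 S (f i)) \<Longrightarrow> Ck_on 1 S (\<lambda>x. \<Sum>i\<in>I. f i x)"
  by (induction I rule: infinite_finite_induct) (auto intro!: C1_add simp: C1_const)

lemma C1_scaleR:
  fixes a :: "'a::real_normed_vector \<Rightarrow> real"
  assumes "Ck_on 1 S a" "Ck_on 1 S f" shows "Ck_on 1 S (\<lambda>x. a x *\<^sub>R f x)"
  by (rule C1_I, rule has_derivative_scaleR[OF C1_deriv C1_deriv])
    (use assms in \<open>auto intro!: continuous_intros C1_continuous_deriv intro: Ck_on_continuous\<close>)

lemma C1_Pair: "Ck_on 1 S f \<Longrightarrow> Ck_on 1 S g \<Longrightarrow> Ck_on 1 S (\<lambda>x. (f x, g x))"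
  by (rule C1_I, rule has_derivative_Pair[OF C1_deriv C1_deriv])
    (auto intro!: continuous_intros C1_continuous_deriv)

lemmas C1_intros = C1_const C1_id C1_add C1_diff C1_sum C1_scaleR C1_Pair

lemma C1_linear_family:
  fixes A :: "'x::real_normed_vector \<Rightarrow> 'b::euclidean_space \<Rightarrow> 'c::real_normed_vector"
  assumes "open S" "\<And>x. x \<in> S \<Longrightarrow> linear (A x)"
    and "\<And>e. Ck_on 1 S (\<lambda>x. A x e)" and "Ck_on 1 S w"
  shows "Ck_on 1 S (\<lambda>x. A x (w x))"
proof -
  have "Ck_on 1 S (\<lambda>x. \<Sum>b\<in>Basis. (w x \<bullet> b) *\<^sub>R A x b)"
    by (intro C1_intros assms C1_bounded_linear[OF bounded_linear_inner_left])
  then show ?thesis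
    by (rule Ck_on_cong[OF assms(1), rotated]) (simp add: linear_family_expand[OF assms(2)])
qed

section \<open>Implicitly defined functions\<close>

text \<open>Differentiates a continuous solution that is already given. As \<open>B\<close> is
  merely a left inverse of the partial derivative in the second slot, overdetermined equations are
  covered too, such as lifts through an immersion. Applying \<open>B\<close> to the remainder
  estimate of \<open>G\<close> bounds the remainder of \<open>u\<close> by a small multiple of |q -
  p| + |u q - u p|.\<close>

lemma implicit_derivative:
  fixes G :: "'p::real_normed_vector \<times> 'e::real_normed_vector \<Rightarrow> 'z::real_normed_vector"
  assumes G: "(G has_derivative G') (at (p, u p))" and cont: "isCont u p"
    and ev: "\<forall>\<^sub>F q in nhds p. G (q, u q) = G (p, u p)"
    and B: "bounded_linear B" and BG: "\<And>w. B (G' (0, w)) = w"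
  shows "(u has_derivative (\<lambda>h. - B (G' (h, 0)))) (at p)"
proof -
  interpret B: bounded_linear B by fact
  interpret G': bounded_linear G' by (rule has_derivative_bounded_linear[OF G])
  let ?D = "\<lambda>h. - B (G' (h, 0))"
  have bD: "bounded_linear ?D"
    by (intro bounded_linear_minus bounded_linear_compose[OF B] bounded_linear_compose[OF G'.bounded_linear_axioms]
        bounded_linear_Pair bounded_linear_ident bounded_linear_zero)
  obtain K where K: "K > 0" "\<And>x. norm (B x) \<le> norm x * K" using B.pos_bounded by blast
  obtain M where M: "M > 0" "\<And>x. norm (?D x) \<le> norm x * M"
    using bounded_linear.pos_bounded[OF bD] by blast
  have split: "G' (a, b) = G' (a, 0) + G' (0, b)" for a b
    using G'.add[of "(a,0)" "(0,b)"] by simp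
  have key: "\<forall>\<^sub>F q in nhds p. norm (u q - u p - ?D (q - p)) \<le> K * e * (norm (q - p) + norm (u q - u p))"
    if "e > 0" for e
  proof -
    obtain d where d: "d > 0" "\<And>y. norm (y - (p, u p)) < d \<Longrightarrow>
        norm (G y - G (p, u p) - G' (y - (p, u p))) \<le> e * norm (y - (p, u p))"
      using G \<open>e > 0\<close> unfolding has_derivative_at_alt by blast
    have "((\<lambda>q. (q, u q)) \<longlongrightarrow> (p, u p)) (nhds p)"
      using cont by (intro tendsto_Pair filterlim_ident) (simp add: isCont_def tendsto_nhds_iff)
    then have "\<forall>\<^sub>F q in nhds p. dist (q, u q) (p, u p) < d" using d(1) by (rule tendstoD)
    with ev show ?thesis
    proof eventually_elim
      case (elim q)
      have "norm (G' (q - p, u q - u p)) \<le> e * norm (q - p, u q - u p)"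
        using d(2)[of "(q, u q)"] elim by (simp add: dist_norm)
      also have "\<dots> \<le> e * (norm (q - p) + norm (u q - u p))"
        using that norm_Pair_le by (intro mult_left_mono) auto
      finally have *: "norm (G' (q - p, u q - u p)) \<le> e * (norm (q - p) + norm (u q - u p))" .
      have "u q - u p - ?D (q - p) = B (G' (q - p, u q - u p))"
        by (subst split) (simp add: B.add BG)
      also have "norm \<dots> \<le> (e * (norm (q - p) + norm (u q - u p))) * K"
        using K(2) * K(1) by (meson mult_right_mono less_imp_le order_trans)
      finally show ?case by (simp add: mult_ac)
    qed
  qed
  have "\<forall>\<^sub>F q in nhds p. norm (u q - u p) \<le> (2 * M + 1) * norm (q - p)"
  \<comment> \<open>With e = 1 / (2 * K) the term |u q - u p| occurs on the right with factor 1/2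
    and is absorbed; a Lipschitz bound at \<open>p\<close> remains.\<close>
  proof (rule eventually_mono[OF key[of "1 / (2 * K)"]])
    fix q assume elim: "norm (u q - u p - ?D (q - p)) \<le> K * (1 / (2 * K)) * (norm (q - p) + norm (u q - u p))"
    have "norm (u q - u p) \<le> norm (u q - u p - ?D (q - p)) + norm (?D (q - p))"
      using norm_triangle_sub by (metis add.commute)
    also have "\<dots> \<le> (norm (q - p) + norm (u q - u p)) / 2 + norm (q - p) * M"
      using elim M(2)[of "q - p"] K(1) by (simp add: field_simps)
    finally show "norm (u q - u p) \<le> (2 * M + 1) * norm (q - p)" by (simp add: field_simps)
  qed (use K(1) in simp)
  note lip = this
  show ?thesis
    unfolding has_derivative_at_alt
  proof (intro conjI bD allI impI)
    fix e :: real assume "e > 0"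
    \<comment> \<open>2 * M + 2 is 1 plus the Lipschitz constant 2 * M + 1 just obtained.\<close>
    define e' where "e' = e / (K * (2 * M + 2))"
    have e': "e' > 0" using \<open>e > 0\<close> K M by (simp add: e'_def)
    have "\<forall>\<^sub>F q in nhds p. norm (u q - u p - ?D (q - p)) \<le> e * norm (q - p)"
      using key[OF e'] lip
    proof eventually_elim
      case (elim q)
      have "norm (u q - u p - ?D (q - p)) \<le> K * e' * (norm (q - p) + (2 * M + 1) * norm (q - p))"
        using elim K(1) e' by (meson add_left_mono mult_left_mono mult_nonneg_nonneg less_imp_le order_trans)
      also have "\<dots> = (K * (2 * M + 2) * e') * norm (q - p)" by (simp add: algebra_simps)
      also have "K * (2 * M + 2) * e' = e" using K M by (simp add: e'_def)
      finally show ?case .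
    qed
    then show "\<exists>d>0. \<forall>y. norm (y - p) < d \<longrightarrow> norm (u y - u p - ?D (y - p)) \<le> e * norm (y - p)"
      unfolding eventually_nhds_metric dist_norm .
  qed
qed

text \<open>A uniform lower bound on the linear maps turns a small residual A p (w p - w0) into a
  small error w p - w0.\<close>

lemma tendsto_solve:
  fixes A :: "'p \<Rightarrow> 'e::real_normed_vector \<Rightarrow> 'z::real_normed_vector"
  assumes "k > 0" "\<forall>\<^sub>F p in F. linear (A p) \<and> (\<forall>v. k * norm v \<le> norm (A p v))"
    and "((\<lambda>p. A p (w p) - A p w0) \<longlongrightarrow> 0) F"
  shows "(w \<longlongrightarrow> w0) F"
proof -
  have "((\<lambda>p. norm (A p (w p) - A p w0) / k) \<longlongrightarrow> 0) F"
    using tendsto_divide_zero[OF tendsto_norm_zero[OF assms(3)]] .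
  moreover have "\<forall>\<^sub>F p in F. norm (w p - w0) \<le> norm (A p (w p) - A p w0) / k"
    using assms(2)
  proof eventually_elim
    case (elim p)
    then have "k * norm (w p - w0) \<le> norm (A p (w p - w0))" by blast
    also have "A p (w p - w0) = A p (w p) - A p w0" using elim linear_diff by blast
    finally show ?case using assms(1) by (simp add: field_simps)
  qed
  ultimately have "((\<lambda>p. w p - w0) \<longlongrightarrow> 0) F" by (rule Lim_null_comparison[rotated])
  then show ?thesis by (simp add: LIM_zero_iff)
qed

text \<open>It suffices that the images of the basis vectors move little: a total change below k / 2
  costs at most half of the lower bound at \<open>x\<close>.\<close>

lemma linear_family_bounded_below:
  fixes A :: "'x::topological_space \<Rightarrow> 'b::euclidean_space \<Rightarrow> 'c::euclidean_space"
  assumes lin: "\<And>x. x \<in> S \<Longrightarrow> linear (A x)"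
    and cont: "\<And>e. continuous_on S (\<lambda>x. A x e)" and "x \<in> S" and inj: "inj (A x)"
  shows "\<exists>k>0. \<forall>\<^sub>F y in at x within S. linear (A y) \<and> (\<forall>v. k * norm v \<le> norm (A y v))"
proof -
  obtain k where k: "k > 0" "\<And>v. k * norm v \<le> norm (A x v)"
    using linear_inj_bounded_below_pos[OF lin[OF \<open>x \<in> S\<close>] inj] by blast
  have "((\<lambda>y. \<Sum>b\<in>Basis. norm (A y b - A x b)) \<longlongrightarrow> (\<Sum>b\<in>Basis. norm (A x b - A x b))) (at x within S)"
    using cont \<open>x \<in> S\<close> unfolding continuous_on by (intro tendsto_intros) auto
  then have "\<forall>\<^sub>F y in at x within S. (\<Sum>b\<in>Basis. norm (A y b - A x b)) < k / 2"
    by (rule order_tendstoD) (use k in simp)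
  moreover have "\<forall>\<^sub>F y in at x within S. y \<in> S" by (simp add: eventually_at_topological) blast
  ultimately have "\<forall>\<^sub>F y in at x within S. linear (A y) \<and> (\<forall>v. k / 2 * norm v \<le> norm (A y v))"
  proof eventually_elim
    case (elim y)
    have ly: "linear (A y)" using lin elim by simp
    moreover have "k / 2 * norm v \<le> norm (A y v)" for v
    proof -
      have "A y v - A x v = (\<Sum>b\<in>Basis. (v \<bullet> b) *\<^sub>R (A y b - A x b))"
        using linear_family_expand[OF ly, of v] linear_family_expand[OF lin[OF \<open>x \<in> S\<close>], of v]
        by (simp add: sum_subtractf scaleR_diff_right)
      also have "norm \<dots> \<le> (\<Sum>b\<in>Basis. norm v * norm (A y b - A x b))"
        by (rule sum_norm_le) (auto intro!: mult_right_mono Basis_le_norm)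
      also have "\<dots> \<le> norm v * (k / 2)"
        using elim unfolding sum_distrib_left[symmetric] by (intro mult_left_mono) auto
      finally have "norm (A y v - A x v) \<le> norm v * (k / 2)" .
      moreover have "norm (A x v) \<le> norm (A y v) + norm (A y v - A x v)"
        by (metis norm_minus_commute norm_triangle_sub)
      ultimately show ?thesis using k(2)[of v] by (simp add: field_simps)
    qed
    ultimately show ?case by blast
  qed
  then show ?thesis using k(1) by (intro exI[of _ "k / 2"]) simp
qed

lemma continuous_on_solve:
  fixes A :: "'x::topological_space \<Rightarrow> 'b::euclidean_space \<Rightarrow> 'c::euclidean_space"
  assumes lin: "\<And>x. x \<in> S \<Longrightarrow> linear (A x)" and inj: "\<And>x. x \<in> S \<Longrightarrow> inj (A x)"
    and cont: "\<And>e. continuous_on S (\<lambda>x. A x e)" and b: "continuous_on S b"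
    and eq: "\<And>x. x \<in> S \<Longrightarrow> A x (w x) = b x"
  shows "continuous_on S w"
  unfolding continuous_on_def
proof
  fix x assume x: "x \<in> S"
  obtain k where k: "k > 0" "\<forall>\<^sub>F y in at x within S. linear (A y) \<and> (\<forall>v. k * norm v \<le> norm (A y v))"
    using linear_family_bounded_below[OF lin cont x inj[OF x]] by blast
  show "(w \<longlongrightarrow> w x) (at x within S)"
  proof (rule tendsto_solve[OF k])
    have "((\<lambda>y. b y - A y (w x)) \<longlongrightarrow> b x - A x (w x)) (at x within S)"
      using b cont x unfolding continuous_on_def by (intro tendsto_diff) auto
    moreover have "\<forall>\<^sub>F y in at x within S. b y - A y (w x) = A y (w y) - A y (w x)"
      using eq by (auto simp: eventually_at_topological)
    ultimately show "((\<lambda>y. A y (w y) - A y (w x)) \<longlongrightarrow> 0) (at x within S)"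
      using eq[OF x] by (auto elim: Lim_transform_eventually)
  qed
qed

text \<open>The derivative solves the differentiated system A w' = b' - A' w. Its existence comes
  from \<open>implicit_derivative\<close>, its continuity from \<open>continuous_on_solve\<close>
  applied to this second system, so no inverse of \<open>A\<close> is ever differentiated.\<close>

lemma C1_solve:
  fixes A :: "'x::real_normed_vector \<Rightarrow> 'b::euclidean_space \<Rightarrow> 'c::euclidean_space"
  assumes S: "open S" and lin: "\<And>x. x \<in> S \<Longrightarrow> linear (A x)" and inj: "\<And>x. x \<in> S \<Longrightarrow> inj (A x)"
    and A: "\<And>e. Ck_on 1 S (\<lambda>x. A x e)" and b: "Ck_on 1 S b"
    and eq: "\<And>x. x \<in> S \<Longrightarrow> A x (w x) = b x"
  shows "Ck_on 1 S w"
proof -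
  have cw: "continuous_on S w"
    by (rule continuous_on_solve[OF lin inj Ck_on_continuous[OF A] Ck_on_continuous[OF b] eq])
  let ?A' = "\<lambda>x h v. \<Sum>i\<in>Basis. (v \<bullet> i) *\<^sub>R frechet_derivative (\<lambda>x. A x i) (at x) h"
  let ?b' = "\<lambda>x. frechet_derivative b (at x)"
  have "\<exists>w'. (w has_derivative w') (at x) \<and> (\<forall>h. A x (w' h) = ?b' x h - ?A' x h (w x))"
    if x: "x \<in> S" for x
  proof -
    obtain B where B: "linear B" "B \<circ> A x = id"
      using linear_injective_left_inverse[OF lin[OF x] inj[OF x]] by blast
    \<comment> \<open>\<open>A y\<close> is written in coordinates: differentiability is assumed for
      fixed vectors, and linearity of \<open>A y\<close> only for \<open>y\<close> in
      \<open>S\<close>.\<close>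
    define G where "G = (\<lambda>(y, v). (\<Sum>i\<in>Basis. (v \<bullet> i) *\<^sub>R A y i) - b y)"
    define G' where "G' = (\<lambda>(h, v). (\<Sum>i\<in>Basis. (w x \<bullet> i) *\<^sub>R frechet_derivative (\<lambda>x. A x i) (at x) h + (v \<bullet> i) *\<^sub>R A x i) - ?b' x h)"
    have dA: "((\<lambda>x. A x i) has_derivative frechet_derivative (\<lambda>x. A x i) (at x)) (at x)" for i
      by (rule C1_deriv[OF A x])
    have dA': "((\<lambda>z. A (fst z) i) has_derivative (\<lambda>z. frechet_derivative (\<lambda>x. A x i) (at x) (fst z))) (at (x, v))" for i v
      using has_derivative_compose[of fst fst "(x, v)" UNIV "\<lambda>x. A x i", OF has_derivative_fst[OF has_derivative_ident]] dA
      by simp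
    have db': "((\<lambda>z. b (fst z)) has_derivative (\<lambda>z. ?b' x (fst z))) (at (x, v))" for v
      using has_derivative_compose[of fst fst "(x, v)" UNIV b, OF has_derivative_fst[OF has_derivative_ident]]
        C1_deriv[OF b x] by simp
    have G: "(G has_derivative G') (at (x, w x))"
      unfolding G_def G'_def case_prod_unfold
      by (rule derivative_eq_intros dA' db' refl | simp)+
    have G0: "G' (0, v) = A x v" for v
      unfolding G'_def using linear_family_expand[OF lin[OF x], of v]
        linear_0[OF C1_linear_deriv[OF b x]] linear_0[OF C1_linear_deriv[OF A x]] by simp
    have Gz: "G (y, w y) = 0" if "y \<in> S" for y
      unfolding G_def using linear_family_expand[OF lin[OF that], of "w y"] eq[OF that] by simp
    have d: "(w has_derivative (\<lambda>h. - B (G' (h, 0)))) (at x)"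
    proof (rule implicit_derivative[where u = w and p = x, OF G])
      show "isCont w x" using cw S x continuous_on_eq_continuous_at by blast
      show "\<forall>\<^sub>F q in nhds x. G (q, w q) = G (x, w x)"
        using eventually_nhds_in_open[OF S x] by eventually_elim (simp add: Gz x)
      show "B (G' (0, v)) = v" for v using B(2) by (simp add: G0 fun_eq_iff)
    qed (use B in \<open>simp add: linear_conv_bounded_linear[symmetric]\<close>)
    let ?w' = "\<lambda>h. - B (G' (h, 0))"
    text \<open>Differentiating \<open>G (y, w y) = 0\<close> identifies \<open>A x \<circ> ?w'\<close>.\<close>
    have "((\<lambda>y. G (y, w y)) has_derivative (\<lambda>h. G' (h, ?w' h))) (at x)"
      using has_derivative_compose[OF has_derivative_Pair[OF has_derivative_ident d] G] .
    moreover have "((\<lambda>y. G (y, w y)) has_derivative (\<lambda>h. 0)) (at x)"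
      by (rule has_derivative_transform_within_open[OF has_derivative_const S x]) (simp add: Gz)
    ultimately have "(\<lambda>h. G' (h, ?w' h)) = (\<lambda>h. 0)" by (rule has_derivative_unique)
    then have z: "G' (h, ?w' h) = 0" for h by metis
    have e: "G' (h, v) = ?A' x h (w x) + A x v - ?b' x h" for h v
      unfolding G'_def using linear_family_expand[OF lin[OF x], of v] by (simp add: sum.distrib)
    have "A x (?w' h) = ?b' x h - ?A' x h (w x)" for h
    proof -
      have aux: "q = r - p" if "p + q - r = 0" for p q r :: 'c
        using that by (metis add_diff_cancel_left' eq_iff_diff_eq_0)
      show ?thesis by (rule aux) (rule trans[OF e[symmetric] z])
    qed
    with d show ?thesis by blast
  qed
  then have "\<forall>x\<in>S. \<exists>w'. (w has_derivative w') (at x) \<and> (\<forall>h. A x (w' h) = ?b' x h - ?A' x h (w x))"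
    by blast
  from bchoice[OF this] obtain w' where w'': "\<forall>x\<in>S. (w has_derivative w' x) (at x) \<and> (\<forall>h. A x (w' x h) = ?b' x h - ?A' x h (w x))"
    by (rule exE)
  have w': "(w has_derivative w' x) (at x)" if "x \<in> S" for x
    using w'' that by blast
  have eq': "A x (w' x h) = ?b' x h - ?A' x h (w x)" if "x \<in> S" for x h
    using w'' that by blast
  show ?thesis
  proof (rule C1_I[OF w'])
    fix u
    show "continuous_on S (\<lambda>x. w' x u)"
      by (rule continuous_on_solve[OF lin inj Ck_on_continuous[OF A] _ eq'])
        (auto intro!: continuous_intros C1_continuous_deriv A b cw)
  qed
qed

text \<open>Stands in for the inverse function theorem: a continuous map into the domain of an
  immersion \<open>h\<close> is C^1 once its composite with \<open>h\<close> is. It is applied with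
  chart expressions of parametrizations as \<open>h\<close>, and with the map of a flow box. The
  second claim is the chain rule, and it doubles as the linear system from which the derivative of
  \<phi> is seen to be continuous.\<close>

lemma C1_lift:
  fixes f :: "'x::real_normed_vector \<Rightarrow> 'c::euclidean_space" and h :: "'b::euclidean_space \<Rightarrow> 'c"
  assumes S: "open S" and T: "open T" and f: "Ck_on 1 S f" and h: "Ck_on 1 T h"
    and inj: "\<And>y. y \<in> T \<Longrightarrow> inj (frechet_derivative h (at y))"
    and \<phi>: "continuous_on S \<phi>" "\<phi> ` S \<subseteq> T" and eq: "\<And>x. x \<in> S \<Longrightarrow> h (\<phi> x) = f x"
  shows "Ck_on 1 S \<phi>"
    and "\<And>x u. x \<in> S \<Longrightarrow> frechet_derivative h (at (\<phi> x)) (frechet_derivative \<phi> (at x) u) = frechet_derivative f (at x) u"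
proof -
  have diff: "\<phi> differentiable (at x)" if x: "x \<in> S" for x
  proof -
    have px: "\<phi> x \<in> T" using \<phi> x by auto
    obtain B where B: "linear B" "B \<circ> frechet_derivative h (at (\<phi> x)) = id"
      using linear_injective_left_inverse[OF C1_linear_deriv[OF h px] inj[OF px]] by blast
    define G where "G = (\<lambda>(y, v). h v - f y)"
    define G' where "G' = (\<lambda>(k, v). frechet_derivative h (at (\<phi> x)) v - frechet_derivative f (at x) k)"
    have dh: "((\<lambda>z. h (snd z)) has_derivative (\<lambda>z. frechet_derivative h (at (\<phi> x)) (snd z))) (at (x, \<phi> x))"
      using has_derivative_compose[of snd snd "(x, \<phi> x)" UNIV h, OF has_derivative_snd[OF has_derivative_ident]]
        C1_deriv[OF h px] by simp
    have df: "((\<lambda>z. f (fst z)) has_derivative (\<lambda>z. frechet_derivative f (at x) (fst z))) (at (x, v))" for v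
      using has_derivative_compose[of fst fst "(x, v)" UNIV f, OF has_derivative_fst[OF has_derivative_ident]]
        C1_deriv[OF f x] by simp
    have G: "(G has_derivative G') (at (x, \<phi> x))"
      unfolding G_def G'_def case_prod_unfold by (rule has_derivative_diff[OF dh df])
    have "(\<phi> has_derivative (\<lambda>k. - B (G' (k, 0)))) (at x)"
    proof (rule implicit_derivative[where u = \<phi> and p = x, OF G])
      show "isCont \<phi> x" using \<phi> S x continuous_on_eq_continuous_at by blast
      show "\<forall>\<^sub>F q in nhds x. G (q, \<phi> q) = G (x, \<phi> x)"
        using eventually_nhds_in_open[OF S x] by eventually_elim (simp add: G_def eq x)
      show "B (G' (0, v)) = v" for v
        using B(2) linear_0[OF C1_linear_deriv[OF f x]] by (simp add: G'_def fun_eq_iff)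
    qed (use B in \<open>simp add: linear_conv_bounded_linear[symmetric]\<close>)
    then show ?thesis by (auto simp: differentiable_def)
  qed
  show eq': "frechet_derivative h (at (\<phi> x)) (frechet_derivative \<phi> (at x) u) = frechet_derivative f (at x) u"
    if x: "x \<in> S" for x u
  proof -
    have "((h \<circ> \<phi>) has_derivative frechet_derivative h (at (\<phi> x)) \<circ> frechet_derivative \<phi> (at x)) (at x)"
      using diff_chain_at[of \<phi> _ x h] diff[OF x] C1_deriv[OF h, of "\<phi> x"] \<phi> x
      by (auto simp: frechet_derivative_works)
    moreover have "((h \<circ> \<phi>) has_derivative frechet_derivative f (at x)) (at x)"
      by (rule has_derivative_transform_within_open[OF C1_deriv[OF f x] S x]) (simp add: eq)
    ultimately show ?thesis by (metis has_derivative_unique o_apply)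
  qed
  have *: "continuous_on S (\<lambda>x. frechet_derivative h (at (\<phi> x)) e)" for e
    by (rule continuous_on_compose2[OF C1_continuous_deriv[OF h] \<phi>])
  have "continuous_on S (\<lambda>x. frechet_derivative \<phi> (at x) u)" for u
    by (rule continuous_on_solve[OF _ _ * C1_continuous_deriv[OF f] eq'])
      (use \<phi> C1_linear_deriv[OF h] inj in auto)
  with diff show "Ck_on 1 S \<phi>" unfolding Ck_on_1 by blast
qed

section \<open>Uniform estimates for C^1 maps on compact sets\<close>

lemma linear_bound_sum:
  fixes A :: "'b::euclidean_space \<Rightarrow> 'c::real_normed_vector"
  assumes "linear A" shows "norm (A v) \<le> (\<Sum>b\<in>Basis. norm (A b)) * norm v"
proof -
  have "norm (A v) \<le> (\<Sum>b\<in>Basis. norm v * norm (A b))"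
    unfolding linear_family_expand[OF assms, of v]
    by (rule sum_norm_le) (auto intro!: mult_right_mono Basis_le_norm)
  then show ?thesis by (simp add: sum_distrib_left mult.commute)
qed

lemma C1_lipschitz_on_compact_convex:
  fixes f :: "'a::euclidean_space \<Rightarrow> 'b::real_normed_vector"
  assumes f: "Ck_on 1 S f" and K: "compact K" "convex K" "K \<subseteq> S"
  obtains C where "C \<ge> 0" "\<And>x y. x \<in> K \<Longrightarrow> y \<in> K \<Longrightarrow> norm (f x - f y) \<le> C * norm (x - y)"
proof -
  have "continuous_on K (\<lambda>x. \<Sum>b\<in>Basis. norm (frechet_derivative f (at x) b))"
    by (intro continuous_intros continuous_on_subset[OF C1_continuous_deriv[OF f] K(3)])
  then have "bounded ((\<lambda>x. \<Sum>b\<in>Basis. norm (frechet_derivative f (at x) b)) ` K)"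
    using K(1) compact_continuous_image compact_imp_bounded by blast
  then obtain C where C: "C > 0" "\<And>x. x \<in> K \<Longrightarrow> \<bar>\<Sum>b\<in>Basis. norm (frechet_derivative f (at x) b)\<bar> \<le> C"
    unfolding bounded_pos by auto
  have "norm (f x - f y) \<le> C * norm (x - y)" if "x \<in> K" "y \<in> K" for x y
  proof (rule differentiable_bound[OF K(2) _ _ that])
    fix z assume z: "z \<in> K"
    show "(f has_derivative frechet_derivative f (at z)) (at z within K)"
      using C1_deriv[OF f, of z] K z has_derivative_at_withinI by blast
    show "onorm (frechet_derivative f (at z)) \<le> C"
    proof (rule onorm_le)
      fix v
      have "norm (frechet_derivative f (at z) v) \<le> (\<Sum>b\<in>Basis. norm (frechet_derivative f (at z) b)) * norm v"
        by (rule linear_bound_sum[OF C1_linear_deriv[OF f]]) (use z K in auto)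
      also have "\<dots> \<le> C * norm v" using C(2)[OF z] by (intro mult_right_mono) auto
      finally show "norm (frechet_derivative f (at z) v) \<le> C * norm v" .
    qed
  qed
  then show ?thesis using C(1) that[of C] by simp
qed

text \<open>The gap between the radii keeps the segment from y to y + v in the larger ball, where
  the derivative is uniformly continuous; the mean value inequality is applied to \<open>f\<close>
  minus its linear part at \<open>y\<close>. Uniformity in \<open>y\<close> is wanted because a
  vector field will be linearized along whole trajectories.\<close>

lemma C1_uniform_derivative:
  fixes f :: "'a::euclidean_space \<Rightarrow> 'b::real_normed_vector"
  assumes f: "Ck_on 1 S f" and R: "cball p R \<subseteq> S" and r: "r < R" and e: "e > 0"
  obtains d where "d > 0" "\<And>y v::'a. y \<in> cball p r \<Longrightarrow> norm v < d \<Longrightarrow>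
     norm (f (y + v) - f y - frechet_derivative f (at y) v) \<le> e * norm v"
proof -
  let ?D = "\<lambda>z. frechet_derivative f (at z)"
  let ?N = "real DIM('a)"
  have "\<exists>d>0. \<forall>y\<in>cball p R. \<forall>z\<in>cball p R. dist z y < d \<longrightarrow> dist (?D z b) (?D y b) < e / ?N" for b
  proof -
    have "uniformly_continuous_on (cball p R) (\<lambda>z. ?D z b)"
      by (rule compact_uniformly_continuous[OF continuous_on_subset[OF C1_continuous_deriv[OF f] R] compact_cball])
    then show ?thesis using e unfolding uniformly_continuous_on_def by auto
  qed
  then obtain d where d: "\<And>b. d b > 0" "\<And>b y z. y\<in>cball p R \<Longrightarrow> z\<in>cball p R \<Longrightarrow> dist z y < d b \<Longrightarrow>
      dist (?D z b) (?D y b) < e / ?N"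
    by metis
  define d0 where "d0 = min (R - r) (Min (d ` Basis))"
  have d0: "d0 > 0" using d(1) r by (auto simp: d0_def)
  have d0b: "d0 \<le> d b" if "b \<in> Basis" for b using that by (auto simp: d0_def min.coboundedI2)
  show thesis
  proof (rule that[OF d0])
    fix y v :: 'a assume y: "y \<in> cball p r" and v: "norm v < d0"
    have seg: "z \<in> cball p R \<and> dist z y < d0" if "z \<in> closed_segment y (y + v)" for z
    proof -
      obtain u where u: "0 \<le> u" "u \<le> 1" "z = y + u *\<^sub>R v"
        using \<open>z \<in> closed_segment y (y + v)\<close> by (auto simp: in_segment algebra_simps)
      have "norm (u *\<^sub>R v) \<le> norm v" using u by (simp add: mult_left_le_one_le)
      then have zy: "dist z y < d0" using v by (simp add: u(3) dist_norm)
      have "dist p z \<le> dist p y + dist z y" by (metis dist_triangle dist_commute)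
      also have "\<dots> \<le> r + d0" using y zy by simp
      also have "\<dots> \<le> R" by (simp add: d0_def)
      finally show ?thesis using zy by simp
    qed
    have yR: "y \<in> cball p R" using y r by auto
    have "norm ((f (y + v) - ?D y (y + v)) - (f y - ?D y y)) \<le> e * norm ((y + v) - y)"
    proof (rule differentiable_bound[where f = "\<lambda>z. f z - ?D y z" and f' = "\<lambda>z h. ?D z h - ?D y h" and S = "closed_segment y (y+v)"])
      fix z assume z: "z \<in> closed_segment y (y + v)"
      have zS: "z \<in> S" and yS: "y \<in> S" using seg[OF z] R yR by auto
      have ly: "linear (?D y)" and lz: "linear (?D z)" using C1_linear_deriv[OF f] zS yS by auto
      show "((\<lambda>z. f z - ?D y z) has_derivative (\<lambda>h. ?D z h - ?D y h)) (at z within closed_segment y (y + v))"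
        by (intro has_derivative_diff has_derivative_at_withinI[OF C1_deriv[OF f zS]]
            bounded_linear_imp_has_derivative ly[unfolded linear_conv_bounded_linear])
      show "onorm (\<lambda>h. ?D z h - ?D y h) \<le> e"
      proof (rule onorm_le)
        fix h
        have l: "linear (\<lambda>h. ?D z h - ?D y h)" by (rule linear_compose_sub[OF lz ly])
        have "norm (?D z h - ?D y h) \<le> (\<Sum>b\<in>Basis. norm (?D z b - ?D y b)) * norm h"
          by (rule linear_bound_sum[OF l])
        also have "(\<Sum>b\<in>Basis. norm (?D z b - ?D y b)) * norm h \<le> e * norm h"
        proof (rule mult_right_mono)
          have "(\<Sum>b\<in>Basis. norm (?D z b - ?D y b)) \<le> (\<Sum>b\<in>(Basis::'a set). e / ?N)"
        proof (rule sum_mono)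
          fix b :: 'a assume "b \<in> Basis"
          then show "norm (?D z b - ?D y b) \<le> e / ?N"
            using d(2)[OF yR, of z b] seg[OF z] d0b[of b] by (simp add: dist_norm)
        qed
          then show "(\<Sum>b\<in>Basis. norm (?D z b - ?D y b)) \<le> e" by simp
        qed simp
        finally show "norm (?D z h - ?D y h) \<le> e * norm h" .
      qed
    qed auto
    then show "norm (f (y + v) - f y - ?D y v) \<le> e * norm v"
      using linear_add[OF C1_linear_deriv[OF f], of y y v] R yR by (auto simp: algebra_simps)
  qed
qed

section \<open>Ordinary differential equations\<close>

text \<open>The primitive of \<open>w\<close> that vanishes at 0, frozen outside [-1, 1]. Being
  bounded and continuous on the whole line, it lets Picard iteration run among bounded continuous
  functions; the base point -1 handles both signs of \<open>s\<close> with ordinary interval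
  integrals.\<close>

definition prim :: "(real \<Rightarrow> 'b::euclidean_space) \<Rightarrow> real \<Rightarrow> 'b" where
  "prim w s = integral {-1..max (-1) (min 1 s)} w - integral {-1..0} w"

lemma prim_0: "prim w 0 = 0"
  by (simp add: prim_def)

lemma prim_bound:
  assumes "continuous_on {-1..1} w" "\<And>s. s \<in> {-1..1} \<Longrightarrow> norm (w s) \<le> B"
  shows "norm (prim w s) \<le> 3 * B"
proof -
  have "norm (integral {-1..c} w) \<le> B * (c + 1)" if "-1 \<le> c" "c \<le> 1" for c
    using integral_bound[of "-1" c w B] assms that continuous_on_subset[of "{-1..1}" w "{-1..c}"] by auto
  from this[of "max (-1) (min 1 s)"] this[of 0]
  have "norm (prim w s) \<le> B * (max (-1) (min 1 s) + 1) + B"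
    unfolding prim_def by (intro order_trans[OF norm_triangle_ineq4] add_mono) auto
  also have "\<dots> \<le> B * 2 + B"
    using order_trans[OF norm_ge_zero assms(2)[of 0]] by (intro add_mono mult_left_mono) auto
  finally show ?thesis by simp
qed

lemma integrable_prim:
  fixes w :: "real \<Rightarrow> 'b::euclidean_space"
  shows "continuous_on {-1..1} w \<Longrightarrow> c \<le> 1 \<Longrightarrow> w integrable_on {-1..c}"
  by (rule integrable_continuous_interval) (auto elim: continuous_on_subset)

lemma prim_diff:
  assumes "continuous_on {-1..1} v" "continuous_on {-1..1} w"
  shows "prim (\<lambda>s. v s - w s) t = prim v t - prim w t"
  unfolding prim_def
  by (simp add: integral_diff integrable_prim assms algebra_simps)

lemma prim_add:
  assumes "continuous_on {-1..1} v" "continuous_on {-1..1} w"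
  shows "prim (\<lambda>s. v s + w s) t = prim v t + prim w t"
  unfolding prim_def
  by (simp add: integral_add integrable_prim assms algebra_simps)

lemma prim_scaleR: "prim (\<lambda>s. c *\<^sub>R w s) t = c *\<^sub>R prim w t"
  unfolding prim_def by (simp add: scaleR_diff_right)

lemma continuous_on_prim:
  assumes "continuous_on {-1..1} w" shows "continuous_on UNIV (prim w)"
proof -
  have "continuous_on {-1..1} (\<lambda>c. integral {-1..c} w)"
    by (rule indefinite_integral_continuous_1) (rule integrable_prim[OF assms], simp)
  then have "continuous_on UNIV (\<lambda>s. integral {-1..max (-1) (min 1 s)} w)"
    by (rule continuous_on_compose2) (auto intro!: continuous_intros)
  then show ?thesis unfolding prim_def by (intro continuous_intros)
qed

lemma prim_has_vector_derivative:
  assumes w: "continuous_on {-1..1} w" and s: "-1 < s" "s < 1"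
  shows "(prim w has_vector_derivative w s) (at s)"
proof -
  have "((\<lambda>c. integral {-1..c} w) has_vector_derivative w s) (at s within {-1..1})"
    by (rule integral_has_vector_derivative[OF w]) (use s in auto)
  then have "((\<lambda>c. integral {-1..c} w) has_vector_derivative w s) (at s)"
    using at_within_interior[of s "{-1..1}"] s by simp
  then have "((\<lambda>c. integral {-1..c} w - integral {-1..0} w) has_vector_derivative w s) (at s)"
    by (auto intro!: derivative_eq_intros)
  then show ?thesis
    by (rule has_vector_derivative_transform_within_open[of _ _ _ "{-1<..<1}"])
      (use s in \<open>auto simp: prim_def min_def max_def\<close>)
qed

text \<open>Time is rescaled to [-1, 1], so \<delta> is the true length of the time interval, and
  the smallness condition makes the Picard map a contraction with factor 1/2.\<close>

lemma picard_exists: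
  fixes f :: "real \<Rightarrow> 'b::euclidean_space \<Rightarrow> 'b"
  assumes cont: "continuous_on ({-1..1} \<times> UNIV) (\<lambda>(s, y). f s y)"
    and lip: "\<And>s y z. s \<in> {-1..1} \<Longrightarrow> norm (f s y - f s z) \<le> K * norm (y - z)"
    and \<delta>: "0 \<le> \<delta>" "0 \<le> K" "3 * \<delta> * K \<le> 1/2"
  shows "\<exists>u. continuous_on UNIV u \<and> (\<forall>s. u s = x + \<delta> *\<^sub>R prim (\<lambda>r. f r (u r)) s)"
proof -
  have cf: "continuous_on {-1..1} (\<lambda>r. f r (u r))" if "continuous_on {-1..1} u" for u
    using continuous_on_compose2[OF cont continuous_on_Pair[OF continuous_on_id that]] by auto
  have cu: "continuous_on {-1..1} (apply_bcontfun u)" for u :: "real \<Rightarrow>\<^sub>C 'b"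
    using apply_bcontfun[of u] by (auto simp: bcontfun_def elim: continuous_on_subset)
  define F :: "(real \<Rightarrow>\<^sub>C 'b) \<Rightarrow> (real \<Rightarrow>\<^sub>C 'b)"
    where "F u = Bcontfun (\<lambda>s. x + \<delta> *\<^sub>R prim (\<lambda>r. f r (apply_bcontfun u r)) s)" for u
  have F: "apply_bcontfun (F u) = (\<lambda>s. x + \<delta> *\<^sub>R prim (\<lambda>r. f r (apply_bcontfun u r)) s)" for u
  proof -
    let ?w = "\<lambda>r. f r (apply_bcontfun u r)"
    have cw: "continuous_on {-1..1} ?w" by (rule cf[OF cu])
    then have "bounded (?w ` {-1..1})"
      by (intro compact_imp_bounded compact_continuous_image) auto
    then obtain B where "\<forall>s\<in>{-1..1}. norm (?w s) \<le> B" unfolding bounded_iff by auto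
    then have B: "\<And>s. s \<in> {-1..1} \<Longrightarrow> norm (?w s) \<le> B" by blast
    have "norm (x + \<delta> *\<^sub>R prim ?w s) \<le> norm x + \<delta> * (3 * B)" for s
      using prim_bound[OF cw B, of s] \<delta>(1)
      by (intro order_trans[OF norm_triangle_ineq]) (auto intro!: mult_left_mono)
    then have "bounded (range (\<lambda>s. x + \<delta> *\<^sub>R prim ?w s))" unfolding bounded_iff by auto
    moreover have "continuous_on UNIV (\<lambda>s. x + \<delta> *\<^sub>R prim ?w s)"
      by (intro continuous_intros continuous_on_prim cw)
    ultimately show ?thesis unfolding F_def
      by (intro Bcontfun_inverse) (simp add: bcontfun_def)
  qed
  have "dist (F u) (F v) \<le> 1/2 * dist u v" for u v
  proof (rule dist_bound)
    fix s
    let ?u = "apply_bcontfun u" and ?v = "apply_bcontfun v"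
    have "dist (apply_bcontfun (F u) s) (apply_bcontfun (F v) s) = norm (\<delta> *\<^sub>R prim (\<lambda>r. f r (?u r) - f r (?v r)) s)"
      unfolding F prim_diff[OF cf[OF cu] cf[OF cu]] by (simp add: dist_norm scaleR_diff_right)
    also have "\<dots> \<le> \<delta> * (3 * (K * dist u v))"
    proof -
      have "norm (prim (\<lambda>r. f r (?u r) - f r (?v r)) s) \<le> 3 * (K * dist u v)"
      proof (rule prim_bound)
        show "continuous_on {-1..1} (\<lambda>r. f r (?u r) - f r (?v r))"
          by (intro continuous_intros cf cu)
        fix r :: real assume r: "r \<in> {-1..1}"
        have "norm (f r (?u r) - f r (?v r)) \<le> K * dist (?u r) (?v r)"
          using lip[OF r] unfolding dist_norm[of "?u r"] .
        also have "\<dots> \<le> K * dist u v" by (rule mult_left_mono[OF dist_bounded \<delta>(2)])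
        finally show "norm (f r (?u r) - f r (?v r)) \<le> K * dist u v" .
      qed
      then show ?thesis using mult_left_mono[OF _ \<delta>(1)] unfolding norm_scaleR abs_of_nonneg[OF \<delta>(1)] by blast
    qed
    also have "\<dots> = (3 * \<delta> * K) * dist u v" by simp
    also have "\<dots> \<le> 1/2 * dist u v" by (rule mult_right_mono[OF \<delta>(3)]) simp
    finally show "dist (apply_bcontfun (F u) s) (apply_bcontfun (F v) s) \<le> 1/2 * dist u v" .
  qed
  then obtain u where "F u = u" using banach_fix_type[of "1/2" F] by auto
  then have "apply_bcontfun u s = x + \<delta> *\<^sub>R prim (\<lambda>r. f r (apply_bcontfun u r)) s" for s
    using fun_cong[OF F[of u], of s] by (simp only:)
  moreover have "continuous_on UNIV (apply_bcontfun u)"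
    using apply_bcontfun[of u] by (auto simp: bcontfun_def)
  ultimately show ?thesis by blast
qed

text \<open>In place of a Gronwall inequality, the estimate is made at a time where the distance is
  maximal. The integral equations bound the maximum there by |x - y|, half of itself and 3 *
  \<delta> * \<eta>; solving for it gives the factors 2 and 6. Allowing two right-hand sides is what
  later compares differences of trajectories with the linearized equation.\<close>

lemma picard_stability:
  fixes f g :: "real \<Rightarrow> 'b::euclidean_space \<Rightarrow> 'b"
  assumes u: "\<And>s. s \<in> {-1..1} \<Longrightarrow> u s = x + \<delta> *\<^sub>R prim (\<lambda>r. f r (u r)) s"
    and v: "\<And>s. s \<in> {-1..1} \<Longrightarrow> v s = y + \<delta> *\<^sub>R prim (\<lambda>r. g r (v r)) s"
    and cu: "continuous_on {-1..1} u" and cv: "continuous_on {-1..1} v"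
    and cf: "continuous_on {-1..1} (\<lambda>r. f r (u r))" and cg: "continuous_on {-1..1} (\<lambda>r. g r (v r))"
    and lip: "\<And>r. r \<in> {-1..1} \<Longrightarrow> norm (f r (u r) - f r (v r)) \<le> K * norm (u r - v r)"
    and diff: "\<And>r. r \<in> {-1..1} \<Longrightarrow> norm (f r (v r) - g r (v r)) \<le> \<eta>"
    and \<delta>: "0 \<le> \<delta>" "0 \<le> K" "3 * \<delta> * K \<le> 1/2" and s: "s \<in> {-1..1}"
  shows "norm (u s - v s) \<le> 2 * norm (x - y) + 6 * \<delta> * \<eta>"
proof -
  have "continuous_on {-1..1} (\<lambda>s. norm (u s - v s))" by (intro continuous_intros cu cv)
  from continuous_attains_sup[OF compact_Icc _ this]
  obtain t where t: "t \<in> {-1..1}" and max: "\<And>s. s \<in> {-1..1} \<Longrightarrow> norm (u s - v s) \<le> norm (u t - v t)"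
    by auto
  have "norm (prim (\<lambda>r. f r (u r) - g r (v r)) t) \<le> 3 * (K * norm (u t - v t) + \<eta>)"
  proof (rule prim_bound)
    show "continuous_on {-1..1} (\<lambda>r. f r (u r) - g r (v r))" by (intro continuous_intros cf cg)
    fix r :: real assume r: "r \<in> {-1..1}"
    have "norm (f r (u r) - g r (v r)) \<le> norm (f r (u r) - f r (v r)) + norm (f r (v r) - g r (v r))"
      using norm_triangle_ineq[of "f r (u r) - f r (v r)" "f r (v r) - g r (v r)"] by simp
    also have "\<dots> \<le> K * norm (u r - v r) + \<eta>" using lip[OF r] diff[OF r] by linarith
    also have "\<dots> \<le> K * norm (u t - v t) + \<eta>" using max[OF r] \<delta>(2) by (simp add: mult_left_mono)
    finally show "norm (f r (u r) - g r (v r)) \<le> K * norm (u t - v t) + \<eta>" .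
  qed
  then have "norm (\<delta> *\<^sub>R prim (\<lambda>r. f r (u r) - g r (v r)) t) \<le> \<delta> * (3 * (K * norm (u t - v t) + \<eta>))"
    using \<delta>(1) by (simp add: mult_left_mono)
  moreover have "u t - v t = (x - y) + \<delta> *\<^sub>R prim (\<lambda>r. f r (u r) - g r (v r)) t"
    unfolding prim_diff[OF cf cg] using u[OF t] v[OF t] by (simp add: scaleR_diff_right)
  ultimately have "norm (u t - v t) \<le> norm (x - y) + \<delta> * (3 * (K * norm (u t - v t) + \<eta>))"
    by (smt (verit) norm_triangle_ineq)
  also have "\<dots> = norm (x - y) + (3 * \<delta> * K) * norm (u t - v t) + 3 * \<delta> * \<eta>"
    by (simp add: algebra_simps)
  also have "\<dots> \<le> norm (x - y) + 1/2 * norm (u t - v t) + 3 * \<delta> * \<eta>"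
    using mult_right_mono[OF \<delta>(3), of "norm (u t - v t)"] by simp
  finally have "norm (u t - v t) \<le> 2 * norm (x - y) + 6 * \<delta> * \<eta>" by simp
  with max[OF s] show ?thesis by linarith
qed

text \<open>The size of \<epsilon> is tied to \<open>K\<close> by hypothesis instead of being chosen
  inside, because all curves of a flow box need a solution on one common interval.\<close>

lemma linear_ode_exists:
  fixes A :: "real \<Rightarrow> 'b::euclidean_space \<Rightarrow> 'b"
  assumes \<epsilon>: "0 < \<epsilon>" "0 \<le> K" "3 * \<epsilon> * K \<le> 1/2"
    and lin: "\<And>t. t \<in> {-\<epsilon>..\<epsilon>} \<Longrightarrow> linear (A t)"
    and cont: "\<And>e. continuous_on {-\<epsilon>..\<epsilon>} (\<lambda>t. A t e)"
    and bound: "\<And>t v. t \<in> {-\<epsilon>..\<epsilon>} \<Longrightarrow> norm (A t v) \<le> K * norm v"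
  obtains n where "n 0 = n0" "\<And>t. t \<in> {-\<epsilon><..<\<epsilon>} \<Longrightarrow> (n has_vector_derivative A t (n t)) (at t)"
proof -
  have in_iv: "\<epsilon> * s \<in> {-\<epsilon>..\<epsilon>}" if "s \<in> {-1..1}" for s
    using that \<epsilon>(1) mult_left_mono[of s 1 \<epsilon>] mult_left_mono[of "-1" s \<epsilon>] by auto
  have c1: "continuous_on ({-1..1} \<times> UNIV) (\<lambda>z. A (\<epsilon> * fst z) e)" for e :: 'b
    by (rule continuous_on_compose2[OF cont]) (use in_iv in \<open>auto intro!: continuous_intros\<close>)
  have "continuous_on ({-1..1} \<times> UNIV) (\<lambda>z. A (\<epsilon> * fst z) (snd z))"
    by (rule continuous_on_linear_family[OF _ c1]) (use in_iv lin in \<open>auto intro!: continuous_intros\<close>)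
  then have "\<exists>u. continuous_on UNIV u \<and> (\<forall>s. u s = n0 + \<epsilon> *\<^sub>R prim (\<lambda>r. A (\<epsilon> * r) (u r)) s)"
    by (intro picard_exists[where K = K])
      (use \<epsilon> bound[OF in_iv] linear_diff[OF lin[OF in_iv], symmetric] in \<open>auto simp: case_prod_unfold\<close>)
  then obtain u where u: "continuous_on UNIV u" "\<And>s. u s = n0 + \<epsilon> *\<^sub>R prim (\<lambda>r. A (\<epsilon> * r) (u r)) s"
    by blast
  have cw: "continuous_on {-1..1} (\<lambda>r. A (\<epsilon> * r) (u r))"
  proof (rule continuous_on_linear_family[where A = "\<lambda>r. A (\<epsilon> * r)" and w = u])
    show "continuous_on {-1..1} (\<lambda>r. A (\<epsilon> * r) e)" for e
      by (rule continuous_on_compose2[OF cont]) (use in_iv in \<open>auto intro!: continuous_intros\<close>)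
  qed (use lin in_iv u(1) in \<open>auto elim: continuous_on_subset\<close>)
  show thesis
  proof (rule that[of "\<lambda>t. u (t / \<epsilon>)"])
    show "u (0 / \<epsilon>) = n0" using u(2)[of 0] by (simp add: prim_0)
    fix t assume t: "t \<in> {-\<epsilon><..<\<epsilon>}"
    then have s: "-1 < t / \<epsilon>" "t / \<epsilon> < 1" using \<epsilon>(1) by (auto simp: field_simps)
    have eq: "u = (\<lambda>s. n0 + \<epsilon> *\<^sub>R prim (\<lambda>r. A (\<epsilon> * r) (u r)) s)" using u(2) by (rule ext)
    have "(u has_vector_derivative \<epsilon> *\<^sub>R A (\<epsilon> * (t / \<epsilon>)) (u (t / \<epsilon>))) (at (t / \<epsilon>))"
      by (subst eq) (use prim_has_vector_derivative[OF cw s] in \<open>auto intro!: derivative_eq_intros\<close>)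
    then have "((u \<circ> (\<lambda>t. t / \<epsilon>)) has_vector_derivative (1 / \<epsilon>) *\<^sub>R (\<epsilon> *\<^sub>R A (\<epsilon> * (t / \<epsilon>)) (u (t / \<epsilon>)))) (at t)"
      by (intro vector_diff_chain_at) (use \<epsilon>(1) in \<open>auto intro!: derivative_eq_intros simp: has_real_derivative_iff_has_vector_derivative[symmetric]\<close>)
    then show "((\<lambda>t. u (t / \<epsilon>)) has_vector_derivative A t (u (t / \<epsilon>))) (at t)"
      using \<epsilon>(1) by (simp add: o_def)
  qed
qed

text \<open>The quantity |z|^2 exp(- 2 C t) does not increase, and it vanishes at
  \<open>a\<close>.\<close>

lemma ode_zero:
  fixes z :: "real \<Rightarrow> 'b::real_inner"
  assumes ab: "a \<le> b" and z: "\<And>t. t \<in> {a..b} \<Longrightarrow> (z has_vector_derivative z' t) (at t)"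
    and bound: "\<And>t. t \<in> {a..b} \<Longrightarrow> norm (z' t) \<le> C * norm (z t)" and "z a = 0"
  shows "z b = 0"
proof -
  let ?\<phi> = "\<lambda>t. (z t \<bullet> z t) * exp (- 2 * C * t)"
  have "?\<phi> b \<le> ?\<phi> a"
  proof (rule DERIV_nonpos_imp_nonincreasing[OF ab])
    fix t assume t: "a \<le> t" "t \<le> b"
    have "((\<lambda>t. z t \<bullet> z t) has_derivative (\<lambda>h. z t \<bullet> (h *\<^sub>R z' t) + (h *\<^sub>R z' t) \<bullet> z t)) (at t)"
      using z[of t] t unfolding has_vector_derivative_def by (intro has_derivative_inner) auto
    then have "((\<lambda>t. z t \<bullet> z t) has_real_derivative 2 * (z t \<bullet> z' t)) (at t)"
      unfolding has_field_derivative_def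
      by (rule has_derivative_eq_rhs) (auto simp: inner_commute algebra_simps)
    then have d: "(?\<phi> has_real_derivative (2 * (z t \<bullet> z' t)) * exp (- 2 * C * t) + exp (- 2 * C * t) * (- 2 * C) * (z t \<bullet> z t)) (at t)"
      by (auto intro!: derivative_eq_intros simp: algebra_simps)
    have "z t \<bullet> z' t \<le> norm (z t) * norm (z' t)" by (rule norm_cauchy_schwarz)
    also have "\<dots> \<le> norm (z t) * (C * norm (z t))" using bound[of t] t by (intro mult_left_mono) auto
    also have "\<dots> = C * (z t \<bullet> z t)" by (simp add: dot_square_norm power2_eq_square)
    finally have "(z t \<bullet> z' t) * exp (- 2 * C * t) \<le> C * (z t \<bullet> z t) * exp (- 2 * C * t)"
      by (intro mult_right_mono) auto
    then have "(2 * (z t \<bullet> z' t)) * exp (- 2 * C * t) + exp (- 2 * C * t) * (- 2 * C) * (z t \<bullet> z t) \<le> 0"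
      by (simp add: algebra_simps)
    with d show "\<exists>y. (?\<phi> has_real_derivative y) (at t) \<and> y \<le> 0" by blast
  qed
  then have "z b \<bullet> z b \<le> 0" using \<open>z a = 0\<close> by (simp add: mult_le_0_iff)
  then show ?thesis by (metis inner_eq_zero_iff inner_ge_zero order_antisym)
qed

text \<open>Trajectories are Picard fixed points for a globally Lipschitz extension of the field.
  For the dependence on the initial point, the candidate derivative is first constructed as the
  solution \<open>m\<close> of the linearized equation along the trajectory; differences of
  trajectories are then compared with it.\<close>

lemma C1_local_flow:
  fixes l :: "'b::euclidean_space \<Rightarrow> 'b"
  assumes l: "Ck_on 1 W l" and R: "R > 0" "cball p R \<subseteq> W"
  obtains \<epsilon> \<Phi> where "\<epsilon> > 0"
    "\<And>x. x \<in> ball p (R/2) \<Longrightarrow> \<Phi> (x, 0) = x"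
    "\<And>x t. x \<in> ball p (R/2) \<Longrightarrow> t \<in> {-\<epsilon><..<\<epsilon>} \<Longrightarrow> \<Phi> (x, t) \<in> cball p R"
    "\<And>x t. x \<in> ball p (R/2) \<Longrightarrow> t \<in> {-\<epsilon><..<\<epsilon>} \<Longrightarrow>
       ((\<lambda>t. \<Phi> (x, t)) has_vector_derivative l (\<Phi> (x, t))) (at t)"
    "Ck_on 1 (ball p (R/2) \<times> {-\<epsilon><..<\<epsilon>}) \<Phi>"
proof -
  let ?B = "cball p R" and ?X = "ball p (R/2)" and ?I = "{-1..1::real}"
  let ?D = "\<lambda>z. frechet_derivative l (at z)"
  obtain K1 where K1: "K1 \<ge> 0" "\<And>y z. y \<in> ?B \<Longrightarrow> z \<in> ?B \<Longrightarrow> norm (l y - l z) \<le> K1 * norm (y - z)"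
    using C1_lipschitz_on_compact_convex[OF l compact_cball convex_cball R(2)] by blast
  have cD: "continuous_on ?B (\<lambda>z. ?D z v)" for v
    by (rule continuous_on_subset[OF C1_continuous_deriv[OF l] R(2)])
  have linD: "linear (?D z)" if "z \<in> ?B" for z
    using C1_linear_deriv[OF l] R(2) that by auto
  have "bounded ((\<lambda>z. \<Sum>b\<in>Basis. norm (?D z b)) ` ?B)"
    by (intro compact_imp_bounded compact_continuous_image continuous_intros cD compact_cball)
  then obtain K2 where "\<forall>z\<in>?B. norm (\<Sum>b\<in>Basis. norm (?D z b)) \<le> K2" unfolding bounded_iff by auto
  then have K2: "(\<Sum>b\<in>Basis. norm (?D z b)) \<le> K2" if "z \<in> ?B" for z using that by fastforce
  have cl: "continuous_on ?B l" by (rule continuous_on_subset[OF Ck_on_continuous[OF l] R(2)])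
  then have "bounded (l ` ?B)" by (intro compact_imp_bounded compact_continuous_image compact_cball)
  then obtain M where M: "\<forall>z\<in>?B. norm (l z) \<le> M" unfolding bounded_iff by auto
  have M0: "0 \<le> M" using M R(1) order_trans[OF norm_ge_zero, of "l p" M] by auto
  define K where "K = max K1 K2"
  have K: "0 \<le> K" "\<And>y z. y \<in> ?B \<Longrightarrow> z \<in> ?B \<Longrightarrow> norm (l y - l z) \<le> K * norm (y - z)"
    using K1(1) order_trans[OF K1(2) mult_right_mono[of K1 K]] by (auto simp: K_def)
  have DK: "norm (?D z v) \<le> K * norm v" if "z \<in> ?B" for z v
    using order_trans[OF linear_bound_sum[OF linD[OF that], of v] mult_right_mono[of _ K "norm v"]] K2[OF that]
    by (simp add: K_def le_max_iff_disj)
  \<comment> \<open>The first bound makes the Picard maps contract, both for the field and for its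
    linearization, since \<open>K\<close> dominates the derivative as well. The second limits the
    displacement \<delta> * (3 * M) to R / 4. The added 1 keeps the denominators positive.\<close>
  define \<delta> where "\<delta> = min (1 / (6 * (K + 1))) (R / (12 * (M + 1)))"
  have \<delta>0: "\<delta> > 0" using K(1) M0 R(1) by (simp add: \<delta>_def)
  have "\<delta> \<le> 1 / (6 * (K + 1))" by (simp add: \<delta>_def)
  then have "3 * \<delta> * (K + 1) \<le> 1/2" using K(1) by (simp add: field_simps)
  then have \<delta>K: "3 * \<delta> * K \<le> 1/2" using \<delta>0 by (simp add: algebra_simps)
  have "\<delta> \<le> R / (12 * (M + 1))" by (simp add: \<delta>_def)
  then have "\<delta> * (3 * (M + 1)) \<le> R / 4" using M0 by (simp add: field_simps)
  then have \<delta>M: "\<delta> * (3 * M) \<le> R / 4" using \<delta>0 by (simp add: algebra_simps)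
  note \<delta> = less_imp_le[OF \<delta>0] K(1) \<delta>K
  \<comment> \<open>The projection onto the ball is 1-Lipschitz, so l \<circ> P is defined
    everywhere and inherits the constant \<open>K\<close>.\<close>
  define P where "P = closest_point ?B"
  have PB: "P z \<in> ?B" for z unfolding P_def by (rule closest_point_in_set) (use R(1) in auto)
  have Pid: "P z = z" if "z \<in> ?B" for z unfolding P_def using that by (rule closest_point_self)
  have Plip: "norm (P y - P z) \<le> norm (y - z)" for y z
    unfolding P_def dist_norm[symmetric] by (rule closest_point_lipschitz) (use R(1) in auto)
  have cP: "continuous_on S P" for S
    unfolding P_def by (rule continuous_on_closest_point) (use R(1) in auto)
  define lh where "lh z = l (P z)" for z
  have lh_lip: "norm (lh y - lh z) \<le> K * norm (y - z)" for y z
    unfolding lh_def using K(2)[OF PB PB] Plip K(1) by (meson mult_left_mono order_trans)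
  have clh: "continuous_on S lh" for S
    unfolding lh_def by (rule continuous_on_compose2[OF cl cP]) (use PB in auto)
  have clh2: "continuous_on S (\<lambda>r. lh (u r))" if "continuous_on S u" for S and u :: "'x::topological_space \<Rightarrow> 'b"
    by (rule continuous_on_compose2[OF clh[of UNIV] that]) auto
  have "\<exists>u. continuous_on UNIV u \<and> (\<forall>s. u s = x + \<delta> *\<^sub>R prim (\<lambda>r. lh (u r)) s)" for x
    by (rule picard_exists[OF _ lh_lip \<delta>])
      (auto simp: case_prod_unfold intro!: clh2 continuous_intros)
  then obtain U where "\<forall>x. continuous_on UNIV (U x) \<and> (\<forall>s. U x s = x + \<delta> *\<^sub>R prim (\<lambda>r. lh (U x r)) s)"
    by metis
  then have cU: "\<And>x. continuous_on UNIV (U x)" and eqU: "\<And>x s. U x s = x + \<delta> *\<^sub>R prim (\<lambda>r. lh (U x r)) s"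
    by blast+
  have cUI: "continuous_on S (U x)" for x S using cU continuous_on_subset by blast
  \<comment> \<open>Start within R / 2, displacement at most R / 4. The margin left up to
    \<open>R\<close> is spent in \<open>C1_uniform_derivative\<close>.\<close>
  have UB: "U x s \<in> cball p (3 * R / 4)" if "x \<in> ?X" for x s
  proof -
    have "norm (prim (\<lambda>r. lh (U x r)) s) \<le> 3 * M"
      by (rule prim_bound[OF clh2[OF cUI]]) (use M PB in \<open>auto simp: lh_def\<close>)
    then have "norm (\<delta> *\<^sub>R prim (\<lambda>r. lh (U x r)) s) \<le> R / 4"
      using order_trans[OF mult_left_mono[OF _ \<delta>(1)] \<delta>M] abs_of_nonneg[OF \<delta>(1)] by simp
    then have "dist x (U x s) \<le> R / 4" using eqU[of x s]
      by (metis add_diff_cancel_left' dist_commute dist_norm)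
    moreover have "dist p x < R / 2" using that by simp
    ultimately show ?thesis using dist_triangle[of p "U x s" x] by simp
  qed
  have UB': "U x s \<in> ?B" if "x \<in> ?X" for x s using UB[OF that, of s] R(1) by simp
  have lhU: "lh (U x s) = l (U x s)" if "x \<in> ?X" for x s
    using Pid[OF UB'[OF that]] by (simp add: lh_def)
  have Ulip: "norm (U x s - U y s) \<le> 2 * norm (x - y)" if "s \<in> ?I" for x y s
    using picard_stability[where f = "\<lambda>_. lh" and g = "\<lambda>_. lh" and u = "U x" and v = "U y" and \<eta> = 0,
        OF eqU eqU cUI cUI clh2[OF cUI] clh2[OF cUI] lh_lip _ \<delta> that] by simp
  define A where "A x r v = ?D (U x r) v" for x r v
  have linA: "linear (A x r)" if "x \<in> ?X" for x r
    unfolding A_def by (rule linD[OF UB'[OF that]])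
  have AK: "norm (A x r v) \<le> K * norm v" if "x \<in> ?X" for x r v
    unfolding A_def by (rule DK[OF UB'[OF that]])
  have cA: "continuous_on S (\<lambda>r. A x r v)" if "x \<in> ?X" for S x v
    unfolding A_def by (rule continuous_on_compose2[OF cD cUI]) (use UB'[OF that] in auto)
  have cA2: "continuous_on S (\<lambda>r. A x r (w r))" if "x \<in> ?X" "continuous_on S w" for S x w
    by (rule continuous_on_linear_family[OF linA[OF that(1)] cA[OF that(1)] that(2)])
  \<comment> \<open>The linearized equation along the trajectory \<open>U x\<close>, with initial
    vector \<open>h\<close>; its solution becomes \<open>m x h\<close>.\<close>
  have "\<exists>u. x \<in> ?X \<longrightarrow> continuous_on UNIV u \<and> (\<forall>s. u s = h + \<delta> *\<^sub>R prim (\<lambda>r. A x r (u r)) s)" for x h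
  proof (cases "x \<in> ?X")
    case True
    have c1: "continuous_on (?I \<times> UNIV) (\<lambda>z. A x (fst z) e)" for e :: 'b
      by (rule continuous_on_compose2[OF cA[OF True, of UNIV]]) (auto intro!: continuous_intros)
    have "continuous_on (?I \<times> UNIV) (\<lambda>z. A x (fst z) (snd z))"
      by (rule continuous_on_linear_family[OF _ c1]) (use linA[OF True] in \<open>auto intro!: continuous_intros\<close>)
    then have "\<exists>u. continuous_on UNIV u \<and> (\<forall>s. u s = h + \<delta> *\<^sub>R prim (\<lambda>r. A x r (u r)) s)"
      by (intro picard_exists[OF _ _ \<delta>])
        (use AK[OF True] in \<open>auto simp: case_prod_unfold linear_diff[OF linA[OF True], symmetric]\<close>)
    then show ?thesis by blast
  qed simp
  then obtain m where "\<forall>x h. x \<in> ?X \<longrightarrow> continuous_on UNIV (m x h) \<and> (\<forall>s. m x h s = h + \<delta> *\<^sub>R prim (\<lambda>r. A x r (m x h r)) s)"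
    by metis
  then have cm: "\<And>x h. x \<in> ?X \<Longrightarrow> continuous_on UNIV (m x h)"
    and eqm: "\<And>x h s. x \<in> ?X \<Longrightarrow> m x h s = h + \<delta> *\<^sub>R prim (\<lambda>r. A x r (m x h r)) s"
    by blast+
  have cmI: "continuous_on S (m x h)" if "x \<in> ?X" for x h S using cm[OF that] continuous_on_subset by blast
  have lipA: "norm (A x r v - A x r w) \<le> K * norm (v - w)" if "x \<in> ?X" for x r v w
    using AK[OF that, of r "v - w"] by (simp add: linear_diff[OF linA[OF that]])
  \<comment> \<open>A solution of the linearized equation with forcing term \<open>E\<close> differs
    from \<open>m\<close> by at most 6 * \<delta> times the size of \<open>E\<close>. The case E = 0
    is uniqueness, from which linearity of \<open>m\<close> in \<open>h\<close> follows.\<close>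
  have uniq: "norm (u s - m x h s) \<le> 6 * \<delta> * \<eta>"
    if x: "x \<in> ?X" and s: "s \<in> ?I" and cu: "continuous_on ?I u" and cE: "continuous_on ?I E"
      and \<eta>: "\<And>r. r \<in> ?I \<Longrightarrow> norm (E r) \<le> \<eta>"
      and u: "\<And>s. s \<in> ?I \<Longrightarrow> u s = h + \<delta> *\<^sub>R prim (\<lambda>r. A x r (u r) + E r) s" for x s u h E \<eta>
    using picard_stability[where f = "\<lambda>r y. A x r y + E r" and g = "A x" and u = u and v = "m x h" and \<eta> = \<eta>,
        OF u eqm[OF x] cu cmI[OF x] _ cA2[OF x cmI[OF x]] _ _ \<delta> s]
    by (simp add: continuous_on_add cA2[OF x cu] cE \<eta> lipA[OF x])
  have unique: "u s = m x h s"
    if "x \<in> ?X" "s \<in> ?I" "continuous_on ?I u" "\<And>s. s \<in> ?I \<Longrightarrow> u s = h + \<delta> *\<^sub>R prim (\<lambda>r. A x r (u r)) s" for x s u h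
    using uniq[OF that(1,2,3), of "\<lambda>_. 0" 0 h] that(4) by simp
  have m_add: "m x (h + k) s = m x h s + m x k s" if "x \<in> ?X" "s \<in> ?I" for x h k s
  proof (rule unique[OF that, symmetric])
    show "continuous_on ?I (\<lambda>s. m x h s + m x k s)" using cmI[OF that(1)] by (intro continuous_intros)
    show "m x h s + m x k s = h + k + \<delta> *\<^sub>R prim (\<lambda>r. A x r (m x h r + m x k r)) s" for s
      using eqm[OF that(1), of h s] eqm[OF that(1), of k s]
      by (simp add: linear_add[OF linA[OF that(1)]] prim_add cA2[OF that(1) cmI[OF that(1)]] scaleR_add_right)
  qed
  have m_scale: "m x (c *\<^sub>R h) s = c *\<^sub>R m x h s" if "x \<in> ?X" "s \<in> ?I" for x h c s
  proof (rule unique[OF that, symmetric])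
    show "continuous_on ?I (\<lambda>s. c *\<^sub>R m x h s)" using cmI[OF that(1)] by (intro continuous_intros)
    show "c *\<^sub>R m x h s = c *\<^sub>R h + \<delta> *\<^sub>R prim (\<lambda>r. A x r (c *\<^sub>R m x h r)) s" for s
      by (subst eqm[OF that(1), of h s]) (simp add: linear_scale[OF linA[OF that(1)]] prim_scaleR scaleR_add_right mult.commute)
  qed
  have linm: "linear (\<lambda>h. m x h s)" if "x \<in> ?X" "s \<in> ?I" for x s
    by (rule linearI) (use m_add[OF that] m_scale[OF that] in auto)
  have dU: "((\<lambda>x. U x s) has_derivative (\<lambda>h. m x h s)) (at x)" if x: "x \<in> ?X" and s: "s \<in> ?I" for x s
    unfolding has_derivative_at_alt
  proof (intro conjI allI impI)
    show "bounded_linear (\<lambda>h. m x h s)" using linm[OF x s] by (simp add: linear_conv_bounded_linear)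
    fix e :: real assume "e > 0"
    define e' where "e' = e / (12 * \<delta>)"
    have e': "e' > 0" using \<open>e > 0\<close> \<delta>0 by (simp add: e'_def)
    have "3 * R / 4 < R" using R(1) by simp
    from C1_uniform_derivative[OF l R(2) this e'] obtain d where d: "d > 0"
      "\<And>y v. y \<in> cball p (3*R/4) \<Longrightarrow> norm v < d \<Longrightarrow> norm (l (y + v) - l y - ?D y v) \<le> e' * norm v" by blast
    obtain d1 where d1: "d1 > 0" "ball x d1 \<subseteq> ?X" using x open_contains_ball[of ?X] open_ball by blast
    show "\<exists>d>0. \<forall>y. norm (y - x) < d \<longrightarrow> norm (U y s - U x s - m x (y - x) s) \<le> e * norm (y - x)"
    proof (intro exI conjI allI impI)
      \<comment> \<open>Trajectories starting at distance below d / 2 stay at distance below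
        \<open>d\<close>, by the factor 2 in \<open>Ulip\<close>.\<close>
      show "min (d / 2) d1 > 0" using d d1 by simp
      fix y assume "norm (y - x) < min (d / 2) d1"
      then have yx: "norm (y - x) < d / 2" and y: "y \<in> ?X" using d1(2) by (auto simp: dist_norm norm_minus_commute)
      \<comment> \<open>The Taylor remainder of the field along the trajectory: the difference of
        two trajectories solves the linearized equation with this forcing term, which is small of
        higher order.\<close>
      define E where "E r = lh (U y r) - lh (U x r) - A x r (U y r - U x r)" for r
      have cE: "continuous_on ?I E" unfolding E_def by (intro continuous_intros clh2 cA2 x cUI)
      have "norm ((U y s - U x s) - m x (y - x) s) \<le> 6 * \<delta> * (e' * (2 * norm (y - x)))"
      proof (rule uniq[OF x s _ cE])
        show "continuous_on ?I (\<lambda>s. U y s - U x s)" by (intro continuous_intros cUI)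
        show "U y s - U x s = y - x + \<delta> *\<^sub>R prim (\<lambda>r. A x r (U y r - U x r) + E r) s" for s
          using eqU[of y s] eqU[of x s] by (simp add: E_def prim_diff clh2 cUI scaleR_diff_right)
        fix r :: real assume r: "r \<in> ?I"
        have n: "norm (U y r - U x r) \<le> 2 * norm (y - x)" by (rule Ulip[OF r])
        have "norm (E r) \<le> e' * norm (U y r - U x r)"
          unfolding E_def lhU[OF x] lhU[OF y] A_def
          using d(2)[OF UB[OF x], of "U y r - U x r" r] n yx by simp
        also have "\<dots> \<le> e' * (2 * norm (y - x))" using n e' by (intro mult_left_mono) auto
        finally show "norm (E r) \<le> e' * (2 * norm (y - x))" .
      qed
      also have "\<dots> = e * norm (y - x)" using \<delta>0 by (simp add: e'_def)
      finally show "norm (U y s - U x s - m x (y - x) s) \<le> e * norm (y - x)" .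
    qed
  qed
  \<comment> \<open>Seen from the trajectory of \<open>y\<close>, the curve \<open>m x h\<close>
    solves the linearized equation with the forcing term (A x - A y) applied to itself, which is
    small by uniform continuity of the derivative. The estimate is uniform in time, so joint
    continuity follows.\<close>
  have cm_x: "\<exists>d>0. \<forall>y\<in>?X. norm (y - x) < d \<longrightarrow> (\<forall>s\<in>?I. norm (m y h s - m x h s) \<le> e)"
    if x: "x \<in> ?X" and e: "e > 0" for x h e
  proof -
    obtain N where N: "N > 0" "\<And>s. s \<in> ?I \<Longrightarrow> norm (m x h s) \<le> N"
    proof -
      have "bounded (m x h ` ?I)" by (intro compact_imp_bounded compact_continuous_image cmI x) auto
      then obtain N where "N > 0" "\<forall>z\<in>m x h ` ?I. norm z \<le> N" unfolding bounded_pos by blast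
      then show ?thesis using that by blast
    qed
    define e' where "e' = e / (6 * \<delta> * N * real DIM('b))"
    have e': "e' > 0" using e \<delta>0 N by (simp add: e'_def)
    have "\<exists>d>0. \<forall>y\<in>?B. \<forall>z\<in>?B. dist z y < d \<longrightarrow> dist (?D z b) (?D y b) < e'" for b
      using compact_uniformly_continuous[OF cD compact_cball, of b] e' unfolding uniformly_continuous_on_def by auto
    then obtain d where d: "\<And>b. d b > 0" "\<And>b y z. y\<in>?B \<Longrightarrow> z\<in>?B \<Longrightarrow> dist z y < d b \<Longrightarrow> dist (?D z b) (?D y b) < e'"
      by metis
    define d0 where "d0 = Min (d ` Basis)"
    have d0: "d0 > 0" using d(1) by (auto simp: d0_def)
    have d0b: "d0 \<le> d b" if "b \<in> Basis" for b using that by (auto simp: d0_def)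
    show ?thesis
    proof (intro exI conjI ballI impI)
      show "d0 / 2 > 0" using d0 by simp
      fix y s assume y: "y \<in> ?X" and yx: "norm (y - x) < d0 / 2" and s: "s \<in> ?I"
      define E where "E r = A x r (m x h r) - A y r (m x h r)" for r
      have cE: "continuous_on ?I E" unfolding E_def by (intro continuous_intros cA2 x y cmI)
      have "norm (m x h s - m y h s) \<le> 6 * \<delta> * (real DIM('b) * e' * N)"
      proof (rule uniq[OF y s cmI[OF x] cE])
        show "m x h s = h + \<delta> *\<^sub>R prim (\<lambda>r. A y r (m x h r) + E r) s" for s
          using eqm[OF x, of h s] by (simp add: E_def)
        fix r :: real assume r: "r \<in> ?I"
        have n: "dist (U x r) (U y r) < d0"
          using Ulip[OF r, of y x] yx by (simp add: dist_norm norm_minus_commute)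
        have "E r = A x r (m x h r) - A y r (m x h r)" by (simp add: E_def)
        also have "norm \<dots> \<le> (\<Sum>b\<in>Basis. norm (A x r b - A y r b)) * norm (m x h r)"
          by (rule linear_bound_sum[OF linear_compose_sub[OF linA[OF x] linA[OF y]]])
        also have "\<dots> \<le> (\<Sum>b\<in>(Basis::'b set). e') * N"
        proof (intro mult_mono sum_mono)
          fix b :: 'b assume "b \<in> Basis"
          from d0b[OF this] show "norm (A x r b - A y r b) \<le> e'"
            using d(2)[OF UB'[OF y] UB'[OF x], of r r b] n by (simp add: A_def dist_norm)
        qed (use N r e' in \<open>auto intro: sum_nonneg\<close>)
        finally show "norm (E r) \<le> real DIM('b) * e' * N" by simp
      qed
      also have "\<dots> = e" using \<delta>0 N(1) by (simp add: e'_def)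
      finally show "norm (m y h s - m x h s) \<le> e" by (simp add: norm_minus_commute)
    qed
  qed
  have cont_m: "continuous_on (?X \<times> {-1<..<1}) (\<lambda>(x, s). m x h s)" for h
    unfolding continuous_on_iff
  proof (intro ballI allI impI)
    fix z0 and e :: real assume z0: "z0 \<in> ?X \<times> {-1<..<1::real}" and e: "0 < e"
    define x s where "x = fst z0" and "s = snd z0"
    have x: "x \<in> ?X" and s: "s \<in> {-1<..<1::real}" and zs: "z0 = (x, s)"
      using z0 by (auto simp: x_def s_def)
    obtain d1 where d1: "d1 > 0" "\<And>y s. y \<in> ?X \<Longrightarrow> norm (y - x) < d1 \<Longrightarrow> s \<in> ?I \<Longrightarrow> norm (m y h s - m x h s) \<le> e / 2"
      using cm_x[OF x, of "e/2" h] e by auto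
    obtain d2 where d2: "d2 > 0" "\<And>t. dist t s < d2 \<Longrightarrow> dist (m x h t) (m x h s) < e / 2"
      using cm[OF x, of h] e unfolding continuous_on_iff by (meson UNIV_I half_gt_zero)
    show "\<exists>d>0. \<forall>z\<in>?X \<times> {-1<..<1}. dist z z0 < d \<longrightarrow> dist (case z of (x, s) \<Rightarrow> m x h s) (case z0 of (x, s) \<Rightarrow> m x h s) < e"
      unfolding zs
    proof (intro exI conjI ballI impI)
      show "min d1 d2 > 0" using d1 d2 by simp
      fix z assume z: "z \<in> ?X \<times> {-1<..<1::real}" and "dist z (x, s) < min d1 d2"
      then have "dist (fst z) x < d1" "dist (snd z) s < d2"
        using dist_fst_le[of z "(x,s)"] dist_snd_le[of z "(x,s)"] by auto
      then have "dist (m (fst z) h (snd z)) (m x h (snd z)) \<le> e / 2" "dist (m x h (snd z)) (m x h s) < e / 2"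
        using d1(2)[of "fst z" "snd z"] d2(2)[of "snd z"] z by (auto simp: dist_norm)
      then have "dist (m (fst z) h (snd z)) (m x h s) < e"
        using dist_triangle[of "m (fst z) h (snd z)" "m x h s" "m x h (snd z)"] by linarith
      then show "dist (case z of (x, s) \<Rightarrow> m x h s) (case (x, s) of (x, s) \<Rightarrow> m x h s) < e"
        by (simp add: case_prod_unfold)
    qed
  qed
  have dUs: "(U x has_vector_derivative \<delta> *\<^sub>R l (U x s)) (at s)" if x: "x \<in> ?X" and s: "s \<in> {-1<..<1}" for x s
  proof -
    have eq: "U x = (\<lambda>s. x + \<delta> *\<^sub>R prim (\<lambda>r. lh (U x r)) s)" using eqU by (rule ext)
    have "((\<lambda>s. x + \<delta> *\<^sub>R prim (\<lambda>r. lh (U x r)) s) has_vector_derivative \<delta> *\<^sub>R lh (U x s)) (at s)"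
      using prim_has_vector_derivative[OF clh2[OF cUI[of _ x]], of s] s by (auto intro!: derivative_eq_intros)
    then have "(U x has_vector_derivative \<delta> *\<^sub>R lh (U x s)) (at s)" unfolding eq[symmetric] .
    then show ?thesis unfolding lhU[OF x] .
  qed
  have cUj: "continuous_on (?X \<times> {-1<..<1}) (\<lambda>z. U (fst z) (snd z))"
    unfolding continuous_on_iff
  proof (intro ballI allI impI)
    fix z0 and e :: real assume z0: "z0 \<in> ?X \<times> {-1<..<1::real}" and e: "0 < e"
    define x s where "x = fst z0" and "s = snd z0"
    have x: "x \<in> ?X" and s: "s \<in> {-1<..<1::real}" and zs: "z0 = (x, s)"
      using z0 by (auto simp: x_def s_def)
    obtain d2 where d2: "d2 > 0" "\<And>t. dist t s < d2 \<Longrightarrow> dist (U x t) (U x s) < e / 2"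
      using cU[of x] e unfolding continuous_on_iff by (meson UNIV_I half_gt_zero)
    show "\<exists>d>0. \<forall>z\<in>?X \<times> {-1<..<1}. dist z z0 < d \<longrightarrow> dist (U (fst z) (snd z)) (U (fst z0) (snd z0)) < e"
      unfolding zs
    proof (intro exI conjI ballI impI)
      show "min (e / 4) d2 > 0" using e d2 by simp
      fix z assume z: "z \<in> ?X \<times> {-1<..<1::real}" and "dist z (x, s) < min (e / 4) d2"
      then have "dist (fst z) x < e / 4" "dist (snd z) s < d2"
        using dist_fst_le[of z "(x,s)"] dist_snd_le[of z "(x,s)"] by auto
      then have "dist (U (fst z) (snd z)) (U x (snd z)) < e / 2" "dist (U x (snd z)) (U x s) < e / 2"
        using Ulip[of "snd z" "fst z" x] d2(2)[of "snd z"] z by (auto simp: dist_norm)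
      then have "dist (U (fst z) (snd z)) (U x s) < e"
        using dist_triangle[of "U (fst z) (snd z)" "U x s" "U x (snd z)"] by linarith
      then show "dist (U (fst z) (snd z)) (U (fst (x, s)) (snd (x, s))) < e" by simp
    qed
  qed
  have cUj2: "continuous_on (?X \<times> {-1<..<1}) (\<lambda>z. l (U (fst z) (snd z)))"
    by (rule continuous_on_compose2[OF cl cUj]) (use UB' in auto)
  have op: "open (?X \<times> {-1<..<1::real})" by (intro open_Times) auto
  \<comment> \<open>The partial derivatives are \<open>m\<close> in the initial point and \<delta>
    times \<open>l\<close> in rescaled time, both jointly continuous. The factor \<delta> is undone
    by the substitution t / \<delta> at the end.\<close>
  have C1: "Ck_on 1 (?X \<times> {-1<..<1}) (\<lambda>(x, s). U x s)"
  proof (rule C1_I)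
    fix z assume z: "z \<in> ?X \<times> {-1<..<1::real}"
    let ?fy = "\<lambda>x s. blinfun_scaleR_left (\<delta> *\<^sub>R l (U x s))"
    have "((\<lambda>(x, s). U x s) has_derivative (\<lambda>(tx, ty). m (fst z) tx (snd z) + ?fy (fst z) (snd z) ty))
        (at (fst z, snd z) within ?X \<times> {-1<..<1})"
    proof (rule has_derivative_partialsI)
      show "((\<lambda>x. U x (snd z)) has_derivative (\<lambda>tx. m (fst z) tx (snd z))) (at (fst z) within ?X)"
        using dU[of "fst z" "snd z"] z by (auto intro: has_derivative_at_withinI)
      show "(U x has_derivative blinfun_apply (?fy x s)) (at s within {-1<..<1})" if "x \<in> ?X" "s \<in> {-1<..<1}" for x s
        using dUs[OF that] by (auto simp: has_vector_derivative_def intro: has_derivative_at_withinI)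
      have "continuous_on (?X \<times> {-1<..<1}) (\<lambda>z. ?fy (fst z) (snd z))"
        by (intro continuous_intros bounded_linear.continuous_on[OF bounded_linear_blinfun_scaleR_left] cUj2)
      then show "continuous (at (fst z, snd z) within ?X \<times> {-1<..<1}) (\<lambda>(x, s). ?fy x s)"
        using z unfolding continuous_on_eq_continuous_within case_prod_unfold prod.collapse by blast
    qed (use z in auto)
    then show "((\<lambda>(x, s). U x s) has_derivative (\<lambda>h. m (fst z) (fst h) (snd z) + snd h *\<^sub>R (\<delta> *\<^sub>R l (U (fst z) (snd z))))) (at z)"
      using at_within_open[OF z op] by (simp add: case_prod_unfold)
  next
    fix h :: "'b \<times> real"
    show "continuous_on (?X \<times> {-1<..<1}) (\<lambda>z. m (fst z) (fst h) (snd z) + snd h *\<^sub>R (\<delta> *\<^sub>R l (U (fst z) (snd z))))"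
      using cont_m[of "fst h"] by (intro continuous_intros cUj2) (simp add: case_prod_unfold)
  qed
  show thesis
  proof (rule that[of \<delta> "\<lambda>(x, t). U x (t / \<delta>)", OF \<delta>0])
    show "(\<lambda>(x, t). U x (t / \<delta>)) (x, 0) = x" for x
      using eqU[of x 0] by (simp add: prim_0)
    show "(\<lambda>(x, t). U x (t / \<delta>)) (x, t) \<in> cball p R" if "x \<in> ?X" for x t
      using UB'[OF that] by simp
    have t: "t / \<delta> \<in> {-1<..<1}" if "t \<in> {-\<delta><..<\<delta>}" for t
      using that \<delta>0 by (auto simp: field_simps)
    show "((\<lambda>t. (\<lambda>(x, t). U x (t / \<delta>)) (x, t)) has_vector_derivative l ((\<lambda>(x, t). U x (t / \<delta>)) (x, t))) (at t)"
      if "x \<in> ?X" "t \<in> {-\<delta><..<\<delta>}" for x t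
    proof -
      have "((\<lambda>t. t / \<delta>) has_vector_derivative 1 / \<delta>) (at t)"
        using \<delta>0 by (auto intro!: derivative_eq_intros simp: has_real_derivative_iff_has_vector_derivative[symmetric])
      from vector_diff_chain_at[OF this dUs[OF that(1) t[OF that(2)]]] show ?thesis
        using \<delta>0 by (simp add: o_def)
    qed
    have "Ck_on 1 (?X \<times> {-\<delta><..<\<delta>}) (\<lambda>z. (\<lambda>(x, s). U x s) (fst z, snd z / \<delta>))"
    proof (rule C1_compose'[OF _ C1])
      have "bounded_linear (\<lambda>z::'b \<times> real. (fst z, snd z / \<delta>))"
        using \<delta>0 by (auto intro!: bounded_linear_Pair bounded_linear_fst bounded_linear_compose[OF bounded_linear_divide bounded_linear_snd])
      then show "Ck_on 1 (?X \<times> {-\<delta><..<\<delta>}) (\<lambda>z. (fst z, snd z / \<delta>))" by (rule C1_linear)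
    qed (use t in auto)
    then show "Ck_on 1 (?X \<times> {-\<delta><..<\<delta>}) (\<lambda>(x, t). U x (t / \<delta>))"
      by (simp add: case_prod_unfold)
  qed
qed

section \<open>Symmetry of second derivatives\<close>

text \<open>The mean value theorem twice: in direction \<open>u\<close> for the difference \<phi> of
  \<open>f\<close> along two parallel segments, then in direction \<open>v\<close> for the
  derivative of \<open>f\<close> along \<open>u\<close>.\<close>

lemma second_difference:
  fixes f :: "'a::real_normed_vector \<Rightarrow> real"
  assumes f: "\<And>y. y \<in> ball x d \<Longrightarrow> (f has_derivative f' y) (at y)"
    and f': "\<And>y. y \<in> ball x d \<Longrightarrow> ((\<lambda>y. f' y u) has_derivative f'' y) (at y)"
    and s: "0 < s" "s * (norm u + norm v) < d"
  shows "\<exists>y\<in>ball x d. f (x + s *\<^sub>R u + s *\<^sub>R v) - f (x + s *\<^sub>R u) - f (x + s *\<^sub>R v) + f x = s * (s * f'' y v)"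
proof -
  have inb: "x + a *\<^sub>R u + b *\<^sub>R v \<in> ball x d" if "0 \<le> a" "a \<le> s" "0 \<le> b" "b \<le> s" for a b
  proof -
    have "norm (a *\<^sub>R u + b *\<^sub>R v) \<le> a * norm u + b * norm v"
      using norm_triangle_ineq[of "a *\<^sub>R u" "b *\<^sub>R v"] that by simp
    also have "\<dots> \<le> s * norm u + s * norm v" using that by (intro add_mono mult_right_mono) auto
    also have "\<dots> < d" using s(2) by (simp add: algebra_simps)
    finally have "norm (a *\<^sub>R u + b *\<^sub>R v) < d" .
    moreover have "dist x (x + a *\<^sub>R u + b *\<^sub>R v) = norm (a *\<^sub>R u + b *\<^sub>R v)"
      by (metis add.assoc add_diff_cancel_left' dist_commute dist_norm)
    ultimately show ?thesis by simp
  qed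
  have dl: "((\<lambda>a. F (p + a *\<^sub>R w)) has_real_derivative F' w) (at a)"
    if "(F has_derivative F') (at (p + a *\<^sub>R w))" for F :: "'a \<Rightarrow> real" and F' p w a
  proof -
    have "((\<lambda>a. F (p + a *\<^sub>R w)) has_derivative (\<lambda>h. F' (h *\<^sub>R w))) (at a)"
      by (rule has_derivative_compose[where f = "\<lambda>a. p + a *\<^sub>R w" and g = F, OF _ that]) (auto intro!: derivative_eq_intros)
    then show ?thesis unfolding has_field_derivative_def
      by (rule has_derivative_eq_rhs)
        (simp add: fun_eq_iff linear_scale[OF bounded_linear.linear[OF has_derivative_bounded_linear[OF that]]] mult.commute)
  qed
  define \<phi> where "\<phi> a = f (x + s *\<^sub>R v + a *\<^sub>R u) - f (x + a *\<^sub>R u)" for a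
  have "(\<phi> has_real_derivative f' (x + s *\<^sub>R v + a *\<^sub>R u) u - f' (x + a *\<^sub>R u) u) (at a)" if "0 \<le> a" "a \<le> s" for a
    unfolding \<phi>_def
    by (intro DERIV_diff dl f) (use inb[OF that, of s] inb[OF that, of 0] s in \<open>simp_all add: algebra_simps\<close>)
  from MVT2[OF s(1) this] obtain a where a: "0 < a" "a < s"
    "\<phi> s - \<phi> 0 = s * (f' (x + s *\<^sub>R v + a *\<^sub>R u) u - f' (x + a *\<^sub>R u) u)" by auto
  have "((\<lambda>b. f' (x + a *\<^sub>R u + b *\<^sub>R v) u) has_real_derivative f'' (x + a *\<^sub>R u + b *\<^sub>R v) v) (at b)"
    if "0 \<le> b" "b \<le> s" for b
    by (rule dl[OF f']) (use inb[of a b] a that in auto)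
  from MVT2[OF s(1) this] obtain b where b: "0 < b" "b < s"
    "f' (x + a *\<^sub>R u + s *\<^sub>R v) u - f' (x + a *\<^sub>R u) u = s * f'' (x + a *\<^sub>R u + b *\<^sub>R v) v" by auto
  have "f (x + s *\<^sub>R u + s *\<^sub>R v) - f (x + s *\<^sub>R u) - f (x + s *\<^sub>R v) + f x = s * (s * f'' (x + a *\<^sub>R u + b *\<^sub>R v) v)"
    using a(3) b(3) by (simp add: \<phi>_def add_ac)
  then show ?thesis using inb[of a b] a b by auto
qed

text \<open>The second difference is symmetric in \<open>u\<close> and \<open>v\<close>, so the two
  mixed derivatives agree when each is taken at a suitable nearby point; their continuity moves both
  points to \<open>x\<close>.\<close>

lemma Ck2_symmetric_real:
  fixes f :: "'a::real_normed_vector \<Rightarrow> real"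
  assumes S: "open S" "x \<in> S" and f: "Ck_on 2 S f"
  shows "frechet_derivative (\<lambda>y. frechet_derivative f (at y) u) (at x) v =
         frechet_derivative (\<lambda>y. frechet_derivative f (at y) v) (at x) u"
proof -
  let ?D = "\<lambda>u v y. frechet_derivative (\<lambda>y. frechet_derivative f (at y) u) (at y) v"
  have c: "Ck_on 1 S (\<lambda>y. frechet_derivative f (at y) u)" for u using f by (simp add: Ck_on_2_iff)
  have cD: "continuous_on S (?D u v)" for u v by (rule C1_continuous_deriv[OF c])
  have "\<bar>?D u v x - ?D v u x\<bar> \<le> e" if e: "e > 0" for e
  proof -
    have "\<exists>d>0. ball x d \<subseteq> S \<and> (\<forall>y\<in>ball x d. \<bar>?D u v y - ?D u v x\<bar> < e / 2)" for u v
    proof -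
      have "isCont (?D u v) x" using cD S continuous_on_eq_continuous_at by blast
      then have "\<forall>\<^sub>F y in at x. dist (?D u v y) (?D u v x) < e / 2"
        unfolding isCont_def by (rule tendstoD) (use e in simp)
      then have "\<forall>\<^sub>F y in nhds x. dist (?D u v y) (?D u v x) < e / 2"
        using e by (simp add: eventually_nhds_conv_at)
      with eventually_nhds_in_open[OF S] have "\<forall>\<^sub>F y in nhds x. y \<in> S \<and> dist (?D u v y) (?D u v x) < e / 2"
        by eventually_elim auto
      then show ?thesis unfolding eventually_nhds_metric by (auto simp: subset_iff dist_commute dist_real_def)
    qed
    then obtain d1 d2 where d1: "d1 > 0" "ball x d1 \<subseteq> S" "\<And>y. y\<in>ball x d1 \<Longrightarrow> \<bar>?D u v y - ?D u v x\<bar> < e / 2"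
      and d2: "d2 > 0" "ball x d2 \<subseteq> S" "\<And>y. y\<in>ball x d2 \<Longrightarrow> \<bar>?D v u y - ?D v u x\<bar> < e / 2"
      by metis
    define d where "d = min d1 d2"
    have d: "d > 0" "ball x d \<subseteq> S" using d1 d2 by (auto simp: d_def)
    define s where "s = d / (2 * (norm u + norm v + 1))"
    have n: "0 < norm u + norm v + 1" by (smt (verit) norm_ge_zero)
    have s: "s > 0" using d n by (simp add: s_def)
    have "s * (norm u + norm v) \<le> s * (norm u + norm v + 1)" using s by simp
    also have "\<dots> = d / 2" using n unfolding s_def by (simp add: field_simps)
    finally have s2: "s * (norm u + norm v) < d" using d by simp
    have df: "(f has_derivative frechet_derivative f (at y)) (at y)" if "y \<in> ball x d" for y
      using C1_deriv[OF Ck_on_2_D[OF f]] d that by auto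
    have df': "((\<lambda>y. frechet_derivative f (at y) u) has_derivative (\<lambda>v. ?D u v y)) (at y)" if "y \<in> ball x d" for y u
      using C1_deriv[OF c, of y u] d that by auto
    obtain y1 where y1: "y1 \<in> ball x d" "f (x + s *\<^sub>R u + s *\<^sub>R v) - f (x + s *\<^sub>R u) - f (x + s *\<^sub>R v) + f x = s * (s * ?D u v y1)"
      using second_difference[OF df df' s s2] by blast
    have s3: "s * (norm v + norm u) < d" using s2 by (simp add: add.commute)
    obtain y2 where y2: "y2 \<in> ball x d" "f (x + s *\<^sub>R v + s *\<^sub>R u) - f (x + s *\<^sub>R v) - f (x + s *\<^sub>R u) + f x = s * (s * ?D v u y2)"
      using second_difference[OF df df' s s3] by blast
    have comm: "x + s *\<^sub>R v + s *\<^sub>R u = x + s *\<^sub>R u + s *\<^sub>R v" by simp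
    have "s * (s * ?D u v y1) = s * (s * ?D v u y2)" using y1(2) y2(2) unfolding comm by linarith
    then have "?D u v y1 = ?D v u y2" using s by simp
    moreover have "\<bar>?D u v y1 - ?D u v x\<bar> < e / 2" by (rule d1(3)) (use y1 in \<open>simp add: d_def\<close>)
    moreover have "\<bar>?D v u y2 - ?D v u x\<bar> < e / 2" by (rule d2(3)) (use y2 in \<open>simp add: d_def\<close>)
    ultimately show ?thesis by linarith
  qed
  then have "\<bar>?D u v x - ?D v u x\<bar> \<le> 0" by (rule field_le_epsilon[of _ 0, simplified])
  then show ?thesis by simp
qed

lemma frechet_derivative_bounded_linear:
  assumes "bounded_linear h" "f differentiable (at x)"
  shows "frechet_derivative (\<lambda>y. h (f y)) (at x) u = h (frechet_derivative f (at x) u)"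
  using frechet_derivative_at[OF bounded_linear.has_derivative[OF assms(1) assms(2)[unfolded frechet_derivative_works]]]
  by metis

text \<open>Reduced to components. It is needed for the Hessian of a coordinate change in the
  transformation law of the Christoffel symbols.\<close>

lemma Ck2_symmetric:
  fixes f :: "'a::real_normed_vector \<Rightarrow> 'b::euclidean_space"
  assumes S: "open S" "x \<in> S" and f: "Ck_on 2 S f"
  shows "frechet_derivative (\<lambda>y. frechet_derivative f (at y) u) (at x) v =
         frechet_derivative (\<lambda>y. frechet_derivative f (at y) v) (at x) u"
proof (rule euclidean_eqI)
  fix b :: 'b assume "b \<in> Basis"
  let ?h = "\<lambda>z. z \<bullet> b"
  have bl: "bounded_linear ?h" by (rule bounded_linear_inner_left)
  have df: "f differentiable (at y)" if "y \<in> S" for y using f that by (simp add: Ck_on_2_iff)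
  have c: "Ck_on 1 S (\<lambda>y. frechet_derivative f (at y) u)" for u using f by (simp add: Ck_on_2_iff)
  have e1: "frechet_derivative (\<lambda>y. ?h (f y)) (at y) u = ?h (frechet_derivative f (at y) u)" if "y \<in> S" for y u
    by (rule frechet_derivative_bounded_linear[OF bl df[OF that]])
  have e2: "frechet_derivative (\<lambda>y. frechet_derivative (\<lambda>y. ?h (f y)) (at y) u) (at x) v
      = ?h (frechet_derivative (\<lambda>y. frechet_derivative f (at y) u) (at x) v)" for u v
  proof -
    have "frechet_derivative (\<lambda>y. frechet_derivative (\<lambda>y. ?h (f y)) (at y) u) (at x)
        = frechet_derivative (\<lambda>y. ?h (frechet_derivative f (at y) u)) (at x)"
      by (rule frechet_derivative_cong_open[OF S]) (rule e1)
    moreover have "frechet_derivative (\<lambda>y. ?h (frechet_derivative f (at y) u)) (at x) v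
        = ?h (frechet_derivative (\<lambda>y. frechet_derivative f (at y) u) (at x) v)"
      by (rule frechet_derivative_bounded_linear[OF bl]) (use c S(2) in \<open>simp add: Ck_on_1\<close>)
    ultimately show ?thesis by simp
  qed
  have "Ck_on 2 S (\<lambda>y. ?h (f y))"
    unfolding Ck_on_2_iff
  proof (intro conjI ballI allI)
    fix y assume "y \<in> S" then show "(\<lambda>y. ?h (f y)) differentiable (at y)"
      using df by (auto simp: differentiable_def intro: bounded_linear.has_derivative[OF bl])
  next
    fix u show "Ck_on 1 S (\<lambda>y. frechet_derivative (\<lambda>y. ?h (f y)) (at y) u)"
      by (rule Ck_on_cong[OF S(1) _ C1_bounded_linear[OF bl c[of u]]]) (simp add: e1)
  qed
  from Ck2_symmetric_real[OF S this, of u v]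
  show "?h (frechet_derivative (\<lambda>y. frechet_derivative f (at y) u) (at x) v) =
        ?h (frechet_derivative (\<lambda>y. frechet_derivative f (at y) v) (at x) u)"
    unfolding e2 .
qed

text \<open>A product rule in which \<open>A s\<close> has to be linear only for \<open>s\<close>
  near \<open>t\<close>, because coordinate expressions such as \<open>metric_in\<close> are linear
  only over the chart image.\<close>

lemma has_derivative_linear_family:
  fixes A :: "'x::real_normed_vector \<Rightarrow> 'b::euclidean_space \<Rightarrow> 'c::real_normed_vector"
  assumes lin: "\<forall>\<^sub>F s in nhds t. linear (A s)" and lin': "\<And>h. linear (A' h)"
    and A: "\<And>e. ((\<lambda>s. A s e) has_derivative (\<lambda>h. A' h e)) (at t)"
    and w: "(w has_derivative w') (at t)"
  shows "((\<lambda>s. A s (w s)) has_derivative (\<lambda>h. A' h (w t) + A t (w' h))) (at t)"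
proof -
  have lint: "linear (A t)" using eventually_nhds_x_imp_x[OF lin] .
  have "((\<lambda>s. \<Sum>b\<in>Basis. (w s \<bullet> b) *\<^sub>R A s b) has_derivative
      (\<lambda>h. \<Sum>b\<in>Basis. (w t \<bullet> b) *\<^sub>R A' h b + (w' h \<bullet> b) *\<^sub>R A t b)) (at t)"
    by (intro has_derivative_sum has_derivative_scaleR A has_derivative_inner_left w)
  moreover have "(\<lambda>h. \<Sum>b\<in>Basis. (w t \<bullet> b) *\<^sub>R A' h b + (w' h \<bullet> b) *\<^sub>R A t b) = (\<lambda>h. A' h (w t) + A t (w' h))"
    by (simp add: sum.distrib linear_family_expand[OF lin', symmetric] linear_family_expand[OF lint, symmetric])
  moreover obtain S where "open S" "t \<in> S" "\<And>s. s \<in> S \<Longrightarrow> linear (A s)"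
    using lin unfolding eventually_nhds by blast
  ultimately show ?thesis
    by (auto intro: has_derivative_transform_within_open simp: linear_family_expand)
qed

section \<open>Lorentzian bilinear forms\<close>

definition lorentz_form :: "(real ^ 'n::finite \<Rightarrow> real ^ 'n \<Rightarrow> real) \<Rightarrow> bool" where
  "lorentz_form B \<longleftrightarrow> bilinear B \<and> (\<forall>u v. B u v = B v u) \<and>
     (\<exists>(E::'n \<Rightarrow> real ^ 'n) i0. \<forall>i j. B (E i) (E j) = (if i \<noteq> j then 0 else if i = i0 then - 1 else 1))"

text \<open>\<open>lorentz_form\<close> provides orthonormal vectors without saying that they span.
  Pairing with them shows that \<open>F\<close>, which builds a vector from its coefficients, is
  injective, hence an isomorphism; \<open>T\<close> is its inverse.\<close>

lemma lorentz_form_coords: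
  fixes B :: "real ^ 'n::finite \<Rightarrow> real ^ 'n \<Rightarrow> real"
  assumes "lorentz_form B"
  obtains T :: "real ^ 'n \<Rightarrow> real ^ 'n" and i0 where "linear T" "\<And>u. T u = 0 \<Longrightarrow> u = 0"
    "\<And>u v. B u v = (\<Sum>i\<in>UNIV - {i0}. T u $ i * T v $ i) - T u $ i0 * T v $ i0"
proof -
  obtain E :: "'n \<Rightarrow> real ^ 'n" and i0 where B: "bilinear B"
    and E: "\<And>i j. B (E i) (E j) = (if i \<noteq> j then 0 else if i = i0 then - 1 else 1)"
    using assms unfolding lorentz_form_def by blast
  define F where "F a = (\<Sum>i\<in>UNIV. a $ i *\<^sub>R E i)" for a :: "real ^ 'n"
  have linF: "linear F"
    unfolding F_def by (auto intro!: linearI simp: scaleR_add_left sum.distrib scaleR_sum_right)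
  have lr: "linear (B x)" "linear (\<lambda>x. B x y)" for x y using B by (auto simp: bilinear_def)
  define \<epsilon> where "\<epsilon> i = (if i = i0 then -1 else 1 :: real)" for i
  have BF: "B (F a) (F b) = (\<Sum>i\<in>UNIV. \<epsilon> i * (a $ i * b $ i))" for a b
  proof -
    have "B (F a) (F b) = (\<Sum>i\<in>UNIV. \<Sum>j\<in>UNIV. a $ i * (b $ j * B (E i) (E j)))"
      unfolding F_def by (simp add: linear_sum[OF lr(1)] linear_sum[OF lr(2)] linear_scale[OF lr(1)] linear_scale[OF lr(2)] sum_distrib_left)
         (subst sum.swap, simp add: mult_ac)
    also have "\<dots> = (\<Sum>i\<in>UNIV. \<Sum>j\<in>UNIV. if i = j then \<epsilon> i * (a $ i * b $ i) else 0)"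
      by (intro sum.cong refl) (simp add: E \<epsilon>_def)
    finally show ?thesis by simp
  qed
  have injF: "inj F"
    unfolding linear_injective_0[OF linF]
  proof (intro allI impI)
    fix a assume "F a = 0"
    then have "B (F a) (F (axis i 1)) = 0" for i by (simp add: linear_0[OF lr(2)])
    then have "\<epsilon> i * a $ i = 0" for i unfolding BF by (simp add: axis_def if_distrib cong: if_cong)
    then have "a $ i = 0" for i by (metis \<epsilon>_def mult_eq_0_iff neg_equal_0_iff_equal zero_neq_one)
    then show "a = 0" by (simp add: vec_eq_iff)
  qed
  then obtain T where T: "linear T" "\<And>x. T (F x) = x" "\<And>x. F (T x) = x"
    using linear_injective_isomorphism[OF linF] by blast
  show thesis
  proof (rule that[OF T(1)])
    show "u = 0" if "T u = 0" for u using T(3)[of u] that linear_0[OF linF] by simp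
    have "(\<Sum>i\<in>UNIV. \<epsilon> i * h i) = (\<Sum>i\<in>UNIV - {i0}. h i) - h i0" for h :: "'n \<Rightarrow> real"
      by (subst sum.remove[of _ i0]) (auto simp: \<epsilon>_def intro: sum.cong)
    then show "B u v = (\<Sum>i\<in>UNIV - {i0}. T u $ i * T v $ i) - T u $ i0 * T v $ i0" for u v
      using BF[of "T u" "T v"] by (simp add: T)
  qed
qed

lemma vec_expand: "(\<Sum>i\<in>UNIV. v $ i *\<^sub>R axis i 1) = (v :: real ^ 'n::finite)"
  by (simp add: vec_eq_iff axis_def if_distrib cong: if_cong)

lemma lorentz_form_bilinear: "lorentz_form B \<Longrightarrow> bilinear B"
  and lorentz_form_sym: "lorentz_form B \<Longrightarrow> B u v = B v u"
  unfolding lorentz_form_def by blast+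

lemma lorentz_form_linear: "lorentz_form B \<Longrightarrow> linear (B u)" "lorentz_form B \<Longrightarrow> linear (\<lambda>u. B u v)"
  using lorentz_form_bilinear by (auto simp: bilinear_def)

text \<open>Non-degeneracy makes the map from vectors to covectors injective, and equal dimensions
  then make it onto.\<close>

lemma lorentz_form_surj:
  fixes B :: "real ^ 'n::finite \<Rightarrow> real ^ 'n \<Rightarrow> real"
  assumes B: "lorentz_form B" and f: "linear f"
  shows "\<exists>w. \<forall>v. B w v = f v"
proof -
  have lin: "linear (\<lambda>w. \<chi> i. B w (axis i 1))"
    by (rule linearI) (simp_all add: vec_eq_iff linear_add[OF lorentz_form_linear(2)[OF B]] linear_scale[OF lorentz_form_linear(2)[OF B]])
  have expand: "B w v = (\<Sum>i\<in>UNIV. v $ i * B w (axis i 1))" for w v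
    using linear_sum[OF lorentz_form_linear(1)[OF B], of w "\<lambda>i. v $ i *\<^sub>R axis i 1" UNIV]
    by (simp add: vec_expand linear_scale[OF lorentz_form_linear(1)[OF B]])
  obtain T :: "real ^ 'n \<Rightarrow> real ^ 'n" and i0 where T: "linear T" "\<And>u. T u = 0 \<Longrightarrow> u = 0"
    "\<And>u v. B u v = (\<Sum>i\<in>UNIV - {i0}. T u $ i * T v $ i) - T u $ i0 * T v $ i0"
    using lorentz_form_coords[OF B] by blast
  have "inj T" using T(2) by (simp add: linear_injective_0[OF T(1)])
  then have surjT: "surj T" by (rule linear_inj_imp_surj[OF T(1)])
  have "inj (\<lambda>w. \<chi> i. B w (axis i 1))"
    unfolding linear_injective_0[OF lin]
  proof (intro allI impI)
    fix w assume "(\<chi> i. B w (axis i 1)) = 0"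
    then have "B w v = 0" for v unfolding expand[of w v] by (simp add: vec_eq_iff)
    \<comment> \<open>Reversing the time coordinate of \<open>w\<close> turns the Lorentzian product
      with \<open>w\<close> into the Euclidean square of \<open>T w\<close>.\<close>
    moreover obtain v where "T v = (\<chi> i. if i = i0 then - T w $ i else T w $ i)" using surjT by (metis surjD)
    ultimately have "(\<Sum>i\<in>UNIV - {i0}. T w $ i * T w $ i) + T w $ i0 * T w $ i0 = 0"
      using T(3)[of w v] by (simp add: sum.If_cases if_distrib Collect_neg_eq Diff_eq cong: sum.cong if_cong)
    then have "(\<Sum>i\<in>UNIV. T w $ i * T w $ i) = 0" by (subst sum.remove[of _ i0]) auto
    then have "T w = 0" by (subst (asm) sum_nonneg_eq_0_iff) (auto simp: vec_eq_iff)
    then show "w = 0" by (rule T(2))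
  qed
  then have "surj (\<lambda>w. \<chi> i. B w (axis i 1))" by (rule linear_inj_imp_surj[OF lin])
  then obtain w where "(\<chi> i. f (axis i 1)) = (\<chi> i. B w (axis i 1))" by (rule surjE)
  then have w: "B w (axis i 1) = f (axis i 1)" for i by (simp add: vec_eq_iff)
  have fv: "f v = (\<Sum>i\<in>UNIV. v $ i * f (axis i 1))" for v
    using linear_sum[OF f, of "\<lambda>i. v $ i *\<^sub>R axis i 1" UNIV]
    by (simp add: vec_expand linear_scale[OF f])
  have "B w v = f v" for v unfolding expand[of w v] fv[of v] w ..
  then show ?thesis by blast
qed

lemma lorentz_form_nondegenerate:
  assumes B: "lorentz_form B" and 0: "\<And>v. B u v = 0"
  shows "u = 0"
proof -
  obtain w where "\<forall>v. B w v = u \<bullet> v" using lorentz_form_surj[OF B, of "\<lambda>v. u \<bullet> v"]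
    by (auto simp: linear_conv_bounded_linear bounded_linear_inner_right)
  then have "u \<bullet> u = 0" using 0[of w] lorentz_form_sym[OF B, of u w] by metis
  then show ?thesis by simp
qed

text \<open>Subtract from \<open>w\<close> the multiple of \<open>v\<close> that cancels its time
  coordinate. As \<open>v\<close> is null and orthogonal to \<open>w\<close>, the remainder has the
  same square as \<open>w\<close>, and that square is now a sum of Euclidean squares. So the form is
  nonnegative on the hyperplane orthogonal to a null vector and vanishes only along that
  vector.\<close>

lemma lorentz_form_null_decomp:
  fixes B :: "real ^ 'n::finite \<Rightarrow> real ^ 'n \<Rightarrow> real"
  assumes B: "lorentz_form B" and v: "v \<noteq> 0" "B v v = 0" and w: "B v w = 0"
  obtains c where "B w w \<ge> 0" "B w w \<le> 0 \<Longrightarrow> w = c *\<^sub>R v"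
proof -
  obtain T :: "real ^ 'n \<Rightarrow> real ^ 'n" and i0 where T: "linear T" "\<And>u. T u = 0 \<Longrightarrow> u = 0"
    "\<And>u v. B u v = (\<Sum>i\<in>UNIV - {i0}. T u $ i * T v $ i) - T u $ i0 * T v $ i0"
    using lorentz_form_coords[OF B] by blast
  have zero: "u = 0" if "T u $ i0 = 0" "(\<Sum>i\<in>UNIV - {i0}. T u $ i * T u $ i) \<le> 0" for u
  proof -
    have "(\<Sum>i\<in>UNIV - {i0}. T u $ i * T u $ i) = 0" using that(2) by (intro antisym sum_nonneg) auto
    then have "\<forall>i\<in>UNIV - {i0}. T u $ i * T u $ i = 0" by (subst (asm) sum_nonneg_eq_0_iff) auto
    then have "T u = 0" using that(1) by (auto simp: vec_eq_iff)
    then show ?thesis by (rule T(2))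
  qed
  have a: "T v $ i0 \<noteq> 0" using zero[of v] v T(3)[of v v] by auto
  define c where "c = T w $ i0 / T v $ i0"
  define d where "d = w - c *\<^sub>R v"
  have d0: "T d $ i0 = 0"
    using a by (simp add: d_def linear_diff[OF T(1)] linear_scale[OF T(1)] c_def)
  have "B d d = B w w - c * B w v - c * B v w + c * c * B v v"
    unfolding d_def
    by (simp add: linear_diff[OF lorentz_form_linear(1)[OF B]] linear_diff[OF lorentz_form_linear(2)[OF B]]
        linear_scale[OF lorentz_form_linear(1)[OF B]] linear_scale[OF lorentz_form_linear(2)[OF B]] algebra_simps)
  then have Bd: "B d d = B w w" using v w lorentz_form_sym[OF B, of w v] by simp
  have eq: "B d d = (\<Sum>i\<in>UNIV - {i0}. T d $ i * T d $ i)" using T(3)[of d d] d0 by simp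
  show thesis
  proof (rule that)
    have "(\<Sum>i\<in>UNIV - {i0}. T d $ i * T d $ i) \<ge> 0" by (rule sum_nonneg) simp
    then show "B w w \<ge> 0" using Bd eq by linarith
    assume "B w w \<le> 0"
    then have "d = 0" using zero[OF d0] eq Bd by simp
    then show "w = c *\<^sub>R v" by (simp add: d_def)
  qed
qed

section \<open>Charts and tangent vectors\<close>

locale atlas =
  fixes A :: "('a::{t2_space, second_countable_topology}, 'n::finite) chart set"
  assumes atlas: "smooth_atlas A"
begin

lemma chart_homeo: "c \<in> A \<Longrightarrow> homeomorphism (fst c) (snd c ` fst c) (snd c) (chart_inv c)"
  and chart_open: "c \<in> A \<Longrightarrow> open (fst c)"
  and chart_image_open: "c \<in> A \<Longrightarrow> open (snd c ` fst c)"
  using atlas unfolding smooth_atlas_def by blast+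

lemma chart_cont: "c \<in> A \<Longrightarrow> continuous_on (fst c) (snd c)"
  and chart_inv_cont: "c \<in> A \<Longrightarrow> continuous_on (snd c ` fst c) (chart_inv c)"
  and chart_inv_left: "c \<in> A \<Longrightarrow> p \<in> fst c \<Longrightarrow> chart_inv c (snd c p) = p"
  and chart_inv_right: "c \<in> A \<Longrightarrow> x \<in> snd c ` fst c \<Longrightarrow> snd c (chart_inv c x) = x"
  and chart_inv_in: "c \<in> A \<Longrightarrow> x \<in> snd c ` fst c \<Longrightarrow> chart_inv c x \<in> fst c"
  using chart_homeo[of c] unfolding homeomorphism_def by auto

lemma chart_exists: obtains c where "c \<in> A" "p \<in> fst c"
  using atlas unfolding smooth_atlas_def by blast

lemma overlap_eq:
  "c \<in> A \<Longrightarrow> snd c ` (fst c \<inter> fst d) = snd c ` fst c \<inter> chart_inv c -` fst d"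
  using chart_inv_left[of c] by force

lemma overlap_open: "c \<in> A \<Longrightarrow> d \<in> A \<Longrightarrow> open (snd c ` (fst c \<inter> fst d))"
  unfolding overlap_eq
  by (intro continuous_open_preimage chart_inv_cont chart_image_open chart_open)

lemma transition_Ck:
  "c \<in> A \<Longrightarrow> d \<in> A \<Longrightarrow> Ck_on k (snd c ` (fst c \<inter> fst d)) (snd d \<circ> chart_inv c)"
  using atlas unfolding smooth_atlas_def by blast

lemma chart_change:
  fixes f :: "'x::real_normed_vector \<Rightarrow> 'a"
  assumes W: "open W" "x \<in> W" "continuous_on W f" and cd: "c \<in> A" "d \<in> A" "f x \<in> fst c" "f x \<in> fst d"
    and diff: "(snd c \<circ> f) differentiable (at x)"
  shows "((snd d \<circ> f) has_derivative (\<lambda>u. frechet_derivative (snd d \<circ> chart_inv c) (at (snd c (f x)))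
     (frechet_derivative (snd c \<circ> f) (at x) u))) (at x)"
proof -
  let ?S = "W \<inter> f -` (fst c \<inter> fst d)"
  have S: "open ?S" "x \<in> ?S"
    using continuous_open_preimage[OF W(3,1) open_Int[OF chart_open[OF cd(1)] chart_open[OF cd(2)]]] W cd by auto
  have "((snd d \<circ> chart_inv c) has_derivative frechet_derivative (snd d \<circ> chart_inv c) (at ((snd c \<circ> f) x))) (at ((snd c \<circ> f) x))"
    by (rule C1_deriv[OF transition_Ck[OF cd(1,2)]]) (use cd in auto)
  from diff_chain_at[OF diff[unfolded frechet_derivative_works] this]
  have "(((snd d \<circ> chart_inv c) \<circ> (snd c \<circ> f)) has_derivative (\<lambda>u. frechet_derivative (snd d \<circ> chart_inv c) (at (snd c (f x)))
     (frechet_derivative (snd c \<circ> f) (at x) u))) (at x)"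
    by (simp add: o_def)
  then show ?thesis
    by (rule has_derivative_transform_within_open[OF _ S]) (use cd chart_inv_left in auto)
qed

lemma tmap_apply: "c \<in> A \<Longrightarrow> f x \<in> fst c \<Longrightarrow> tmap A f x u c = frechet_derivative (snd c \<circ> f) (at x) u"
  by (simp add: tmap_def)

lemma tmap_in_tspace:
  fixes f :: "'x::real_normed_vector \<Rightarrow> 'a"
  assumes "open W" "x \<in> W" "continuous_on W f"
    and "\<And>c. c \<in> A \<Longrightarrow> f x \<in> fst c \<Longrightarrow> (snd c \<circ> f) differentiable (at x)"
  shows "tmap A f x u \<in> tspace A (f x)"
  unfolding tspace_def
proof (intro CollectI conjI ballI allI impI)
  fix c d assume "c \<in> A" "d \<in> A" "f x \<in> fst c \<and> f x \<in> fst d"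
  then show "tmap A f x u d = frechet_derivative (snd d \<circ> chart_inv c) (at (snd c (f x))) (tmap A f x u c)"
    using frechet_derivative_at[OF chart_change[OF assms(1-3)]] assms(4) by (simp add: tmap_apply) metis
qed (auto simp: tmap_def)

lemma tspace_change:
  "v \<in> tspace A p \<Longrightarrow> c \<in> A \<Longrightarrow> d \<in> A \<Longrightarrow> p \<in> fst c \<Longrightarrow> p \<in> fst d \<Longrightarrow>
   v d = frechet_derivative (snd d \<circ> chart_inv c) (at (snd c p)) (v c)"
  unfolding tspace_def by blast

lemma tspace_eqI:
  assumes "v \<in> tspace A p" "w \<in> tspace A p" "c \<in> A" "p \<in> fst c" "v c = w c"
  shows "v = w"
proof
  fix d
  show "v d = w d"
  proof (cases "d \<in> A \<and> p \<in> fst d")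
    case True then show ?thesis using tspace_change assms by metis
  next
    case False
    then have "v d = 0" "w d = 0" using assms(1,2) unfolding tspace_def by blast+
    then show ?thesis by simp
  qed
qed

lemma zero_in_tspace: "zero_tvec \<in> tspace A p"
proof -
  have "frechet_derivative (snd d \<circ> chart_inv c) (at (snd c p)) 0 = 0" if "c \<in> A" "d \<in> A" "p \<in> fst c" "p \<in> fst d" for c d
    by (rule linear_0[OF C1_linear_deriv[OF transition_Ck]]) (use that in auto)
  then show ?thesis unfolding tspace_def by auto
qed

lemma chart_inv_differentiable:
  assumes "c \<in> A" "d \<in> A" "x \<in> snd c ` fst c" "chart_inv c x \<in> fst d"
  shows "(snd d \<circ> chart_inv c) differentiable (at x)"
proof -
  have "x \<in> snd c ` (fst c \<inter> fst d)" using assms overlap_eq by auto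
  then show ?thesis using transition_Ck[OF assms(1,2), of 1] unfolding Ck_on_1 by blast
qed

lemma tmap_chart_inv_in_tspace:
  assumes "c \<in> A" "x \<in> snd c ` fst c"
  shows "tmap A (chart_inv c) x u \<in> tspace A (chart_inv c x)"
  by (rule tmap_in_tspace[OF chart_image_open[OF assms(1)] assms(2) chart_inv_cont[OF assms(1)]])
    (rule chart_inv_differentiable[OF assms(1) _ assms(2)])

lemma tmap_chart_inv_self:
  assumes "c \<in> A" "x \<in> snd c ` fst c"
  shows "tmap A (chart_inv c) x u c = u"
proof -
  have "frechet_derivative (snd c \<circ> chart_inv c) (at x) = frechet_derivative (\<lambda>x. x) (at x)"
    by (rule frechet_derivative_cong_open[OF chart_image_open[OF assms(1)] assms(2)])
      (simp add: chart_inv_right assms(1))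
  then show ?thesis using assms by (simp add: tmap_apply chart_inv_in)
qed

lemma tspace_from_chart:
  assumes "v \<in> tspace A p" "c \<in> A" "p \<in> fst c"
  shows "v = tmap A (chart_inv c) (snd c p) (v c)"
  by (rule tspace_eqI[OF assms(1) _ assms(2,3)])
    (use tmap_chart_inv_in_tspace[OF assms(2), of "snd c p"] tmap_chart_inv_self[OF assms(2)] assms(3) chart_inv_left[OF assms(2,3)] in auto)

lemma transition_inverse:
  assumes "c \<in> A" "d \<in> A" "p \<in> fst c" "p \<in> fst d"
  shows "frechet_derivative (snd c \<circ> chart_inv d) (at (snd d p)) (frechet_derivative (snd d \<circ> chart_inv c) (at (snd c p)) u) = u"
proof -
  let ?v = "tmap A (chart_inv c) (snd c p) u"
  have v: "?v \<in> tspace A p" using tmap_chart_inv_in_tspace[of c "snd c p" u] assms chart_inv_left[of c p] by auto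
  have "?v c = u" by (rule tmap_chart_inv_self) (use assms in auto)
  then show ?thesis using tspace_change[OF v, of c d] tspace_change[OF v, of d c] assms by metis
qed

lemma Ck_map_2D: "Ck_map A 2 W f \<Longrightarrow> Ck_map A 1 W f"
  unfolding Ck_map_def using Ck_on_2_D by blast

lemma Ck_map_subset: "Ck_map A k W f \<Longrightarrow> W' \<subseteq> W \<Longrightarrow> Ck_map A k W' f"
  unfolding Ck_map_def by (auto intro: continuous_on_subset elim!: Ck_on_subset)

lemma Ck_map_cont: "Ck_map A k W f \<Longrightarrow> continuous_on W f"
  by (simp add: Ck_map_def)

lemma Ck_map_chart: "Ck_map A k W f \<Longrightarrow> c \<in> A \<Longrightarrow> Ck_on k (W \<inter> f -` fst c) (snd c \<circ> f)"
  by (simp add: Ck_map_def)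

lemma open_chart_preimage: "open W \<Longrightarrow> Ck_map A k W f \<Longrightarrow> c \<in> A \<Longrightarrow> open (W \<inter> f -` fst c)"
  by (rule continuous_open_preimage[OF Ck_map_cont _ chart_open])

lemma Ck_map_differentiable:
  "Ck_map A 1 W f \<Longrightarrow> c \<in> A \<Longrightarrow> x \<in> W \<Longrightarrow> f x \<in> fst c \<Longrightarrow> (snd c \<circ> f) differentiable (at x)"
  unfolding Ck_map_def Ck_on_1 by blast

lemma Ck_map_tmap_in_tspace: "open W \<Longrightarrow> Ck_map A 1 W f \<Longrightarrow> x \<in> W \<Longrightarrow> tmap A f x u \<in> tspace A (f x)"
  by (rule tmap_in_tspace) (auto simp: Ck_map_cont Ck_map_differentiable)

section \<open>Local parametrizations\<close>

lemma homeomorphism_inv_into_subset: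
  assumes "homeomorphism W (\<psi> ` W) \<psi> (inv_into W \<psi>)" "W' \<subseteq> W"
  shows "homeomorphism W' (\<psi> ` W') \<psi> (inv_into W' \<psi>)"
proof -
  have inj: "inj_on \<psi> W" using assms(1) unfolding homeomorphism_def by (metis inj_on_inverseI)
  then have inj': "inj_on \<psi> W'" using assms(2) inj_on_subset by blast
  have eq: "inv_into W' \<psi> y = inv_into W \<psi> y" if "y \<in> \<psi> ` W'" for y
    using that inj inj' assms(2) by (auto simp: inv_into_f_f subset_iff)
  have "continuous_on (\<psi> ` W') (inv_into W \<psi>)" "continuous_on W' \<psi>"
    using assms unfolding homeomorphism_def by (meson continuous_on_subset image_mono)+
  then have "continuous_on (\<psi> ` W') (inv_into W' \<psi>)" "continuous_on W' \<psi>"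
    using eq by (simp_all cong: continuous_on_cong)
  then show ?thesis unfolding homeomorphism_def using inj'
    by (auto simp: inv_into_f_f f_inv_into_f image_iff)
qed

context
  fixes W :: "(real ^ 'm::finite) set" and \<psi> :: "real ^ 'm \<Rightarrow> 'a" and k :: nat and N :: "'a set"
  assumes P: "(W, \<psi>) \<in> params A k N"
begin

lemma params_open: "open W"
  and params_openin: "openin (top_of_set N) (\<psi> ` W)"
  and params_homeo: "homeomorphism W (\<psi> ` W) \<psi> (inv_into W \<psi>)"
  and params_Ck_map: "Ck_map A k W \<psi>"
  and params_immersion: "x \<in> W \<Longrightarrow> tmap A \<psi> x u = zero_tvec \<Longrightarrow> u = 0"
  using P unfolding params_def by blast+

lemma params_cont: "continuous_on W \<psi>"
  and params_inv_cont: "continuous_on (\<psi> ` W) (inv_into W \<psi>)"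
  using params_homeo unfolding homeomorphism_def by blast+

lemma params_inj: "inj_on \<psi> W"
  using params_homeo unfolding homeomorphism_def by (metis inj_on_inverseI)

lemma params_inv: "x \<in> W \<Longrightarrow> inv_into W \<psi> (\<psi> x) = x"
  by (simp add: inv_into_f_f params_inj)

lemma params_subset: "\<psi> ` W \<subseteq> N"
  using params_openin openin_imp_subset by blast

lemma params_image_openin: "open U \<Longrightarrow> U \<subseteq> W \<Longrightarrow> openin (top_of_set N) (\<psi> ` U)"
proof -
  assume "open U" "U \<subseteq> W"
  then have "openin (top_of_set (\<psi> ` W)) (\<psi> ` U)"
    using homeomorphism_imp_open_map[OF params_homeo, of U] by (auto intro: open_openin_trans simp: params_open openin_open_eq)
  then show ?thesis using params_openin openin_trans by blast
qed

lemma params_preimage_open: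
  assumes "openin (top_of_set N) D" shows "open (W \<inter> \<psi> -` D)"
proof -
  obtain D' where D': "open D'" "D = N \<inter> D'" using assms by (auto simp: openin_open)
  have "W \<inter> \<psi> -` D = W \<inter> \<psi> -` D'" using D'(2) params_subset by auto
  then show ?thesis using continuous_open_preimage[OF params_cont params_open D'(1)] by simp
qed

lemma params_shrink: "open U \<Longrightarrow> U \<subseteq> W \<Longrightarrow> (U, \<psi>) \<in> params A k N"
  unfolding params_def
  using params_image_openin homeomorphism_inv_into_subset[OF params_homeo] Ck_map_subset[OF params_Ck_map] params_immersion
  by auto

lemma params_restrict:
  assumes "openin (top_of_set N) D" shows "(W \<inter> \<psi> -` D, \<psi>) \<in> params A k D"
proof -
  let ?W = "W \<inter> \<psi> -` D"
  have s: "(?W, \<psi>) \<in> params A k N"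
    by (rule params_shrink[OF params_preimage_open[OF assms]]) auto
  then have "openin (top_of_set N) (\<psi> ` ?W)" by (simp add: params_def)
  then have "openin (top_of_set D) (\<psi> ` ?W)"
    by (rule openin_subset_trans) (use openin_imp_subset[OF assms] in auto)
  with s show ?thesis by (simp add: params_def)
qed

end

lemma params_mono:
  "openin (top_of_set N) D \<Longrightarrow> (W, \<psi>) \<in> params A k D \<Longrightarrow> (W, \<psi>) \<in> params A k N"
  unfolding params_def using openin_trans by blast

lemma params_Ck_map_1: "(W, \<psi>) \<in> params A 2 N \<Longrightarrow> Ck_map A 1 W \<psi>"
  by (rule Ck_map_2D[OF params_Ck_map])

text \<open>\<open>params\<close> states the immersion property for tangent vectors as families over
  all charts; a single chart around the point already detects the zero vector.\<close>

lemma params_chart_inj: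
  fixes \<psi> :: "real ^ 'm::finite \<Rightarrow> 'a"
  assumes P: "(W, \<psi>) \<in> params A 2 N" and x: "x \<in> W" "c \<in> A" "\<psi> x \<in> fst c"
  shows "inj (frechet_derivative (snd c \<circ> \<psi>) (at x))"
proof -
  have lin: "linear (frechet_derivative (snd c \<circ> \<psi>) (at x))"
    using Ck_map_differentiable[OF params_Ck_map_1[OF P] x(2,1,3)] by (rule linear_frechet_derivative)
  show ?thesis
    unfolding linear_injective_0[OF lin]
  proof (intro allI impI)
    fix u assume "frechet_derivative (snd c \<circ> \<psi>) (at x) u = 0"
    then have "tmap A \<psi> x u c = zero_tvec c" using x by (simp add: tmap_apply)
    then have "tmap A \<psi> x u = zero_tvec"
      by (rule tspace_eqI[OF Ck_map_tmap_in_tspace[OF params_open[OF P] params_Ck_map_1[OF P] x(1)] zero_in_tspace x(2,3)])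
    then show "u = 0" by (rule params_immersion[OF P x(1)])
  qed
qed

text \<open>In a chart \<open>c\<close> around the image point, snd c \<circ> \<psi> is an immersion
  between Euclidean spaces and \<open>C1_lift\<close> applies. This is what makes changes of
  parametrization C^1, for \<open>H\<close> as well as for cross-sections.\<close>

lemma lift_C1:
  fixes f :: "'x::real_normed_vector \<Rightarrow> 'a" and \<psi> :: "real ^ 'm::finite \<Rightarrow> 'a"
  assumes P: "(W, \<psi>) \<in> params A 2 N" and S: "open S" and f: "Ck_map A 1 S f" and sub: "f ` S \<subseteq> \<psi> ` W"
  shows "Ck_on 1 S (\<lambda>x. inv_into W \<psi> (f x))"
    and "\<And>x u. x \<in> S \<Longrightarrow> tmap A \<psi> (inv_into W \<psi> (f x)) (frechet_derivative (\<lambda>x. inv_into W \<psi> (f x)) (at x) u) = tmap A f x u"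
proof -
  let ?\<phi> = "\<lambda>x. inv_into W \<psi> (f x)"
  have cf: "continuous_on S f" by (rule Ck_map_cont[OF f])
  have c\<phi>: "continuous_on S ?\<phi>" by (rule continuous_on_compose2[OF params_inv_cont[OF P] cf sub])
  have \<psi>\<phi>: "\<psi> (?\<phi> x) = f x" if "x \<in> S" for x using sub that by (meson f_inv_into_f image_subset_iff)
  have \<phi>W: "?\<phi> x \<in> W" if "x \<in> S" for x using sub that by (meson inv_into_into image_subset_iff)
  have *: "\<exists>U. open U \<and> x \<in> U \<and> U \<subseteq> S \<and> Ck_on 1 U ?\<phi> \<and>
      (\<forall>u. tmap A \<psi> (?\<phi> x) (frechet_derivative ?\<phi> (at x) u) = tmap A f x u)" if x: "x \<in> S" for x
  proof -
    obtain c where c: "c \<in> A" "f x \<in> fst c" using chart_exists .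
    let ?U = "S \<inter> f -` fst c" and ?T = "W \<inter> \<psi> -` fst c"
    have U: "open ?U" by (rule open_chart_preimage[OF S f c(1)])
    have xU: "x \<in> ?U" using x c(2) by auto
    have T: "open ?T" by (rule open_chart_preimage[OF params_open[OF P] params_Ck_map[OF P] c(1)])
    have inj: "inj (frechet_derivative (snd c \<circ> \<psi>) (at y))" if "y \<in> ?T" for y
      using params_chart_inj[OF P _ c(1)] that by auto
    have sub': "?\<phi> ` ?U \<subseteq> ?T" using \<phi>W \<psi>\<phi> by auto
    have eq: "(snd c \<circ> \<psi>) (?\<phi> y) = (snd c \<circ> f) y" if "y \<in> ?U" for y using \<psi>\<phi> that by simp
    note lift = C1_lift[OF U T Ck_map_chart[OF f c(1)] Ck_map_chart[OF params_Ck_map_1[OF P] c(1)] inj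
        continuous_on_subset[OF c\<phi> Int_lower1] sub' eq]
    have "tmap A \<psi> (?\<phi> x) (frechet_derivative ?\<phi> (at x) u) = tmap A f x u" for u
    proof (rule tspace_eqI[OF _ Ck_map_tmap_in_tspace[OF S f x] c])
      show "tmap A \<psi> (?\<phi> x) (frechet_derivative ?\<phi> (at x) u) \<in> tspace A (f x)"
        using Ck_map_tmap_in_tspace[OF params_open[OF P] params_Ck_map_1[OF P] \<phi>W[OF x]] \<psi>\<phi>[OF x] by metis
      show "tmap A \<psi> (?\<phi> x) (frechet_derivative ?\<phi> (at x) u) c = tmap A f x u c"
        unfolding tmap_apply[where f = f, OF c] tmap_apply[where f = \<psi> and x = "?\<phi> x", unfolded \<psi>\<phi>[OF x], OF c]
        by (rule lift(2)[OF _ _ xU])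
    qed
    then show ?thesis using lift(1) U x c by (intro exI[of _ ?U]) auto
  qed
  show "Ck_on 1 S ?\<phi>" by (rule Ck_on_local) (use * in blast)
  show "tmap A \<psi> (?\<phi> x) (frechet_derivative ?\<phi> (at x) u) = tmap A f x u" if "x \<in> S" for x u
    using *[OF that] by blast
qed

text \<open>\<open>sub_tspace\<close> collects vectors from all parametrizations through the point.
  Any other one factors through \<psi> near the point by \<open>lift_C1\<close>, so its vectors are
  images under the differential of \<psi>.\<close>

lemma sub_tspace_eq:
  fixes \<psi> :: "real ^ 'm::finite \<Rightarrow> 'a"
  assumes P: "(W, \<psi>) \<in> params A 2 N" and x: "x \<in> W"
  shows "sub_tspace TYPE('m) A N (\<psi> x) = range (tmap A \<psi> x)"
proof
  show "range (tmap A \<psi> x) \<subseteq> sub_tspace TYPE('m) A N (\<psi> x)"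
    using P x unfolding sub_tspace_def by blast
  show "sub_tspace TYPE('m) A N (\<psi> x) \<subseteq> range (tmap A \<psi> x)"
  proof
    fix v assume "v \<in> sub_tspace TYPE('m) A N (\<psi> x)"
    then obtain W' and \<psi>' :: "real ^ 'm \<Rightarrow> 'a" and y u where
      P': "(W', \<psi>') \<in> params A 2 N" and y: "y \<in> W'" "\<psi>' y = \<psi> x" "v = tmap A \<psi>' y u"
      unfolding sub_tspace_def by blast
    let ?S = "W' \<inter> \<psi>' -` (\<psi> ` W)"
    have S: "open ?S" by (rule params_preimage_open[OF P' params_openin[OF P]])
    have "tmap A \<psi> (inv_into W \<psi> (\<psi>' y)) (frechet_derivative (\<lambda>x. inv_into W \<psi> (\<psi>' x)) (at y) u) = tmap A \<psi>' y u"
      by (rule lift_C1(2)[OF P S]) (use x y in \<open>auto intro: Ck_map_subset[OF params_Ck_map_1[OF P']]\<close>)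
    then show "v \<in> range (tmap A \<psi> x)" using y params_inv[OF P x] by (metis rangeI)
  qed
qed

end

section \<open>The Levi-Civita connection in charts\<close>

lemma frechet_derivative_apply: "(f has_derivative f') (at x) \<Longrightarrow> frechet_derivative f (at x) h = f' h"
  using frechet_derivative_at by metis

locale lorentz = atlas A for A :: "('a::{t2_space, second_countable_topology}, 'n::finite) chart set" +
  fixes g :: "('a, 'n) tensor2"
  assumes metric: "lorentzian_metric A 2 g"
begin

abbreviation Dmetric :: "('a, 'n) chart \<Rightarrow> real ^ 'n \<Rightarrow> real ^ 'n \<Rightarrow> real ^ 'n \<Rightarrow> real ^ 'n \<Rightarrow> real" where
  "Dmetric c x h u v \<equiv> frechet_derivative (\<lambda>y. metric_in A g c y u v) (at x) h"

text \<open>The Christoffel symbols of the first kind, that is, \<open>christoffel\<close> with its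
  upper index lowered by the metric.\<close>

definition koszul :: "('a, 'n) chart \<Rightarrow> real ^ 'n \<Rightarrow> real ^ 'n \<Rightarrow> real ^ 'n \<Rightarrow> real ^ 'n \<Rightarrow> real" where
  "koszul c x u v w = (Dmetric c x u v w + Dmetric c x v u w - Dmetric c x w u v) / 2"

lemma metric_lorentz_form: "c \<in> A \<Longrightarrow> x \<in> snd c ` fst c \<Longrightarrow> lorentz_form (metric_in A g c x)"
  using metric unfolding lorentzian_metric_def lorentz_form_def by blast

lemma metric_Ck: "c \<in> A \<Longrightarrow> Ck_on 2 (snd c ` fst c) (\<lambda>x. metric_in A g c x u v)"
  using metric unfolding lorentzian_metric_def by blast

lemmas metric_C1 = Ck_on_2_D[OF metric_Ck]
lemmas metric_linear = lorentz_form_linear[OF metric_lorentz_form]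
lemmas metric_sym = lorentz_form_sym[OF metric_lorentz_form]

lemma Dmetric_C1: "c \<in> A \<Longrightarrow> Ck_on 1 (snd c ` fst c) (\<lambda>x. Dmetric c x h u v)"
  using metric_Ck unfolding Ck_on_2_iff by blast

lemma metric_deriv:
  "c \<in> A \<Longrightarrow> x \<in> snd c ` fst c \<Longrightarrow> ((\<lambda>y. metric_in A g c y u v) has_derivative (\<lambda>h. Dmetric c x h u v)) (at x)"
  using C1_deriv[OF metric_C1] .

lemma Dmetric_eq:
  assumes "c \<in> A" "x \<in> snd c ` fst c" "(f has_derivative f') (at x)"
    and "\<And>y. y \<in> snd c ` fst c \<Longrightarrow> f y = metric_in A g c y u v"
  shows "Dmetric c x h u v = f' h"
proof -
  have "((\<lambda>y. metric_in A g c y u v) has_derivative f') (at x)"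
    by (rule has_derivative_transform_within_open[OF assms(3) chart_image_open[OF assms(1)] assms(2) assms(4)])
  then show ?thesis using frechet_derivative_at by metis
qed

lemma Dmetric_linear:
  assumes c: "c \<in> A" "x \<in> snd c ` fst c"
  shows "linear (\<lambda>h. Dmetric c x h u v)" "linear (\<lambda>u. Dmetric c x h u v)" "linear (\<lambda>v. Dmetric c x h u v)"
proof -
  show "linear (\<lambda>h. Dmetric c x h u v)" by (rule C1_linear_deriv[OF metric_C1[OF c(1)] c(2)])
  show "linear (\<lambda>u. Dmetric c x h u v)"
  proof (rule linearI)
    show "Dmetric c x h (a + b) v = Dmetric c x h a v + Dmetric c x h b v" for a b
      by (rule Dmetric_eq[OF c has_derivative_add[OF metric_deriv[OF c] metric_deriv[OF c]]])
        (simp add: linear_add[OF metric_linear(2)[OF c(1)]])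
    show "Dmetric c x h (r *\<^sub>R a) v = r *\<^sub>R Dmetric c x h a v" for r a
      by (rule Dmetric_eq[OF c has_derivative_scaleR_right[OF metric_deriv[OF c]]])
        (simp add: linear_scale[OF metric_linear(2)[OF c(1)]])
  qed
  show "linear (\<lambda>v. Dmetric c x h u v)"
  proof (rule linearI)
    show "Dmetric c x h u (a + b) = Dmetric c x h u a + Dmetric c x h u b" for a b
      by (rule Dmetric_eq[OF c has_derivative_add[OF metric_deriv[OF c] metric_deriv[OF c]]])
        (simp add: linear_add[OF metric_linear(1)[OF c(1)]])
    show "Dmetric c x h u (r *\<^sub>R a) = r *\<^sub>R Dmetric c x h u a" for r a
      by (rule Dmetric_eq[OF c has_derivative_scaleR_right[OF metric_deriv[OF c]]])
        (simp add: linear_scale[OF metric_linear(1)[OF c(1)]])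
  qed
qed

lemma Dmetric_sym: "c \<in> A \<Longrightarrow> x \<in> snd c ` fst c \<Longrightarrow> Dmetric c x h u v = Dmetric c x h v u"
  by (rule Dmetric_eq[OF _ _ metric_deriv]) (auto intro: metric_sym)

lemma metric_has_derivative:
  fixes x :: "'x::real_normed_vector \<Rightarrow> real ^ 'n"
  assumes c: "c \<in> A" "x t \<in> snd c ` fst c" and x: "(x has_derivative x') (at t)"
    and X: "(X has_derivative X') (at t)" and Y: "(Y has_derivative Y') (at t)"
  shows "((\<lambda>s. metric_in A g c (x s) (X s) (Y s)) has_derivative
     (\<lambda>h. Dmetric c (x t) (x' h) (X t) (Y t) + metric_in A g c (x t) (X' h) (Y t) + metric_in A g c (x t) (X t) (Y' h))) (at t)"
proof -
  have "isCont x t" using x has_derivative_continuous by (auto simp: isCont_def continuous_within)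
  then have ev: "\<forall>\<^sub>F s in nhds t. x s \<in> snd c ` fst c"
    using c topological_tendstoD[of x "x t" "at t"] chart_image_open[OF c(1)]
    unfolding isCont_def by (auto simp: eventually_nhds_conv_at)
  have d: "((\<lambda>s. metric_in A g c (x s) u v) has_derivative (\<lambda>h. Dmetric c (x t) (x' h) u v)) (at t)" for u v
    by (rule has_derivative_compose[OF x metric_deriv[OF c]])
  have "((\<lambda>s. metric_in A g c (x s) u (Y s)) has_derivative
      (\<lambda>h. Dmetric c (x t) (x' h) u (Y t) + metric_in A g c (x t) u (Y' h))) (at t)" for u
    by (rule has_derivative_linear_family[OF _ _ d Y])
      (use ev metric_linear(1)[OF c(1)] Dmetric_linear(3)[OF c] in \<open>auto elim: eventually_mono\<close>)
  from has_derivative_linear_family[where A = "\<lambda>s u. metric_in A g c (x s) u (Y s)"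
      and A' = "\<lambda>h u. Dmetric c (x t) (x' h) u (Y t) + metric_in A g c (x t) u (Y' h)", OF _ _ this X]
      eventually_mono[OF ev metric_linear(2)[OF c(1)]] linear_compose_add[OF Dmetric_linear(2)[OF c] metric_linear(2)[OF c]]
  have "((\<lambda>s. metric_in A g c (x s) (X s) (Y s)) has_derivative
     (\<lambda>h. (Dmetric c (x t) (x' h) (X t) (Y t) + metric_in A g c (x t) (X t) (Y' h)) + metric_in A g c (x t) (X' h) (Y t))) (at t)"
    by blast
  then show ?thesis by (simp add: add_ac)
qed

text \<open>A tangent vector is the image of its components under the differential of the inverse
  chart, so on \<open>tspace\<close> the values of \<open>g\<close> can be computed in any
  chart.\<close>

lemma metric_eq:
  assumes "v \<in> tspace A p" "w \<in> tspace A p" "c \<in> A" "p \<in> fst c"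
  shows "g p v w = metric_in A g c (snd c p) (v c) (w c)"
  unfolding metric_in_def
  using tspace_from_chart[OF assms(1,3,4)] tspace_from_chart[OF assms(2-4)] chart_inv_left[OF assms(3,4)] by metis

lemma metric_in_tmap:
  assumes "c \<in> A" "x \<in> snd c ` fst c"
  shows "metric_in A g c x u v = g (chart_inv c x) (tmap A (chart_inv c) x u) (tmap A (chart_inv c) x v)"
  by (simp add: metric_in_def)

subsection \<open>Christoffel symbols\<close>

lemma koszul_linear:
  assumes c: "c \<in> A" "x \<in> snd c ` fst c"
  shows "linear (\<lambda>u. koszul c x u v w)" "linear (\<lambda>v. koszul c x u v w)" "linear (\<lambda>w. koszul c x u v w)"
proof -
  have *: "linear (\<lambda>u. (f u + h u - k u) / 2)"
    if "linear f" "linear h" "linear k" for f h k :: "real ^ 'n \<Rightarrow> real"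
    by (rule linearI) (simp_all add: linear_add[OF that(1)] linear_add[OF that(2)] linear_add[OF that(3)]
        linear_scale[OF that(1)] linear_scale[OF that(2)] linear_scale[OF that(3)] field_simps)
  show "linear (\<lambda>u. koszul c x u v w)" "linear (\<lambda>v. koszul c x u v w)" "linear (\<lambda>w. koszul c x u v w)"
    unfolding koszul_def by (intro * Dmetric_linear[OF c])+
qed

lemma linear_eq_on_axis:
  fixes f f' :: "real ^ 'k::finite \<Rightarrow> 'c::real_vector"
  assumes "linear f" "linear f'" "\<And>i. f (axis i 1) = f' (axis i 1)"
  shows "f v = f' v"
  using linear_sum[OF assms(1), of "\<lambda>i. v $ i *\<^sub>R axis i 1" UNIV] linear_sum[OF assms(2), of "\<lambda>i. v $ i *\<^sub>R axis i 1" UNIV]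
  by (simp add: vec_expand linear_scale[OF assms(1)] linear_scale[OF assms(2)] assms(3))

text \<open>Non-degeneracy makes the matrix of the metric injective, so \<open>matrix_inv\<close> is
  a true inverse. From here on \<open>christoffel\<close> is known only through this
  pairing.\<close>

lemma christoffel_koszul:
  assumes c: "c \<in> A" "x \<in> snd c ` fst c"
  shows "metric_in A g c x (christoffel A g c x u v) w = koszul c x u v w"
proof -
  let ?M = "\<chi> i j. metric_in A g c x (axis i 1) (axis j 1)"
  let ?b = "\<chi> l. koszul c x u v (axis l 1)"
  have Mv: "(?M *v a) $ i = metric_in A g c x a (axis i 1)" for a i
  proof -
    have "(?M *v a) $ i = (\<Sum>j\<in>UNIV. metric_in A g c x (axis i 1) (axis j 1) * a $ j)"
      by (simp add: matrix_vector_mult_def)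
    also have "\<dots> = metric_in A g c x (axis i 1) (\<Sum>j\<in>UNIV. a $ j *\<^sub>R axis j 1)"
      by (simp add: linear_sum[OF metric_linear(1)[OF c]] linear_scale[OF metric_linear(1)[OF c]] mult.commute)
    finally show ?thesis using metric_sym[OF c] by (simp add: vec_expand)
  qed
  have inj: "inj ((*v) ?M)"
    unfolding linear_injective_0[OF matrix_vector_mul_linear]
  proof (intro allI impI)
    fix a assume "?M *v a = 0"
    then have "metric_in A g c x a (axis i 1) = 0" for i using Mv[of a i] by simp
    then have "metric_in A g c x a v = 0" for v
      using linear_eq_on_axis[OF metric_linear(1)[OF c] linear_zero, of a v] by simp
    then show "a = 0" by (rule lorentz_form_nondegenerate[OF metric_lorentz_form[OF c]])
  qed
  then have "invertible ?M" by (simp add: invertible_left_inverse matrix_left_invertible_injective)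
  then have "?M *v (matrix_inv ?M *v ?b) = ?b"
    using someI_ex[of "\<lambda>B. ?M ** B = mat 1 \<and> B ** ?M = mat 1"]
    by (simp add: matrix_vector_mul_assoc invertible_def matrix_inv_def)
  moreover have "christoffel A g c x u v = matrix_inv ?M *v ?b"
    unfolding christoffel_def koszul_def ..
  ultimately have "metric_in A g c x (christoffel A g c x u v) (axis l 1) = koszul c x u v (axis l 1)" for l
    using Mv[of "christoffel A g c x u v" l] by simp
  then show ?thesis by (rule linear_eq_on_axis[OF metric_linear(1)[OF c] koszul_linear(3)[OF c]])
qed

lemma christoffel_unique:
  assumes c: "c \<in> A" "x \<in> snd c ` fst c" and "\<And>z. metric_in A g c x w z = koszul c x u v z"
  shows "w = christoffel A g c x u v"
proof -
  have "w - christoffel A g c x u v = 0"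
    by (rule lorentz_form_nondegenerate[OF metric_lorentz_form[OF c]])
      (simp add: linear_diff[OF metric_linear(2)[OF c]] christoffel_koszul[OF c] assms(3))
  then show ?thesis by simp
qed

lemma christoffel_linear:
  assumes c: "c \<in> A" "x \<in> snd c ` fst c"
  shows "linear (\<lambda>u. christoffel A g c x u v)" "linear (christoffel A g c x u)"
  by (rule linearI; rule christoffel_unique[OF c, symmetric];
      simp add: linear_add[OF metric_linear(2)[OF c]] linear_scale[OF metric_linear(2)[OF c]] christoffel_koszul[OF c]
        linear_add[OF koszul_linear(1)[OF c]] linear_add[OF koszul_linear(2)[OF c]]
        linear_scale[OF koszul_linear(1)[OF c]] linear_scale[OF koszul_linear(2)[OF c]])+

lemma C1_vec_lambda:
  fixes f :: "'k::finite \<Rightarrow> 'x::real_normed_vector \<Rightarrow> real"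
  assumes "\<And>i. Ck_on 1 S (f i)" shows "Ck_on 1 S (\<lambda>x. \<chi> i. f i x)"
proof -
  have "(\<lambda>x. \<chi> i. f i x) = (\<lambda>x. \<Sum>i\<in>UNIV. f i x *\<^sub>R axis i 1)"
    using vec_expand[of "\<chi> i. f i x" for x] by (auto simp: fun_eq_iff)
  then show ?thesis using assms by (auto intro!: C1_intros)
qed

text \<open>The Christoffel vector solves a linear system with C^1 coefficients, so
  \<open>C1_solve\<close> applies and \<open>matrix_inv\<close> is not differentiated. The
  right-hand side contains first derivatives of the metric, and this is where class C^2 is
  used.\<close>

lemma christoffel_C1:
  assumes c: "c \<in> A" shows "Ck_on 1 (snd c ` fst c) (\<lambda>x. christoffel A g c x u v)"
proof (rule C1_solve[OF chart_image_open[OF c]])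
  let ?L = "\<lambda>x w. \<chi> i. metric_in A g c x w (axis i 1)"
  let ?b = "\<lambda>x. \<chi> i. koszul c x u v (axis i 1)"
  show lin: "linear (?L x)" if "x \<in> snd c ` fst c" for x
    by (rule linearI) (simp_all add: vec_eq_iff linear_add[OF metric_linear(2)[OF c that]] linear_scale[OF metric_linear(2)[OF c that]])
  show "inj (?L x)" if x: "x \<in> snd c ` fst c" for x
    unfolding linear_injective_0[OF lin[OF x]]
  proof (intro allI impI)
    fix a assume "?L x a = 0"
    then have "metric_in A g c x a (axis i 1) = 0" for i by (simp add: vec_eq_iff)
    then have "metric_in A g c x a v = 0" for v
      using linear_eq_on_axis[OF metric_linear(1)[OF c x] linear_zero, of a v] by simp
    then show "a = 0" by (rule lorentz_form_nondegenerate[OF metric_lorentz_form[OF c x]])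
  qed
  show "Ck_on 1 (snd c ` fst c) (\<lambda>x. ?L x e)" for e
    by (rule C1_vec_lambda[OF metric_C1[OF c]])
  show "?L x (christoffel A g c x u v) = ?b x" if x: "x \<in> snd c ` fst c" for x
    by (simp add: christoffel_koszul[OF c x])
  have "Ck_on 1 (snd c ` fst c) (\<lambda>x. (1/2) *\<^sub>R (Dmetric c x u v w + Dmetric c x v u w - Dmetric c x w u v))" for w
    by (intro C1_intros Dmetric_C1 c)
  then show "Ck_on 1 (snd c ` fst c) ?b"
    by (intro C1_vec_lambda) (simp add: koszul_def)
qed

text \<open>Adding the Koszul expression to the one with \<open>u\<close> and \<open>v\<close>
  exchanged leaves only the derivative in direction \<open>h\<close>; the other terms cancel in
  pairs.\<close>

lemma metric_compat:
  assumes c: "c \<in> A" "x \<in> snd c ` fst c"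
  shows "metric_in A g c x (christoffel A g c x h u) v + metric_in A g c x u (christoffel A g c x h v) = Dmetric c x h u v"
proof -
  have "metric_in A g c x u (christoffel A g c x h v) = koszul c x h v u"
    using metric_sym[OF c] christoffel_koszul[OF c] by simp
  moreover have "koszul c x h u v + koszul c x h v u = Dmetric c x h u v"
    unfolding koszul_def using Dmetric_sym[OF c, where h = h and u = v and v = u] by (simp add: field_simps)
  ultimately show ?thesis by (simp add: christoffel_koszul[OF c])
qed

lemma metric_transition:
  assumes c: "c \<in> A" "d \<in> A" "x \<in> snd c ` (fst c \<inter> fst d)"
  shows "metric_in A g c x u v = metric_in A g d ((snd d \<circ> chart_inv c) x)
     (frechet_derivative (snd d \<circ> chart_inv c) (at x) u) (frechet_derivative (snd d \<circ> chart_inv c) (at x) v)"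
proof -
  have x: "x \<in> snd c ` fst c" "chart_inv c x \<in> fst d" using c overlap_eq[of c d] by auto
  note t = tmap_chart_inv_in_tspace[OF c(1) x(1)]
  show ?thesis
    unfolding metric_in_tmap[OF c(1) x(1)] metric_eq[OF t t c(2) x(2)]
    using x c(2) by (simp add: tmap_apply)
qed

text \<open>Differentiating the transformation law of the metric produces terms with the Hessian
  \<open>?H\<close> of the coordinate change. In the Koszul combination the symmetry of
  \<open>?H\<close> cancels all of them but one, and \<open>christoffel_unique\<close> removes the
  pairing with test vectors.\<close>

lemma christoffel_transition:
  assumes c: "c \<in> A" "d \<in> A" "x \<in> snd c ` (fst c \<inter> fst d)"
  defines "\<tau> \<equiv> snd d \<circ> chart_inv c"
  shows "frechet_derivative \<tau> (at x) (christoffel A g c x u v) =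
     christoffel A g d (\<tau> x) (frechet_derivative \<tau> (at x) u) (frechet_derivative \<tau> (at x) v)
     + frechet_derivative (\<lambda>y. frechet_derivative \<tau> (at y) v) (at x) u"
proof -
  let ?S = "snd c ` (fst c \<inter> fst d)"
  let ?T = "\<lambda>y. frechet_derivative \<tau> (at y)"
  let ?H = "\<lambda>h u. frechet_derivative (\<lambda>y. ?T y u) (at x) h"
  have S: "open ?S" by (rule overlap_open[OF c(1,2)])
  have x: "x \<in> snd c ` fst c" "chart_inv c x \<in> fst d" using c overlap_eq[of c d] by auto
  have \<tau>x: "\<tau> x \<in> snd d ` fst d" using x by (auto simp: \<tau>_def)
  have \<tau>2: "Ck_on 2 ?S \<tau>" unfolding \<tau>_def by (rule transition_Ck[OF c(1,2)])
  have d\<tau>: "(\<tau> has_derivative ?T x) (at x)" by (rule C1_deriv[OF Ck_on_2_D[OF \<tau>2] c(3)])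
  have dT: "((\<lambda>y. ?T y u) has_derivative (\<lambda>h. ?H h u)) (at x)" for u
    by (rule C1_deriv[OF _ c(3)]) (use \<tau>2 in \<open>auto simp: Ck_on_2_iff\<close>)
  have H_sym: "?H h u = ?H u h" for h u by (rule Ck2_symmetric[OF S c(3) \<tau>2])
  have eq: "metric_in A g d (\<tau> y) (?T y u) (?T y v) = metric_in A g c y u v" if "y \<in> ?S" for y u v
    using metric_transition[OF c(1,2) that] by (simp add: \<tau>_def)
  have D: "Dmetric c x h u v = Dmetric d (\<tau> x) (?T x h) (?T x u) (?T x v)
      + metric_in A g d (\<tau> x) (?H h u) (?T x v) + metric_in A g d (\<tau> x) (?T x u) (?H h v)" for h u v
  proof -
    have "((\<lambda>y. metric_in A g c y u v) has_derivative (\<lambda>h. Dmetric d (\<tau> x) (?T x h) (?T x u) (?T x v)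
      + metric_in A g d (\<tau> x) (?H h u) (?T x v) + metric_in A g d (\<tau> x) (?T x u) (?H h v))) (at x)"
      by (rule has_derivative_transform_within_open[OF metric_has_derivative[OF c(2) \<tau>x d\<tau> dT dT] S c(3) eq])
    then show ?thesis by (rule frechet_derivative_apply)
  qed
  note ms = metric_sym[OF c(2) \<tau>x]
  have K: "koszul c x u v w = koszul d (\<tau> x) (?T x u) (?T x v) (?T x w) + metric_in A g d (\<tau> x) (?H u v) (?T x w)" for w
  proof -
    have H: "?H v u = ?H u v" "?H w u = ?H u w" "?H w v = ?H v w" by (rule H_sym)+
    show ?thesis
      unfolding koszul_def D H using ms[of "?T x v" "?H u w"] by (simp add: field_simps)
  qed
  let ?w = "?T x (christoffel A g c x u v) - ?H u v"
  have "metric_in A g d (\<tau> x) ?w z = koszul d (\<tau> x) (?T x u) (?T x v) z" for z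
  proof -
    \<comment> \<open>The preimage of \<open>z\<close> under the differential of the transition, so
      that the formula for image vectors reaches an arbitrary test vector.\<close>
    let ?z = "frechet_derivative (snd c \<circ> chart_inv d) (at (\<tau> x)) z"
    have z: "?T x ?z = z"
      using transition_inverse[of d c "chart_inv c x" z] c x chart_inv_in[OF c(1) x(1)] chart_inv_right[OF c(1) x(1)]
      by (simp add: \<tau>_def)
    have "metric_in A g d (\<tau> x) (?T x (christoffel A g c x u v)) (?T x ?z) = koszul c x u v ?z"
      using eq[OF c(3)] christoffel_koszul[OF c(1) x(1)] by simp
    then show ?thesis unfolding K z by (simp add: linear_diff[OF metric_linear(2)[OF c(2) \<tau>x]])
  qed
  then have "?w = christoffel A g d (\<tau> x) (?T x u) (?T x v)" by (rule christoffel_unique[OF c(2) \<tau>x])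
  then show ?thesis by (simp add: algebra_simps)
qed

subsection \<open>Covariant derivatives\<close>

lemma cov_deriv_linear:
  fixes f :: "'x::real_normed_vector \<Rightarrow> 'a"
  assumes c: "c \<in> A" "f x \<in> fst c" and "(snd c \<circ> f) differentiable (at x)" "(\<lambda>y. X y c) differentiable (at x)"
  shows "linear (cov_deriv A g c f X x)"
proof -
  have l: "linear (frechet_derivative (\<lambda>y. X y c) (at x))" "linear (frechet_derivative (snd c \<circ> f) (at x))"
    using assms by (auto intro: linear_frechet_derivative)
  have "snd c (f x) \<in> snd c ` fst c" using c by auto
  from linear_compose[OF l(2) christoffel_linear(1)[OF c(1) this]]
  have "linear (\<lambda>u. christoffel A g c (snd c (f x)) (frechet_derivative (snd c \<circ> f) (at x) u) (X x c))"
    by (simp add: comp_def)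
  from linear_compose_add[OF l(1) this] show ?thesis unfolding cov_deriv_def .
qed

text \<open>The Hessian term of \<open>christoffel_transition\<close> cancels against the one that
  arises from differentiating the transformed components of \<open>X\<close>. It follows that being
  parallel can be checked in a single chart.\<close>

lemma field_change:
  fixes f :: "'x::real_normed_vector \<Rightarrow> 'a"
  assumes W: "open W" "x \<in> W" "continuous_on W f" and X: "\<And>y. y \<in> W \<Longrightarrow> X y \<in> tspace A (f y)"
    and cd: "c \<in> A" "d \<in> A" "f x \<in> fst c" "f x \<in> fst d"
    and diff: "(snd c \<circ> f) differentiable (at x)" "(\<lambda>y. X y c) differentiable (at x)"
  shows "(\<lambda>y. X y d) differentiable (at x)"
    and "cov_deriv A g d f X x u = frechet_derivative (snd d \<circ> chart_inv c) (at (snd c (f x))) (cov_deriv A g c f X x u)"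
proof -
  let ?\<tau> = "snd d \<circ> chart_inv c" and ?x = "snd c \<circ> f"
  let ?T = "\<lambda>y. frechet_derivative ?\<tau> (at y)" and ?O = "snd c ` (fst c \<inter> fst d)"
  let ?S = "W \<inter> f -` (fst c \<inter> fst d)"
  have S: "open ?S" "x \<in> ?S"
    using continuous_open_preimage[OF W(3,1) open_Int[OF chart_open[OF cd(1)] chart_open[OF cd(2)]]] W cd by auto
  have eq: "?T (?x y) (X y c) = X y d" if "y \<in> ?S" for y
    using tspace_change[OF X, of y c d] that cd by simp
  have xO: "?x y \<in> ?O" if "y \<in> ?S" for y using that by auto
  have O: "open ?O" by (rule overlap_open[OF cd(1,2)])
  have \<tau>2: "Ck_on 2 ?O ?\<tau>" by (rule transition_Ck[OF cd(1,2)])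
  have T1: "Ck_on 1 ?O (\<lambda>y. ?T y e)" for e using \<tau>2 by (auto simp: Ck_on_2_iff)
  have linT: "linear (?T y)" if "y \<in> ?O" for y using C1_linear_deriv[OF Ck_on_2_D[OF \<tau>2] that] .
  let ?T' = "\<lambda>h e. frechet_derivative (\<lambda>y. ?T y e) (at (?x x)) (frechet_derivative ?x (at x) h)"
  have linT': "linear (?T' h)" for h
  proof (rule linearI)
    have d: "((\<lambda>y. ?T y e) has_derivative frechet_derivative (\<lambda>y. ?T y e) (at (?x x))) (at (?x x))" for e
      by (rule C1_deriv[OF T1 xO[OF S(2)]])
    show "?T' h (a + b) = ?T' h a + ?T' h b" for a b
    proof -
      have "((\<lambda>y. ?T y (a + b)) has_derivative (\<lambda>h. frechet_derivative (\<lambda>y. ?T y a) (at (?x x)) h + frechet_derivative (\<lambda>y. ?T y b) (at (?x x)) h)) (at (?x x))"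
        by (rule has_derivative_transform_within_open[OF has_derivative_add[OF d d] O xO[OF S(2)]])
          (simp add: linear_add[OF linT])
      then show ?thesis by (rule frechet_derivative_apply)
    qed
    show "?T' h (r *\<^sub>R a) = r *\<^sub>R ?T' h a" for r a
    proof -
      have "((\<lambda>y. ?T y (r *\<^sub>R a)) has_derivative (\<lambda>h. r *\<^sub>R frechet_derivative (\<lambda>y. ?T y a) (at (?x x)) h)) (at (?x x))"
        by (rule has_derivative_transform_within_open[OF has_derivative_scaleR_right[OF d] O xO[OF S(2)]])
          (simp add: linear_scale[OF linT])
      then show ?thesis by (rule frechet_derivative_apply)
    qed
  qed
  have "((\<lambda>s. ?T (?x s) (X s c)) has_derivative (\<lambda>h. ?T' h (X x c) + ?T (?x x) (frechet_derivative (\<lambda>y. X y c) (at x) h))) (at x)"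
  proof (rule has_derivative_linear_family[OF _ linT'])
    show "\<forall>\<^sub>F s in nhds x. linear (?T (?x s))"
      using eventually_nhds_in_open[OF S] by eventually_elim (rule linT[OF xO])
    show "((\<lambda>s. ?T (?x s) e) has_derivative (\<lambda>h. ?T' h e)) (at x)" for e
      by (rule has_derivative_compose[where f = ?x and g = "\<lambda>y. ?T y e", OF _ C1_deriv[OF T1 xO[OF S(2)]]])
        (use diff in \<open>simp add: frechet_derivative_works\<close>)
    show "((\<lambda>y. X y c) has_derivative frechet_derivative (\<lambda>y. X y c) (at x)) (at x)"
      using diff by (simp add: frechet_derivative_works)
  qed
  then have dX: "((\<lambda>y. X y d) has_derivative (\<lambda>h. ?T' h (X x c) + ?T (?x x) (frechet_derivative (\<lambda>y. X y c) (at x) h))) (at x)"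
    by (rule has_derivative_transform_within_open[OF _ S eq])
  then show "(\<lambda>y. X y d) differentiable (at x)" by (auto simp: differentiable_def)
  have e1: "frechet_derivative (\<lambda>y. X y d) (at x) u = ?T' u (X x c) + ?T (?x x) (frechet_derivative (\<lambda>y. X y c) (at x) u)"
    by (rule frechet_derivative_apply[OF dX])
  have e2: "frechet_derivative (snd d \<circ> f) (at x) u = ?T (?x x) (frechet_derivative ?x (at x) u)"
    unfolding o_apply[of "snd c" f x] by (rule frechet_derivative_apply[OF chart_change[OF W cd diff(1)]])
  have tx: "?\<tau> (?x x) = snd d (f x)" using cd chart_inv_left by simp
  have e3: "X x d = ?T (?x x) (X x c)" using eq[OF S(2)] by simp
  have "?T (?x x) (christoffel A g c (?x x) (frechet_derivative ?x (at x) u) (X x c)) =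
      christoffel A g d (?\<tau> (?x x)) (?T (?x x) (frechet_derivative ?x (at x) u)) (?T (?x x) (X x c)) + ?T' u (X x c)"
    by (rule christoffel_transition[OF cd(1,2) xO[OF S(2)]])
  then show "cov_deriv A g d f X x u = ?T (snd c (f x)) (cov_deriv A g c f X x u)"
    unfolding cov_deriv_def e1 e2 e3 tx[symmetric]
    using linear_add[OF linT[OF xO[OF S(2)]]] by (simp add: algebra_simps)
qed

text \<open>In a chart the derivative of the product vanishes by \<open>metric_compat\<close>, and
  the interval is connected. It serves twice: to keep the velocity of a geodesic null, and to keep
  the product of the rigging with \<open>L\<close> equal to -1.\<close>

lemma metric_const_along:
  assumes I: "open I" "is_interval I" and \<gamma>: "continuous_on I \<gamma>"
    "\<And>t c. t \<in> I \<Longrightarrow> c \<in> A \<Longrightarrow> \<gamma> t \<in> fst c \<Longrightarrow> (snd c \<circ> \<gamma>) differentiable (at t)"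
    and X: "parallel_along A g I \<gamma> X" and Y: "parallel_along A g I \<gamma> Y" and st: "s \<in> I" "t \<in> I"
  shows "g (\<gamma> s) (X s) (Y s) = g (\<gamma> t) (X t) (Y t)"
proof -
  have "((\<lambda>t. g (\<gamma> t) (X t) (Y t)) has_derivative (\<lambda>h. 0)) (at t)" if t: "t \<in> I" for t
  proof -
    obtain c where c: "c \<in> A" "\<gamma> t \<in> fst c" using chart_exists .
    let ?S = "I \<inter> \<gamma> -` fst c"
    have S: "open ?S" "t \<in> ?S"
      using continuous_open_preimage[OF \<gamma>(1) I(1) chart_open[OF c(1)]] t c by auto
    let ?x = "snd c \<circ> \<gamma>"
    have xt: "?x t \<in> snd c ` fst c" using c by auto
    have diff: "(?x has_derivative frechet_derivative ?x (at t)) (at t)"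
      using \<gamma>(2)[OF t c] by (simp add: frechet_derivative_works)
    have par: "(\<lambda>s. Z s c) differentiable (at t)"
        "frechet_derivative (\<lambda>s. Z s c) (at t) 1 = - christoffel A g c (?x t) (frechet_derivative ?x (at t) 1) (Z t c)"
      if "parallel_along A g I \<gamma> Z" for Z
      using that t c unfolding parallel_along_def cov_deriv_def by (auto simp: eq_neg_iff_add_eq_0)
    have dd: "((\<lambda>s. Z s c) has_derivative frechet_derivative (\<lambda>s. Z s c) (at t)) (at t)" if "parallel_along A g I \<gamma> Z" for Z
      using par(1)[OF that] by (simp add: frechet_derivative_works)
    let ?F = "\<lambda>h. Dmetric c (?x t) (frechet_derivative ?x (at t) h) (X t c) (Y t c)
      + metric_in A g c (?x t) (frechet_derivative (\<lambda>s. X s c) (at t) h) (Y t c)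
      + metric_in A g c (?x t) (X t c) (frechet_derivative (\<lambda>s. Y s c) (at t) h)"
    have F: "((\<lambda>s. metric_in A g c (?x s) (X s c) (Y s c)) has_derivative ?F) (at t)"
      by (rule metric_has_derivative[OF c(1) xt diff dd[OF X] dd[OF Y]])
    have "?F 1 = 0"
      unfolding par(2)[OF X] par(2)[OF Y]
      using metric_compat[OF c(1) xt, of "frechet_derivative ?x (at t) 1" "X t c" "Y t c"]
      using linear_neg[OF metric_linear(1)[OF c(1) xt]] linear_neg[OF metric_linear(2)[OF c(1) xt]] by simp
    moreover have "?F h = h *\<^sub>R ?F 1" for h
      using linear_scale[OF bounded_linear.linear[OF has_derivative_bounded_linear[OF F]], of h 1] by (simp only: real_scaleR_def mult.right_neutral)
    ultimately have "?F = (\<lambda>h. 0)" by (simp add: fun_eq_iff)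
    with F have "((\<lambda>s. metric_in A g c (?x s) (X s c) (Y s c)) has_derivative (\<lambda>h. 0)) (at t)" by (simp only:)
    then show ?thesis
    proof (rule has_derivative_transform_within_open[OF _ S])
      fix s assume "s \<in> ?S"
      then show "metric_in A g c (?x s) (X s c) (Y s c) = g (\<gamma> s) (X s) (Y s)"
        using metric_eq[OF _ _ c(1), of "X s" "\<gamma> s" "Y s"] X Y unfolding parallel_along_def by auto
    qed
  qed
  then have "((\<lambda>t. g (\<gamma> t) (X t) (Y t)) has_derivative (\<lambda>h. 0)) (at t within I)" if "t \<in> I" for t
    using that has_derivative_at_withinI by blast
  then show ?thesis
    using has_derivative_zero_unique[of I "\<lambda>t. g (\<gamma> t) (X t) (Y t)" s t] I(2) st
    by (auto simp: is_interval_convex)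
qed

end

section \<open>Geodesics\<close>

lemma C1_bilinear_family:
  fixes B :: "'x::real_normed_vector \<Rightarrow> 'b::euclidean_space \<Rightarrow> 'c::euclidean_space \<Rightarrow> 'd::real_normed_vector"
  assumes "open S" "\<And>x v. x \<in> S \<Longrightarrow> linear (\<lambda>u. B x u v)" "\<And>x u. x \<in> S \<Longrightarrow> linear (B x u)"
    and "\<And>u v. Ck_on 1 S (\<lambda>x. B x u v)" "Ck_on 1 S a" "Ck_on 1 S b"
  shows "Ck_on 1 S (\<lambda>x. B x (a x) (b x))"
proof (rule C1_linear_family[OF assms(1,3) _ assms(6)])
  show "Ck_on 1 S (\<lambda>x. B x (a x) e)" for e
    by (rule C1_linear_family[OF assms(1,2,4,5)])
qed

lemma continuous_on_bilinear_family:
  fixes B :: "'x::topological_space \<Rightarrow> 'b::euclidean_space \<Rightarrow> 'c::euclidean_space \<Rightarrow> 'd::real_normed_vector"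
  assumes "\<And>x v. x \<in> S \<Longrightarrow> linear (\<lambda>u. B x u v)" "\<And>x u. x \<in> S \<Longrightarrow> linear (B x u)"
    and "\<And>u v. continuous_on S (\<lambda>x. B x u v)" "continuous_on S a" "continuous_on S b"
  shows "continuous_on S (\<lambda>x. B x (a x) (b x))"
proof (rule continuous_on_linear_family[OF assms(2) _ assms(5)])
  show "continuous_on S (\<lambda>x. B x (a x) e)" for e
    by (rule continuous_on_linear_family[OF assms(1,3,4)])
qed

context lorentz
begin

definition spray :: "('a, 'n) chart \<Rightarrow> (real ^ 'n) \<times> (real ^ 'n) \<Rightarrow> (real ^ 'n) \<times> (real ^ 'n)" where
  "spray c z = (snd z, - christoffel A g c (fst z) (snd z) (snd z))"

text \<open>A C^2 metric gives a C^1, hence locally Lipschitz, right-hand side for the geodesic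
  equation written as a first-order system.\<close>

lemma spray_C1:
  assumes c: "c \<in> A" shows "Ck_on 1 (snd c ` fst c \<times> UNIV) (spray c)"
proof -
  let ?S = "snd c ` fst c \<times> (UNIV :: (real ^ 'n) set)"
  have f: "Ck_on 1 ?S fst" "Ck_on 1 ?S snd"
    by (auto intro!: C1_linear bounded_linear_fst bounded_linear_snd)
  have "Ck_on 1 ?S (\<lambda>z. christoffel A g c (fst z) (snd z) (snd z))"
  proof (rule C1_bilinear_family[where B = "\<lambda>z u v. christoffel A g c (fst z) u v", OF _ _ _ _ f(2) f(2)])
    show "open ?S" by (intro open_Times chart_image_open c) auto
    show "Ck_on 1 ?S (\<lambda>z. christoffel A g c (fst z) u v)" for u v
      by (rule C1_compose'[OF f(1) christoffel_C1[OF c]]) auto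
  qed (use christoffel_linear[OF c] in auto)
  then have "Ck_on 1 ?S (\<lambda>z. (snd z, (-1) *\<^sub>R christoffel A g c (fst z) (snd z) (snd z)))"
    by (intro C1_intros f)
  then show ?thesis by (simp add: spray_def[abs_def])
qed

lemma geodesicD:
  assumes "geodesic A g I \<gamma>"
  shows "open I" "is_interval I" "Ck_map A 2 I \<gamma>" "continuous_on I \<gamma>" "parallel_along A g I \<gamma> (\<lambda>t. tmap A \<gamma> t 1)"
  using assms by (auto simp: geodesic_def Ck_map_def)

lemma geodesic_differentiable:
  assumes "geodesic A g I \<gamma>" "t \<in> I" "c \<in> A" "\<gamma> t \<in> fst c"
  shows "(snd c \<circ> \<gamma>) differentiable (at t)"
  using Ck_map_differentiable[OF Ck_map_2D[OF geodesicD(3)[OF assms(1)]]] assms by blast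

lemma has_vector_derivative_frechet:
  "f differentiable (at t) \<Longrightarrow> (f has_vector_derivative frechet_derivative f (at t) 1) (at t)"
  by (metis frechet_derivative_eq_vector_derivative vector_derivative_works scaleR_one)

lemma geodesic_spray:
  assumes \<gamma>: "geodesic A g I \<gamma>" and t: "t \<in> I" "c \<in> A" "\<gamma> t \<in> fst c"
  shows "((\<lambda>s. (snd c (\<gamma> s), tmap A \<gamma> s 1 c)) has_vector_derivative spray c (snd c (\<gamma> t), tmap A \<gamma> t 1 c)) (at t)"
proof -
  have "((snd c \<circ> \<gamma>) has_vector_derivative tmap A \<gamma> t 1 c) (at t)"
    unfolding tmap_apply[where f = \<gamma>, OF t(2,3)]
    by (rule has_vector_derivative_frechet[OF geodesic_differentiable[OF \<gamma> t]])
  then have 1: "((\<lambda>s. snd c (\<gamma> s)) has_vector_derivative tmap A \<gamma> t 1 c) (at t)"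
    by (simp add: o_def)
  have p: "(\<lambda>s. tmap A \<gamma> s 1 c) differentiable (at t)" "cov_deriv A g c \<gamma> (\<lambda>t. tmap A \<gamma> t 1) t 1 = 0"
    using geodesicD(5)[OF \<gamma>] t unfolding parallel_along_def by blast+
  have "frechet_derivative (\<lambda>s. tmap A \<gamma> s 1 c) (at t) 1 =
      - christoffel A g c (snd c (\<gamma> t)) (tmap A \<gamma> t 1 c) (tmap A \<gamma> t 1 c)"
    using p(2) unfolding cov_deriv_def tmap_apply[where f = \<gamma>, OF t(2,3), symmetric]
    by (rule eq_neg_iff_add_eq_0[THEN iffD2])
  then have 2: "((\<lambda>s. tmap A \<gamma> s 1 c) has_vector_derivative
      - christoffel A g c (snd c (\<gamma> t)) (tmap A \<gamma> t 1 c) (tmap A \<gamma> t 1 c)) (at t)"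
    using has_vector_derivative_frechet[OF p(1)] by simp
  show ?thesis unfolding spray_def fst_conv snd_conv
    by (rule has_vector_derivative_Pair[OF 1 2])
qed

text \<open>Position and velocity of both curves stay for a while in a ball on which the spray is
  Lipschitz, and \<open>ode_zero\<close> applies to their difference. Forward time is enough for a
  comparison on [0, 1].\<close>

lemma geodesic_unique_locally:
  assumes 1: "geodesic A g I1 \<gamma>1" and 2: "geodesic A g I2 \<gamma>2" and s: "s \<in> I1" "s \<in> I2"
    and eq: "\<gamma>1 s = \<gamma>2 s" "tmap A \<gamma>1 s 1 = tmap A \<gamma>2 s 1"
  shows "\<exists>\<epsilon>>0. \<forall>t\<in>{s..s+\<epsilon>}. \<gamma>1 t = \<gamma>2 t"
proof -
  obtain c where c: "c \<in> A" "\<gamma>1 s \<in> fst c" using chart_exists .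
  let ?Y1 = "\<lambda>t. (snd c (\<gamma>1 t), tmap A \<gamma>1 t 1 c)" and ?Y2 = "\<lambda>t. (snd c (\<gamma>2 t), tmap A \<gamma>2 t 1 c)"
  let ?O = "snd c ` fst c \<times> (UNIV :: (real ^ 'n) set)"
  have O: "open ?O" by (intro open_Times chart_image_open c) auto
  have Y: "?Y2 s = ?Y1 s" using eq by simp
  have "?Y1 s \<in> ?O" using c by auto
  then obtain r where r: "r > 0" "cball (?Y1 s) r \<subseteq> ?O" using O open_contains_cball by blast
  obtain C where C: "C \<ge> 0" "\<And>x y. x \<in> cball (?Y1 s) r \<Longrightarrow> y \<in> cball (?Y1 s) r \<Longrightarrow> norm (spray c x - spray c y) \<le> C * norm (x - y)"
    using C1_lipschitz_on_compact_convex[OF spray_C1[OF c(1)] compact_cball convex_cball r(2)] by blast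
  have near: "\<exists>\<epsilon>>0. \<forall>t. \<bar>t - s\<bar> \<le> \<epsilon> \<longrightarrow> t \<in> I \<and> \<gamma> t \<in> fst c \<and> (snd c (\<gamma> t), tmap A \<gamma> t 1 c) \<in> cball (?Y1 s) r"
    if \<gamma>: "geodesic A g I \<gamma>" "s \<in> I" "\<gamma> s \<in> fst c" "(snd c (\<gamma> s), tmap A \<gamma> s 1 c) = ?Y1 s" for I \<gamma>
  proof -
    let ?Y = "\<lambda>t. (snd c (\<gamma> t), tmap A \<gamma> t 1 c)"
    have "open (I \<inter> \<gamma> -` fst c)"
      by (rule continuous_open_preimage[OF geodesicD(4)[OF \<gamma>(1)] geodesicD(1)[OF \<gamma>(1)] chart_open[OF c(1)]])
    then have e1: "\<forall>\<^sub>F t in nhds s. t \<in> I \<inter> \<gamma> -` fst c" using \<gamma> by (intro eventually_nhds_in_open) auto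
    have "isCont ?Y s"
      using has_vector_derivative_continuous[OF geodesic_spray[OF \<gamma>(1,2) c(1) \<gamma>(3)]] by simp
    then have "(?Y \<longlongrightarrow> ?Y s) (nhds s)" by (simp add: isCont_def tendsto_nhds_iff)
    then have "\<forall>\<^sub>F t in nhds s. ?Y t \<in> ball (?Y1 s) r"
      using r(1) \<gamma>(4) by (intro topological_tendstoD) auto
    with e1 have "\<forall>\<^sub>F t in nhds s. t \<in> I \<and> \<gamma> t \<in> fst c \<and> ?Y t \<in> cball (?Y1 s) r"
      by eventually_elim auto
    then obtain d where "d > 0" "\<And>t. dist t s < d \<Longrightarrow> t \<in> I \<and> \<gamma> t \<in> fst c \<and> ?Y t \<in> cball (?Y1 s) r"
      unfolding eventually_nhds_metric by blast
    then show ?thesis by (intro exI[of _ "d / 2"]) (auto simp: dist_real_def)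
  qed
  obtain e1 where e1: "e1 > 0" "\<And>t. \<bar>t - s\<bar> \<le> e1 \<Longrightarrow> t \<in> I1 \<and> \<gamma>1 t \<in> fst c \<and> ?Y1 t \<in> cball (?Y1 s) r"
    using near[OF 1 s(1) c(2) refl] by blast
  obtain e2 where e2: "e2 > 0" "\<And>t. \<bar>t - s\<bar> \<le> e2 \<Longrightarrow> t \<in> I2 \<and> \<gamma>2 t \<in> fst c \<and> ?Y2 t \<in> cball (?Y1 s) r"
    using near[OF 2 s(2) _ Y] c(2) eq(1) by auto
  show ?thesis
  proof (intro exI conjI ballI)
    show "min e1 e2 > 0" using e1 e2 by simp
    fix b assume b: "b \<in> {s..s + min e1 e2}"
    have "?Y1 b - ?Y2 b = 0"
    proof (rule ode_zero[where z = "\<lambda>t. ?Y1 t - ?Y2 t" and a = s and b = b and z' = "\<lambda>t. spray c (?Y1 t) - spray c (?Y2 t)" and C = C])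
      show "s \<le> b" using b by simp
      fix t assume t: "t \<in> {s..b}"
      have t': "\<bar>t - s\<bar> \<le> e1" "\<bar>t - s\<bar> \<le> e2" using b t by auto
      show "((\<lambda>t. ?Y1 t - ?Y2 t) has_vector_derivative spray c (?Y1 t) - spray c (?Y2 t)) (at t)"
        by (intro has_vector_derivative_diff geodesic_spray[OF 1 _ c(1)] geodesic_spray[OF 2 _ c(1)])
          (use e1(2)[OF t'(1)] e2(2)[OF t'(2)] in auto)
      show "norm (spray c (?Y1 t) - spray c (?Y2 t)) \<le> C * norm (?Y1 t - ?Y2 t)"
        by (rule C(2)) (use e1(2)[OF t'(1)] e2(2)[OF t'(2)] in blast)+
    qed (use Y in simp)
    then have "snd c (\<gamma>1 b) = snd c (\<gamma>2 b)" by (simp add: zero_prod_def)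
    then show "\<gamma>1 b = \<gamma>2 b"
      using e1(2)[of b] e2(2)[of b] b chart_inv_left[OF c(1)] by (metis abs_of_nonneg atLeastAtMost_iff diff_ge_0_iff_ge diff_le_eq add.commute min.bounded_iff le_diff_eq)
  qed
qed

text \<open>At the infimum \<open>s\<close> of the times of disagreement the curves still agree to
  first order, so \<open>geodesic_unique_locally\<close> pushes the infimum further to the
  right.\<close>

lemma geodesic_unique:
  assumes 1: "geodesic A g I1 \<gamma>1" and 2: "geodesic A g I2 \<gamma>2" and I: "{0..1} \<subseteq> I1" "{0..1} \<subseteq> I2"
    and eq: "\<gamma>1 0 = \<gamma>2 0" "tmap A \<gamma>1 0 1 = tmap A \<gamma>2 0 1"
  shows "\<gamma>1 1 = \<gamma>2 1"
proof (rule ccontr)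
  assume ne: "\<gamma>1 1 \<noteq> \<gamma>2 1"
  define D where "D = {s \<in> {0..1}. \<gamma>1 s \<noteq> \<gamma>2 s}"
  define s where "s = Inf D"
  have D: "1 \<in> D" "bdd_below D" using ne by (auto simp: D_def)
  have s01: "0 \<le> s" "s \<le> 1"
    unfolding s_def using D by (auto intro!: cInf_greatest cInf_lower simp: D_def)
  have below: "\<gamma>1 r = \<gamma>2 r" if "0 \<le> r" "r < s" for r
    using that s01 cInf_lower[OF _ D(2), of r] by (force simp: D_def s_def)
  have sI: "s \<in> I1" "s \<in> I2" using s01 I by auto
  have c1: "isCont \<gamma>1 s" and c2: "isCont \<gamma>2 s"
    using geodesicD(1,4)[OF 1] geodesicD(1,4)[OF 2] sI continuous_on_eq_continuous_at by blast+
  have ev: "\<forall>\<^sub>F r in at_left s. \<gamma>1 r = \<gamma>2 r" if "s > 0"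
    using eventually_at_left_real[OF that] by eventually_elim (auto intro: below)
  have eqs: "\<gamma>1 s = \<gamma>2 s"
  proof (cases "s = 0")
    case False
    then have "s > 0" using s01 by simp
    have "(\<gamma>1 \<longlongrightarrow> \<gamma>1 s) (at_left s)" "(\<gamma>2 \<longlongrightarrow> \<gamma>2 s) (at_left s)"
      using c1 c2 by (auto simp: isCont_def intro: filterlim_at_split[THEN iffD1, THEN conjunct1])
    moreover from this(1) have "(\<gamma>2 \<longlongrightarrow> \<gamma>1 s) (at_left s)"
      by (rule Lim_transform_eventually[OF _ ev[OF \<open>s > 0\<close>]])
    ultimately show ?thesis using tendsto_unique trivial_limit_at_left_real by blast
  qed (use eq in simp)
  \<comment> \<open>The curves agree up to \<open>s\<close>, so both velocities are the left-sided
    derivative of one and the same function.\<close>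
  have eqv: "tmap A \<gamma>1 s 1 = tmap A \<gamma>2 s 1"
  proof (cases "s = 0")
    case False
    then have s0: "s > 0" using s01 by simp
    obtain c where c: "c \<in> A" "\<gamma>1 s \<in> fst c" using chart_exists .
    have c': "\<gamma>2 s \<in> fst c" using c eqs by simp
    have d1: "((snd c \<circ> \<gamma>1) has_vector_derivative tmap A \<gamma>1 s 1 c) (at s within {0..s})"
      unfolding tmap_apply[where f = \<gamma>1, OF c]
      by (rule has_vector_derivative_at_within[OF has_vector_derivative_frechet[OF geodesic_differentiable[OF 1 sI(1) c]]])
    have d2: "((snd c \<circ> \<gamma>2) has_vector_derivative tmap A \<gamma>2 s 1 c) (at s within {0..s})"
      unfolding tmap_apply[where f = \<gamma>2, OF c(1) c']
      by (rule has_vector_derivative_at_within[OF has_vector_derivative_frechet[OF geodesic_differentiable[OF 2 sI(2) c(1) c']]])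
    have "((snd c \<circ> \<gamma>2) has_vector_derivative tmap A \<gamma>1 s 1 c) (at s within {0..s})"
      by (rule has_vector_derivative_transform[OF _ _ d1]) (use s0 below eqs in \<open>auto simp: le_less\<close>)
    then have "tmap A \<gamma>1 s 1 c = tmap A \<gamma>2 s 1 c"
      using vector_derivative_unique_within[OF _ _ d2] s0 by (metis at_within_Icc_at_left trivial_limit_at_left_real)
    moreover have "tmap A \<gamma>1 s 1 \<in> tspace A (\<gamma>1 s)" "tmap A \<gamma>2 s 1 \<in> tspace A (\<gamma>2 s)"
      using geodesicD(5)[OF 1] geodesicD(5)[OF 2] sI by (auto simp: parallel_along_def)
    ultimately show ?thesis using tspace_eqI[OF _ _ c] eqs by metis
  qed (use eq in simp)
  obtain \<epsilon> where \<epsilon>: "\<epsilon> > 0" "\<And>t. t \<in> {s..s+\<epsilon>} \<Longrightarrow> \<gamma>1 t = \<gamma>2 t"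
    using geodesic_unique_locally[OF 1 2 sI eqs eqv] by blast
  have "s + \<epsilon> \<le> d" if "d \<in> D" for d
  proof (rule ccontr)
    assume "\<not> s + \<epsilon> \<le> d"
    moreover have "s \<le> d" unfolding s_def by (rule cInf_lower[OF that D(2)])
    ultimately have "\<gamma>1 d = \<gamma>2 d" by (intro \<epsilon>(2)) auto
    then show False using that by (simp add: D_def)
  qed
  then have "s + \<epsilon> \<le> Inf D" using D(1) by (intro cInf_greatest) auto
  then show False using \<epsilon>(1) by (simp add: s_def)
qed

section \<open>The exponential map and rescaled geodesics\<close>

lemma exp_map_eq:
  assumes "exp_rel A g z v q" shows "exp_map A g z v = q"
  unfolding exp_map_def
proof (rule the_equality)
  show "exp_rel A g z v q" by fact
next
  fix q' assume "exp_rel A g z v q'"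
  then obtain I' \<gamma>' where 1: "geodesic A g I' \<gamma>'" "0 \<in> I'" "1 \<in> I'" "\<gamma>' 0 = z" "tmap A \<gamma>' 0 1 = v" "\<gamma>' 1 = q'"
    unfolding exp_rel_def by blast
  obtain I \<gamma> where 2: "geodesic A g I \<gamma>" "0 \<in> I" "1 \<in> I" "\<gamma> 0 = z" "tmap A \<gamma> 0 1 = v" "\<gamma> 1 = q"
    using assms unfolding exp_rel_def by blast
  have sub: "{0..1} \<subseteq> J" if "geodesic A g J \<beta>" "0 \<in> J" "1 \<in> J" for J \<beta>
    using geodesicD(2)[OF that(1)] that(2,3) unfolding is_interval_1 by fastforce
  show "q' = q"
    using geodesic_unique[OF 1(1) 2(1) sub[OF 1(1-3)] sub[OF 2(1-3)]] 1 2 by simp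
qed

lemma frechet_derivative_rescale:
  fixes f :: "real \<Rightarrow> 'b::real_normed_vector"
  assumes "f differentiable (at (a * t))"
  shows "((\<lambda>s. f (a * s)) has_derivative (\<lambda>h. a *\<^sub>R frechet_derivative f (at (a * t)) h)) (at t)"
proof -
  have "((\<lambda>s. f (a * s)) has_derivative (\<lambda>h. frechet_derivative f (at (a * t)) (a * h))) (at t)"
    by (rule has_derivative_compose[where f = "\<lambda>s. a * s" and g = f, OF _ assms[unfolded frechet_derivative_works]])
      (auto intro!: derivative_eq_intros)
  then show ?thesis
    by (rule has_derivative_eq_rhs) (use linear_scale[OF linear_frechet_derivative[OF assms], of a] in auto)
qed

text \<open>Velocity scales by \<open>a\<close> and acceleration by its square, since the
  Christoffel term is quadratic in the velocity. The value a = 0 is included and yields constant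
  curves, which represent the exponential of the zero vector.\<close>

lemma geodesic_rescale:
  assumes \<gamma>: "geodesic A g I \<gamma>"
  shows "geodesic A g {t. a * t \<in> I} (\<lambda>t. \<gamma> (a * t))"
    and "\<And>t. a * t \<in> I \<Longrightarrow> tmap A (\<lambda>t. \<gamma> (a * t)) t 1 = scale_tvec a (tmap A \<gamma> (a * t) 1)"
proof -
  let ?J = "{t. a * t \<in> I}" and ?\<beta> = "\<lambda>t. \<gamma> (a * t)"
  have ca: "continuous_on UNIV (\<lambda>t. a * t)" by (intro continuous_intros)
  have J: "open ?J"
    using continuous_open_vimage[OF geodesicD(1)[OF \<gamma>], of "\<lambda>t. a * t"] ca by (simp add: vimage_def continuous_on_eq_continuous_at)
  have iJ: "is_interval ?J"
    unfolding is_interval_1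
  proof (intro allI impI ballI)
    fix x y z assume "x \<in> ?J" "y \<in> ?J" "x \<le> z \<and> z \<le> y"
    then show "z \<in> ?J"
      using geodesicD(2)[OF \<gamma>] mult_left_mono[of x z a] mult_left_mono[of z y a] mult_left_mono_neg[of x z a] mult_left_mono_neg[of z y a]
      unfolding is_interval_1 mem_Collect_eq by (metis linear)
  qed
  have c2: "Ck_on 2 (?J \<inter> ?\<beta> -` fst c) (snd c \<circ> ?\<beta>)" if c: "c \<in> A" for c
  proof -
    let ?S = "I \<inter> \<gamma> -` fst c" and ?S' = "?J \<inter> ?\<beta> -` fst c" and ?x = "snd c \<circ> \<gamma>"
    have S': "open ?S'" using J chart_open[OF c] geodesicD(4)[OF \<gamma>]
      by (intro continuous_open_preimage continuous_on_compose2[OF geodesicD(4)[OF \<gamma>] continuous_on_subset[OF ca]]) auto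
    have x2: "Ck_on 2 ?S ?x" by (rule Ck_map_chart[OF geodesicD(3)[OF \<gamma>] c])
    have d: "((snd c \<circ> ?\<beta>) has_derivative (\<lambda>h. a *\<^sub>R frechet_derivative ?x (at (a * t)) h)) (at t)" if "t \<in> ?S'" for t
    proof -
      have "?x differentiable (at (a * t))" using x2 that unfolding Ck_on_2_iff by auto
      from frechet_derivative_rescale[OF this] show ?thesis by (simp add: o_def)
    qed
    show ?thesis unfolding Ck_on_2_iff
    proof (intro conjI ballI allI)
      show "(snd c \<circ> ?\<beta>) differentiable (at t)" if "t \<in> ?S'" for t using d[OF that] by (auto simp: differentiable_def)
      fix u
      have "Ck_on 1 ?S (\<lambda>t. frechet_derivative ?x (at t) u)" using x2 unfolding Ck_on_2_iff by blast
      from C1_compose'[OF C1_linear[OF bounded_linear_mult_right] this, of a ?S']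
      have "Ck_on 1 ?S' (\<lambda>t. frechet_derivative ?x (at (a * t)) u)" by auto
      then have "Ck_on 1 ?S' (\<lambda>t. a *\<^sub>R frechet_derivative ?x (at (a * t)) u)"
        by (rule C1_bounded_linear[OF bounded_linear_scaleR_right])
      then show "Ck_on 1 ?S' (\<lambda>t. frechet_derivative (snd c \<circ> ?\<beta>) (at t) u)"
        by (rule Ck_on_cong[OF S', rotated]) (rule frechet_derivative_apply[OF d, symmetric])
    qed
  qed
  have "continuous_on ?J ?\<beta>"
    by (rule continuous_on_compose2[OF geodesicD(4)[OF \<gamma>] continuous_on_subset[OF ca]]) auto
  then have ck: "Ck_map A 2 ?J ?\<beta>" using c2 by (simp add: Ck_map_def)
  show tm: "tmap A ?\<beta> t 1 = scale_tvec a (tmap A \<gamma> (a * t) 1)" if t: "a * t \<in> I" for t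
  proof
    fix c
    show "tmap A ?\<beta> t 1 c = scale_tvec a (tmap A \<gamma> (a * t) 1) c"
    proof (cases "c \<in> A \<and> \<gamma> (a * t) \<in> fst c")
      case True
      have "((snd c \<circ> ?\<beta>) has_derivative (\<lambda>h. a *\<^sub>R frechet_derivative (snd c \<circ> \<gamma>) (at (a * t)) h)) (at t)"
        using frechet_derivative_rescale[OF geodesic_differentiable[OF \<gamma> t]] True by (simp add: o_def)
      from frechet_derivative_apply[OF this, of 1] show ?thesis using True by (simp add: tmap_def scale_tvec_def)
    qed (auto simp: tmap_def scale_tvec_def)
  qed
  have "parallel_along A g ?J ?\<beta> (\<lambda>t. tmap A ?\<beta> t 1)"
    unfolding parallel_along_def
  proof (intro ballI conjI impI)
    fix t assume t: "t \<in> ?J"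
    show "tmap A ?\<beta> t 1 \<in> tspace A (?\<beta> t)"
      by (rule Ck_map_tmap_in_tspace[OF J Ck_map_2D[OF ck] t])
    fix c assume c: "c \<in> A" "?\<beta> t \<in> fst c"
    have p: "(\<lambda>s. tmap A \<gamma> s 1 c) differentiable (at (a * t))"
        "cov_deriv A g c \<gamma> (\<lambda>t. tmap A \<gamma> t 1) (a * t) 1 = 0"
      using geodesicD(5)[OF \<gamma>] t c unfolding parallel_along_def by auto
    have "((\<lambda>s. a *\<^sub>R tmap A \<gamma> (a * s) 1 c) has_derivative (\<lambda>h. a *\<^sub>R (a *\<^sub>R frechet_derivative (\<lambda>s. tmap A \<gamma> s 1 c) (at (a * t)) h))) (at t)"
      by (rule has_derivative_scaleR_right[OF frechet_derivative_rescale[OF p(1)]])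
    then have d: "((\<lambda>s. tmap A ?\<beta> s 1 c) has_derivative (\<lambda>h. a *\<^sub>R (a *\<^sub>R frechet_derivative (\<lambda>s. tmap A \<gamma> s 1 c) (at (a * t)) h))) (at t)"
      by (rule has_derivative_transform_within_open[OF _ J t]) (use tm in \<open>simp add: scale_tvec_def\<close>)
    then show "(\<lambda>s. tmap A ?\<beta> s 1 c) differentiable (at t)" by (auto simp: differentiable_def)
    have xt: "snd c (\<gamma> (a * t)) \<in> snd c ` fst c" using c by auto
    have tI: "a * t \<in> I" using t by simp
    have "frechet_derivative (snd c \<circ> ?\<beta>) (at t) 1 = tmap A ?\<beta> t 1 c" using c by (simp add: tmap_def)
    also have "\<dots> = a *\<^sub>R frechet_derivative (snd c \<circ> \<gamma>) (at (a * t)) 1"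
      using tm[OF tI] c by (simp add: scale_tvec_def tmap_def)
    finally have v: "frechet_derivative (snd c \<circ> ?\<beta>) (at t) 1 = a *\<^sub>R frechet_derivative (snd c \<circ> \<gamma>) (at (a * t)) 1" .
    have "cov_deriv A g c ?\<beta> (\<lambda>t. tmap A ?\<beta> t 1) t 1 = a *\<^sub>R (a *\<^sub>R cov_deriv A g c \<gamma> (\<lambda>t. tmap A \<gamma> t 1) (a * t) 1)"
      unfolding cov_deriv_def frechet_derivative_apply[OF d] v tm[OF tI] scale_tvec_def
      by (simp add: linear_scale[OF christoffel_linear(1)[OF c(1) xt]] linear_scale[OF christoffel_linear(2)[OF c(1) xt]] scaleR_add_right)
    then show "cov_deriv A g c ?\<beta> (\<lambda>t. tmap A ?\<beta> t 1) t 1 = 0" using p(2) by simp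
  qed
  with J iJ ck show "geodesic A g ?J ?\<beta>" by (simp add: geodesic_def)
qed

lemma exp_rel_geodesic:
  assumes \<gamma>: "geodesic A g I \<gamma>" "0 \<in> I" "t \<in> I"
  shows "exp_rel A g (\<gamma> 0) (scale_tvec t (tmap A \<gamma> 0 1)) (\<gamma> t)"
  unfolding exp_rel_def
proof (intro exI conjI)
  show "geodesic A g {s. t * s \<in> I} (\<lambda>s. \<gamma> (t * s))" by (rule geodesic_rescale(1)[OF \<gamma>(1)])
  show "tmap A (\<lambda>s. \<gamma> (t * s)) 0 1 = scale_tvec t (tmap A \<gamma> 0 1)"
    using geodesic_rescale(2)[OF \<gamma>(1), of t 0] \<gamma> by simp
qed (use \<gamma> in auto)

lemma null_flow_geodesic:
  assumes \<gamma>: "geodesic A g I \<gamma>" "0 \<in> I" "t \<in> I" and L: "tmap A \<gamma> 0 1 = L (\<gamma> 0)"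
  shows "null_flow A g L (\<gamma> 0, t) = \<gamma> t"
  using exp_map_eq[OF exp_rel_geodesic[OF \<gamma>]] L by (simp add: null_flow_def)

lemma exp_defined_geodesic:
  assumes "exp_defined A g z (scale_tvec t v)" "t \<noteq> 0"
  obtains I \<gamma> where "geodesic A g I \<gamma>" "0 \<in> I" "t \<in> I" "\<gamma> 0 = z" "tmap A \<gamma> 0 1 = v"
proof -
  obtain I \<gamma> where \<gamma>: "geodesic A g I \<gamma>" "0 \<in> I" "1 \<in> I" "\<gamma> 0 = z" "tmap A \<gamma> 0 1 = scale_tvec t v"
    using assms(1) unfolding exp_defined_def exp_rel_def by blast
  show thesis
  proof (rule that[OF geodesic_rescale(1)[OF \<gamma>(1), of "1 / t"]])
    show "tmap A (\<lambda>s. \<gamma> (1 / t * s)) 0 1 = v"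
      using geodesic_rescale(2)[OF \<gamma>(1), of "1 / t" 0] \<gamma> assms(2) by (simp add: scale_tvec_def)
  qed (use \<gamma> assms(2) in auto)
qed

end

section \<open>Gram determinants\<close>

lemma bilinear_vec_expand:
  fixes h :: "real ^ 'm::finite \<Rightarrow> real ^ 'm \<Rightarrow> real"
  assumes "bilinear h"
  shows "h u v = (\<Sum>i\<in>UNIV. \<Sum>j\<in>UNIV. u $ i * (h (axis i 1) (axis j 1) * v $ j))"
proof -
  have l: "linear (\<lambda>u. h u v)" "linear (h u)" for u v using assms by (auto simp: bilinear_def)
  have "h u v = (\<Sum>i\<in>UNIV. u $ i * h (axis i 1) v)"
    using linear_sum[OF l(1), of "\<lambda>i. u $ i *\<^sub>R axis i 1" UNIV] by (simp add: vec_expand linear_scale[OF l(1)])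
  also have "\<dots> = (\<Sum>i\<in>UNIV. u $ i * (\<Sum>j\<in>UNIV. v $ j * h (axis i 1) (axis j 1)))"
    using linear_sum[OF l(2), of _ "\<lambda>i. v $ i *\<^sub>R axis i 1" UNIV] by (simp add: vec_expand linear_scale[OF l(2)])
  finally show ?thesis by (simp add: sum_distrib_left mult_ac)
qed

text \<open>The new Gram matrix is the old one multiplied by the matrix of \<open>M\<close> on the
  right and by its transpose on the left.\<close>

lemma gram_det:
  fixes h :: "real ^ 'm::finite \<Rightarrow> real ^ 'm \<Rightarrow> real"
  assumes h: "bilinear h"
  shows "det (\<chi> i j. h (M (axis i 1)) (M (axis j 1))) = (det (matrix M))\<^sup>2 * det (\<chi> i j. h (axis i 1) (axis j 1))"
proof -
  have "(\<chi> i j. h (M (axis i 1)) (M (axis j 1))) = transpose (matrix M) ** ((\<chi> i j. h (axis i 1) (axis j 1)) ** matrix M)"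
    by (subst bilinear_vec_expand[OF h])
      (simp add: vec_eq_iff matrix_matrix_mult_def transpose_def matrix_def sum_distrib_left)
  then show ?thesis by (simp add: det_mul det_transpose power2_eq_square)
qed

lemma continuous_on_det:
  fixes M :: "'x::topological_space \<Rightarrow> real ^ 'k::finite ^ 'k"
  assumes "\<And>i j. continuous_on S (\<lambda>x. M x $ i $ j)"
  shows "continuous_on S (\<lambda>x. det (M x))"
  unfolding det_def by (intro continuous_intros assms)

text \<open>With \<open>d = b - a\<close>, the map \<open>u \<mapsto> u + d(u) l\<close> transforms one form into the other. The reflection along
  \<open>l\<close> conjugates it to its inverse, so that its determinant squares to 1.\<close>
lemma det_rank_one_update:
  fixes G :: "real ^ 'm::finite \<Rightarrow> real ^ 'm \<Rightarrow> real"
  assumes G: "bilinear G" and ker: "\<And>u. G l u = 0" "\<And>u. G u l = 0"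
    and a: "linear a" "a l = 1" and b: "linear b" "b l = 1"
  shows "det (\<chi> i j. G (axis i 1) (axis j 1) + a (axis i 1) * a (axis j 1)) =
         det (\<chi> i j. G (axis i 1) (axis j 1) + b (axis i 1) * b (axis j 1))"
proof -
  have l: "linear (\<lambda>u. G u v)" "linear (G u)" for u v using G by (auto simp: bilinear_def)
  define d where "d u = b u - a u" for u
  have d: "linear d" "d l = 0" unfolding d_def using linear_compose_sub[OF b(1) a(1)] a b by auto
  define M where "M u = u + d u *\<^sub>R l" for u
  define M' where "M' u = u - d u *\<^sub>R l" for u
  define S where "S u = u - (2 * (l \<bullet> u) / (l \<bullet> l)) *\<^sub>R l" for u
  have l0: "l \<bullet> l \<noteq> 0" using a linear_0[OF a(1)] by force
  have linM: "linear M" "linear M'" "linear S"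
    unfolding M_def M'_def S_def
    by (rule linearI; simp add: linear_add[OF d(1)] linear_scale[OF d(1)] inner_add_right algebra_simps add_divide_distrib)+
  have "M \<circ> M' = id" by (auto simp: M_def M'_def linear_diff[OF d(1)] linear_scale[OF d(1)] d(2))
  moreover have "S \<circ> (M \<circ> S) = M'"
  proof
    fix u
    have dS: "d (S u) = d u" by (simp add: S_def linear_diff[OF d(1)] linear_scale[OF d(1)] d(2))
    have Sl: "S l = - l" using l0 by (simp add: S_def scaleR_2[symmetric] algebra_simps)
    have SS: "S (S u) = u"
      using l0 by (simp add: S_def inner_diff_right algebra_simps)
    show "(S \<circ> (M \<circ> S)) u = M' u"
      by (simp add: M_def dS linear_add[OF linM(3)] linear_scale[OF linM(3)] Sl SS M'_def)
  qed
  moreover have "S \<circ> S = id"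
    using l0 by (auto simp: S_def inner_diff_right algebra_simps)
  ultimately have "det (matrix M) * det (matrix M') = 1" "det (matrix S) * (det (matrix M) * det (matrix S)) = det (matrix M')"
      "det (matrix S) * det (matrix S) = 1"
    using linM by (metis det_I det_mul matrix_compose matrix_id_mat_1 linear_compose)+
  then have M1: "(det (matrix M))\<^sup>2 = 1" by (metis mult.assoc mult.commute mult_1 power2_eq_square)
  let ?h = "\<lambda>u v. G u v + a u * a v"
  have h: "bilinear ?h" unfolding bilinear_def
    by (auto intro!: linearI simp: linear_add[OF l(1)] linear_add[OF l(2)] linear_scale[OF l(1)] linear_scale[OF l(2)]
        linear_add[OF a(1)] linear_scale[OF a(1)] algebra_simps)
  have "?h (M u) (M v) = G u v + b u * b v" for u v
  proof -
    have "a (M u) = b u" for u by (simp add: M_def linear_add[OF a(1)] linear_scale[OF a(1)] a(2) d_def)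
    moreover have "G (M u) (M v) = G u v"
      by (simp add: M_def linear_add[OF l(1)] linear_add[OF l(2)] linear_scale[OF l(1)] linear_scale[OF l(2)] ker)
    ultimately show ?thesis by simp
  qed
  then show ?thesis using gram_det[OF h, of M] M1 by simp
qed

lemma linear_divide_real: "linear f \<Longrightarrow> linear (\<lambda>u. f u / (r::real))"
  using linear_compose_scale_right[of f "1 / r"] by simp

lemma continuous_on_local:
  fixes f :: "'x::real_normed_vector \<Rightarrow> 'y::real_normed_vector"
  assumes "\<And>x. x \<in> S \<Longrightarrow> \<exists>U. open U \<and> x \<in> U \<and> continuous_on U f"
  shows "continuous_on S f"
  using Ck_on_local[where k = 0 and S = S and f = f] assms by simp

section \<open>Null hypersurfaces\<close>

locale null_hyp = lorentz A g
  for A :: "('a::{t2_space, second_countable_topology}, 'n::finite) chart set" and g :: "('a, 'n) tensor2" +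
  fixes T L :: "'a \<Rightarrow> ('a, 'n) tvec" and H :: "'a set" and mt :: "'m::finite itself"
  assumes card_m: "CARD('m) + 1 = CARD('n)"
    and time: "time_orientation A g T"
    and nullH: "null_hypersurface TYPE('m) A 2 g H"
    and nullL: "null_geodesic_field TYPE('m) A g T H L"
begin

lemma L_props:
  assumes "p \<in> H"
  shows "L p \<in> tspace A p" "L p \<noteq> zero_tvec" "g p (L p) (L p) \<le> 0" "g p (T p) (L p) < 0"
    and "w \<in> sub_tspace TYPE('m) A H p \<Longrightarrow> g p (L p) w = 0"
  using nullL assms unfolding null_geodesic_field_def normal_space_def future_directed_def by blast+

lemma T_tspace: "T p \<in> tspace A p"
  using time unfolding time_orientation_def by blast

lemma L_field: "Ck_field_along TYPE('m) A 1 H L"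
  using nullL unfolding null_geodesic_field_def by blast

lemma L_C1:
  fixes \<psi> :: "real ^ 'm \<Rightarrow> 'a"
  assumes "(W, \<psi>) \<in> params A 2 H" "c \<in> A"
  shows "Ck_on 1 (W \<inter> \<psi> -` fst c) (\<lambda>x. L (\<psi> x) c)"
  using L_field assms unfolding Ck_field_along_def Suc_1 by blast

lemma params_exist:
  assumes "p \<in> H" obtains W and \<psi> :: "real ^ 'm \<Rightarrow> 'a" and x where "(W, \<psi>) \<in> params A 2 H" "x \<in> W" "\<psi> x = p"
proof -
  have "\<exists>(W, \<psi>::real ^ 'm \<Rightarrow> 'a)\<in>params A 2 H. p \<in> \<psi> ` W"
    using nullH assms unfolding null_hypersurface_def submanifold_def by blast
  then show ?thesis using that by auto
qed

context
  fixes W and \<psi> :: "real ^ 'm \<Rightarrow> 'a"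
  assumes P: "(W, \<psi>) \<in> params A 2 H"
begin

lemma params_H: "x \<in> W \<Longrightarrow> \<psi> x \<in> H"
  using params_subset[OF P] by blast

lemma tmap_tspace: "x \<in> W \<Longrightarrow> tmap A \<psi> x u \<in> tspace A (\<psi> x)"
  by (rule Ck_map_tmap_in_tspace[OF params_open[OF P] params_Ck_map_1[OF P]])

lemma tmap_sub_tspace: "x \<in> W \<Longrightarrow> tmap A \<psi> x u \<in> sub_tspace TYPE('m) A H (\<psi> x)"
  using P unfolding sub_tspace_def by blast

lemma tmap_chart_linear: "x \<in> W \<Longrightarrow> c \<in> A \<Longrightarrow> \<psi> x \<in> fst c \<Longrightarrow> linear (\<lambda>u. tmap A \<psi> x u c)"
  using linear_frechet_derivative[OF Ck_map_differentiable[OF params_Ck_map_1[OF P]]] by (simp add: tmap_apply)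

lemma tmap_chart_inj: "x \<in> W \<Longrightarrow> c \<in> A \<Longrightarrow> \<psi> x \<in> fst c \<Longrightarrow> inj (\<lambda>u. tmap A \<psi> x u c)"
  using params_chart_inj[OF P] by (simp add: tmap_apply)

lemma g_tmap:
  "x \<in> W \<Longrightarrow> c \<in> A \<Longrightarrow> \<psi> x \<in> fst c \<Longrightarrow> v \<in> tspace A (\<psi> x) \<Longrightarrow>
   g (\<psi> x) v (tmap A \<psi> x u) = metric_in A g c (snd c (\<psi> x)) (v c) (tmap A \<psi> x u c)"
  by (rule metric_eq[OF _ tmap_tspace])

lemma g_tmap_linear:
  assumes x: "x \<in> W" and v: "v \<in> tspace A (\<psi> x)"
  shows "linear (\<lambda>u. g (\<psi> x) v (tmap A \<psi> x u))"
proof -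
  obtain c where c: "c \<in> A" "\<psi> x \<in> fst c" using chart_exists .
  have "snd c (\<psi> x) \<in> snd c ` fst c" using c by auto
  from linear_compose[OF tmap_chart_linear[OF x c] metric_linear(1)[OF c(1) this]]
  show ?thesis unfolding g_tmap[OF x c v] comp_def .
qed

lemma g_sym:
  assumes "v \<in> tspace A p" "w \<in> tspace A p" shows "g p v w = g p w v"
proof -
  obtain c where c: "c \<in> A" "p \<in> fst c" using chart_exists .
  then show ?thesis using metric_eq[OF assms c] metric_eq[OF assms(2,1) c] metric_sym[OF c(1), of "snd c p"] by auto
qed

lemma g_tmap_bilinear:
  assumes x: "x \<in> W" shows "bilinear (\<lambda>u v. g (\<psi> x) (tmap A \<psi> x u) (tmap A \<psi> x v))"
  unfolding bilinear_def
  using g_tmap_linear[OF x tmap_tspace[OF x]] g_sym[OF tmap_tspace[OF x] tmap_tspace[OF x]] by simp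

text \<open>\<open>L\<close> is proportional to the null direction of \<open>TH\<close>, as it is causal and orthogonal to it.\<close>
lemma L_tangent:
  assumes x: "x \<in> W" obtains l where "tmap A \<psi> x l = L (\<psi> x)"
proof -
  let ?p = "\<psi> x"
  have p: "?p \<in> H" by (rule params_H[OF x])
  obtain c where c: "c \<in> A" "?p \<in> fst c" using chart_exists .
  have xc: "snd c ?p \<in> snd c ` fst c" using c by auto
  obtain v where v: "v \<in> sub_tspace TYPE('m) A H ?p" "v \<noteq> zero_tvec" "\<And>w. w \<in> sub_tspace TYPE('m) A H ?p \<Longrightarrow> g ?p v w = 0"
    using nullH p unfolding null_hypersurface_def by blast
  obtain w where w: "v = tmap A \<psi> x w" using v(1) sub_tspace_eq[OF P x] by auto
  have vt: "v \<in> tspace A ?p" unfolding w by (rule tmap_tspace[OF x])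
  have v0: "v c \<noteq> 0" using tspace_eqI[OF vt zero_in_tspace c] v(2) by auto
  have "metric_in A g c (snd c ?p) (v c) (v c) = 0" using v(3)[OF v(1)] metric_eq[OF vt vt c] by simp
  moreover have "metric_in A g c (snd c ?p) (v c) (L ?p c) = 0"
    using L_props(5)[OF p v(1)] g_sym[OF L_props(1)[OF p] vt] metric_eq[OF vt L_props(1)[OF p] c] by simp
  moreover have "metric_in A g c (snd c ?p) (L ?p c) (L ?p c) \<le> 0"
    using L_props(3)[OF p] metric_eq[OF L_props(1)[OF p] L_props(1)[OF p] c] by simp
  ultimately obtain k where "L ?p c = k *\<^sub>R v c"
    using lorentz_form_null_decomp[OF metric_lorentz_form[OF c(1) xc] v0] by metis
  then have "L ?p c = tmap A \<psi> x (k *\<^sub>R w) c"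
    using linear_scale[OF tmap_chart_linear[OF x c]] by (simp add: w)
  then have "tmap A \<psi> x (k *\<^sub>R w) = L ?p"
    using tspace_eqI[OF tmap_tspace[OF x] L_props(1)[OF p] c] by metis
  then show ?thesis by (rule that)
qed

lemma L_null: "x \<in> W \<Longrightarrow> g (\<psi> x) (L (\<psi> x)) (L (\<psi> x)) = 0"
  using L_tangent L_props(5)[OF params_H tmap_sub_tspace] by metis

text \<open>The tangent space of \<open>H\<close> lies in the orthogonal complement of the null
  vector \<open>L\<close>, where \<open>lorentz_form_null_decomp\<close> describes the metric. The
  second claim recognizes a null tangent vector as a multiple of \<open>L\<close>.\<close>

lemma tangent_nonneg:
  assumes x: "x \<in> W"
  shows "g (\<psi> x) (tmap A \<psi> x u) (tmap A \<psi> x u) \<ge> 0"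
    and "tmap A \<psi> x l = L (\<psi> x) \<Longrightarrow> g (\<psi> x) (tmap A \<psi> x u) (tmap A \<psi> x u) = 0 \<Longrightarrow> \<exists>k. u = k *\<^sub>R l"
proof -
  let ?p = "\<psi> x"
  have p: "?p \<in> H" by (rule params_H[OF x])
  obtain c where c: "c \<in> A" "?p \<in> fst c" using chart_exists .
  have xc: "snd c ?p \<in> snd c ` fst c" using c by auto
  have L0: "L ?p c \<noteq> 0" using tspace_eqI[OF L_props(1)[OF p] zero_in_tspace c] L_props(2)[OF p] by auto
  have LL: "metric_in A g c (snd c ?p) (L ?p c) (L ?p c) = 0"
    using L_null[OF x] metric_eq[OF L_props(1)[OF p] L_props(1)[OF p] c] by simp
  have Lu: "metric_in A g c (snd c ?p) (L ?p c) (tmap A \<psi> x u c) = 0"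
    using L_props(5)[OF p tmap_sub_tspace[OF x]] g_tmap[OF x c L_props(1)[OF p]] by simp
  obtain k where k: "metric_in A g c (snd c ?p) (tmap A \<psi> x u c) (tmap A \<psi> x u c) \<ge> 0"
    "metric_in A g c (snd c ?p) (tmap A \<psi> x u c) (tmap A \<psi> x u c) \<le> 0 \<Longrightarrow> tmap A \<psi> x u c = k *\<^sub>R L ?p c"
    using lorentz_form_null_decomp[OF metric_lorentz_form[OF c(1) xc] L0 LL Lu] by metis
  show "g ?p (tmap A \<psi> x u) (tmap A \<psi> x u) \<ge> 0" using k(1) g_tmap[OF x c tmap_tspace[OF x]] by simp
  assume l: "tmap A \<psi> x l = L ?p" and 0: "g ?p (tmap A \<psi> x u) (tmap A \<psi> x u) = 0"
  then have "tmap A \<psi> x u c = k *\<^sub>R tmap A \<psi> x l c" using k(2) g_tmap[OF x c tmap_tspace[OF x]] by simp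
  then have "tmap A \<psi> x u c = tmap A \<psi> x (k *\<^sub>R l) c" using linear_scale[OF tmap_chart_linear[OF x c]] by simp
  then have "u = k *\<^sub>R l" using tmap_chart_inj[OF x c] by (auto dest: injD)
  then show "\<exists>k. u = k *\<^sub>R l" by blast
qed

end

section \<open>The volume density of the rigged metric\<close>

text \<open>The rigged metric of the form \<open>v \<mapsto> g(T, v) / g(T, L)\<close>, which is defined on all of \<open>H\<close>.\<close>
definition h0 :: "('a, 'n) tensor2" where
  "h0 p v w = g p v w + (g p (T p) v / g p (T p) (L p)) * (g p (T p) w / g p (T p) (L p))"

definition gram :: "('a, 'n) tensor2 \<Rightarrow> (real ^ 'm \<Rightarrow> 'a) \<Rightarrow> real ^ 'm \<Rightarrow> real" where
  "gram h \<psi> x = det (\<chi> i j. h (\<psi> x) (tmap A \<psi> x (axis i 1)) (tmap A \<psi> x (axis j 1)))"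

text \<open>The coordinate vector \<open>l\<close> of \<open>L\<close> lies in the kernel of the
  metric on the tangent space, and both one-forms take the value 1 on it, so
  \<open>det_rank_one_update\<close> equates the determinants although the metrics differ.\<close>

lemma gram_rigged:
  fixes \<psi> :: "real ^ 'm \<Rightarrow> 'a"
  assumes P: "(W, \<psi>) \<in> params A 2 H" and x: "x \<in> W"
    and N: "N (\<psi> x) \<in> tspace A (\<psi> x)" "g (\<psi> x) (N (\<psi> x)) (L (\<psi> x)) = - 1"
  shows "gram (rigged_metric g N) \<psi> x = gram h0 \<psi> x"
proof -
  obtain l where l: "tmap A \<psi> x l = L (\<psi> x)" using L_tangent[OF P x] .
  let ?G = "\<lambda>u v. g (\<psi> x) (tmap A \<psi> x u) (tmap A \<psi> x v)"
  let ?a = "\<lambda>u. - g (\<psi> x) (N (\<psi> x)) (tmap A \<psi> x u)"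
  let ?b = "\<lambda>u. g (\<psi> x) (T (\<psi> x)) (tmap A \<psi> x u) / g (\<psi> x) (T (\<psi> x)) (L (\<psi> x))"
  have ker: "?G l u = 0" for u
    unfolding l by (rule L_props(5)[OF params_H[OF P x] tmap_sub_tspace[OF P x]])
  have ker': "?G u l = 0" for u
    using ker[of u] g_sym[OF P tmap_tspace[OF P x] tmap_tspace[OF P x]] by metis
  have a: "linear ?a" "?a l = 1"
    using linear_compose_neg[OF g_tmap_linear[OF P x N(1)]] N(2) by (auto simp: l)
  have b: "linear ?b" "?b l = 1"
    using linear_divide_real[OF g_tmap_linear[OF P x T_tspace]] L_props(4)[OF params_H[OF P x]] by (auto simp: l)
  show ?thesis
    using det_rank_one_update[OF g_tmap_bilinear[OF P x] ker ker' a b]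
    by (simp add: gram_def rigged_metric_def rigging_form_def h0_def)
qed

lemma h0_bilinear:
  fixes \<psi> :: "real ^ 'm \<Rightarrow> 'a"
  assumes P: "(W, \<psi>) \<in> params A 2 H" and x: "x \<in> W"
  shows "bilinear (\<lambda>u v. h0 (\<psi> x) (tmap A \<psi> x u) (tmap A \<psi> x v))"
proof -
  have a: "linear (\<lambda>u. g (\<psi> x) (T (\<psi> x)) (tmap A \<psi> x u) / g (\<psi> x) (T (\<psi> x)) (L (\<psi> x)))" (is "linear ?a")
    by (rule linear_divide_real[OF g_tmap_linear[OF P x T_tspace]])
  have G: "linear (\<lambda>u. g (\<psi> x) (tmap A \<psi> x u) (tmap A \<psi> x v))" "linear (\<lambda>v. g (\<psi> x) (tmap A \<psi> x u) (tmap A \<psi> x v))" for u v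
    using g_tmap_bilinear[OF P x] by (auto simp: bilinear_def)
  show ?thesis unfolding bilinear_def h0_def
    using linear_compose_add[OF G(1) linear_compose_scale_right[OF a, of "?a v" for v, unfolded real_scaleR_def]]
      linear_compose_add[OF G(2) linear_compose_scale_right[OF a, of "?a u" for u, unfolded real_scaleR_def]]
    by (simp add: mult.commute)
qed

lemma gram_h0_transition:
  fixes \<psi> \<psi>' :: "real ^ 'm \<Rightarrow> 'a"
  assumes P: "(W, \<psi>) \<in> params A 2 H" and y: "y \<in> W" "\<psi> y = \<psi>' x"
    and D: "\<And>u. tmap A \<psi> y (D u) = tmap A \<psi>' x u"
  shows "gram h0 \<psi>' x = (det (matrix D))\<^sup>2 * gram h0 \<psi> y"
  using gram_det[OF h0_bilinear[OF P y(1)], of D] unfolding gram_def y(2) D .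

text \<open>As \<open>T\<close> is assumed continuous only, continuity is all that is claimed; it
  yields the Borel measurability of the volume density.\<close>

lemma gram_h0_continuous:
  fixes \<psi> :: "real ^ 'm \<Rightarrow> 'a"
  assumes P: "(W, \<psi>) \<in> params A 2 H"
  shows "continuous_on W (gram h0 \<psi>)"
proof -
  have "continuous_on (W \<inter> \<psi> -` fst c) (gram h0 \<psi>)" if c: "c \<in> A" for c
  proof -
    let ?S = "W \<inter> \<psi> -` fst c"
    have x: "continuous_on ?S (\<lambda>x. snd c (\<psi> x))"
      by (rule continuous_on_compose2[OF chart_cont[OF c] continuous_on_subset[OF params_cont[OF P]]]) auto
    have t: "continuous_on ?S (\<lambda>x. tmap A \<psi> x u c)" for u
      using C1_continuous_deriv[OF Ck_map_chart[OF params_Ck_map_1[OF P] c], of u]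
      by (rule continuous_on_eq) (simp add: tmap_apply c)
    have Lc: "continuous_on ?S (\<lambda>x. L (\<psi> x) c)" by (rule Ck_on_continuous[OF L_C1[OF P c]])
    have Tc: "continuous_on ?S (\<lambda>x. T (\<psi> x) c)"
      by (rule continuous_on_compose2[of "fst c"])
        (use time c in \<open>auto simp: time_orientation_def intro: continuous_on_subset[OF params_cont[OF P]]\<close>)
    have m: "continuous_on ?S (\<lambda>x. metric_in A g c (snd c (\<psi> x)) (a x) (b x))"
      if "continuous_on ?S a" "continuous_on ?S b" for a b
    proof (rule continuous_on_bilinear_family[where B = "\<lambda>x. metric_in A g c (snd c (\<psi> x))", OF _ _ _ that])
      show "continuous_on ?S (\<lambda>x. metric_in A g c (snd c (\<psi> x)) u v)" for u v
        by (rule continuous_on_compose2[OF Ck_on_continuous[OF metric_Ck[OF c]] x]) auto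
    qed (use metric_linear[OF c] in auto)
    have gm: "continuous_on ?S (\<lambda>x. g (\<psi> x) (X x) (Y x))"
      if "continuous_on ?S (\<lambda>x. X x c)" "continuous_on ?S (\<lambda>x. Y x c)"
        "\<And>x. x \<in> ?S \<Longrightarrow> X x \<in> tspace A (\<psi> x)" "\<And>x. x \<in> ?S \<Longrightarrow> Y x \<in> tspace A (\<psi> x)" for X Y
      using m[OF that(1,2)] by (rule continuous_on_eq) (use metric_eq[OF that(3,4) c] in auto)
    have 1: "continuous_on ?S (\<lambda>x. g (\<psi> x) (tmap A \<psi> x u) (tmap A \<psi> x v))" for u v
      by (rule gm[where X = "\<lambda>x. tmap A \<psi> x u" and Y = "\<lambda>x. tmap A \<psi> x v", OF t t]) (use tmap_tspace[OF P] in auto)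
    have 2: "continuous_on ?S (\<lambda>x. g (\<psi> x) (T (\<psi> x)) (tmap A \<psi> x v))" for v
      by (rule gm[where X = "\<lambda>x. T (\<psi> x)" and Y = "\<lambda>x. tmap A \<psi> x v", OF Tc t]) (use tmap_tspace[OF P] T_tspace in auto)
    have 3: "continuous_on ?S (\<lambda>x. g (\<psi> x) (T (\<psi> x)) (L (\<psi> x)))"
      by (rule gm[where X = "\<lambda>x. T (\<psi> x)" and Y = "\<lambda>x. L (\<psi> x)", OF Tc Lc]) (use L_props(1) params_H[OF P] T_tspace in auto)
    have 4: "g (\<psi> x) (T (\<psi> x)) (L (\<psi> x)) \<noteq> 0" if "x \<in> ?S" for x
      using L_props(4) params_H[OF P] that by force
    show ?thesis unfolding gram_def h0_def
      by (rule continuous_on_det) (use 4 in \<open>auto intro!: continuous_intros 1 2 3\<close>)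
  qed
  then show ?thesis
    using open_chart_preimage[OF params_open[OF P] params_Ck_map[OF P]] chart_exists
    by (intro continuous_on_local) (metis IntI vimageI2)
qed

section \<open>The rigging along the null flow\<close>

context
  fixes S V N and kt :: "'k::finite itself"
  assumes S: "submanifold TYPE('k) A 2 S"
    and V: "flow_domain TYPE('k) TYPE('m) A g H L S V"
    and N: "rigging_field TYPE('k) A g L S V N"
begin

lemma flow_curve:
  assumes z: "z \<in> S"
  shows "open {t. (z, t) \<in> V}" "is_interval {t. (z, t) \<in> V}" "(z, 0) \<in> V"
    and "t \<in> {t. (z, t) \<in> V} \<Longrightarrow> null_flow A g L (z, t) \<in> H"
    and "t \<in> {t. (z, t) \<in> V} \<Longrightarrow> \<exists>J \<gamma>. geodesic A g J \<gamma> \<and> 0 \<in> J \<and> t \<in> J \<and> \<gamma> 0 = z \<and>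
      tmap A \<gamma> 0 1 = L z \<and> (\<forall>s\<in>J. null_flow A g L (z, s) = \<gamma> s)"
proof -
  have op: "openin (top_of_set (S \<times> UNIV)) V" using V by (simp add: flow_domain_def)
  then obtain V' where V': "open V'" "V = (S \<times> UNIV) \<inter> V'" by (auto simp: openin_open)
  have "{t. (z, t) \<in> V} = (\<lambda>t. (z, t)) -` V'" using z V' by auto
  then show op: "open {t. (z, t) \<in> V}"
    by (simp add: continuous_open_vimage[OF V'(1)] continuous_intros)
  show "is_interval {t. (z, t) \<in> V}" and z0: "(z, 0) \<in> V"
    using V z by (auto simp: flow_domain_def)
  show "null_flow A g L (z, t) \<in> H" if "t \<in> {t. (z, t) \<in> V}"
    using V that by (auto simp: flow_domain_def)
  have key: "\<exists>J \<gamma>. geodesic A g J \<gamma> \<and> 0 \<in> J \<and> t \<in> J \<and> \<gamma> 0 = z \<and>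
      tmap A \<gamma> 0 1 = L z \<and> (\<forall>s\<in>J. null_flow A g L (z, s) = \<gamma> s)" if t: "(z, t) \<in> V" "t \<noteq> 0" for t
  proof -
    have "exp_defined A g z (scale_tvec t (L z))" using V t by (auto simp: flow_domain_def)
    then obtain J \<gamma> where \<gamma>: "geodesic A g J \<gamma>" "0 \<in> J" "t \<in> J" "\<gamma> 0 = z" "tmap A \<gamma> 0 1 = L z"
      using t(2) by (rule exp_defined_geodesic)
    then show ?thesis using null_flow_geodesic[OF \<gamma>(1,2)] by metis
  qed
  \<comment> \<open>For t = 0 the exponential of the zero vector says nothing about a geodesic with
    velocity \<open>L z\<close>. A small positive parameter in the same interval supplies
    one.\<close>
  obtain e where e: "e > 0" "ball 0 e \<subseteq> {t. (z, t) \<in> V}" using op z0 open_contains_ball by (metis mem_Collect_eq)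
  have "e / 2 \<in> ball 0 e" using e(1) by simp
  then have e2: "(z, e / 2) \<in> V" "e / 2 \<noteq> 0" using e(1) subsetD[OF e(2), of "e / 2"] by auto
  show "\<exists>J \<gamma>. geodesic A g J \<gamma> \<and> 0 \<in> J \<and> t \<in> J \<and> \<gamma> 0 = z \<and>
      tmap A \<gamma> 0 1 = L z \<and> (\<forall>s\<in>J. null_flow A g L (z, s) = \<gamma> s)" if t: "t \<in> {t. (z, t) \<in> V}"
    using key[of t] key[OF e2] t by (cases "t = 0") auto
qed

lemma null_flow_0: "z \<in> S \<Longrightarrow> null_flow A g L (z, 0) = z"
  using flow_curve(5)[of z 0] flow_curve(3)[of z] by auto

text \<open>Near each time the flow curve coincides with one geodesic and inherits its regularity.
  The velocity is null because it is parallel and equals the null vector \<open>L z\<close> at time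
  0.\<close>

lemma flow_curve_regular:
  assumes z: "z \<in> S" and t: "t \<in> {t. (z, t) \<in> V}"
  defines "\<beta> \<equiv> \<lambda>t. null_flow A g L (z, t)"
  shows "isCont \<beta> t"
    and "c \<in> A \<Longrightarrow> \<beta> t \<in> fst c \<Longrightarrow> (snd c \<circ> \<beta>) differentiable (at t)"
    and "g (\<beta> t) (tmap A \<beta> t 1) (tmap A \<beta> t 1) = 0" and "tmap A \<beta> t 1 \<in> tspace A (\<beta> t)"
proof -
  obtain J \<gamma> where \<gamma>: "geodesic A g J \<gamma>" "0 \<in> J" "t \<in> J" "\<gamma> 0 = z" "tmap A \<gamma> 0 1 = L z" "\<And>s. s \<in> J \<Longrightarrow> \<beta> s = \<gamma> s"
    using flow_curve(5)[OF z t] unfolding \<beta>_def by blast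
  note J = geodesicD(1)[OF \<gamma>(1)]
  have "continuous_on J \<beta>" using geodesicD(4)[OF \<gamma>(1)] \<gamma>(6) by (simp cong: continuous_on_cong)
  then show "isCont \<beta> t" using J \<gamma>(3) continuous_on_eq_continuous_at by blast
  show d: "(snd c \<circ> \<beta>) differentiable (at t)" if "c \<in> A" "\<beta> t \<in> fst c" for c
    by (rule differentiable_cong_open[OF J \<gamma>(3) _ geodesic_differentiable[OF \<gamma>(1,3) that(1)]])
      (use that \<gamma> in auto)
  have "frechet_derivative (snd c \<circ> \<beta>) (at t) = frechet_derivative (snd c \<circ> \<gamma>) (at t)" for c :: "('a, 'n) chart"
    by (rule frechet_derivative_cong_open[OF J \<gamma>(3)]) (use \<gamma>(6) in auto)
  then have eq: "tmap A \<beta> t 1 = tmap A \<gamma> t 1" unfolding tmap_def using \<gamma>(3,6) by auto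
  have par: "parallel_along A g J \<gamma> (\<lambda>t. tmap A \<gamma> t 1)" by (rule geodesicD(5)[OF \<gamma>(1)])
  show "tmap A \<beta> t 1 \<in> tspace A (\<beta> t)"
    using par \<gamma>(3,6) unfolding eq parallel_along_def by auto
  have zH: "z \<in> H" using flow_curve(4)[OF z, of 0] flow_curve(3)[OF z] null_flow_0[OF z] by simp
  obtain W and \<psi> :: "real ^ 'm \<Rightarrow> 'a" and x where P: "(W, \<psi>) \<in> params A 2 H" "x \<in> W" "\<psi> x = z"
    using params_exist[OF zH] .
  have "g (\<gamma> t) (tmap A \<gamma> t 1) (tmap A \<gamma> t 1) = g (\<gamma> 0) (tmap A \<gamma> 0 1) (tmap A \<gamma> 0 1)"
    by (rule metric_const_along[OF J geodesicD(2,4)[OF \<gamma>(1)] _ par par \<gamma>(3,2)]) (rule geodesic_differentiable[OF \<gamma>(1)])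
  also have "\<dots> = 0" using L_null[OF P(1,2)] P(3) \<gamma>(4,5) by simp
  finally show "g (\<beta> t) (tmap A \<beta> t 1) (tmap A \<beta> t 1) = 0" using eq \<gamma>(3,6) by simp
qed

text \<open>Read in a parametrization of \<open>H\<close>, the curve has a null tangent velocity,
  hence a multiple of \<open>L\<close> by \<open>tangent_nonneg\<close>. The factor is left
  undetermined: the covariant derivative is linear in the direction and vanishes in direction
  \<open>L\<close>.\<close>

lemma L_parallel_along_flow:
  assumes z: "z \<in> S"
  shows "parallel_along A g {t. (z, t) \<in> V} (\<lambda>t. null_flow A g L (z, t)) (\<lambda>t. L (null_flow A g L (z, t)))"
  unfolding parallel_along_def
proof (intro ballI conjI impI)
  let ?\<beta> = "\<lambda>t. null_flow A g L (z, t)" and ?I = "{t. (z, t) \<in> V}"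
  fix t assume t: "t \<in> ?I"
  have bH: "?\<beta> s \<in> H" if "s \<in> ?I" for s using flow_curve(4)[OF z that] .
  show "L (?\<beta> t) \<in> tspace A (?\<beta> t)" by (rule L_props(1)[OF bH[OF t]])
  fix c assume c: "c \<in> A" "?\<beta> t \<in> fst c"
  obtain W and \<sigma> :: "real ^ 'k \<Rightarrow> 'a" and x where \<sigma>: "(W, \<sigma>) \<in> params A 2 S" "x \<in> W" "\<sigma> x = z"
  proof -
    have "\<exists>(W, \<sigma>::real ^ 'k \<Rightarrow> 'a)\<in>params A 2 S. z \<in> \<sigma> ` W" using S z unfolding submanifold_def by blast
    then show ?thesis using that by auto
  qed
  obtain U and \<psi> :: "real ^ 'm \<Rightarrow> 'a" and y0 where \<psi>: "(U, \<psi>) \<in> params A 2 H" "y0 \<in> U" "\<psi> y0 = ?\<beta> t"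
    using params_exist[OF bH[OF t]] .
  define y where "y s = inv_into U \<psi> (?\<beta> s)" for s
  have yt: "y t = y0" using params_inv[OF \<psi>(1,2)] \<psi>(3) by (simp add: y_def)
  \<comment> \<open>The flow map in parametrizations is C^1 by \<open>diffeo_onto_image\<close>;
    with the cross-section parameter \<open>x\<close> frozen, the curve becomes differentiable
    inside \<open>H\<close>, and this makes its velocity tangent to \<open>H\<close>.\<close>
  have "Ck_on 1 {(x, t). x \<in> W \<and> (\<sigma> x, t) \<in> V \<and> null_flow A g L (\<sigma> x, t) \<in> \<psi> ` U}
          (\<lambda>(x, t). inv_into U \<psi> (null_flow A g L (\<sigma> x, t)))"
    using V \<sigma>(1) \<psi>(1) unfolding flow_domain_def diffeo_onto_image_def by blast
  then have Fd: "(\<lambda>(x, t). inv_into U \<psi> (null_flow A g L (\<sigma> x, t))) differentiable (at (x, t))"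
    using \<sigma> t \<psi> unfolding Ck_on_1 by (metis (mono_tags, lifting) case_prodI imageI mem_Collect_eq)
  have "((\<lambda>t. (\<lambda>(x, t). inv_into U \<psi> (null_flow A g L (\<sigma> x, t))) (x, t)) has_derivative
      (\<lambda>h. frechet_derivative (\<lambda>(x, t). inv_into U \<psi> (null_flow A g L (\<sigma> x, t))) (at (x, t)) (0, h))) (at t)"
    by (rule has_derivative_compose[where f = "\<lambda>t. (x, t)" and f' = "\<lambda>h. (0, h)"
          and g = "\<lambda>(x, t). inv_into U \<psi> (null_flow A g L (\<sigma> x, t))", OF _ Fd[unfolded frechet_derivative_works]])
      (auto intro!: derivative_eq_intros)
  then have "(y has_derivative (\<lambda>h. frechet_derivative (\<lambda>(x, t). inv_into U \<psi> (null_flow A g L (\<sigma> x, t))) (at (x, t)) (0, h))) (at t)"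
    unfolding y_def \<sigma>(3) prod.case .
  then have yd: "y differentiable (at t)" by (auto simp: differentiable_def)
  then have y': "(y has_derivative frechet_derivative y (at t)) (at t)" by (simp add: frechet_derivative_works)
  obtain Q where Q: "open Q" "\<psi> ` U = H \<inter> Q" using params_openin[OF \<psi>(1)] by (auto simp: openin_open)
  have cb: "continuous_on ?I ?\<beta>"
    using flow_curve_regular(1)[OF z] by (auto intro: continuous_at_imp_continuous_on)
  \<comment> \<open>The times at which the curve stays in the image of \<psi>, where
    \<open>y\<close> represents it.\<close>
  let ?R = "?I \<inter> ?\<beta> -` Q"
  have R: "open ?R" by (rule continuous_open_preimage[OF cb flow_curve(1)[OF z] Q(1)])
  have "?\<beta> t \<in> \<psi> ` U" using \<psi>(2,3) by (metis imageI)
  then have tR: "t \<in> ?R" using t Q(2) by auto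
  have \<psi>y: "\<psi> (y s) = ?\<beta> s" if "s \<in> ?R" for s
    unfolding y_def using that bH Q(2) by (intro f_inv_into_f) auto
  let ?u = "frechet_derivative y (at t) 1"
  have cd: "((snd c \<circ> ?\<beta>) has_derivative (\<lambda>h. frechet_derivative (snd c \<circ> \<psi>) (at y0) (frechet_derivative y (at t) h))) (at t)"
    if c: "c \<in> A" "?\<beta> t \<in> fst c" for c
  proof -
    have "(snd c \<circ> \<psi>) differentiable (at (y t))"
      unfolding yt using Ck_map_differentiable[OF params_Ck_map_1[OF \<psi>(1)] c(1) \<psi>(2)] c(2) \<psi>(3) by simp
    from has_derivative_compose[OF y' this[unfolded frechet_derivative_works]]
    show ?thesis unfolding yt
      by (rule has_derivative_transform_within_open[OF _ R tR]) (simp add: \<psi>y)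
  qed
  have vel: "tmap A ?\<beta> t 1 = tmap A \<psi> y0 ?u"
    unfolding tmap_def \<psi>(3)
  proof (intro ext if_cong refl)
    fix c assume "c \<in> A \<and> ?\<beta> t \<in> fst c"
    then show "frechet_derivative (snd c \<circ> ?\<beta>) (at t) 1 = frechet_derivative (snd c \<circ> \<psi>) (at y0) ?u"
      using frechet_derivative_apply[OF cd, of c 1] by blast
  qed
  obtain l where l: "tmap A \<psi> y0 l = L (\<psi> y0)" using L_tangent[OF \<psi>(1,2)] .
  have "g (\<psi> y0) (tmap A \<psi> y0 ?u) (tmap A \<psi> y0 ?u) = 0"
    using flow_curve_regular(3)[OF z t] unfolding vel \<psi>(3) .
  then obtain k where k: "?u = k *\<^sub>R l" using tangent_nonneg(2)[OF \<psi>(1,2) l] by blast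
  have c\<psi>: "\<psi> y0 \<in> fst c" using c \<psi>(3) by simp
  have Ld: "(\<lambda>x. L (\<psi> x) c) differentiable (at y0)"
    using L_C1[OF \<psi>(1) c(1)] c\<psi> \<psi>(2) unfolding Ck_on_1 by blast
  have Lb: "((\<lambda>s. L (?\<beta> s) c) has_derivative (\<lambda>h. frechet_derivative (\<lambda>x. L (\<psi> x) c) (at y0) (frechet_derivative y (at t) h))) (at t)"
  proof -
    have "(\<lambda>x. L (\<psi> x) c) differentiable (at (y t))" unfolding yt by (rule Ld)
    from has_derivative_compose[OF y' this[unfolded frechet_derivative_works]]
    show ?thesis unfolding yt
      by (rule has_derivative_transform_within_open[OF _ R tR]) (simp add: \<psi>y)
  qed
  then show "(\<lambda>s. L (?\<beta> s) c) differentiable (at t)" by (auto simp: differentiable_def)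
  have \<psi>d: "(snd c \<circ> \<psi>) differentiable (at y0)"
    by (rule Ck_map_differentiable[OF params_Ck_map_1[OF \<psi>(1)] c(1) \<psi>(2) c\<psi>])
  have lin: "linear (cov_deriv A g c \<psi> (L \<circ> \<psi>) y0)"
    by (rule cov_deriv_linear[OF c(1) c\<psi> \<psi>d]) (use Ld in simp)
  have "cov_deriv A g c \<psi> (L \<circ> \<psi>) y0 l = 0"
    using nullL \<psi>(1,2) l c(1) c\<psi> unfolding null_geodesic_field_def by blast
  then have "cov_deriv A g c \<psi> (L \<circ> \<psi>) y0 ?u = 0" unfolding k by (simp add: linear_scale[OF lin])
  then show "cov_deriv A g c ?\<beta> (\<lambda>t. L (?\<beta> t)) t 1 = 0"
    unfolding cov_deriv_def frechet_derivative_apply[OF Lb] frechet_derivative_apply[OF cd[OF c]] \<psi>(3)[symmetric]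
    by (simp add: o_def)
qed

lemma rigging_normalized:
  assumes "q \<in> null_flow A g L ` V"
  shows "N q \<in> tspace A q" "g q (N q) (L q) = - 1"
proof -
  obtain z t where zt: "(z, t) \<in> V" "q = null_flow A g L (z, t)" using assms by force
  have op: "openin (top_of_set (S \<times> UNIV)) V" using V by (simp add: flow_domain_def)
  have z: "z \<in> S" using zt(1) openin_imp_subset[OF op] by auto
  let ?\<beta> = "\<lambda>t. null_flow A g L (z, t)" and ?I = "{t. (z, t) \<in> V}"
  have par: "parallel_along A g ?I ?\<beta> (\<lambda>t. N (?\<beta> t))"
    using N z unfolding rigging_field_def by blast
  show "N q \<in> tspace A q" using par zt unfolding parallel_along_def by auto
  have cb: "continuous_on ?I ?\<beta>"
    using flow_curve_regular(1)[OF z] by (auto intro: continuous_at_imp_continuous_on)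
  have "g (?\<beta> t) (N (?\<beta> t)) (L (?\<beta> t)) = g (?\<beta> 0) (N (?\<beta> 0)) (L (?\<beta> 0))"
    by (rule metric_const_along[OF flow_curve(1,2)[OF z] cb _ par L_parallel_along_flow[OF z]])
      (use flow_curve_regular(2)[OF z] flow_curve(3)[OF z] zt in auto)
  also have "\<dots> = - 1" using N z unfolding null_flow_0[OF z] rigging_field_def by blast
  finally show "g q (N q) (L q) = - 1" using zt by simp
qed

end

end

section \<open>Change of variables\<close>

text \<open>The change of variables theorem of the library needs a well-ordered index type. We obtain one
  as a copy of a given finite type.\<close>

typedef 'm wo_copy = "UNIV :: 'm set" ..

instantiation wo_copy :: (finite) wellorder
begin

definition less_eq_wo_copy :: "'a wo_copy \<Rightarrow> 'a wo_copy \<Rightarrow> bool" where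
  "less_eq_wo_copy x y \<longleftrightarrow> to_nat (Rep_wo_copy x) \<le> to_nat (Rep_wo_copy y)"

definition less_wo_copy :: "'a wo_copy \<Rightarrow> 'a wo_copy \<Rightarrow> bool" where
  "less_wo_copy x y \<longleftrightarrow> to_nat (Rep_wo_copy x) < to_nat (Rep_wo_copy y)"

instance
proof
  fix P :: "'a wo_copy \<Rightarrow> bool" and a
  assume step: "\<And>x. (\<And>y. y < x \<Longrightarrow> P y) \<Longrightarrow> P x"
  have "\<forall>a. to_nat (Rep_wo_copy a) = n \<longrightarrow> P a" for n
    by (induction n rule: less_induct) (metis step less_wo_copy_def)
  then show "P a" by blast
qed (auto simp: less_eq_wo_copy_def less_wo_copy_def Rep_wo_copy_inject)

end

instance wo_copy :: (finite) finite
proof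
  have "(UNIV :: 'a wo_copy set) = range Abs_wo_copy" by (metis Abs_wo_copy_cases surj_def UNIV_I)
  then show "finite (UNIV :: 'a wo_copy set)" using finite_imageI[OF finite[of UNIV], of Abs_wo_copy] by metis
qed

lemma bij_Rep_wo_copy: "bij Rep_wo_copy"
  by (metis Abs_wo_copy_inverse Rep_wo_copy_inverse UNIV_I bijI')

text \<open>Conjugation by \<open>f\<close> matches the permutations of the two index types and
  preserves signs in the Leibniz formula.\<close>

lemma det_reindex:
  fixes f :: "'k::finite \<Rightarrow> 'm::finite" and M :: "real ^ 'm ^ 'm"
  assumes f: "bij f"
  shows "det (\<chi> i j. M $ f i $ f j) = det M"
proof -
  let ?i = "inv f"
  have fi: "f (?i y) = y" "?i (f x) = x" for x y
    using f by (auto simp: bij_is_surj surj_f_inv_f bij_is_inj inv_f_f)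
  have perm: "q permutes UNIV \<longleftrightarrow> bij q" for q :: "'x \<Rightarrow> 'x"
    by (metis UNIV_I bij_imp_permutes permutes_bij)
  have sgn: "sign (f \<circ> q \<circ> ?i) = sign q" if "bij q" for q
    using sign_map_permutation[of f UNIV q] f that
    by (simp add: map_permutation_def bij_is_inj bij_is_surj perm restrict_id_def comp_def)
  have "det (\<chi> i j. M $ f i $ f j) = (\<Sum>q | q permutes UNIV. of_int (sign q) * (\<Prod>i\<in>UNIV. M $ f i $ f (q i)))"
    by (simp add: det_def)
  also have "\<dots> = (\<Sum>p | p permutes UNIV. of_int (sign p) * (\<Prod>i\<in>UNIV. M $ i $ p i))"
  proof (rule sum.reindex_bij_witness[where i = "\<lambda>p. ?i \<circ> p \<circ> f" and j = "\<lambda>q. f \<circ> q \<circ> ?i"])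
    fix q assume "q \<in> {q. q permutes (UNIV :: 'k set)}"
    then have q: "bij q" by (simp add: perm)
    show "f \<circ> q \<circ> ?i \<in> {p. p permutes UNIV}"
      using q f by (simp add: perm bij_comp bij_imp_bij_inv)
    show "?i \<circ> (f \<circ> q \<circ> ?i) \<circ> f = q" by (simp add: fun_eq_iff fi)
    have "(\<Prod>i\<in>UNIV. M $ i $ f (q (?i i))) = (\<Prod>i\<in>UNIV. M $ f i $ f (q (?i (f i))))"
      using prod.reindex_bij_betw[of f UNIV UNIV "\<lambda>i. M $ i $ f (q (?i i))"] f by simp
    then show "of_int (sign (f \<circ> q \<circ> ?i)) * (\<Prod>i\<in>UNIV. M $ i $ (f \<circ> q \<circ> ?i) i) =
        of_int (sign q) * (\<Prod>i\<in>UNIV. M $ f i $ f (q i))"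
      by (simp add: sgn[OF q] fi)
  next
    fix p assume "p \<in> {p. p permutes (UNIV :: 'm set)}"
    then have p: "bij p" by (simp add: perm)
    show "?i \<circ> p \<circ> f \<in> {q. q permutes UNIV}"
      using p f by (simp add: perm bij_comp bij_imp_bij_inv)
    show "f \<circ> (?i \<circ> p \<circ> f) \<circ> ?i = p" by (simp add: fun_eq_iff fi)
  qed
  also have "\<dots> = det M" by (simp add: det_def)
  finally show ?thesis .
qed

definition to_wo :: "real ^ 'm::finite \<Rightarrow> real ^ 'm wo_copy" where
  "to_wo x = (\<chi> i. x $ Rep_wo_copy i)"

definition of_wo :: "real ^ 'm::finite wo_copy \<Rightarrow> real ^ 'm" where
  "of_wo y = (\<chi> i. y $ Abs_wo_copy i)"

lemma of_to_wo [simp]: "of_wo (to_wo x) = x" and to_of_wo [simp]: "to_wo (of_wo y) = y"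
  by (simp_all add: vec_eq_iff of_wo_def to_wo_def Abs_wo_copy_inverse Rep_wo_copy_inverse)

lemma linear_to_wo: "linear to_wo" and linear_of_wo: "linear of_wo"
  by (auto intro!: linearI simp: vec_eq_iff of_wo_def to_wo_def)

lemma bounded_linear_to_wo: "bounded_linear to_wo" and bounded_linear_of_wo: "bounded_linear of_wo"
  using linear_to_wo linear_of_wo by (simp_all add: linear_conv_bounded_linear)

lemma prod_Basis_vec: "(\<Prod>b\<in>Basis. f b) = (\<Prod>i\<in>UNIV. f (axis i 1))" for f :: "real ^ 'm::finite \<Rightarrow> real"
proof -
  have "Basis = range (\<lambda>i::'m. axis i (1::real))" by (auto simp: Basis_vec_def)
  moreover have "inj (\<lambda>i::'m. axis i (1::real))" by (auto simp: inj_def axis_eq_axis)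
  ultimately show ?thesis using prod.reindex[of "\<lambda>i::'m. axis i (1::real)" UNIV f] by (simp only: o_def)
qed

text \<open>Preimages of boxes are boxes with the same side lengths in another order, and Lebesgue
  measure is determined by its values on boxes.\<close>

lemma distr_of_wo: "distr lborel borel of_wo = (lborel :: (real ^ 'm::finite) measure)"
proof (rule lborel_eqI[symmetric])
  have m: "of_wo \<in> borel_measurable borel"
    by (intro borel_measurable_continuous_onI linear_continuous_on bounded_linear_of_wo)
  fix l u :: "real ^ 'm" assume lu: "\<And>b. b \<in> Basis \<Longrightarrow> l \<bullet> b \<le> u \<bullet> b"
  have le: "l $ i \<le> u $ i" for i using lu[of "axis i 1"] by (simp add: cart_eq_inner_axis)
  have le': "to_wo l \<bullet> b \<le> to_wo u \<bullet> b" if "b \<in> Basis" for b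
    using that le by (auto simp: Basis_vec_def inner_axis to_wo_def)
  have "of_wo -` box l u = box (to_wo l) (to_wo u)"
    by (auto simp: mem_box_cart to_wo_def of_wo_def) (metis Abs_wo_copy_inverse Rep_wo_copy_inverse UNIV_I)+
  then have "emeasure (distr lborel borel of_wo) (box l u) = emeasure lborel (box (to_wo l) (to_wo u))"
    using m by (subst emeasure_distr) simp_all
  also have "\<dots> = ennreal (\<Prod>b\<in>Basis. (to_wo u - to_wo l) \<bullet> b)"
    using le' by (simp add: emeasure_lborel_box_eq)
  also have "(\<Prod>b\<in>Basis. (to_wo u - to_wo l) \<bullet> b) = (\<Prod>i\<in>UNIV. (u - l) $ Rep_wo_copy i)"
    by (simp add: prod_Basis_vec inner_axis to_wo_def)
  also have "\<dots> = (\<Prod>i\<in>UNIV. (u - l) $ i)"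
    using prod.reindex_bij_betw[of Rep_wo_copy UNIV UNIV "\<lambda>i. (u - l) $ i"] bij_Rep_wo_copy by simp
  also have "\<dots> = (\<Prod>b\<in>Basis. (u - l) \<bullet> b)" by (simp add: prod_Basis_vec inner_axis)
  finally show "emeasure (distr lborel borel of_wo) (box l u) = ennreal (\<Prod>b\<in>Basis. (u - l) \<bullet> b)" .
qed simp

lemma nn_integral_of_wo:
  fixes h :: "real ^ 'm::finite \<Rightarrow> ennreal"
  assumes "h \<in> borel_measurable borel"
  shows "(\<integral>\<^sup>+x. h x \<partial>lborel) = (\<integral>\<^sup>+y. h (of_wo y) \<partial>lborel)"
proof -
  have m: "of_wo \<in> borel_measurable borel"
    by (intro borel_measurable_continuous_onI linear_continuous_on bounded_linear_of_wo)
  have "(\<integral>\<^sup>+x. h x \<partial>lborel) = (\<integral>\<^sup>+x. h x \<partial>distr lborel borel (of_wo :: _ \<Rightarrow> real ^ 'm))"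
    by (simp add: distr_of_wo)
  also have "\<dots> = (\<integral>\<^sup>+y. h (of_wo y) \<partial>lborel)"
    by (rule nn_integral_distr) (use assms m in simp_all)
  finally show ?thesis .
qed

section \<open>Change of variables for nonnegative integrals\<close>

lemma set_nn_integral_finite_iff:
  fixes q :: "'b::euclidean_space \<Rightarrow> real"
  assumes m: "set_borel_measurable borel X q" and 0: "\<And>x. x \<in> X \<Longrightarrow> 0 \<le> q x"
  shows "(\<integral>\<^sup>+x\<in>X. q x \<partial>lborel) < \<infinity> \<longleftrightarrow> q absolutely_integrable_on X"
    and "q absolutely_integrable_on X \<Longrightarrow> (\<integral>\<^sup>+x\<in>X. q x \<partial>lborel) = ennreal (integral X q)"
proof -
  let ?Q = "\<lambda>x. indicator X x *\<^sub>R q x"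
  have Q: "?Q \<in> borel_measurable lborel" using m by (simp add: set_borel_measurable_def)
  have eq: "(\<integral>\<^sup>+x. ennreal (norm (?Q x)) \<partial>lborel) = (\<integral>\<^sup>+x\<in>X. q x \<partial>lborel)"
    by (intro nn_integral_cong) (auto simp: indicator_def 0)
  show iff: "(\<integral>\<^sup>+x\<in>X. q x \<partial>lborel) < \<infinity> \<longleftrightarrow> q absolutely_integrable_on X"
  proof -
    have "q absolutely_integrable_on X \<longleftrightarrow> integrable lborel ?Q"
      unfolding set_integrable_def integrable_completion[OF Q] ..
    then show ?thesis unfolding integrable_iff_bounded eq using Q by simp
  qed
  assume "q absolutely_integrable_on X"
  then have "(\<integral>\<^sup>+x\<in>X. q x \<partial>lborel) < \<infinity>" using iff by simp
  then show "(\<integral>\<^sup>+x\<in>X. q x \<partial>lborel) = ennreal (integral X q)"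
    using set_nn_integral_lborel_eq_integral[OF m 0] by blast
qed

text \<open>The vector-valued theorem is applied with values in \<open>real ^ 1\<close>; absolute
  integrability and the value of the integral pass through \<open>vec\<close> together.\<close>

lemma change_of_variables_real:
  fixes f :: "real ^ 'm::{finite,wellorder} \<Rightarrow> real" and \<phi> :: "real ^ 'm::_ \<Rightarrow> real ^ 'm::_"
  assumes S: "S \<in> sets lebesgue" and d: "\<And>x. x \<in> S \<Longrightarrow> (\<phi> has_derivative \<phi>' x) (at x within S)" and inj: "inj_on \<phi> S"
  shows "(\<lambda>x. \<bar>det (matrix (\<phi>' x))\<bar> * f (\<phi> x)) absolutely_integrable_on S \<and>
           integral S (\<lambda>x. \<bar>det (matrix (\<phi>' x))\<bar> * f (\<phi> x)) = b
     \<longleftrightarrow> f absolutely_integrable_on (\<phi> ` S) \<and> integral (\<phi> ` S) f = b"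
proof -
  have lift: "q absolutely_integrable_on X \<and> integral X q = b \<longleftrightarrow>
      (\<lambda>x. vec (q x) :: real ^ 1) absolutely_integrable_on X \<and> integral X (\<lambda>x. vec (q x) :: real ^ 1) = vec b"
    for q :: "real ^ 'm::_ \<Rightarrow> real" and X
  proof -
    have 1: "bounded_linear (vec :: real \<Rightarrow> real ^ 1)"
      by (simp add: linear_conv_bounded_linear[symmetric] linearI vec_eq_iff)
    have 2: "bounded_linear (\<lambda>v :: real ^ 1. v $ 1)" by (rule bounded_linear_vec_nth)
    show ?thesis
    proof
      assume q: "q absolutely_integrable_on X \<and> integral X q = b"
      then have "q integrable_on X" using set_lebesgue_integral_eq_integral(1) by blast
      from integral_linear[OF this 1] absolutely_integrable_linear[OF _ 1] q
      show "(\<lambda>x. vec (q x) :: real ^ 1) absolutely_integrable_on X \<and> integral X (\<lambda>x. vec (q x) :: real ^ 1) = vec b"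
        unfolding o_def by blast
    next
      assume q: "(\<lambda>x. vec (q x) :: real ^ 1) absolutely_integrable_on X \<and> integral X (\<lambda>x. vec (q x) :: real ^ 1) = vec b"
      then have "(\<lambda>x. vec (q x) :: real ^ 1) integrable_on X" using set_lebesgue_integral_eq_integral(1) by blast
      from integral_linear[OF this 2] absolutely_integrable_linear[OF conjunct1[OF q] 2] q
      show "q absolutely_integrable_on X \<and> integral X q = b"
        by (simp add: o_def)
    qed
  qed
  have "vec (r * s) = r *\<^sub>R (vec s :: real ^ 1)" for r s :: real by (simp add: vec_eq_iff)
  then show ?thesis unfolding lift
    using has_absolute_integral_change_of_variables[OF S d inj, of "\<lambda>x. vec (f x) :: real ^ 1" "vec b"] by simp
qed

text \<open>The two sides are absolutely integrable together. Either both nonnegative integrals are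
  finite, and then equal, or both are infinite.\<close>

lemma nn_integral_change_of_variables_wo:
  fixes f :: "real ^ 'm::{finite,wellorder} \<Rightarrow> real" and \<phi> :: "real ^ 'm::_ \<Rightarrow> real ^ 'm::_"
  assumes S: "open S" and \<phi>: "Ck_on 1 S \<phi>" and inj: "inj_on \<phi> S"
    and f: "f \<in> borel_measurable borel" "\<And>y. 0 \<le> f y"
  shows "(\<integral>\<^sup>+x\<in>S. ennreal (\<bar>det (matrix (frechet_derivative \<phi> (at x)))\<bar> * f (\<phi> x)) \<partial>lborel) = (\<integral>\<^sup>+y\<in>\<phi> ` S. ennreal (f y) \<partial>lborel)"
proof -
  let ?q = "\<lambda>x. \<bar>det (matrix (frechet_derivative \<phi> (at x)))\<bar> * f (\<phi> x)"
  have c: "continuous_on S \<phi>" by (rule Ck_on_continuous[OF \<phi>])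
  have o: "open (\<phi> ` S)" by (rule invariance_of_domain[OF c S inj])
  have cd: "continuous_on S (\<lambda>x. \<bar>det (matrix (frechet_derivative \<phi> (at x)))\<bar>)"
    by (intro continuous_intros continuous_on_det) (auto simp: matrix_def intro!: continuous_intros C1_continuous_deriv[OF \<phi>])
  \<comment> \<open>\<phi> is known to be continuous only on \<open>S\<close>. Cutting off inside
    the argument of \<open>f\<close> yields a globally Borel function that agrees with the integrand
    on \<open>S\<close>.\<close>
  have "(\<lambda>x. indicator S x *\<^sub>R \<phi> x) \<in> borel_measurable borel"
    using S by (intro borel_measurable_continuous_on_indicator c) auto
  then have "(\<lambda>x. f (indicator S x *\<^sub>R \<phi> x)) \<in> borel_measurable borel" by (rule measurable_compose[OF _ f(1)])
  moreover have "(\<lambda>x. indicator S x *\<^sub>R \<bar>det (matrix (frechet_derivative \<phi> (at x)))\<bar>) \<in> borel_measurable borel"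
    using S by (intro borel_measurable_continuous_on_indicator cd) auto
  ultimately have "(\<lambda>x. (indicator S x *\<^sub>R \<bar>det (matrix (frechet_derivative \<phi> (at x)))\<bar>) * f (indicator S x *\<^sub>R \<phi> x)) \<in> borel_measurable borel"
    by (rule borel_measurable_times[rotated])
  also have "(\<lambda>x. (indicator S x *\<^sub>R \<bar>det (matrix (frechet_derivative \<phi> (at x)))\<bar>) * f (indicator S x *\<^sub>R \<phi> x)) = (\<lambda>x. indicator S x *\<^sub>R ?q x)"
    by (auto simp: fun_eq_iff indicator_def)
  finally have mq: "set_borel_measurable borel S ?q" by (simp add: set_borel_measurable_def)
  have mf: "set_borel_measurable borel (\<phi> ` S) f"
    unfolding set_borel_measurable_def using o f(1) by (intro borel_measurable_scaleR borel_measurable_indicator) auto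
  note q = set_nn_integral_finite_iff[OF mq] and ff = set_nn_integral_finite_iff[OF mf f(2)]
  have q0: "0 \<le> ?q x" for x using f(2) by simp
  have SL: "S \<in> sets lebesgue" using S by (simp add: borel_open)
  note cov = change_of_variables_real[OF SL has_derivative_at_withinI[OF C1_deriv[OF \<phi>]] inj, of f]
  show ?thesis
  proof (cases "?q absolutely_integrable_on S")
    case True
    then have "f absolutely_integrable_on \<phi> ` S" "integral (\<phi> ` S) f = integral S ?q" using cov by blast+
    then show ?thesis using True q(2)[OF q0] ff(2) by simp
  next
    case False
    then have "\<not> f absolutely_integrable_on \<phi> ` S" using cov by blast
    then have "\<not> (\<integral>\<^sup>+y\<in>\<phi> ` S. ennreal (f y) \<partial>lborel) < \<infinity>" "\<not> (\<integral>\<^sup>+x\<in>S. ennreal (?q x) \<partial>lborel) < \<infinity>"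
      using False q(1)[OF q0] ff(1) by blast+
    then show ?thesis by (simp add: not_less top.extremum_unique)
  qed
qed

text \<open>Conjugation with the copied index type changes neither Lebesgue measure, by
  \<open>distr_of_wo\<close>, nor the Jacobian determinant, by \<open>det_reindex\<close>.\<close>

lemma nn_integral_change_of_variables:
  fixes f :: "real ^ 'm::finite \<Rightarrow> real" and \<phi> :: "real ^ 'm \<Rightarrow> real ^ 'm"
  assumes S: "open S" and \<phi>: "Ck_on 1 S \<phi>" and inj: "inj_on \<phi> S"
    and f: "f \<in> borel_measurable borel" "\<And>y. 0 \<le> f y"
  shows "(\<integral>\<^sup>+x\<in>S. ennreal (\<bar>det (matrix (frechet_derivative \<phi> (at x)))\<bar> * f (\<phi> x)) \<partial>lborel) = (\<integral>\<^sup>+y\<in>\<phi> ` S. ennreal (f y) \<partial>lborel)"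
proof -
  let ?S = "of_wo -` S" and ?\<phi> = "\<lambda>y. to_wo (\<phi> (of_wo y))" and ?f = "\<lambda>y. f (of_wo y)"
  have cont: "continuous_on X of_wo" for X by (rule linear_continuous_on[OF bounded_linear_of_wo])
  have mo: "of_wo \<in> borel_measurable borel" by (rule borel_measurable_continuous_onI[OF cont])
  have S': "open ?S" using continuous_open_preimage[OF cont open_UNIV S] by simp
  have \<phi>': "Ck_on 1 ?S ?\<phi>"
    by (rule C1_bounded_linear[OF bounded_linear_to_wo C1_compose'[OF C1_linear[OF bounded_linear_of_wo] \<phi>]]) auto
  have inj': "inj_on ?\<phi> ?S"
    using inj by (auto simp: inj_on_def) (metis of_to_wo to_of_wo)
  have im: "?\<phi> ` ?S = of_wo -` (\<phi> ` S)"
  proof safe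
    fix x s assume "of_wo x = \<phi> s" "s \<in> S"
    then have "x = ?\<phi> (to_wo s)" by (metis of_to_wo to_of_wo)
    moreover have "to_wo s \<in> ?S" using \<open>s \<in> S\<close> by simp
    ultimately show "x \<in> ?\<phi> ` ?S" by blast
  qed simp
  have det: "det (matrix (frechet_derivative ?\<phi> (at y))) = det (matrix (frechet_derivative \<phi> (at (of_wo y))))" if y: "y \<in> ?S" for y
  proof -
    have d: "(?\<phi> has_derivative (\<lambda>h. to_wo (frechet_derivative \<phi> (at (of_wo y)) (of_wo h)))) (at y)"
      by (rule bounded_linear.has_derivative[OF bounded_linear_to_wo
            has_derivative_compose[OF bounded_linear_imp_has_derivative[OF bounded_linear_of_wo] C1_deriv[OF \<phi>]]])
        (use y in auto)
    have ax: "of_wo (axis j 1) = axis (Rep_wo_copy j) (1::real)" for j :: "'m wo_copy"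
      by (auto simp: vec_eq_iff of_wo_def axis_def Abs_wo_copy_inverse Rep_wo_copy_inverse)
    have "matrix (frechet_derivative ?\<phi> (at y)) = (\<chi> i j. matrix (frechet_derivative \<phi> (at (of_wo y))) $ Rep_wo_copy i $ Rep_wo_copy j)"
      unfolding frechet_derivative_at[OF d, symmetric] by (simp add: vec_eq_iff matrix_def to_wo_def ax)
    then show ?thesis by (simp add: det_reindex[OF bij_Rep_wo_copy])
  qed
  have mD: "(\<lambda>x. ennreal (\<bar>det (matrix (frechet_derivative \<phi> (at x)))\<bar> * f (\<phi> x)) * indicator S x) \<in> borel_measurable borel"
  proof -
    have c: "continuous_on S \<phi>" by (rule Ck_on_continuous[OF \<phi>])
    have cd: "continuous_on S (\<lambda>x. \<bar>det (matrix (frechet_derivative \<phi> (at x)))\<bar>)"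
      by (intro continuous_intros continuous_on_det) (auto simp: matrix_def intro!: continuous_intros C1_continuous_deriv[OF \<phi>])
    have "(\<lambda>x. indicator S x *\<^sub>R \<phi> x) \<in> borel_measurable borel"
      using S by (intro borel_measurable_continuous_on_indicator c) auto
    then have "(\<lambda>x. f (indicator S x *\<^sub>R \<phi> x)) \<in> borel_measurable borel" by (rule measurable_compose[OF _ f(1)])
    moreover have "(\<lambda>x. indicator S x *\<^sub>R \<bar>det (matrix (frechet_derivative \<phi> (at x)))\<bar>) \<in> borel_measurable borel"
      using S by (intro borel_measurable_continuous_on_indicator cd) auto
    ultimately have "(\<lambda>x. ennreal ((indicator S x *\<^sub>R \<bar>det (matrix (frechet_derivative \<phi> (at x)))\<bar>) * f (indicator S x *\<^sub>R \<phi> x))) \<in> borel_measurable borel"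
      by measurable
    also have "(\<lambda>x. ennreal ((indicator S x *\<^sub>R \<bar>det (matrix (frechet_derivative \<phi> (at x)))\<bar>) * f (indicator S x *\<^sub>R \<phi> x)))
       = (\<lambda>x. ennreal (\<bar>det (matrix (frechet_derivative \<phi> (at x)))\<bar> * f (\<phi> x)) * indicator S x)"
      by (auto simp: fun_eq_iff indicator_def)
    finally show ?thesis .
  qed
  have "(\<integral>\<^sup>+x\<in>S. ennreal (\<bar>det (matrix (frechet_derivative \<phi> (at x)))\<bar> * f (\<phi> x)) \<partial>lborel)
      = (\<integral>\<^sup>+y. ennreal (\<bar>det (matrix (frechet_derivative \<phi> (at (of_wo y))))\<bar> * f (\<phi> (of_wo y))) * indicator S (of_wo y) \<partial>lborel)"
    by (rule nn_integral_of_wo[OF mD])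
  also have "\<dots> = (\<integral>\<^sup>+y\<in>?S. ennreal (\<bar>det (matrix (frechet_derivative ?\<phi> (at y)))\<bar> * ?f (?\<phi> y)) \<partial>lborel)"
    by (intro nn_integral_cong) (auto simp: indicator_def det)
  also have "\<dots> = (\<integral>\<^sup>+y\<in>?\<phi> ` ?S. ennreal (?f y) \<partial>lborel)"
    by (rule nn_integral_change_of_variables_wo[OF S' \<phi>' inj' measurable_compose[OF mo f(1)] f(2)])
  also have "\<dots> = (\<integral>\<^sup>+y. ennreal (f (of_wo y)) * indicator (\<phi> ` S) (of_wo y) \<partial>lborel)"
    unfolding im by (intro nn_integral_cong) (simp add: indicator_def)
  also have "\<dots> = (\<integral>\<^sup>+y\<in>\<phi> ` S. ennreal (f y) \<partial>lborel)"
  proof (rule nn_integral_of_wo[symmetric])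
    have "open (\<phi> ` S)" by (rule invariance_of_domain[OF Ck_on_continuous[OF \<phi>] S inj])
    then show "(\<lambda>y. ennreal (f y) * indicator (\<phi> ` S) y) \<in> borel_measurable borel"
      using f(1) by (intro borel_measurable_times_ennreal borel_measurable_indicator) auto
  qed
  finally show ?thesis .
qed

section \<open>The Riemannian volume measure\<close>

context atlas
begin

text \<open>Guarantees a member for the enumeration in \<open>countable_params\<close> even when
  \<open>D\<close> is empty.\<close>

lemma empty_param: "({}, \<psi> :: real ^ 'm::finite \<Rightarrow> 'a) \<in> params A k D"
proof -
  have "Ck_on k {} f" for f :: "real ^ 'm \<Rightarrow> real ^ 'n" by (rule Ck_on_local) simp
  then show ?thesis by (simp add: params_def Ck_map_def homeomorphism_def)
qed

text \<open>By second countability (Lindelof), countably many of the relatively open images already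
  cover \<open>D\<close>.\<close>

lemma countable_params:
  assumes D: "submanifold TYPE('m::finite) A 2 D"
  obtains F :: "nat \<Rightarrow> (real ^ 'm) set \<times> (real ^ 'm \<Rightarrow> 'a)"
  where "\<And>i. F i \<in> params A 2 D" "(\<Union>i. snd (F i) ` fst (F i)) = D"
proof -
  let ?P = "params A 2 D :: ((real ^ 'm) set \<times> (real ^ 'm \<Rightarrow> 'a)) set"
  let ?im = "\<lambda>p :: (real ^ 'm) set \<times> (real ^ 'm \<Rightarrow> 'a). snd p ` fst p"
  obtain \<F> where \<F>: "\<F> \<subseteq> ?im ` ?P" "countable \<F>" "\<Union>\<F> = \<Union>(?im ` ?P)"
    using Lindelof_openin[of "?im ` ?P" D] params_openin by (metis (no_types, lifting) imageE prod.collapse)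
  from countable_subset_image[THEN iffD1, OF conjI[OF \<F>(2,1)]]
  obtain \<P> where P: "\<P> \<subseteq> ?P" "countable \<P>" "\<F> = ?im ` \<P>" by blast
  have "\<Union>(?im ` ?P) = D"
  proof
    show "\<Union>(?im ` ?P) \<subseteq> D" using params_subset by fastforce
    show "D \<subseteq> \<Union>(?im ` ?P)" using D unfolding submanifold_def by fastforce
  qed
  then have U: "\<Union>(?im ` insert ({}, undefined) \<P>) = D" using \<F>(3) P(3) by simp
  define F where "F = from_nat_into (insert ({}, undefined) \<P>)"
  have r: "range F = insert ({}, undefined) \<P>"
    unfolding F_def by (rule range_from_nat_into) (use P(2) in auto)
  show thesis
  proof (rule that)
    show "F i \<in> params A 2 D" for i
    proof -
      have "F i \<in> insert ({}, undefined) \<P>" unfolding r[symmetric] by (rule rangeI)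
      then consider "F i = ({}, undefined)" | "F i \<in> \<P>" by (rule insertE)
      then show ?thesis by cases (use empty_param P(1) in auto)
    qed
    show "(\<Union>i. ?im (F i)) = D" using U unfolding r[symmetric] image_image .
  qed
qed

lemma openin_sets: "openin (top_of_set D) X \<Longrightarrow> X \<in> sets (restrict_space borel D)"
  by (auto simp: openin_open sets_restrict_space)

lemma disjointed_params:
  assumes D: "submanifold TYPE('m::finite) A 2 D"
  obtains F :: "nat \<Rightarrow> (real ^ 'm) set \<times> (real ^ 'm \<Rightarrow> 'a)" and Q
  where "\<And>i. F i \<in> params A 2 D" "\<And>i. Q i \<subseteq> snd (F i) ` fst (F i)" "(\<Union>i. Q i) = D"
    "disjoint_family Q" "\<And>i. Q i \<in> sets (restrict_space borel D)"
proof -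
  obtain F :: "nat \<Rightarrow> (real ^ 'm) set \<times> (real ^ 'm \<Rightarrow> 'a)"
    where F: "\<And>i. F i \<in> params A 2 D" "(\<Union>i. snd (F i) ` fst (F i)) = D"
    using countable_params[OF D] by blast
  let ?O = "\<lambda>i. snd (F i) ` fst (F i)"
  have "?O i \<in> sets (restrict_space borel D)" for i
    using params_openin[of "fst (F i)" "snd (F i)"] F(1)[of i] by (intro openin_sets) simp
  then have "range (disjointed ?O) \<subseteq> sets (restrict_space borel D)"
    by (intro sets.range_disjointed_sets) auto
  then show ?thesis
    using F by (intro that[of F "disjointed ?O"] disjointed_subset disjoint_family_disjointed)
      (auto simp: UN_disjointed_eq)
qed

text \<open>Inside one parametrization the values are prescribed. Disjoint Borel pieces, each within
  a single image, reduce an arbitrary Borel set to this case by countable additivity.\<close>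

lemma volume_measure_unique:
  assumes D: "submanifold TYPE('m::finite) A 2 D"
    and \<mu>: "is_volume_measure TYPE('m) A h D \<mu>" and \<mu>': "is_volume_measure TYPE('m) A h D \<mu>'"
  shows "\<mu> = \<mu>'"
proof -
  obtain F :: "nat \<Rightarrow> (real ^ 'm) set \<times> (real ^ 'm \<Rightarrow> 'a)" and Q
    where F: "\<And>i. F i \<in> params A 2 D" "\<And>i. Q i \<subseteq> snd (F i) ` fst (F i)" "(\<Union>i. Q i) = D"
    "disjoint_family Q" "\<And>i. Q i \<in> sets (restrict_space borel D)"
    using disjointed_params[OF D] by blast
  have s: "sets \<mu> = sets (restrict_space borel D)" "sets \<mu>' = sets (restrict_space borel D)"
    using \<mu> \<mu>' by (auto simp: is_volume_measure_def)
  show ?thesis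
  proof (rule measure_eqI)
    show "sets \<mu> = sets \<mu>'" using s by simp
    fix B assume B: "B \<in> sets \<mu>"
    have BD: "B \<subseteq> D" using sets.sets_into_space[OF B] sets_eq_imp_space_eq[OF s(1)] by (simp add: space_restrict_space)
    have BQ: "B \<inter> Q i \<in> sets \<mu>" "B \<inter> Q i \<in> sets \<mu>'" for i using B F(5) s by auto
    have dis: "disjoint_family (\<lambda>i. B \<inter> Q i)" using F(4) by (auto simp: disjoint_family_on_def)
    have U: "(\<Union>i. B \<inter> Q i) = B" using F(3) BD by auto
    have eq: "emeasure \<mu> (B \<inter> Q i) = emeasure \<mu>' (B \<inter> Q i)" for i
    proof -
      obtain W \<psi> where W: "F i = (W, \<psi>)" by (cases "F i")
      have p: "(W, \<psi>) \<in> params A 2 D" "B \<inter> Q i \<subseteq> \<psi> ` W" using F(1,2)[of i] W by auto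
      show ?thesis using \<mu> \<mu>' p BQ[of i] unfolding is_volume_measure_def by fastforce
    qed
    have r: "range (\<lambda>i. B \<inter> Q i) \<subseteq> sets \<mu>" "range (\<lambda>i. B \<inter> Q i) \<subseteq> sets \<mu>'" using BQ by blast+
    have "emeasure \<mu> B = (\<Sum>i. emeasure \<mu> (B \<inter> Q i))"
      using suminf_emeasure[OF r(1) dis] unfolding U by (rule sym)
    also have "\<dots> = emeasure \<mu>' B"
      unfolding eq using suminf_emeasure[OF r(2) dis] unfolding U .
    finally show "emeasure \<mu> B = emeasure \<mu>' B" .
  qed
qed

lemma volume_measure_eq:
  assumes "submanifold TYPE('m::finite) A 2 D" "is_volume_measure TYPE('m) A h D \<mu>"
  shows "volume_measure TYPE('m) A h D = \<mu>"
  unfolding volume_measure_def using assms volume_measure_unique by (blast intro: the_equality)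

lemma submanifold_openin:
  assumes H: "submanifold TYPE('m::finite) A k H" and D: "openin (top_of_set H) D"
  shows "submanifold TYPE('m) A k D"
  unfolding submanifold_def
proof
  fix p assume p: "p \<in> D"
  then have "p \<in> H" using openin_imp_subset[OF D] by auto
  then obtain W and \<psi> :: "real ^ 'm \<Rightarrow> 'a" where P: "(W, \<psi>) \<in> params A k H" "p \<in> \<psi> ` W"
    using H unfolding submanifold_def by fastforce
  have "(W \<inter> \<psi> -` D, \<psi>) \<in> params A k D" by (rule params_restrict[OF P(1) D])
  moreover have "p \<in> \<psi> ` (W \<inter> \<psi> -` D)" using P(2) p by auto
  ultimately show "\<exists>(W, \<psi>::real ^ 'm \<Rightarrow> 'a)\<in>params A k D. p \<in> \<psi> ` W"
    by (intro bexI[of _ "(W \<inter> \<psi> -` D, \<psi>)"]) simp_all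
qed

end

lemma suminf_swap_ennreal: "(\<Sum>n. \<Sum>i. f n i) = (\<Sum>i. \<Sum>n. f n i)" for f :: "nat \<Rightarrow> nat \<Rightarrow> ennreal"
proof -
  have "(\<Sum>n. \<Sum>i. f n i) = (\<Sum>n. \<integral>\<^sup>+i. f n i \<partial>count_space UNIV)" by (simp add: nn_integral_count_space_nat)
  also have "\<dots> = (\<integral>\<^sup>+i. (\<Sum>n. f n i) \<partial>count_space UNIV)" by (rule nn_integral_suminf[symmetric]) simp
  also have "\<dots> = (\<Sum>i. \<Sum>n. f n i)" by (simp add: nn_integral_count_space_nat)
  finally show ?thesis .
qed

section \<open>The volume measure of \<open>h0\<close> on the whole hypersurface\<close>

context null_hyp
begin

lemma H_submanifold: "submanifold TYPE('m) A 2 H"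
  using nullH by (simp add: null_hypersurface_def)

definition local_volume :: "(real ^ 'm) set \<Rightarrow> (real ^ 'm \<Rightarrow> 'a) \<Rightarrow> 'a set \<Rightarrow> ennreal" where
  "local_volume W \<psi> B = (\<integral>\<^sup>+ x \<in> W \<inter> \<psi> -` B. ennreal (sqrt (gram h0 \<psi> x)) \<partial>lborel)"

lemma params_borel:
  fixes \<psi> :: "real ^ 'm \<Rightarrow> 'a"
  assumes P: "(W, \<psi>) \<in> params A 2 H" and B: "B \<in> sets (restrict_space borel H)"
  shows "W \<inter> \<psi> -` B \<in> sets borel"
proof -
  obtain B' where B': "B' \<in> sets borel" "B = H \<inter> B'" using B by (auto simp: sets_restrict_space)
  have W: "W \<in> sets borel" using params_open[OF P] by simp
  have "\<psi> \<in> borel_measurable (restrict_space borel W)"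
    by (rule borel_measurable_continuous_on_restrict[OF params_cont[OF P]])
  from measurable_sets[OF this B'(1)] have "\<psi> -` B' \<inter> W \<in> sets (restrict_space borel W)"
    by (simp add: space_restrict_space)
  then have "\<psi> -` B' \<inter> W \<in> sets borel" using W by (auto simp: sets_restrict_space_iff)
  moreover have "W \<inter> \<psi> -` B = \<psi> -` B' \<inter> W" using params_subset[OF P] B'(2) by auto
  ultimately show ?thesis by simp
qed

lemma density_measurable:
  fixes \<psi> :: "real ^ 'm \<Rightarrow> 'a"
  assumes P: "(W, \<psi>) \<in> params A 2 H"
  shows "(\<lambda>x. indicator W x *\<^sub>R sqrt (gram h0 \<psi> x)) \<in> borel_measurable borel"
  using params_open[OF P]
  by (intro borel_measurable_continuous_on_indicator continuous_on_real_sqrt gram_h0_continuous[OF P]) auto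

text \<open>Expresses the local volume through an honest measure, from which countable additivity is
  inherited. The indicator of \<open>W\<close> makes the density Borel on the whole space.\<close>

lemma local_volume_emeasure:
  fixes \<psi> :: "real ^ 'm \<Rightarrow> 'a"
  assumes P: "(W, \<psi>) \<in> params A 2 H" and B: "B \<in> sets (restrict_space borel H)"
  shows "local_volume W \<psi> B = emeasure (density lborel (\<lambda>x. ennreal (indicator W x *\<^sub>R sqrt (gram h0 \<psi> x)))) (W \<inter> \<psi> -` B)"
proof -
  have "emeasure (density lborel (\<lambda>x. ennreal (indicator W x *\<^sub>R sqrt (gram h0 \<psi> x)))) (W \<inter> \<psi> -` B)
      = (\<integral>\<^sup>+ x \<in> W \<inter> \<psi> -` B. ennreal (indicator W x *\<^sub>R sqrt (gram h0 \<psi> x)) \<partial>lborel)"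
    using density_measurable[OF P] params_borel[OF P B] by (intro emeasure_density) auto
  also have "\<dots> = local_volume W \<psi> B"
    unfolding local_volume_def by (intro nn_integral_cong) (auto simp: indicator_def)
  finally show ?thesis ..
qed

lemma local_volume_suminf:
  fixes \<psi> :: "real ^ 'm \<Rightarrow> 'a"
  assumes P: "(W, \<psi>) \<in> params A 2 H" and B: "\<And>i::nat. B i \<in> sets (restrict_space borel H)" "disjoint_family B"
  shows "(\<Sum>i. local_volume W \<psi> (B i)) = local_volume W \<psi> (\<Union>i. B i)"
proof -
  let ?M = "density lborel (\<lambda>x. ennreal (indicator W x *\<^sub>R sqrt (gram h0 \<psi> x)))"
  have U: "(\<Union>i. B i) \<in> sets (restrict_space borel H)" using B(1) by auto
  have "(\<Sum>i. emeasure ?M (W \<inter> \<psi> -` B i)) = emeasure ?M (\<Union>i. W \<inter> \<psi> -` B i)"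
    using params_borel[OF P B(1)] B(2) by (intro suminf_emeasure) (auto simp: disjoint_family_on_def)
  also have "(\<Union>i. W \<inter> \<psi> -` B i) = W \<inter> \<psi> -` (\<Union>i. B i)" by auto
  finally show ?thesis by (simp add: local_volume_emeasure[OF P] B(1) U)
qed

text \<open>A change of parametrization multiplies the Gram determinant by the square of the
  Jacobian, and its root by the absolute value, which is the factor in the change of
  variables.\<close>

lemma local_volume_invariant:
  fixes \<psi> \<psi>' :: "real ^ 'm \<Rightarrow> 'a"
  assumes P: "(W, \<psi>) \<in> params A 2 H" and P': "(W', \<psi>') \<in> params A 2 H"
    and B: "B \<in> sets (restrict_space borel H)" "B \<subseteq> \<psi> ` W" "B \<subseteq> \<psi>' ` W'"
  shows "local_volume W \<psi> B = local_volume W' \<psi>' B"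
proof -
  let ?S = "W \<inter> \<psi> -` (\<psi>' ` W')"
  let ?\<phi> = "\<lambda>x. inv_into W' \<psi>' (\<psi> x)"
  have S: "open ?S" by (rule params_preimage_open[OF P params_openin[OF P']])
  have ck: "Ck_map A 1 ?S \<psi>" by (rule Ck_map_subset[OF params_Ck_map_1[OF P]]) auto
  have sub: "\<psi> ` ?S \<subseteq> \<psi>' ` W'" by auto
  note lift = lift_C1[OF P' S ck sub]
  have \<psi>\<phi>: "\<psi>' (?\<phi> x) = \<psi> x" "?\<phi> x \<in> W'" if "x \<in> ?S" for x
    using that by (auto intro: f_inv_into_f inv_into_into)
  have inj: "inj_on ?\<phi> ?S"
  proof (rule inj_onI)
    fix x y assume "x \<in> ?S" "y \<in> ?S" "?\<phi> x = ?\<phi> y"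
    then have "\<psi> x = \<psi> y" using \<psi>\<phi>(1) by metis
    then show "x = y" using params_inj[OF P] \<open>x \<in> ?S\<close> \<open>y \<in> ?S\<close> by (meson IntD1 inj_onD)
  qed
  have im: "?\<phi> ` ?S = W' \<inter> \<psi>' -` (\<psi> ` W)"
  proof
    show "?\<phi> ` ?S \<subseteq> W' \<inter> \<psi>' -` (\<psi> ` W)" using \<psi>\<phi> by auto
    show "W' \<inter> \<psi>' -` (\<psi> ` W) \<subseteq> ?\<phi> ` ?S"
    proof
      fix y assume y: "y \<in> W' \<inter> \<psi>' -` (\<psi> ` W)"
      then obtain x where x: "x \<in> W" "\<psi>' y = \<psi> x" by auto
      have "\<psi> x \<in> \<psi>' ` W'" unfolding x(2)[symmetric] using y by blast
      then have "x \<in> ?S" using x(1) by blast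
      moreover have "y = ?\<phi> x" using params_inv[OF P', of y] y unfolding x(2) by simp
      ultimately show "y \<in> ?\<phi> ` ?S" by blast
    qed
  qed
  \<comment> \<open>The change of variables asks for a nonnegative real Borel function.
    \<open>sqrt\<close> of a negative number is negative, so \<open>max 0\<close> imitates the
    truncation made by \<open>ennreal\<close>, and the sign of the Gram determinant need not be
    discussed.\<close>
  define f where "f y = max 0 (indicator W' y *\<^sub>R sqrt (gram h0 \<psi>' y)) * indicator (W' \<inter> \<psi>' -` B) y" for y
  have f: "f \<in> borel_measurable borel" "0 \<le> f y" for y
    unfolding f_def using density_measurable[OF P'] params_borel[OF P' B(1)]
    by (auto intro!: borel_measurable_times borel_measurable_max borel_measurable_indicator)
  have "local_volume W' \<psi>' B = (\<integral>\<^sup>+y\<in>?\<phi> ` ?S. ennreal (f y) \<partial>lborel)"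
    unfolding local_volume_def im
    by (intro nn_integral_cong) (use B(2) in \<open>auto simp: f_def indicator_def max_def ennreal_neg\<close>)
  also have "\<dots> = (\<integral>\<^sup>+x\<in>?S. ennreal (\<bar>det (matrix (frechet_derivative ?\<phi> (at x)))\<bar> * f (?\<phi> x)) \<partial>lborel)"
    by (rule nn_integral_change_of_variables[OF S lift(1) inj f, symmetric])
  also have "\<dots> = local_volume W \<psi> B"
    unfolding local_volume_def
  proof (intro nn_integral_cong)
    fix x
    show "ennreal (\<bar>det (matrix (frechet_derivative ?\<phi> (at x)))\<bar> * f (?\<phi> x)) * indicator ?S x
        = ennreal (sqrt (gram h0 \<psi> x)) * indicator (W \<inter> \<psi> -` B) x"
    proof (cases "x \<in> ?S")
      case True
      note y = \<psi>\<phi>[OF True]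
      have "gram h0 \<psi> x = (det (matrix (frechet_derivative ?\<phi> (at x))))\<^sup>2 * gram h0 \<psi>' (?\<phi> x)"
        by (rule gram_h0_transition[where \<psi> = \<psi>' and \<psi>' = \<psi> and y = "?\<phi> x" and x = x, OF P' y(2,1)]) (rule lift(2)[OF True])
      then have "sqrt (gram h0 \<psi> x) = \<bar>det (matrix (frechet_derivative ?\<phi> (at x)))\<bar> * sqrt (gram h0 \<psi>' (?\<phi> x))"
        by (simp add: real_sqrt_mult)
      then have "ennreal (sqrt (gram h0 \<psi> x)) = ennreal (\<bar>det (matrix (frechet_derivative ?\<phi> (at x)))\<bar> * max 0 (sqrt (gram h0 \<psi>' (?\<phi> x))))"
        by (auto simp: max_def ennreal_neg mult_nonneg_nonpos)
      then show ?thesis using True y by (auto simp: f_def indicator_def)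
    next
      case False
      then show ?thesis using B(3) by (auto simp: indicator_def)
    qed
  qed
  finally show ?thesis ..
qed

text \<open>Local volumes are summed over a disjoint Borel decomposition whose pieces lie in
  parametrizations. By \<open>local_volume_invariant\<close> on each piece, the sum has the right
  density in every other parametrization.\<close>

lemma h0_volume_exists: "\<exists>\<mu>. is_volume_measure TYPE('m) A h0 H \<mu>"
proof -
  let ?R = "restrict_space borel H"
  obtain F :: "nat \<Rightarrow> (real ^ 'm) set \<times> (real ^ 'm \<Rightarrow> 'a)" and Q
    where F: "\<And>i. F i \<in> params A 2 H" "\<And>i. Q i \<subseteq> snd (F i) ` fst (F i)" "(\<Union>i. Q i) = H"
    "disjoint_family Q" "\<And>i. Q i \<in> sets ?R"
    using disjointed_params[OF H_submanifold] by blast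
  have P: "(fst (F i), snd (F i)) \<in> params A 2 H" for i using F(1)[of i] by simp
  define \<mu>0 where "\<mu>0 B = (\<Sum>i. local_volume (fst (F i)) (snd (F i)) (B \<inter> Q i))" for B
  have pos: "positive (sets ?R) \<mu>0" by (simp add: positive_def \<mu>0_def local_volume_def)
  have ca: "countably_additive (sets ?R) \<mu>0"
  proof (rule countably_additiveI)
    fix B :: "nat \<Rightarrow> 'a set" assume B: "range B \<subseteq> sets ?R" "disjoint_family B" "(\<Union>i. B i) \<in> sets ?R"
    have "(\<Sum>n. \<mu>0 (B n)) = (\<Sum>i. \<Sum>n. local_volume (fst (F i)) (snd (F i)) (B n \<inter> Q i))"
      unfolding \<mu>0_def by (rule suminf_swap_ennreal)
    also have "\<dots> = (\<Sum>i. local_volume (fst (F i)) (snd (F i)) (\<Union>n. B n \<inter> Q i))"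
      by (intro suminf_cong local_volume_suminf[OF P]) (use B F(5) in \<open>auto simp: disjoint_family_on_def\<close>)
    also have "\<dots> = \<mu>0 (\<Union>n. B n)"
      unfolding \<mu>0_def Int_commute[of _ "Q i" for i] Int_UN_distrib ..
    finally show "(\<Sum>n. \<mu>0 (B n)) = \<mu>0 (\<Union>n. B n)" .
  qed
  define \<mu> where "\<mu> = measure_of (space ?R) (sets ?R) \<mu>0"
  have s: "sets \<mu> = sets ?R" unfolding \<mu>_def by (rule sets.sets_measure_of_eq)
  have e: "emeasure \<mu> B = \<mu>0 B" if "B \<in> sets ?R" for B
    unfolding \<mu>_def by (rule emeasure_measure_of_sigma[OF sets.sigma_algebra_axioms pos ca that])
  have "emeasure \<mu> B = local_volume W \<psi> B"
    if p: "(W, \<psi>) \<in> params A 2 H" "B \<in> sets ?R" "B \<subseteq> \<psi> ` W" for W \<psi> B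
  proof -
    have "emeasure \<mu> B = (\<Sum>i. local_volume W \<psi> (B \<inter> Q i))"
      unfolding e[OF p(2)] \<mu>0_def
      by (intro suminf_cong local_volume_invariant[OF P p(1)]) (use p F(2,5) in auto)
    also have "\<dots> = local_volume W \<psi> (\<Union>i. B \<inter> Q i)"
      by (rule local_volume_suminf[OF p(1)]) (use p(2) F(4,5) in \<open>auto simp: disjoint_family_on_def\<close>)
    also have "(\<Union>i. B \<inter> Q i) = B"
      using F(3) sets.sets_into_space[OF p(2)] by (auto simp: space_restrict_space)
    finally show ?thesis .
  qed
  then have "is_volume_measure TYPE('m) A h0 H \<mu>"
    unfolding is_volume_measure_def s local_volume_def gram_def by auto
  then show ?thesis by blast
qed

text \<open>Parametrizations of the relatively open set \<open>D\<close> are parametrizations of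
  \<open>H\<close>, so the restricted measure has the prescribed density. Uniqueness then identifies
  it with \<open>volume_measure\<close>, which is a definite description.\<close>

lemma restrict_volume:
  assumes \<mu>: "is_volume_measure TYPE('m) A h0 H \<mu>" and D: "openin (top_of_set H) D"
    and h: "\<And>W (\<psi>::real ^ 'm \<Rightarrow> 'a) x. (W, \<psi>) \<in> params A 2 H \<Longrightarrow> x \<in> W \<Longrightarrow> \<psi> x \<in> D \<Longrightarrow> gram h \<psi> x = gram h0 \<psi> x"
  shows "volume_measure TYPE('m) A h D = restrict_space \<mu> D"
proof (rule volume_measure_eq[OF submanifold_openin[OF H_submanifold D]])
  have s: "sets \<mu> = sets (restrict_space borel H)" using \<mu> by (simp add: is_volume_measure_def)
  have sp: "space \<mu> = H" using sets_eq_imp_space_eq[OF s] by (simp add: space_restrict_space)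
  have DH: "D \<subseteq> H" by (rule openin_imp_subset[OF D])
  have DM: "D \<inter> space \<mu> \<in> sets \<mu>" using openin_sets[OF D] s sp DH by (simp add: Int_absorb2)
  have sD: "sets (restrict_space \<mu> D) = sets (restrict_space borel D)"
    unfolding sets_restrict_space s image_image using DH by (auto simp: Int_absorb2 Int_assoc[symmetric])
  show "is_volume_measure TYPE('m) A h D (restrict_space \<mu> D)"
    unfolding is_volume_measure_def
  proof (intro conjI sD ballI, safe)
    fix W B and \<psi> :: "real ^ 'm \<Rightarrow> 'a"
    assume p: "(W, \<psi>) \<in> params A 2 D" and B: "B \<in> sets (restrict_space \<mu> D)" and BW: "B \<subseteq> \<psi> ` W"
    have pH: "(W, \<psi>) \<in> params A 2 H" by (rule params_mono[OF D p])
    have B': "B \<in> sets \<mu>" "B \<subseteq> D" using B DM by (auto simp: sets_restrict_space_iff)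
    have "emeasure (restrict_space \<mu> D) B = emeasure \<mu> B" by (rule emeasure_restrict_space[OF DM B'(2)])
    also have "\<dots> = (\<integral>\<^sup>+ x \<in> W \<inter> \<psi> -` B. ennreal (sqrt (gram h0 \<psi> x)) \<partial>lborel)"
      using \<mu> pH B'(1) BW unfolding is_volume_measure_def gram_def by blast
    also have "\<dots> = (\<integral>\<^sup>+ x \<in> W \<inter> \<psi> -` B. ennreal (sqrt (gram h \<psi> x)) \<partial>lborel)"
    proof (intro nn_integral_cong)
      fix x
      have "gram h \<psi> x = gram h0 \<psi> x" if "x \<in> W" by (rule h[OF pH that]) (use params_subset[OF p] that in auto)
      then show "ennreal (sqrt (gram h0 \<psi> x)) * indicator (W \<inter> \<psi> -` B) x = ennreal (sqrt (gram h \<psi> x)) * indicator (W \<inter> \<psi> -` B) x"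
        by (auto simp: indicator_def)
    qed
    finally show "emeasure (restrict_space \<mu> D) B = (\<integral>\<^sup>+ x \<in> W \<inter> \<psi> -` B. ennreal (sqrt (det (\<chi> i j. h (\<psi> x) (tmap A \<psi> x (axis i 1)) (tmap A \<psi> x (axis j 1))))) \<partial>lborel)"
      by (simp add: gram_def)
  qed
qed

theorem vol_L_exists:
  obtains \<mu> where "sets \<mu> = sets (restrict_space borel H)"
    "\<And>S V N. spacelike_cross_section TYPE('k::finite) A 2 g H S \<Longrightarrow> flow_domain TYPE('k) TYPE('m) A g H L S V \<Longrightarrow>
       rigging_field TYPE('k) A g L S V N \<Longrightarrow>
       volume_measure TYPE('m) A (rigged_metric g N) (null_flow A g L ` V) = restrict_space \<mu> (null_flow A g L ` V)"
proof -
  obtain \<mu> where \<mu>: "is_volume_measure TYPE('m) A h0 H \<mu>" using h0_volume_exists by blast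
  show thesis
  proof (rule that)
    show "sets \<mu> = sets (restrict_space borel H)" using \<mu> by (simp add: is_volume_measure_def)
    fix S V N
    assume a: "spacelike_cross_section TYPE('k::finite) A 2 g H S" "flow_domain TYPE('k) TYPE('m) A g H L S V"
       "rigging_field TYPE('k) A g L S V N"
    have S: "submanifold TYPE('k) A 2 S" using a(1) by (simp add: spacelike_cross_section_def)
    have op: "openin (top_of_set H) (null_flow A g L ` V)"
      using a(2) unfolding flow_domain_def diffeo_onto_image_def by blast
    show "volume_measure TYPE('m) A (rigged_metric g N) (null_flow A g L ` V) = restrict_space \<mu> (null_flow A g L ` V)"
      by (rule restrict_volume[OF \<mu> op]) (rule gram_rigged, assumption+, rule rigging_normalized[OF S a(2,3)], assumption, rule rigging_normalized[OF S a(2,3)])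
  qed
qed

end

section \<open>Flow boxes\<close>

text \<open>A left inverse of the differential and its continuity in operator norm give injectivity
  near \<open>a\<close>; the lower bound from \<open>linear_family_bounded_below\<close> keeps
  nearby differentials injective.\<close>

lemma C1_locally_injective:
  fixes f :: "'a::euclidean_space \<Rightarrow> 'b::euclidean_space"
  assumes S: "open S" "a \<in> S" and f: "Ck_on 1 S f" and inj: "inj (frechet_derivative f (at a))"
  obtains r where "r > 0" "ball a r \<subseteq> S" "inj_on f (ball a r)" "\<And>x. x \<in> ball a r \<Longrightarrow> inj (frechet_derivative f (at x))"
proof -
  let ?D = "\<lambda>x. frechet_derivative f (at x)"
  have lin: "linear (?D x)" if "x \<in> S" for x by (rule C1_linear_deriv[OF f that])
  obtain B where B: "linear B" "B \<circ> ?D a = id" using linear_injective_left_inverse[OF lin[OF S(2)] inj] by blast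
  have on: "\<exists>d>0. \<forall>x. dist a x < d \<longrightarrow> onorm (\<lambda>v. ?D x v - ?D a v) < e" if e: "e > 0" for e
  proof -
    have "isCont (\<lambda>x. \<Sum>b\<in>Basis. norm (?D x b - ?D a b)) a"
      using C1_continuous_deriv[OF f] S continuous_on_eq_continuous_at
      by (intro continuous_intros) blast
    then have "\<forall>\<^sub>F x in at a. dist (\<Sum>b\<in>Basis. norm (?D x b - ?D a b)) (\<Sum>b\<in>Basis. norm (?D a b - ?D a b)) < e"
      unfolding isCont_def by (rule tendstoD) (rule e)
    then have "\<forall>\<^sub>F x in nhds a. (\<Sum>b\<in>Basis. norm (?D x b - ?D a b)) < e"
      unfolding eventually_nhds_conv_at using e by (auto simp: dist_real_def elim: eventually_mono)
    with eventually_nhds_in_open[OF S] have "\<forall>\<^sub>F x in nhds a. onorm (\<lambda>v. ?D x v - ?D a v) < e"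
    proof eventually_elim
      case (elim x)
      have "onorm (\<lambda>v. ?D x v - ?D a v) \<le> (\<Sum>b\<in>Basis. norm (?D x b - ?D a b))"
        by (rule onorm_le) (rule linear_bound_sum[OF linear_compose_sub[OF lin[OF elim(1)] lin[OF S(2)]]])
      then show ?case using elim by simp
    qed
    then show ?thesis unfolding eventually_nhds_metric by (simp add: dist_commute)
  qed
  obtain r1 where r1: "r1 > 0" "ball a r1 \<subseteq> S" "inj_on f (ball a r1)"
    using has_derivative_locally_injective[where f = f and f' = ?D and g' = B, OF S(2,1) _ B(2) C1_deriv[OF f] on] B(1)
    by (auto simp: linear_conv_bounded_linear)
  obtain k where k: "k > 0" "\<forall>\<^sub>F y in at a within S. linear (?D y) \<and> (\<forall>v. k * norm v \<le> norm (?D y v))"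
    using linear_family_bounded_below[where A = ?D, OF lin C1_continuous_deriv[OF f] S(2) inj] by blast
  have "\<forall>\<^sub>F y in at a within S. inj (?D y)"
    using k(2)
  proof eventually_elim
    case (elim y)
    have l: "linear (?D y)" and b: "\<And>v. k * norm v \<le> norm (?D y v)" using elim by blast+
    show ?case unfolding linear_injective_0[OF l]
    proof (intro allI impI)
      fix v assume "?D y v = 0"
      then have "k * norm v \<le> 0" using b[of v] by simp
      then show "v = 0" using k(1) by (simp add: mult_le_0_iff)
    qed
  qed
  then have "\<forall>\<^sub>F y in nhds a. inj (?D y)"
    using at_within_open[OF S(2,1)] inj by (simp add: eventually_nhds_conv_at)
  then obtain r2 where r2: "r2 > 0" "\<And>y. dist y a < r2 \<Longrightarrow> inj (?D y)" unfolding eventually_nhds_metric by blast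
  show thesis
    by (rule that[of "min r1 r2"]) (use r1 r2 in \<open>auto simp: dist_commute intro: inj_on_subset\<close>)
qed

text \<open>\<open>params\<close> and \<open>diffeo_onto_image\<close> are phrased with
  \<open>inv_into\<close>, so an inverse obtained in another way has to be exchanged for it.\<close>

lemma homeomorphism_inv_into:
  assumes "homeomorphism S T f g" shows "homeomorphism S T f (inv_into S f)"
proof -
  have inj: "inj_on f S" using assms unfolding homeomorphism_def by (metis inj_on_inverseI)
  have eq: "inv_into S f y = g y" if "y \<in> T" for y
    using assms that inj unfolding homeomorphism_def by (metis imageI inv_into_f_eq)
  show ?thesis
    by (rule homeomorphism_cong[OF assms]) (simp_all add: eq)
qed

context atlas
begin

lemma Ck_map_1_compose:
  fixes h :: "'x::real_normed_vector \<Rightarrow> 'y::euclidean_space"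
  assumes f: "Ck_map A 1 T f" and h: "Ck_on 1 S h" "h ` S \<subseteq> T"
  shows "Ck_map A 1 S (\<lambda>x. f (h x))"
  unfolding Ck_map_def
proof (intro conjI ballI)
  show "continuous_on S (\<lambda>x. f (h x))"
    by (rule continuous_on_compose2[OF Ck_map_cont[OF f] Ck_on_continuous[OF h(1)] h(2)])
  fix c assume c: "c \<in> A"
  have "Ck_on 1 (S \<inter> (\<lambda>x. f (h x)) -` fst c) ((snd c \<circ> f) \<circ> h)"
    by (rule C1_compose[OF Ck_on_subset[OF h(1)] Ck_map_chart[OF f c]]) (use h(2) in auto)
  then show "Ck_on 1 (S \<inter> (\<lambda>x. f (h x)) -` fst c) (snd c \<circ> (\<lambda>x. f (h x)))" by (simp add: o_def)
qed

text \<open>The disc of a flow box has to be a C^2 submanifold. For an affine inner map the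
  derivative is constant, so second derivatives of a composite reduce to C^1 composition.\<close>

lemma Ck_map_2_affine:
  fixes E :: "'x::real_normed_vector \<Rightarrow> 'y::euclidean_space"
  assumes T: "open T" and f: "Ck_map A 2 T f" and S: "open S" and E: "bounded_linear E" "(\<lambda>x. p + E x) ` S \<subseteq> T"
  shows "Ck_map A 2 S (\<lambda>x. f (p + E x))"
    and "\<And>x u. x \<in> S \<Longrightarrow> tmap A (\<lambda>x. f (p + E x)) x u = tmap A f (p + E x) (E u)"
proof -
  let ?h = "\<lambda>x. p + E x"
  have dh: "(?h has_derivative E) (at x)" for x
    using bounded_linear_imp_has_derivative[OF E(1)] by (auto intro!: derivative_eq_intros)
  have h1: "Ck_on 1 S ?h" by (intro C1_intros C1_linear E(1))
  have k1: "Ck_map A 1 S (\<lambda>x. f (?h x))" by (rule Ck_map_1_compose[OF Ck_map_2D[OF f] h1 E(2)])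
  have d: "((snd c \<circ> (\<lambda>x. f (?h x))) has_derivative (\<lambda>u. frechet_derivative (snd c \<circ> f) (at (?h x)) (E u))) (at x)"
    if "x \<in> S" "c \<in> A" "f (?h x) \<in> fst c" for c x
  proof -
    have "(snd c \<circ> f) differentiable (at (?h x))"
      using Ck_map_differentiable[OF Ck_map_2D[OF f] that(2) _ that(3)] that(1) E(2) by auto
    from has_derivative_compose[OF dh this[unfolded frechet_derivative_works]] show ?thesis by (simp add: o_def)
  qed
  show "Ck_map A 2 S (\<lambda>x. f (?h x))"
    unfolding Ck_map_def
  proof (intro conjI ballI)
    show "continuous_on S (\<lambda>x. f (?h x))" by (rule Ck_map_cont[OF k1])
    fix c assume c: "c \<in> A"
    let ?S = "S \<inter> (\<lambda>x. f (?h x)) -` fst c" and ?T = "T \<inter> f -` fst c"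
    have oS: "open ?S" by (rule open_chart_preimage[OF S k1 c])
    show "Ck_on 2 ?S (snd c \<circ> (\<lambda>x. f (?h x)))"
      unfolding Ck_on_2_iff
    proof (intro conjI ballI allI)
      show "(snd c \<circ> (\<lambda>x. f (?h x))) differentiable (at x)" if "x \<in> ?S" for x
        using d[of x c] that c by (auto simp: differentiable_def)
      fix u
      have "Ck_on 1 ?T (\<lambda>x. frechet_derivative (snd c \<circ> f) (at x) (E u))"
        using Ck_map_chart[OF f c] unfolding Ck_on_2_iff by blast
      then have "Ck_on 1 ?S (\<lambda>x. frechet_derivative (snd c \<circ> f) (at (?h x)) (E u))"
        by (rule C1_compose'[OF Ck_on_subset[OF h1 Int_lower1]]) (use E(2) in auto)
      then show "Ck_on 1 ?S (\<lambda>x. frechet_derivative (snd c \<circ> (\<lambda>x. f (?h x))) (at x) u)"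
        by (rule Ck_on_cong[OF oS, rotated]) (use frechet_derivative_apply[OF d] c in auto)
    qed
  qed
  show "tmap A (\<lambda>x. f (?h x)) x u = tmap A f (?h x) (E u)" if "x \<in> S" for x u
    unfolding tmap_def using frechet_derivative_apply[OF d[OF that]] by (auto intro!: ext)
qed

end

section \<open>Integral curves of \<open>L\<close> as geodesics\<close>

context null_hyp
begin

text \<open>The chain rule trades the derivative of L \<circ> \<psi> in direction \<open>l\<close>
  for a time derivative, which turns \<nabla>_L L = 0 on \<open>H\<close> into an equation along the
  curve.\<close>

lemma L_parallel_at:
  fixes \<psi> :: "real ^ 'm \<Rightarrow> 'a" and y :: "real \<Rightarrow> real ^ 'm"
  assumes P: "(W, \<psi>) \<in> params A 2 H" and I: "open I" "t \<in> I" and yW: "y t \<in> W"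
    and y: "(y has_vector_derivative l) (at t)" and l: "tmap A \<psi> (y t) l = L (\<psi> (y t))"
    and c: "c \<in> A" "\<psi> (y t) \<in> fst c"
  shows "((snd c \<circ> (\<lambda>s. \<psi> (y s))) has_derivative (\<lambda>h. h *\<^sub>R L (\<psi> (y t)) c)) (at t)"
    and "(\<lambda>s. L (\<psi> (y s)) c) differentiable (at t)"
    and "cov_deriv A g c (\<lambda>s. \<psi> (y s)) (\<lambda>s. L (\<psi> (y s))) t 1 = 0"
proof -
  have y': "(y has_derivative (\<lambda>h. h *\<^sub>R l)) (at t)" using y by (simp add: has_vector_derivative_def)
  have \<psi>d: "(snd c \<circ> \<psi>) differentiable (at (y t))"
    by (rule Ck_map_differentiable[OF params_Ck_map_1[OF P] c(1) yW c(2)])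
  have "((snd c \<circ> (\<lambda>s. \<psi> (y s))) has_derivative (\<lambda>h. frechet_derivative (snd c \<circ> \<psi>) (at (y t)) (h *\<^sub>R l))) (at t)"
    using has_derivative_compose[OF y' \<psi>d[unfolded frechet_derivative_works]] by (simp add: o_def)
  moreover have "frechet_derivative (snd c \<circ> \<psi>) (at (y t)) (h *\<^sub>R l) = h *\<^sub>R L (\<psi> (y t)) c" for h
    unfolding linear_scale[OF linear_frechet_derivative[OF \<psi>d]] l[symmetric] tmap_apply[where f = \<psi>, OF c] ..
  ultimately show cd: "((snd c \<circ> (\<lambda>s. \<psi> (y s))) has_derivative (\<lambda>h. h *\<^sub>R L (\<psi> (y t)) c)) (at t)" by simp
  have Ld: "(\<lambda>x. L (\<psi> x) c) differentiable (at (y t))"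
    using L_C1[OF P c(1)] c(2) yW unfolding Ck_on_1 by blast
  have Lb: "((\<lambda>s. L (\<psi> (y s)) c) has_derivative (\<lambda>h. frechet_derivative (\<lambda>x. L (\<psi> x) c) (at (y t)) (h *\<^sub>R l))) (at t)"
    by (rule has_derivative_compose[OF y' Ld[unfolded frechet_derivative_works]])
  then show "(\<lambda>s. L (\<psi> (y s)) c) differentiable (at t)" by (auto simp: differentiable_def)
  have z: "cov_deriv A g c \<psi> (L \<circ> \<psi>) (y t) l = 0"
    using nullL P yW l c unfolding null_geodesic_field_def by blast
  have "frechet_derivative (snd c \<circ> (\<lambda>s. \<psi> (y s))) (at t) 1 = frechet_derivative (snd c \<circ> \<psi>) (at (y t)) l"
    unfolding frechet_derivative_apply[OF cd] l[symmetric] tmap_apply[where f = \<psi>, OF c] by simp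
  then show "cov_deriv A g c (\<lambda>s. \<psi> (y s)) (\<lambda>s. L (\<psi> (y s))) t 1 = 0"
    using z unfolding cov_deriv_def frechet_derivative_apply[OF Lb] by (simp add: o_def)
qed

text \<open>The velocity is \<open>L\<close> itself, so the geodesic equation is \<nabla>_L L = 0.
  Since \<open>L\<close> is C^1 along a C^1 curve, the curve is of class C^2, as
  \<open>geodesic\<close> demands.\<close>

lemma integral_curve_geodesic:
  fixes \<psi> :: "real ^ 'm \<Rightarrow> 'a" and y :: "real \<Rightarrow> real ^ 'm"
  assumes P: "(W, \<psi>) \<in> params A 2 H" and I: "open I" "is_interval I" and yW: "\<And>t. t \<in> I \<Longrightarrow> y t \<in> W"
    and l: "\<And>x. x \<in> W \<Longrightarrow> tmap A \<psi> x (l x) = L (\<psi> x)" and lc: "continuous_on W l"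
    and y: "\<And>t. t \<in> I \<Longrightarrow> (y has_vector_derivative l (y t)) (at t)"
  shows "geodesic A g I (\<lambda>t. \<psi> (y t))" and "\<And>t. t \<in> I \<Longrightarrow> tmap A (\<lambda>t. \<psi> (y t)) t 1 = L (\<psi> (y t))"
proof -
  let ?\<gamma> = "\<lambda>t. \<psi> (y t)"
  note at = L_parallel_at[OF P I(1) _ yW y l[OF yW]]
  have cy: "continuous_on I y"
    using y has_vector_derivative_continuous continuous_at_imp_continuous_on by blast
  have y1: "Ck_on 1 I y"
  proof (rule C1_I)
    show "(y has_derivative (\<lambda>h. h *\<^sub>R l (y t))) (at t)" if "t \<in> I" for t
      using y[OF that] by (simp add: has_vector_derivative_def)
    show "continuous_on I (\<lambda>t. u *\<^sub>R l (y t))" for u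
      using yW by (intro continuous_intros continuous_on_compose2[OF lc cy]) auto
  qed
  show tm: "tmap A ?\<gamma> t 1 = L (?\<gamma> t)" if t: "t \<in> I" for t
  proof
    fix c
    have "L (?\<gamma> t) c = 0" if "\<not> (c \<in> A \<and> ?\<gamma> t \<in> fst c)"
      using L_props(1)[OF params_H[OF P yW[OF t]]] that unfolding tspace_def by blast
    then show "tmap A ?\<gamma> t 1 c = L (?\<gamma> t) c"
      unfolding tmap_def using frechet_derivative_apply[OF at(1)[OF t t t t]] by auto
  qed
  have k1: "Ck_map A 1 I ?\<gamma>"
    by (rule Ck_map_1_compose[OF params_Ck_map_1[OF P] y1]) (use yW in auto)
  have k2: "Ck_map A 2 I ?\<gamma>"
    unfolding Ck_map_def
  proof (intro conjI ballI)
    show "continuous_on I ?\<gamma>" by (rule Ck_map_cont[OF k1])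
    fix c assume c: "c \<in> A"
    let ?S = "I \<inter> ?\<gamma> -` fst c"
    have S: "open ?S" by (rule open_chart_preimage[OF I(1) k1 c])
    show "Ck_on 2 ?S (snd c \<circ> ?\<gamma>)"
      unfolding Ck_on_2_iff
    proof (intro conjI ballI allI)
      show "(snd c \<circ> ?\<gamma>) differentiable (at t)" if "t \<in> ?S" for t
        by (rule Ck_map_differentiable[OF k1 c]) (use that in auto)
      fix u
      have "Ck_on 1 ?S (\<lambda>t. L (?\<gamma> t) c)"
        by (rule C1_compose'[OF Ck_on_subset[OF y1 Int_lower1] L_C1[OF P c]]) (use yW in auto)
      then have "Ck_on 1 ?S (\<lambda>t. u *\<^sub>R L (?\<gamma> t) c)" by (rule C1_bounded_linear[OF bounded_linear_scaleR_right])
      then show "Ck_on 1 ?S (\<lambda>t. frechet_derivative (snd c \<circ> ?\<gamma>) (at t) u)"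
        by (rule Ck_on_cong[OF S, rotated]) (use frechet_derivative_apply[OF at(1)] c in auto)
    qed
  qed
  have "parallel_along A g I ?\<gamma> (\<lambda>t. tmap A ?\<gamma> t 1)"
    unfolding parallel_along_def
  proof (intro ballI conjI impI)
    fix t assume t: "t \<in> I"
    show "tmap A ?\<gamma> t 1 \<in> tspace A (?\<gamma> t)" by (rule Ck_map_tmap_in_tspace[OF I(1) k1 t])
    fix c assume c: "c \<in> A" "?\<gamma> t \<in> fst c"
    note at' = at[OF t t t t c]
    show "(\<lambda>s. tmap A ?\<gamma> s 1 c) differentiable (at t)"
      by (rule differentiable_cong_open[OF I(1) t _ at'(2)]) (simp add: tm)
    have "frechet_derivative (\<lambda>s. tmap A ?\<gamma> s 1 c) (at t) = frechet_derivative (\<lambda>s. L (?\<gamma> s) c) (at t)"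
      by (rule frechet_derivative_cong_open[OF I(1) t]) (simp add: tm)
    then show "cov_deriv A g c ?\<gamma> (\<lambda>t. tmap A ?\<gamma> t 1) t 1 = 0"
      using at'(3) unfolding cov_deriv_def tm[OF t] by simp
  qed
  with I k2 show "geodesic A g I ?\<gamma>" by (simp add: geodesic_def)
qed

end

text \<open>Gathers all choices made near a point, so that no further shrinking interrupts the
  arguments. \<open>l\<close> is \<open>L\<close> read in \<psi>; \<open>E\<close> embeds
  isometrically into the hyperplane orthogonal to \<open>l x0\<close>, so that x0 + E \<xi> is a
  disc transversal to the flow \<Phi> of \<open>l\<close>. One \<delta> bounds both its radius and
  the time, and \<open>K\<close> bounds the coefficients of parallel transport uniformly over the
  box.\<close>

locale flow_box = null_hyp A g T L H mt
  for A :: "('a::{t2_space, second_countable_topology}, 'n::finite) chart set" and g :: "('a, 'n) tensor2"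
    and T L :: "'a \<Rightarrow> ('a, 'n) tvec" and H :: "'a set" and mt :: "'m::finite itself" +
  fixes kt :: "'k::finite itself" and c :: "('a, 'n) chart" and W :: "(real ^ 'm) set" and \<psi> :: "real ^ 'm \<Rightarrow> 'a"
    and x0 :: "real ^ 'm" and R K \<delta> :: real and l :: "real ^ 'm \<Rightarrow> real ^ 'm" and E :: "real ^ 'k \<Rightarrow> real ^ 'm"
    and \<Phi> :: "(real ^ 'm) \<times> real \<Rightarrow> real ^ 'm"
  assumes card_k: "CARD('k) + 2 = CARD('n)"
    and c: "c \<in> A" and P: "(W, \<psi>) \<in> params A 2 H" and Wc: "\<psi> ` W \<subseteq> fst c"
    and l: "\<And>x. x \<in> W \<Longrightarrow> tmap A \<psi> x (l x) = L (\<psi> x)" and l1: "Ck_on 1 W l"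
    and \<delta>: "0 < \<delta>" and R: "cball x0 R \<subseteq> W" "\<delta> \<le> R / 2"
    and E: "linear E" "\<And>\<xi>. norm (E \<xi>) = norm \<xi>" "\<And>\<xi>. E \<xi> \<bullet> l x0 = 0"
    and transversal: "\<And>x. x \<in> ball x0 \<delta> \<Longrightarrow> l x \<bullet> l x0 \<noteq> 0"
    and \<Phi>0: "\<And>x. x \<in> ball x0 \<delta> \<Longrightarrow> \<Phi> (x, 0) = x"
    and \<Phi>R: "\<And>x t. x \<in> ball x0 \<delta> \<Longrightarrow> t \<in> {-\<delta><..<\<delta>} \<Longrightarrow> \<Phi> (x, t) \<in> cball x0 R"
    and \<Phi>': "\<And>x t. x \<in> ball x0 \<delta> \<Longrightarrow> t \<in> {-\<delta><..<\<delta>} \<Longrightarrow>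
       ((\<lambda>t. \<Phi> (x, t)) has_vector_derivative l (\<Phi> (x, t))) (at t)"
    and \<Phi>1: "Ck_on 1 (ball 0 \<delta> \<times> {-\<delta><..<\<delta>}) (\<lambda>(\<xi>, t). \<Phi> (x0 + E \<xi>, t))"
    and \<Phi>inj: "inj_on (\<lambda>(\<xi>, t). \<Phi> (x0 + E \<xi>, t)) (ball 0 \<delta> \<times> {-\<delta><..<\<delta>})"
    and \<Phi>inj': "\<And>z. z \<in> ball 0 \<delta> \<times> {-\<delta><..<\<delta>} \<Longrightarrow> inj (frechet_derivative (\<lambda>(\<xi>, t). \<Phi> (x0 + E \<xi>, t)) (at z))"
    and K: "0 \<le> K" "3 * (\<delta> / 2) * K \<le> 1 / 2"
      "\<And>x v. x \<in> cball x0 R \<Longrightarrow> norm (christoffel A g c (snd c (\<psi> x)) (L (\<psi> x) c) v) \<le> K * norm v"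
begin

definition D :: "(real ^ 'k) set" where "D = ball 0 \<delta>"
text \<open>Half of the time range of \<Phi>: parallel transport is solved on the closed interval
  from -\<delta>/2 to \<delta>/2, which still lies in the open range.\<close>

definition I :: "real set" where "I = {-\<delta>/2<..<\<delta>/2}"
definition \<Theta> :: "(real ^ 'k) \<times> real \<Rightarrow> real ^ 'm" where "\<Theta> z = \<Phi> (x0 + E (fst z), snd z)"
definition \<sigma> :: "real ^ 'k \<Rightarrow> 'a" where "\<sigma> \<xi> = \<psi> (x0 + E \<xi>)"
definition S :: "'a set" where "S = \<sigma> ` D"
definition V :: "('a \<times> real) set" where "V = S \<times> I"
abbreviation F :: "'a \<times> real \<Rightarrow> 'a" where "F \<equiv> null_flow A g L"

lemma I_sub: "I \<subseteq> {-\<delta><..<\<delta>}" and I0: "0 \<in> I" and I_open: "open I" and I_interval: "is_interval I"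
  and D_open: "open D" and DI_open: "open (D \<times> I)"
  using \<delta> by (auto intro!: open_Times simp: I_def D_def is_interval_convex)

lemma DI_sub: "D \<times> I \<subseteq> ball 0 \<delta> \<times> {-\<delta><..<\<delta>}"
  using I_sub by (auto simp: D_def)

lemma bl_E: "bounded_linear E" and E_inj: "E u = 0 \<Longrightarrow> u = 0"
  using E(1) E(2)[of u] by (auto simp: linear_conv_bounded_linear)

lemma xi_ball: "\<xi> \<in> D \<Longrightarrow> x0 + E \<xi> \<in> ball x0 \<delta>"
  using E(2) by (simp add: dist_norm D_def)

lemma ball_W: "x \<in> ball x0 \<delta> \<Longrightarrow> x \<in> W"
  using R \<delta> by (auto simp: subset_iff)

lemma xi_W: "\<xi> \<in> D \<Longrightarrow> x0 + E \<xi> \<in> W"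
  using xi_ball ball_W by blast

lemma \<Theta>_C1: "Ck_on 1 (D \<times> I) \<Theta>"
proof -
  have "\<Theta> = (\<lambda>(\<xi>, t). \<Phi> (x0 + E \<xi>, t))" by (auto simp: \<Theta>_def)
  then show ?thesis using Ck_on_subset[OF \<Phi>1 DI_sub] by simp
qed

lemma \<Theta>_inj: "inj_on \<Theta> (D \<times> I)" and \<Theta>_inj': "z \<in> D \<times> I \<Longrightarrow> inj (frechet_derivative \<Theta> (at z))"
proof -
  have eq: "\<Theta> = (\<lambda>(\<xi>, t). \<Phi> (x0 + E \<xi>, t))" by (auto simp: \<Theta>_def)
  show "inj_on \<Theta> (D \<times> I)" unfolding eq by (rule inj_on_subset[OF \<Phi>inj DI_sub])
  show "inj (frechet_derivative \<Theta> (at z))" if "z \<in> D \<times> I" unfolding eq by (rule \<Phi>inj') (use DI_sub that in blast)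
qed

lemma \<Theta>_R: "z \<in> D \<times> I \<Longrightarrow> \<Theta> z \<in> cball x0 R"
  unfolding \<Theta>_def by (rule \<Phi>R) (use xi_ball I_sub in auto)

lemma \<Theta>_W: "z \<in> D \<times> I \<Longrightarrow> \<Theta> z \<in> W"
  using \<Theta>_R R(1) by blast

lemma \<Theta>_0: "\<xi> \<in> D \<Longrightarrow> \<Theta> (\<xi>, 0) = x0 + E \<xi>"
  unfolding \<Theta>_def using \<Phi>0 xi_ball by simp

text \<open>The disc together with time has dimension \<open>CARD('k) + 1\<close>, which equals
  \<open>CARD('m)\<close>, so invariance of domain turns the injective map into an open
  embedding.\<close>

lemma \<Theta>_homeo: "homeomorphism (D \<times> I) (\<Theta> ` (D \<times> I)) \<Theta> (inv_into (D \<times> I) \<Theta>)"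
  and \<Theta>_open: "open (\<Theta> ` (D \<times> I))"
proof -
  have dim: "DIM(real ^ 'm) \<le> DIM((real ^ 'k) \<times> real)" using card_m card_k by simp
  note cont = Ck_on_continuous[OF \<Theta>_C1]
  show "open (\<Theta> ` (D \<times> I))" by (rule invariance_of_domain_gen[OF DI_open cont \<Theta>_inj dim])
  obtain h where "homeomorphism (D \<times> I) (\<Theta> ` (D \<times> I)) \<Theta> h"
    using invariance_of_domain_homeomorphism[OF DI_open cont dim \<Theta>_inj] .
  then show "homeomorphism (D \<times> I) (\<Theta> ` (D \<times> I)) \<Theta> (inv_into (D \<times> I) \<Theta>)"
    by (rule homeomorphism_inv_into)
qed

subsection \<open>The cross-section\<close>

lemma \<sigma>_Ck_map: "Ck_map A 2 D \<sigma>" and \<sigma>_tmap: "\<xi> \<in> D \<Longrightarrow> tmap A \<sigma> \<xi> u = tmap A \<psi> (x0 + E \<xi>) (E u)"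
  unfolding \<sigma>_def
  using Ck_map_2_affine[OF params_open[OF P] params_Ck_map[OF P] D_open bl_E, of x0] xi_W by auto

lemma \<sigma>_homeo: "homeomorphism D S \<sigma> (inv_into D \<sigma>)"
proof -
  obtain h where h: "linear h" "h \<circ> E = id"
    using linear_injective_left_inverse[OF E(1)] E_inj by (auto simp: linear_injective_0[OF E(1)])
  let ?\<iota> = "\<lambda>\<xi>. x0 + E \<xi>"
  have hE: "h (E \<xi>) = \<xi>" for \<xi> using h(2) by (simp add: fun_eq_iff)
  have "homeomorphism D (?\<iota> ` D) ?\<iota> (\<lambda>x. h (x - x0))"
    unfolding homeomorphism_def
  proof (intro conjI ballI)
    show "continuous_on D ?\<iota>" by (intro continuous_intros linear_continuous_on bl_E)
    show "continuous_on (?\<iota> ` D) (\<lambda>x. h (x - x0))"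
      by (rule bounded_linear.continuous_on[OF h(1)[unfolded linear_conv_bounded_linear]]) (intro continuous_intros)
  qed (auto simp: hE image_image)
  moreover have "homeomorphism (?\<iota> ` D) (\<psi> ` (?\<iota> ` D)) \<psi> (inv_into (?\<iota> ` D) \<psi>)"
    by (rule homeomorphism_inv_into_subset[OF params_homeo[OF P]]) (use xi_W in auto)
  ultimately have "homeomorphism D (\<psi> ` (?\<iota> ` D)) (\<psi> \<circ> ?\<iota>) ((\<lambda>x. h (x - x0)) \<circ> inv_into (?\<iota> ` D) \<psi>)"
    by (rule homeomorphism_compose)
  moreover have "\<psi> \<circ> ?\<iota> = \<sigma>" "\<psi> ` (?\<iota> ` D) = S" by (auto simp: \<sigma>_def S_def)
  ultimately show ?thesis using homeomorphism_inv_into by metis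
qed

lemma \<sigma>_params: "(D, \<sigma>) \<in> params A 2 S"
proof -
  have "u = 0" if "\<xi> \<in> D" "tmap A \<sigma> \<xi> u = zero_tvec" for \<xi> u
    using params_immersion[OF P xi_W[OF that(1)], of "E u"] that E_inj by (simp add: \<sigma>_tmap)
  then show ?thesis unfolding params_def using \<sigma>_Ck_map \<sigma>_homeo D_open by (auto simp: S_def)
qed

lemma S_H: "S \<subseteq> H"
  unfolding S_def \<sigma>_def using params_H[OF P] xi_W by auto

lemma S_submanifold: "submanifold TYPE('k) A 2 S"
  unfolding submanifold_def
proof
  fix p assume "p \<in> S"
  then have "p \<in> \<sigma> ` D" by (simp add: S_def)
  then show "\<exists>(W, \<sigma>::real ^ 'k \<Rightarrow> 'a)\<in>params A 2 S. p \<in> \<sigma> ` W"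
    by (intro bexI[OF _ \<sigma>_params]) simp
qed

text \<open>A null vector tangent to the disc would be a multiple of \<open>l\<close>. Tangent
  vectors of the disc come from \<open>E\<close> and are orthogonal to \<open>l x0\<close>, whereas
  \<open>l\<close> is not, so such a vector vanishes.\<close>

lemma cross_section: "spacelike_cross_section TYPE('k) A 2 g H S"
  unfolding spacelike_cross_section_def
proof (intro conjI card_k S_H S_submanifold ballI impI)
  fix z v assume z: "z \<in> S" and v: "v \<in> sub_tspace TYPE('k) A S z" "v \<noteq> zero_tvec"
  obtain \<xi> where \<xi>: "\<xi> \<in> D" "z = \<sigma> \<xi>" using z by (auto simp: S_def)
  let ?x = "x0 + E \<xi>"
  note xW = xi_W[OF \<xi>(1)]
  obtain u where u: "v = tmap A \<sigma> \<xi> u" using v(1) sub_tspace_eq[OF \<sigma>_params \<xi>(1)] \<xi>(2) by auto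
  have v': "v = tmap A \<psi> ?x (E u)" unfolding u by (rule \<sigma>_tmap[OF \<xi>(1)])
  have zx: "z = \<psi> ?x" by (simp add: \<xi>(2) \<sigma>_def)
  have "g z v v \<noteq> 0"
  proof
    assume "g z v v = 0"
    then obtain k where k: "E u = k *\<^sub>R l ?x"
      using tangent_nonneg(2)[OF P xW l[OF xW], of "E u"] unfolding zx v' by blast
    have "k * (l ?x \<bullet> l x0) = 0" using E(3)[of u] unfolding k by simp
    then have "E u = 0" using transversal[OF xi_ball[OF \<xi>(1)]] k by simp
    then have "tmap A \<psi> ?x (E u) = tmap A \<psi> ?x 0" by simp
    moreover have "tmap A \<psi> ?x 0 = zero_tvec"
    proof (rule tspace_eqI[OF tmap_tspace[OF P xW] zero_in_tspace c])
      show fc: "\<psi> ?x \<in> fst c" using Wc xW by auto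
      show "tmap A \<psi> ?x 0 c = 0" by (rule linear_0[OF tmap_chart_linear[OF P xW c fc]])
    qed
    ultimately show False using v(2) v' by simp
  qed
  moreover have "g z v v \<ge> 0" unfolding zx v' by (rule tangent_nonneg(1)[OF P xW])
  ultimately show "0 < g z v v" by simp
qed

subsection \<open>The flow\<close>

lemma curve:
  assumes \<xi>: "\<xi> \<in> D"
  shows "geodesic A g I (\<lambda>t. \<psi> (\<Theta> (\<xi>, t)))" and "t \<in> I \<Longrightarrow> tmap A (\<lambda>t. \<psi> (\<Theta> (\<xi>, t))) t 1 = L (\<psi> (\<Theta> (\<xi>, t)))"
proof -
  have y: "((\<lambda>t. \<Theta> (\<xi>, t)) has_vector_derivative l (\<Theta> (\<xi>, t))) (at t)" if "t \<in> I" for t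
    unfolding \<Theta>_def fst_conv snd_conv by (rule \<Phi>'[OF xi_ball[OF \<xi>]]) (use that I_sub in auto)
  have yW: "\<Theta> (\<xi>, t) \<in> W" if "t \<in> I" for t using \<Theta>_W \<xi> that by simp
  note * = integral_curve_geodesic[where y = "\<lambda>t. \<Theta> (\<xi>, t)", OF P I_open I_interval yW l Ck_on_continuous[OF l1] y]
  show "geodesic A g I (\<lambda>t. \<psi> (\<Theta> (\<xi>, t)))" by (rule *(1))
  show "t \<in> I \<Longrightarrow> tmap A (\<lambda>t. \<psi> (\<Theta> (\<xi>, t))) t 1 = L (\<psi> (\<Theta> (\<xi>, t)))" by (rule *(2))
qed

text \<open>Where the two descriptions of the flow meet: the integral curve is a geodesic with
  initial velocity \<open>L\<close>, and the exponential map has to follow it.\<close>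

lemma F_eq: "\<xi> \<in> D \<Longrightarrow> t \<in> I \<Longrightarrow> F (\<sigma> \<xi>, t) = \<psi> (\<Theta> (\<xi>, t))"
  using null_flow_geodesic[OF curve(1) I0, of \<xi> t L] curve(2)[OF _ I0, of \<xi>] \<Theta>_0[of \<xi>] by (simp add: \<sigma>_def)

lemma F_exp: "\<xi> \<in> D \<Longrightarrow> t \<in> I \<Longrightarrow> exp_defined A g (\<sigma> \<xi>) (scale_tvec t (L (\<sigma> \<xi>)))"
  using exp_rel_geodesic[OF curve(1) I0, of \<xi> t] curve(2)[OF _ I0, of \<xi>] \<Theta>_0[of \<xi>]
  unfolding exp_defined_def by (auto simp: \<sigma>_def)

lemma F_H: "\<xi> \<in> D \<Longrightarrow> t \<in> I \<Longrightarrow> F (\<sigma> \<xi>, t) \<in> H"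
  unfolding F_eq by (rule params_H[OF P \<Theta>_W]) simp

lemma F_image: "F ` V = \<psi> ` \<Theta> ` (D \<times> I)"
proof -
  have "V = (\<lambda>z. (\<sigma> (fst z), snd z)) ` (D \<times> I)"
    using map_prod_surj_on[of \<sigma> D S id I I] by (simp add: V_def S_def map_prod_def split_beta)
  then have "F ` V = (\<lambda>z. F (\<sigma> (fst z), snd z)) ` (D \<times> I)" by (simp only: image_image)
  also have "\<dots> = (\<lambda>z. \<psi> (\<Theta> z)) ` (D \<times> I)"
    by (rule image_cong[OF refl]) (use F_eq in auto)
  finally show ?thesis by (simp add: image_image)
qed

lemma F_homeo: "homeomorphism V (F ` V) F (inv_into V F)"
proof -
  have "homeomorphism (S \<times> I) (D \<times> I) (map_prod (inv_into D \<sigma>) id) (map_prod \<sigma> id)"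
  proof -
    have c: "continuous_on S (inv_into D \<sigma>)" "continuous_on D \<sigma>" and i: "\<And>x. x \<in> D \<Longrightarrow> inv_into D \<sigma> (\<sigma> x) = x"
      using \<sigma>_homeo unfolding homeomorphism_def by blast+
    have "continuous_on (S \<times> I) (\<lambda>z. (inv_into D \<sigma> (fst z), snd z))" "continuous_on (D \<times> I) (\<lambda>z. (\<sigma> (fst z), snd z))"
      by (intro continuous_intros continuous_on_compose2[OF c(1)] continuous_on_compose2[OF c(2)]; auto)+
    then show ?thesis unfolding homeomorphism_def map_prod_def using i
      by (force simp: split_beta S_def image_iff)
  qed
  moreover note \<Theta>_homeo
  ultimately have "homeomorphism V (\<Theta> ` (D \<times> I)) (\<Theta> \<circ> map_prod (inv_into D \<sigma>) id) (map_prod \<sigma> id \<circ> inv_into (D \<times> I) \<Theta>)"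
    unfolding V_def by (rule homeomorphism_compose)
  moreover have "homeomorphism (\<Theta> ` (D \<times> I)) (\<psi> ` \<Theta> ` (D \<times> I)) \<psi> (inv_into (\<Theta> ` (D \<times> I)) \<psi>)"
    by (rule homeomorphism_inv_into_subset[OF params_homeo[OF P]]) (use \<Theta>_W in auto)
  ultimately have h: "homeomorphism V (F ` V) (\<psi> \<circ> (\<Theta> \<circ> map_prod (inv_into D \<sigma>) id))
      ((map_prod \<sigma> id \<circ> inv_into (D \<times> I) \<Theta>) \<circ> inv_into (\<Theta> ` (D \<times> I)) \<psi>)"
    unfolding F_image by (rule homeomorphism_compose)
  have "homeomorphism V (F ` V) F ((map_prod \<sigma> id \<circ> inv_into (D \<times> I) \<Theta>) \<circ> inv_into (\<Theta> ` (D \<times> I)) \<psi>)"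
  proof (rule homeomorphism_cong[OF h])
    fix z assume "z \<in> V"
    then obtain \<xi> t where z: "\<xi> \<in> D" "t \<in> I" "z = (\<sigma> \<xi>, t)" by (auto simp: V_def S_def)
    have "inv_into D \<sigma> (\<sigma> \<xi>) = \<xi>" by (rule params_inv[OF \<sigma>_params z(1)])
    then show "F z = (\<psi> \<circ> (\<Theta> \<circ> map_prod (inv_into D \<sigma>) id)) z" using F_eq z by simp
  qed auto
  then show ?thesis by (rule homeomorphism_inv_into)
qed

lemma inv_F: "\<xi> \<in> D \<Longrightarrow> t \<in> I \<Longrightarrow> inv_into V F (\<psi> (\<Theta> (\<xi>, t))) = (\<sigma> \<xi>, t)"
proof -
  assume "\<xi> \<in> D" "t \<in> I"
  then have "(\<sigma> \<xi>, t) \<in> V" "F (\<sigma> \<xi>, t) = \<psi> (\<Theta> (\<xi>, t))" using F_eq by (auto simp: V_def S_def)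
  then show ?thesis using F_homeo unfolding homeomorphism_def by metis
qed

text \<open>An arbitrary parametrization of \<open>S\<close> differs from \<sigma> by a C^1 map
  \<tau>, through which the flow becomes \<psi> after \<Theta>; \<open>lift_C1\<close> then reads
  the result in the given parametrization of \<open>H\<close>.\<close>

lemma diffeo1:
  fixes \<sigma>' :: "real ^ 'k \<Rightarrow> 'a" and \<psi>' :: "real ^ 'm \<Rightarrow> 'a"
  assumes P1: "(W', \<sigma>') \<in> params A 2 S" and P2: "(U, \<psi>') \<in> params A 2 H"
  shows "Ck_on 1 {(x, t). x \<in> W' \<and> (\<sigma>' x, t) \<in> V \<and> F (\<sigma>' x, t) \<in> \<psi>' ` U} (\<lambda>(x, t). inv_into U \<psi>' (F (\<sigma>' x, t)))"
proof -
  have sub: "\<sigma>' ` W' \<subseteq> \<sigma> ` D" using params_subset[OF P1] by (simp add: S_def)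
  let ?\<tau> = "\<lambda>x. inv_into D \<sigma> (\<sigma>' x)"
  have \<tau>: "Ck_on 1 W' ?\<tau>" by (rule lift_C1(1)[OF \<sigma>_params params_open[OF P1] params_Ck_map_1[OF P1] sub])
  have \<tau>D: "?\<tau> x \<in> D" "\<sigma> (?\<tau> x) = \<sigma>' x" if "x \<in> W'" for x
    using that sub by (meson image_subset_iff inv_into_into f_inv_into_f)+
  let ?Z = "W' \<times> I" and ?\<kappa> = "\<lambda>z. \<Theta> (?\<tau> (fst z), snd z)"
  have Z: "open ?Z" by (intro open_Times params_open[OF P1] I_open)
  have k1: "Ck_on 1 ?Z (\<lambda>z. (?\<tau> (fst z), snd z))"
    by (intro C1_Pair C1_compose'[OF C1_linear[OF bounded_linear_fst] \<tau>] C1_linear bounded_linear_snd) auto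
  have \<kappa>: "Ck_on 1 ?Z ?\<kappa>" by (rule C1_compose'[OF k1 \<Theta>_C1]) (use \<tau>D in auto)
  have f: "Ck_map A 1 ?Z (\<lambda>z. \<psi> (?\<kappa> z))"
    by (rule Ck_map_1_compose[OF params_Ck_map_1[OF P] \<kappa>]) (use \<tau>D \<Theta>_W in auto)
  have feq: "F (\<sigma>' x, t) = \<psi> (?\<kappa> (x, t))" if "(x, t) \<in> ?Z" for x t
    using F_eq[OF \<tau>D(1), of x t] \<tau>D(2)[of x] that by auto
  obtain O' where O': "open O'" "\<psi>' ` U = H \<inter> O'" using params_openin[OF P2] by (auto simp: openin_open)
  let ?X = "{(x, t). x \<in> W' \<and> (\<sigma>' x, t) \<in> V \<and> F (\<sigma>' x, t) \<in> \<psi>' ` U}"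
  have XZ: "?X \<subseteq> ?Z" by (auto simp: V_def)
  have VS: "(\<sigma>' x, t) \<in> V" if "(x, t) \<in> ?Z" for x t using that params_subset[OF P1] by (auto simp: V_def)
  \<comment> \<open>\<open>lift_C1\<close> wants an open domain, so the condition on the image in
    \<open>H\<close> is replaced by membership in an open set of the ambient manifold.\<close>
  have "?X = ?Z \<inter> (\<lambda>z. \<psi> (?\<kappa> z)) -` O'"
  proof -
    have "\<psi> (?\<kappa> z) \<in> H" if "z \<in> ?Z" for z
      by (rule params_H[OF P \<Theta>_W]) (use that \<tau>D in auto)
    then show ?thesis unfolding O'(2) using feq VS by (auto simp: V_def)
  qed
  then have X: "open ?X" using continuous_open_preimage[OF Ck_map_cont[OF f] Z O'(1)] by simp
  have "(\<lambda>z. \<psi> (?\<kappa> z)) ` ?X \<subseteq> \<psi>' ` U"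
  proof (rule image_subsetI)
    fix z assume z: "z \<in> ?X"
    then have "(fst z, snd z) \<in> ?Z" "F (\<sigma>' (fst z), snd z) \<in> \<psi>' ` U" using XZ by auto
    then show "\<psi> (?\<kappa> z) \<in> \<psi>' ` U" using feq[of "fst z" "snd z"] by simp
  qed
  then have "Ck_on 1 ?X (\<lambda>z. inv_into U \<psi>' (\<psi> (?\<kappa> z)))"
    by (rule lift_C1(1)[OF P2 X Ck_map_subset[OF f XZ]])
  then show ?thesis
  proof (rule Ck_on_cong[OF X, rotated])
    fix z assume "z \<in> ?X"
    then have "(fst z, snd z) \<in> ?Z" using XZ by auto
    from feq[OF this] show "inv_into U \<psi>' (\<psi> (?\<kappa> z)) = (\<lambda>(x, t). inv_into U \<psi>' (F (\<sigma>' x, t))) z"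
      by (simp add: case_prod_unfold)
  qed
qed

text \<open>The inverse of \<Theta> is C^1 by \<open>C1_lift\<close>, because it is continuous and
  \<Theta> has injective differentials. The disc and time components of this inverse then describe
  the inverse of the flow.\<close>

lemma diffeo2:
  fixes \<sigma>' :: "real ^ 'k \<Rightarrow> 'a" and \<psi>' :: "real ^ 'm \<Rightarrow> 'a"
  assumes P1: "(W', \<sigma>') \<in> params A 2 S" and P2: "(U, \<psi>') \<in> params A 2 H"
  shows "Ck_on 1 {y \<in> U. \<psi>' y \<in> F ` V \<and> fst (inv_into V F (\<psi>' y)) \<in> \<sigma>' ` W'}
      (\<lambda>y. (inv_into W' \<sigma>' (fst (inv_into V F (\<psi>' y))), snd (inv_into V F (\<psi>' y))))"
proof -
  have FV: "openin (top_of_set H) (F ` V)"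
    unfolding F_image by (rule params_image_openin[OF P \<Theta>_open]) (use \<Theta>_W in auto)
  let ?Ya = "U \<inter> \<psi>' -` (F ` V)"
  have Y0: "open ?Ya" by (rule params_preimage_open[OF P2 FV])
  let ?a = "\<lambda>y. inv_into W \<psi> (\<psi>' y)" and ?\<eta> = "\<lambda>y. inv_into (D \<times> I) \<Theta> (inv_into W \<psi> (\<psi>' y))"
  have "F ` V \<subseteq> \<psi> ` W" unfolding F_image using \<Theta>_W by auto
  then have a: "Ck_on 1 ?Ya ?a"
    by (intro lift_C1(1)[OF P Y0 Ck_map_subset[OF params_Ck_map_1[OF P2]]]) auto
  have a_im: "?a y \<in> \<Theta> ` (D \<times> I)" if "y \<in> ?Ya" for y
  proof -
    have "\<psi>' y \<in> \<psi> ` \<Theta> ` (D \<times> I)" using that unfolding F_image by simp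
    then obtain w where w: "\<psi>' y = \<psi> w" "w \<in> \<Theta> ` (D \<times> I)" by (rule imageE)
    from w(2) obtain z where z: "w = \<Theta> z" "z \<in> D \<times> I" by (rule imageE)
    note z = z(2) w(1)[unfolded z(1)]
    then show ?thesis using params_inv[OF P \<Theta>_W[OF z(1)]] by auto
  qed
  have c\<eta>: "continuous_on ?Ya ?\<eta>"
    by (rule continuous_on_compose2[OF _ Ck_on_continuous[OF a]]) (use \<Theta>_homeo a_im in \<open>auto simp: homeomorphism_def\<close>)
  have \<eta>im: "?\<eta> ` ?Ya \<subseteq> D \<times> I" using inv_into_into[OF a_im] by (rule image_subsetI)
  have \<eta>eq: "\<Theta> (?\<eta> y) = ?a y" if "y \<in> ?Ya" for y using a_im[OF that] by (rule f_inv_into_f)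
  have \<eta>: "Ck_on 1 ?Ya ?\<eta>" by (rule C1_lift(1)[OF Y0 DI_open a \<Theta>_C1 \<Theta>_inj' c\<eta> \<eta>im \<eta>eq])
  have inv: "inv_into V F (\<psi>' y) = (\<sigma> (fst (?\<eta> y)), snd (?\<eta> y))" if y: "y \<in> ?Ya" for y
  proof -
    have "\<psi> (?a y) = \<psi>' y" using y \<open>F ` V \<subseteq> \<psi> ` W\<close> by (auto intro!: f_inv_into_f)
    then have eq: "\<psi>' y = \<psi> (\<Theta> (fst (?\<eta> y), snd (?\<eta> y)))" using \<eta>eq[OF y] by simp
    have "?\<eta> y \<in> D \<times> I" using \<eta>im y by blast
    then have "fst (?\<eta> y) \<in> D" "snd (?\<eta> y) \<in> I" by (simp_all only: mem_Times_iff)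
    from inv_F[OF this] show ?thesis unfolding eq[symmetric] .
  qed
  let ?f = "\<lambda>y. \<sigma> (fst (?\<eta> y))"
  have \<eta>1: "Ck_on 1 ?Ya (\<lambda>y. fst (?\<eta> y))" "Ck_on 1 ?Ya (\<lambda>y. snd (?\<eta> y))"
    by (rule C1_bounded_linear[OF bounded_linear_fst \<eta>]) (rule C1_bounded_linear[OF bounded_linear_snd \<eta>])
  have \<eta>D: "fst (?\<eta> y) \<in> D" if "y \<in> ?Ya" for y using subsetD[OF \<eta>im imageI[OF that]] by (simp only: mem_Times_iff)
  have f: "Ck_map A 1 ?Ya ?f"
    by (rule Ck_map_1_compose[OF Ck_map_2D[OF \<sigma>_Ck_map] \<eta>1(1)]) (use \<eta>D in blast)
  let ?Y = "{y \<in> U. \<psi>' y \<in> F ` V \<and> fst (inv_into V F (\<psi>' y)) \<in> \<sigma>' ` W'}"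
  have Yeq: "?Y = ?Ya \<inter> ?f -` (\<sigma>' ` W')"
  proof (rule set_eqI)
    fix y show "y \<in> ?Y \<longleftrightarrow> y \<in> ?Ya \<inter> ?f -` (\<sigma>' ` W')"
    proof (cases "y \<in> ?Ya")
      case True
      with inv[OF True] show ?thesis by simp
    qed blast
  qed
  obtain O' where O': "open O'" "\<sigma>' ` W' = S \<inter> O'" using params_openin[OF P1] by (auto simp: openin_open)
  have "?f y \<in> S" if "y \<in> ?Ya" for y unfolding S_def by (rule imageI[OF \<eta>D[OF that]])
  then have "?Ya \<inter> ?f -` (\<sigma>' ` W') = ?Ya \<inter> ?f -` O'" unfolding O'(2) by blast
  then have Y: "open ?Y"
    using continuous_open_preimage[OF Ck_map_cont[OF f] Y0 O'(1)] unfolding Yeq by (simp only:)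
  have YY0: "?Y \<subseteq> ?Ya" by auto
  have "Ck_on 1 ?Y (\<lambda>y. inv_into W' \<sigma>' (?f y))"
    by (rule lift_C1(1)[OF P1 Y Ck_map_subset[OF f YY0]]) (use Yeq in auto)
  then have "Ck_on 1 ?Y (\<lambda>y. (inv_into W' \<sigma>' (?f y), snd (?\<eta> y)))"
    by (rule C1_Pair[OF _ Ck_on_subset[OF \<eta>1(2) YY0]])
  then show ?thesis
  proof (rule Ck_on_cong[OF Y, rotated])
    fix y assume "y \<in> ?Y"
    then have "y \<in> ?Ya" by blast
    from inv[OF this] show "(inv_into W' \<sigma>' (?f y), snd (?\<eta> y)) =
        (inv_into W' \<sigma>' (fst (inv_into V F (\<psi>' y))), snd (inv_into V F (\<psi>' y)))" by simp
  qed
qed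

lemma flow_domain: "flow_domain TYPE('k) TYPE('m) A g H L S V"
  unfolding flow_domain_def
proof (intro conjI ballI)
  show op: "openin (top_of_set (S \<times> UNIV)) V"
  proof -
    have "V = (S \<times> UNIV) \<inter> (UNIV \<times> I)" by (auto simp: V_def)
    moreover have "open (UNIV \<times> I)" by (intro open_Times I_open) simp
    ultimately show ?thesis by (auto simp: openin_open)
  qed
  show "S \<times> {0} \<subseteq> V" using I0 by (auto simp: V_def)
  show "is_interval {t. (z, t) \<in> V}" if "z \<in> S" for z
    using that I_interval by (simp add: V_def)
  show "case x of (z, t) \<Rightarrow> exp_defined A g z (scale_tvec t (L z)) \<and> F (z, t) \<in> H" if "x \<in> V" for x
    using that F_exp F_H by (auto simp: V_def S_def)
  show "diffeo_onto_image TYPE('k) TYPE('m) A 1 S H V F"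
    unfolding diffeo_onto_image_def
  proof (intro conjI op F_homeo, goal_cases)
    case 1
    show ?case unfolding F_image by (rule params_image_openin[OF P \<Theta>_open]) (use \<Theta>_W in auto)
  next
    case 2
    show ?case using diffeo1 diffeo2 by fast
  qed
qed

end

section \<open>Existence of a rigging on the flow box\<close>

context flow_box
begin

lemma chart_at: "z \<in> D \<times> I \<Longrightarrow> \<psi> (\<Theta> z) \<in> fst c"
  using Wc \<Theta>_W by auto

text \<open>If \<open>w\<close> is orthogonal to \<open>TS\<close> with \<open>g(w, L) = -1\<close>, then so is the null vector \<open>w + g(w, w)/2 L\<close>.\<close>
lemma initial_rigging:
  assumes \<xi>: "\<xi> \<in> D"
  shows "\<exists>n. (\<forall>u. metric_in A g c (snd c (\<sigma> \<xi>)) n (tmap A \<sigma> \<xi> u c) = 0) \<and>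
     metric_in A g c (snd c (\<sigma> \<xi>)) n (L (\<sigma> \<xi>) c) = - 1 \<and> metric_in A g c (snd c (\<sigma> \<xi>)) n n = 0"
proof -
  let ?x = "x0 + E \<xi>" and ?p = "\<sigma> \<xi>"
  note xW = xi_W[OF \<xi>]
  have px: "?p = \<psi> ?x" by (simp add: \<sigma>_def)
  have fc: "\<psi> ?x \<in> fst c" using Wc xW by auto
  have xc: "snd c ?p \<in> snd c ` fst c" using fc px by auto
  let ?B = "metric_in A g c (snd c ?p)"
  have B: "lorentz_form ?B" by (rule metric_lorentz_form[OF c xc])
  note Bl = lorentz_form_linear[OF B] and Bs = lorentz_form_sym[OF B]
  let ?T = "range (\<lambda>u. tmap A \<psi> ?x (E u) c)"
  have linT: "linear (\<lambda>u. tmap A \<psi> ?x (E u) c)"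
    using linear_compose[OF E(1) tmap_chart_linear[OF P xW c fc]] by (simp add: o_def)
  have subT: "subspace ?T" by (rule linear_subspace_image[OF linT subspace_UNIV])
  obtain y z where yz: "y \<in> span ?T" "\<And>w. w \<in> span ?T \<Longrightarrow> orthogonal z w" "L ?p c = y + z"
    using orthogonal_subspace_decomp_exists[of ?T "L ?p c"] by metis
  have spanT: "span ?T = ?T" using subT by (simp add: span_eq_iff)
  have "z \<noteq> 0"
  proof
    assume "z = 0"
    then obtain u where u: "L ?p c = tmap A \<psi> ?x (E u) c" using yz(1,3) spanT by auto
    then have "tmap A \<psi> ?x (l ?x) c = tmap A \<psi> ?x (E u) c" using l[OF xW] px by simp
    then have "l ?x = E u" using tmap_chart_inj[OF P xW c fc] by (auto dest: injD)
    then show False using transversal[OF xi_ball[OF \<xi>]] E(3)[of u] by simp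
  qed
  then have zz: "z \<bullet> z \<noteq> 0" by simp
  \<comment> \<open>\<open>z\<close> is the Euclidean part of \<open>L\<close> normal to the tangent
    space of the disc. It gives a covector that vanishes on that space and takes the value -1 on
    \<open>L\<close>; the metric converts it into \<open>w\<close>.\<close>
  define a where "a = (- 1 / (z \<bullet> z)) *\<^sub>R z"
  have aT: "a \<bullet> v = 0" if "v \<in> ?T" for v using yz(2)[of v] that spanT by (simp add: a_def orthogonal_def)
  have aL: "a \<bullet> L ?p c = - 1"
    using yz(2)[OF yz(1)] zz unfolding yz(3) by (simp add: a_def orthogonal_def inner_add_right)
  obtain w where w: "\<And>v. ?B w v = a \<bullet> v"
    using lorentz_form_surj[OF B, of "\<lambda>v. a \<bullet> v"] by (auto simp: linear_conv_bounded_linear bounded_linear_inner_right)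
  have LT: "?B (L ?p c) (tmap A \<psi> ?x u c) = 0" for u
    using L_props(5)[OF params_H[OF P xW] tmap_sub_tspace[OF P xW]] g_tmap[OF P xW c fc L_props(1)[OF params_H[OF P xW]]]
    by (simp add: px)
  have LL: "?B (L ?p c) (L ?p c) = 0" using LT[of "l ?x"] l[OF xW] px by simp
  define n where "n = w + (?B w w / 2) *\<^sub>R L ?p c"
  have Bn: "?B n v = a \<bullet> v + (?B w w / 2) * ?B (L ?p c) v" for v
    by (simp add: n_def linear_add[OF Bl(2)] linear_scale[OF Bl(2)] w)
  have "?B n (tmap A \<sigma> \<xi> u c) = 0" for u
    unfolding Bn \<sigma>_tmap[OF \<xi>] using aT LT by auto
  moreover have "?B n (L ?p c) = - 1" unfolding Bn using aL LL by simp
  moreover have "?B n n = 0"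
  proof -
    have "?B n n = ?B n w + (?B w w / 2) * ?B n (L ?p c)"
      by (subst (2) n_def) (simp add: linear_add[OF Bl(1)] linear_scale[OF Bl(1)])
    also have "?B n w = ?B w w + (?B w w / 2) * ?B w (L ?p c)"
      unfolding Bn using Bs[of "L ?p c" w] by (simp add: w)
    also have "?B w (L ?p c) = - 1" unfolding w by (rule aL)
    finally show ?thesis using \<open>?B n (L ?p c) = - 1\<close> by simp
  qed
  ultimately show ?thesis by blast
qed

text \<open>Along an integral curve the velocity is \<open>L\<close>, so in the chart
  \<open>c\<close> being parallel is a linear equation. The uniform constant \<open>K\<close> yields
  the same interval for every \<xi>.\<close>

lemma transport_exists:
  assumes \<xi>: "\<xi> \<in> D"
  shows "\<exists>n. n 0 = n0 \<and> (\<forall>t\<in>I. (n has_vector_derivative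
     - christoffel A g c (snd c (\<psi> (\<Theta> (\<xi>, t)))) (L (\<psi> (\<Theta> (\<xi>, t))) c) (n t)) (at t))"
proof -
  let ?J = "{-(\<delta>/2)..\<delta>/2}"
  let ?y = "\<lambda>t. \<Theta> (\<xi>, t)"
  let ?A = "\<lambda>t v. - christoffel A g c (snd c (\<psi> (?y t))) (L (\<psi> (?y t)) c) v"
  have J: "t \<in> {-\<delta><..<\<delta>}" if "t \<in> ?J" for t using that \<delta> by auto
  have yR: "?y t \<in> cball x0 R" if "t \<in> ?J" for t
    unfolding \<Theta>_def by (rule \<Phi>R) (use xi_ball[OF \<xi>] J[OF that] in auto)
  have yW: "?y t \<in> W" if "t \<in> ?J" for t using yR[OF that] R(1) by blast
  have yc: "snd c (\<psi> (?y t)) \<in> snd c ` fst c" if "t \<in> ?J" for t using yW[OF that] Wc by auto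
  have cy: "continuous_on ?J ?y"
  proof (rule continuous_at_imp_continuous_on, rule ballI)
    fix t assume "t \<in> ?J"
    from has_vector_derivative_continuous[OF \<Phi>'[OF xi_ball[OF \<xi>] J[OF this]]]
    show "isCont ?y t" unfolding \<Theta>_def by simp
  qed
  have cx: "continuous_on ?J (\<lambda>t. snd c (\<psi> (?y t)))"
    by (rule continuous_on_compose2[OF chart_cont[OF c] continuous_on_compose2[OF params_cont[OF P] cy]])
      (use yW Wc in auto)
  have W_eq: "W \<inter> \<psi> -` fst c = W" using Wc by auto
  have cL: "continuous_on ?J (\<lambda>t. L (\<psi> (?y t)) c)"
    by (rule continuous_on_compose2[OF Ck_on_continuous[OF L_C1[OF P c, unfolded W_eq]] cy]) (use yW in auto)
  have cont: "continuous_on ?J (\<lambda>t. ?A t e)" for e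
  proof (intro continuous_on_minus continuous_on_linear_family[where A = "\<lambda>t u. christoffel A g c (snd c (\<psi> (?y t))) u e", OF _ _ cL])
    show "linear (\<lambda>u. christoffel A g c (snd c (\<psi> (?y t))) u e)" if "t \<in> ?J" for t
      by (rule christoffel_linear(1)[OF c yc[OF that]])
    show "continuous_on ?J (\<lambda>t. christoffel A g c (snd c (\<psi> (?y t))) u e)" for u
      by (rule continuous_on_compose2[OF Ck_on_continuous[OF christoffel_C1[OF c]] cx]) (use yc in auto)
  qed
  have lin: "linear (?A t)" if "t \<in> ?J" for t
    using linear_compose_neg[OF christoffel_linear(2)[OF c yc[OF that]]] .
  have half: "0 < \<delta> / 2" using \<delta> by simp
  obtain n where "n 0 = n0" "\<And>t. t \<in> {-(\<delta>/2)<..<\<delta>/2} \<Longrightarrow> (n has_vector_derivative ?A t (n t)) (at t)"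
    using linear_ode_exists[where A = ?A and \<epsilon> = "\<delta> / 2" and K = K and ?n0.0 = n0, OF half K(1,2) lin cont] K(3)[OF yR] by auto
  then show ?thesis by (auto simp: I_def)
qed

lemma rigging_exists: "\<exists>N. rigging_field TYPE('k) A g L S V N"
proof -
  let ?B = "\<lambda>\<xi>. metric_in A g c (snd c (\<sigma> \<xi>))"
  obtain n0 where n0: "\<And>\<xi>. \<xi> \<in> D \<Longrightarrow> (\<forall>u. ?B \<xi> (n0 \<xi>) (tmap A \<sigma> \<xi> u c) = 0) \<and> ?B \<xi> (n0 \<xi>) (L (\<sigma> \<xi>) c) = - 1 \<and> ?B \<xi> (n0 \<xi>) (n0 \<xi>) = 0"
    using bchoice[of D "\<lambda>\<xi> n. (\<forall>u. ?B \<xi> n (tmap A \<sigma> \<xi> u c) = 0) \<and> ?B \<xi> n (L (\<sigma> \<xi>) c) = - 1 \<and> ?B \<xi> n n = 0"]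
      initial_rigging by blast
  let ?ode = "\<lambda>\<xi> n. n 0 = n0 \<xi> \<and> (\<forall>t\<in>I. (n has_vector_derivative
     - christoffel A g c (snd c (\<psi> (\<Theta> (\<xi>, t)))) (L (\<psi> (\<Theta> (\<xi>, t))) c) (n t)) (at t))"
  obtain n where n: "\<And>\<xi>. \<xi> \<in> D \<Longrightarrow> ?ode \<xi> (n \<xi>)"
    using bchoice[of D ?ode] transport_exists by blast
  \<comment> \<open>Initial vectors and solutions are chosen separately for each \<xi>, in keeping
    with \<open>rigging_field\<close>, which constrains \<open>N\<close> curve by curve. The inverse
    flow locates \<open>q\<close>, and the differential of the inverse chart turns components into a
    tangent vector.\<close>
  define N where "N q = (let z = inv_into V F q in tmap A (chart_inv c) (snd c q) (n (inv_into D \<sigma> (fst z)) (snd z)))" for q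
  have N: "N (\<psi> (\<Theta> (\<xi>, t))) = tmap A (chart_inv c) (snd c (\<psi> (\<Theta> (\<xi>, t)))) (n \<xi> t)" if "\<xi> \<in> D" "t \<in> I" for \<xi> t
    unfolding N_def inv_F[OF that] by (simp add: params_inv[OF \<sigma>_params that(1)])
  have fc: "\<psi> (\<Theta> (\<xi>, t)) \<in> fst c" if "\<xi> \<in> D" "t \<in> I" for \<xi> t using chart_at that by simp
  have NT: "N (\<psi> (\<Theta> (\<xi>, t))) \<in> tspace A (\<psi> (\<Theta> (\<xi>, t)))" and Nc: "N (\<psi> (\<Theta> (\<xi>, t))) c = n \<xi> t"
    if "\<xi> \<in> D" "t \<in> I" for \<xi> t
    unfolding N[OF that] using tmap_chart_inv_in_tspace[OF c, of "snd c (\<psi> (\<Theta> (\<xi>, t)))" "n \<xi> t"]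
      tmap_chart_inv_self[OF c, of "snd c (\<psi> (\<Theta> (\<xi>, t)))" "n \<xi> t"] fc[OF that] chart_inv_left[OF c fc[OF that]] by auto
  have S0: "\<psi> (\<Theta> (\<xi>, 0)) = \<sigma> \<xi>" if "\<xi> \<in> D" for \<xi> using \<Theta>_0[OF that] by (simp add: \<sigma>_def)
  have "rigging_field TYPE('k) A g L S V N"
    unfolding rigging_field_def
  proof (intro conjI ballI)
    fix z assume z: "z \<in> S"
    obtain \<xi> where \<xi>: "\<xi> \<in> D" "z = \<sigma> \<xi>" using z by (auto simp: S_def)
    have zc: "z \<in> fst c" using fc[OF \<xi>(1) I0] S0[OF \<xi>(1)] \<xi>(2) by simp
    show zT: "N z \<in> tspace A z" using NT[OF \<xi>(1) I0] S0[OF \<xi>(1)] \<xi>(2) by simp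
    have nz: "N z c = n0 \<xi>" using Nc[OF \<xi>(1) I0] S0[OF \<xi>(1)] \<xi>(2) n[OF \<xi>(1)] by simp
    note geq = metric_eq[OF zT _ c zc, unfolded nz]
    have zH: "z \<in> H" using S_H z by auto
    show "g z (N z) (L z) = - 1" using geq[OF L_props(1)[OF zH]] n0[OF \<xi>(1)] \<xi>(2) by simp
    show "g z (N z) (N z) = 0" using geq[OF zT] n0[OF \<xi>(1)] \<xi>(2) nz by simp
    show "g z (N z) v = 0" if v: "v \<in> sub_tspace TYPE('k) A S z" for v
    proof -
      obtain u where u: "v = tmap A \<sigma> \<xi> u" using v sub_tspace_eq[OF \<sigma>_params \<xi>(1)] \<xi>(2) by auto
      have "v \<in> tspace A z"
        unfolding u \<xi>(2) by (rule Ck_map_tmap_in_tspace[OF D_open Ck_map_2D[OF \<sigma>_Ck_map] \<xi>(1)])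
      then show ?thesis using geq n0[OF \<xi>(1)] \<xi>(2) u by simp
    qed
    have VI: "{t. (z, t) \<in> V} = I" using z by (auto simp: V_def)
    let ?\<gamma> = "\<lambda>t. F (z, t)"
    have \<gamma>: "?\<gamma> t = \<psi> (\<Theta> (\<xi>, t))" if "t \<in> I" for t using F_eq[OF \<xi>(1) that] \<xi>(2) by simp
    have XT: "N (?\<gamma> t) \<in> tspace A (?\<gamma> t)" if "t \<in> I" for t using NT[OF \<xi>(1) that] \<gamma>[OF that] by simp
    have Xc: "N (?\<gamma> t) c = n \<xi> t" if "t \<in> I" for t using Nc[OF \<xi>(1) that] \<gamma>[OF that] by simp
    have \<gamma>c: "?\<gamma> t \<in> fst c" if "t \<in> I" for t using fc[OF \<xi>(1) that] \<gamma>[OF that] by simp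
    have cont\<gamma>: "continuous_on I ?\<gamma>"
      using geodesicD(4)[OF curve(1)[OF \<xi>(1)]] \<gamma> by (simp cong: continuous_on_cong)
    show "parallel_along A g {t. (z, t) \<in> V} ?\<gamma> (\<lambda>t. N (?\<gamma> t))"
      unfolding parallel_along_def VI
    proof (intro ballI conjI impI)
      fix t assume t: "t \<in> I"
      show "N (?\<gamma> t) \<in> tspace A (?\<gamma> t)" by (rule XT[OF t])
      have y: "((\<lambda>t. \<Theta> (\<xi>, t)) has_vector_derivative l (\<Theta> (\<xi>, t))) (at t)"
        unfolding \<Theta>_def fst_conv snd_conv by (rule \<Phi>'[OF xi_ball[OF \<xi>(1)]]) (use t I_sub in auto)
      have yW: "\<Theta> (\<xi>, t) \<in> W" using \<Theta>_W \<xi>(1) t by simp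
      have "((snd c \<circ> (\<lambda>s. \<psi> (\<Theta> (\<xi>, s)))) has_derivative (\<lambda>h. h *\<^sub>R L (\<psi> (\<Theta> (\<xi>, t))) c)) (at t)"
        by (rule L_parallel_at(1)[where y = "\<lambda>s. \<Theta> (\<xi>, s)", OF P I_open t yW y l[OF yW] c fc[OF \<xi>(1) t]])
      then have d\<gamma>: "((snd c \<circ> ?\<gamma>) has_derivative (\<lambda>h. h *\<^sub>R L (\<psi> (\<Theta> (\<xi>, t))) c)) (at t)"
        by (rule has_derivative_transform_within_open[OF _ I_open t]) (simp add: \<gamma>)
      have "(n \<xi> has_derivative (\<lambda>h. h *\<^sub>R (- christoffel A g c (snd c (\<psi> (\<Theta> (\<xi>, t)))) (L (\<psi> (\<Theta> (\<xi>, t))) c) (n \<xi> t)))) (at t)"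
        using n[OF \<xi>(1)] t unfolding has_vector_derivative_def by blast
      then have dX: "((\<lambda>s. N (?\<gamma> s) c) has_derivative (\<lambda>h. h *\<^sub>R (- christoffel A g c (snd c (\<psi> (\<Theta> (\<xi>, t)))) (L (\<psi> (\<Theta> (\<xi>, t))) c) (n \<xi> t)))) (at t)"
        by (rule has_derivative_transform_within_open[OF _ I_open t]) (simp add: Xc)
      have dd: "(snd c \<circ> ?\<gamma>) differentiable (at t)" "(\<lambda>s. N (?\<gamma> s) c) differentiable (at t)"
        using d\<gamma> dX by (auto simp: differentiable_def)
      have cov: "cov_deriv A g c ?\<gamma> (\<lambda>t. N (?\<gamma> t)) t 1 = 0"
        unfolding cov_deriv_def frechet_derivative_apply[OF d\<gamma>] frechet_derivative_apply[OF dX] unfolding Xc[OF t] unfolding \<gamma>[OF t] by simp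
      \<comment> \<open>The equation was solved in the chart \<open>c\<close> of the box;
        \<open>field_change\<close> carries it to every other chart.\<close>
      fix d assume d: "d \<in> A" "?\<gamma> t \<in> fst d"
      note ch = field_change[where X = "\<lambda>t. N (?\<gamma> t)", OF I_open t cont\<gamma> XT c d(1) \<gamma>c[OF t] d(2) dd]
      show "(\<lambda>s. N (?\<gamma> s) d) differentiable (at t)" by (rule ch(1))
      have "?\<gamma> t \<in> fst c \<inter> fst d" using \<gamma>c[OF t] d(2) by simp
      then have "linear (frechet_derivative (snd d \<circ> chart_inv c) (at (snd c (?\<gamma> t))))"
        by (intro C1_linear_deriv[OF transition_Ck[OF c d(1)]]) auto
      moreover have "cov_deriv A g d ?\<gamma> (\<lambda>t. N (?\<gamma> t)) t 1 =
          frechet_derivative (snd d \<circ> chart_inv c) (at (snd c (?\<gamma> t))) (cov_deriv A g c ?\<gamma> (\<lambda>t. N (?\<gamma> t)) t 1)"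
        by (rule ch(2))
      ultimately show "cov_deriv A g d ?\<gamma> (\<lambda>t. N (?\<gamma> t)) t 1 = 0" using cov linear_0 by metis
    qed
  qed
  then show ?thesis by blast
qed

lemma base_point: "\<psi> x0 \<in> F ` V"
proof -
  have 0: "0 \<in> D" using \<delta> by (simp add: D_def)
  have "F (\<sigma> 0, 0) = \<psi> x0" using F_eq[OF 0 I0] \<Theta>_0[OF 0] linear_0[OF E(1)] by simp
  moreover have "(\<sigma> 0, 0) \<in> V" using 0 I0 by (auto simp: V_def S_def)
  ultimately show ?thesis by (metis imageI)
qed

end

section \<open>Construction of a flow box at a given point\<close>

context null_hyp
begin

text \<open>Successive choices around \<open>p\<close>: a parametrization within one chart, a ball
  on which \<open>l\<close> has a C^1 local flow, and a neighbourhood on which disc and time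
  together parametrize injectively with injective differentials.\<close>

lemma flow_box_exists:
  fixes kt :: "'k::finite itself"
  assumes p: "p \<in> H" and card_k: "CARD('k) + 2 = CARD('n)"
  obtains c and W :: "(real ^ 'm) set" and \<psi> x0 R K \<delta> l and E :: "real ^ 'k \<Rightarrow> real ^ 'm" and \<Phi>
  where "flow_box A g T L H c W \<psi> x0 R K \<delta> l E \<Phi>" "\<psi> x0 = p"
proof -
  obtain W0 and \<psi> :: "real ^ 'm \<Rightarrow> 'a" and x0 where P0: "(W0, \<psi>) \<in> params A 2 H" "x0 \<in> W0" "\<psi> x0 = p"
    using params_exist[OF p] .
  obtain c where c: "c \<in> A" "p \<in> fst c" using chart_exists .
  define W where "W = W0 \<inter> \<psi> -` fst c"
  have W: "open W" unfolding W_def by (rule open_chart_preimage[OF params_open[OF P0(1)] params_Ck_map[OF P0(1)] c(1)])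
  have P: "(W, \<psi>) \<in> params A 2 H" by (rule params_shrink[OF P0(1) W]) (auto simp: W_def)
  have x0: "x0 \<in> W" using P0 c by (simp add: W_def)
  have Wc: "\<psi> ` W \<subseteq> fst c" by (auto simp: W_def)
  have W_eq: "W \<inter> \<psi> -` fst c = W" using Wc by auto
  have "\<forall>x\<in>W. \<exists>l. tmap A \<psi> x l = L (\<psi> x)" using L_tangent[OF P] by metis
  from bchoice[OF this] obtain l where l: "\<And>x. x \<in> W \<Longrightarrow> tmap A \<psi> x (l x) = L (\<psi> x)" by blast
  let ?D\<psi> = "\<lambda>x. frechet_derivative (snd c \<circ> \<psi>) (at x)"
  have \<psi>2: "Ck_on 2 W (snd c \<circ> \<psi>)" using Ck_map_chart[OF params_Ck_map[OF P] c(1)] unfolding W_eq .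
  have fc: "\<psi> x \<in> fst c" if "x \<in> W" for x using Wc that by auto
  have l1: "Ck_on 1 W l"
  proof (rule C1_solve[where A = ?D\<psi> and b = "\<lambda>x. L (\<psi> x) c", OF W])
    show "linear (?D\<psi> x)" if "x \<in> W" for x by (rule C1_linear_deriv[OF Ck_on_2_D[OF \<psi>2] that])
    show "inj (?D\<psi> x)" if "x \<in> W" for x by (rule params_chart_inj[OF P that c(1) fc[OF that]])
    show "Ck_on 1 W (\<lambda>x. ?D\<psi> x e)" for e using \<psi>2 unfolding Ck_on_2_iff by blast
    show "Ck_on 1 W (\<lambda>x. L (\<psi> x) c)" using L_C1[OF P c(1)] unfolding W_eq .
    show "?D\<psi> x (l x) = L (\<psi> x) c" if "x \<in> W" for x
      using l[OF that] tmap_apply[where f = \<psi> and x = x, OF c(1) fc[OF that]] by metis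
  qed
  obtain R where R: "R > 0" "cball x0 R \<subseteq> W" using W x0 open_contains_cball by metis
  obtain \<epsilon> \<Phi> where \<epsilon>: "\<epsilon> > 0"
    and \<Phi>: "\<And>x. x \<in> ball x0 (R/2) \<Longrightarrow> \<Phi> (x, 0) = x"
    "\<And>x t. x \<in> ball x0 (R/2) \<Longrightarrow> t \<in> {-\<epsilon><..<\<epsilon>} \<Longrightarrow> \<Phi> (x, t) \<in> cball x0 R"
    "\<And>x t. x \<in> ball x0 (R/2) \<Longrightarrow> t \<in> {-\<epsilon><..<\<epsilon>} \<Longrightarrow> ((\<lambda>t. \<Phi> (x, t)) has_vector_derivative l (\<Phi> (x, t))) (at t)"
    "Ck_on 1 (ball x0 (R/2) \<times> {-\<epsilon><..<\<epsilon>}) \<Phi>"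
    by (rule C1_local_flow[OF l1 R]) (rule that; blast)
  have l0: "l x0 \<noteq> 0"
  proof
    assume "l x0 = 0"
    then have "L p c = 0" using l[OF x0] linear_0[OF tmap_chart_linear[OF P x0 c(1) fc[OF x0]]] P0(3) by simp
    then have "L p = zero_tvec" using tspace_eqI[OF L_props(1)[OF p] zero_in_tspace c] by simp
    then show False using L_props(2)[OF p] by simp
  qed
  \<comment> \<open>Both sides equal \<open>CARD('n) - 2\<close>, so the hyperplane orthogonal to
    \<open>l x0\<close> is an isometric image of the parameter space of the disc.\<close>
  have dims: "dim (UNIV :: (real ^ 'k) set) = dim {v. l x0 \<bullet> v = 0}"
    using dim_hyperplane[OF l0] card_k card_m by simp
  obtain E :: "real ^ 'k \<Rightarrow> real ^ 'm" where E: "linear E" "range E = {v. l x0 \<bullet> v = 0}" "\<And>\<xi>. norm (E \<xi>) = norm \<xi>"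
    using isometries_subspaces[OF subspace_UNIV subspace_hyperplane dims] by (metis UNIV_I)
  have E0: "E \<xi> \<bullet> l x0 = 0" for \<xi> using E(2) by (metis (mono_tags) inner_commute mem_Collect_eq rangeI)
  have blE: "bounded_linear E" using E(1) by (simp add: linear_conv_bounded_linear)
  have E_inj: "u = 0" if "E u = 0" for u using E(3)[of u] that by simp
  have "isCont (\<lambda>x. l x \<bullet> l x0) x0"
    using Ck_on_continuous[OF l1] W x0 continuous_on_eq_continuous_at by (intro continuous_intros) blast
  moreover have "l x0 \<bullet> l x0 \<noteq> 0" using l0 by simp
  ultimately obtain d1 where d1: "d1 > 0" "\<And>x. dist x0 x < d1 \<Longrightarrow> l x \<bullet> l x0 \<noteq> 0"
    using continuous_at_avoid by blast
  define \<Theta> where "\<Theta> = (\<lambda>(\<xi>, t). \<Phi> (x0 + E \<xi>, t))"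
  let ?Q = "ball (0 :: real ^ 'k) (R/2) \<times> {-\<epsilon><..<\<epsilon>}"
  have Q: "open ?Q" "(0, 0) \<in> ?Q" using R \<epsilon> by (auto intro!: open_Times)
  have \<Theta>1: "Ck_on 1 ?Q \<Theta>"
  proof -
    have "Ck_on 1 ?Q (\<lambda>z. (x0 + E (fst z), snd z))"
      by (intro C1_Pair C1_add C1_const C1_linear bounded_linear_snd bounded_linear_compose[OF blE bounded_linear_fst])
    moreover have "(\<lambda>z. (x0 + E (fst z), snd z)) ` ?Q \<subseteq> ball x0 (R/2) \<times> {-\<epsilon><..<\<epsilon>}"
      using E(3) by (auto simp: dist_norm)
    ultimately show ?thesis using C1_compose'[OF _ \<Phi>(4)] by (simp add: \<Theta>_def case_prod_unfold)
  qed
  let ?D = "frechet_derivative \<Theta> (at (0, 0))"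
  have \<Theta>': "(\<Theta> has_derivative ?D) (at (0, 0))" by (rule C1_deriv[OF \<Theta>1 Q(2)])
  have linD: "linear ?D" by (rule C1_linear_deriv[OF \<Theta>1 Q(2)])
  have D1: "?D (h, 0) = E h" for h
  proof -
    have "((\<lambda>\<xi>. \<Theta> (\<xi>, 0)) has_derivative (\<lambda>h. ?D (h, 0))) (at 0)"
      by (rule has_derivative_compose[where f = "\<lambda>\<xi>. (\<xi>, 0)", OF _ \<Theta>']) (auto intro!: derivative_eq_intros)
    moreover have "((\<lambda>\<xi>. \<Theta> (\<xi>, 0)) has_derivative E) (at 0)"
    proof (rule has_derivative_transform_within_open[OF _ open_ball[of 0 "R/2"], where x = 0 and f = "\<lambda>\<xi>. x0 + E \<xi>"])
      show "((\<lambda>\<xi>. x0 + E \<xi>) has_derivative E) (at 0)"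
        using bounded_linear_imp_has_derivative[OF blE] by (auto intro!: derivative_eq_intros)
      show "(0 :: real ^ 'k) \<in> ball 0 (R/2)" using R by simp
      show "x0 + E \<xi> = \<Theta> (\<xi>, 0)" if "\<xi> \<in> ball 0 (R/2)" for \<xi>
        using \<Phi>(1)[of "x0 + E \<xi>"] E(3)[of \<xi>] that by (simp add: \<Theta>_def dist_norm)
    qed
    ultimately show ?thesis using has_derivative_unique by metis
  qed
  have D2: "?D (0, s) = s *\<^sub>R l x0" for s
  proof -
    have "((\<lambda>t. \<Theta> (0, t)) has_derivative (\<lambda>s. ?D (0, s))) (at 0)"
      by (rule has_derivative_compose[where f = "\<lambda>t. (0, t)", OF _ \<Theta>']) (auto intro!: derivative_eq_intros)
    moreover have "((\<lambda>t. \<Theta> (0, t)) has_derivative (\<lambda>s. s *\<^sub>R l x0)) (at 0)"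
      using \<Phi>(3)[of x0 0] \<Phi>(1)[of x0] R \<epsilon> linear_0[OF E(1)] by (simp add: \<Theta>_def has_vector_derivative_def)
    ultimately show ?thesis using has_derivative_unique by metis
  qed
  \<comment> \<open>The differential at the centre sends (h, s) to E h plus s times
    \<open>l x0\<close>. The summands are orthogonal and \<open>E\<close> preserves norms.\<close>
  have injD: "inj ?D"
    unfolding linear_injective_0[OF linD]
  proof (intro allI impI)
    fix z :: "(real ^ 'k) \<times> real" assume "?D z = 0"
    moreover have "?D z = ?D (fst z, 0) + ?D (0, snd z)" using linear_add[OF linD, of "(fst z, 0)" "(0, snd z)"] by simp
    ultimately have e: "E (fst z) + snd z *\<^sub>R l x0 = 0" by (simp add: D1 D2)
    then have "(E (fst z) + snd z *\<^sub>R l x0) \<bullet> l x0 = 0" by simp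
    then have "snd z = 0" using E0 l0 by (simp add: inner_add_left)
    then show "z = 0" using e E_inj by (simp add: prod_eq_iff)
  qed
  obtain \<rho> where \<rho>: "\<rho> > 0" "ball (0, 0) \<rho> \<subseteq> ?Q" "inj_on \<Theta> (ball (0, 0) \<rho>)"
    "\<And>z. z \<in> ball (0, 0) \<rho> \<Longrightarrow> inj (frechet_derivative \<Theta> (at z))"
    using C1_locally_injective[OF Q \<Theta>1 injD] by blast
  have cx: "continuous_on (cball x0 R) (\<lambda>x. snd c (\<psi> x))"
    by (rule continuous_on_compose2[OF chart_cont[OF c(1)] continuous_on_subset[OF params_cont[OF P] R(2)]]) (use fc R in auto)
  have \<Gamma>: "continuous_on (cball x0 R) (\<lambda>x. christoffel A g c (snd c (\<psi> x)) (L (\<psi> x) c) b)" for b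
  proof (rule continuous_on_linear_family[where A = "\<lambda>x u. christoffel A g c (snd c (\<psi> x)) u b"])
    show "linear (\<lambda>u. christoffel A g c (snd c (\<psi> x)) u b)" if "x \<in> cball x0 R" for x
      by (rule christoffel_linear(1)[OF c(1)]) (use fc R that in auto)
    show "continuous_on (cball x0 R) (\<lambda>x. christoffel A g c (snd c (\<psi> x)) u b)" for u
      by (rule continuous_on_compose2[OF Ck_on_continuous[OF christoffel_C1[OF c(1)]] cx]) (use fc R in auto)
    show "continuous_on (cball x0 R) (\<lambda>x. L (\<psi> x) c)"
      using continuous_on_subset[OF Ck_on_continuous[OF L_C1[OF P c(1)]]] R(2) unfolding W_eq by blast
  qed
  have "bounded ((\<lambda>x. \<Sum>b\<in>Basis. norm (christoffel A g c (snd c (\<psi> x)) (L (\<psi> x) c) b)) ` cball x0 R)"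
    by (intro compact_imp_bounded compact_continuous_image continuous_intros \<Gamma> compact_cball)
  then obtain K where K: "K > 0" "\<forall>x\<in>cball x0 R. norm (\<Sum>b\<in>Basis. norm (christoffel A g c (snd c (\<psi> x)) (L (\<psi> x) c) b)) \<le> K"
    unfolding bounded_pos by auto
  have K': "norm (christoffel A g c (snd c (\<psi> x)) (L (\<psi> x) c) v) \<le> K * norm v" if x: "x \<in> cball x0 R" for x v
  proof -
    have "snd c (\<psi> x) \<in> snd c ` fst c" using fc R x by auto
    from linear_bound_sum[OF christoffel_linear(2)[OF c(1) this]]
    have "norm (christoffel A g c (snd c (\<psi> x)) (L (\<psi> x) c) v)
        \<le> (\<Sum>b\<in>Basis. norm (christoffel A g c (snd c (\<psi> x)) (L (\<psi> x) c) b)) * norm v" .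
    also have "\<dots> \<le> K * norm v" using bspec[OF K(2) x] by (intro mult_right_mono) auto
    finally show ?thesis .
  qed
  \<comment> \<open>R / 2 and \<epsilon> keep within the domain of the local flow, \<open>d1\<close>
    keeps \<open>l\<close> transversal, \<rho> / 2 fits the product of disc and interval into the
    ball of radius \<rho>, and 1 / (3 * K) is the smallness condition of parallel transport on half
    the interval.\<close>
  define \<delta> where "\<delta> = Min {R / 2, \<epsilon>, d1, \<rho> / 2, 1 / (3 * K)}"
  have \<delta>: "0 < \<delta>" "\<delta> \<le> R / 2" "\<delta> \<le> \<epsilon>" "\<delta> \<le> d1" "\<delta> \<le> \<rho> / 2" "\<delta> \<le> 1 / (3 * K)"
    unfolding \<delta>_def using R \<epsilon> d1 \<rho> K by (auto simp: Min_gr_iff intro: Min_le)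
  have sub1: "x \<in> ball x0 (R/2)" if "x \<in> ball x0 \<delta>" for x using that \<delta>(2) by simp
  have sub2: "t \<in> {-\<epsilon><..<\<epsilon>}" if "t \<in> {-\<delta><..<\<delta>}" for t using that \<delta>(3) by auto
  have sub3: "ball (0 :: real ^ 'k) \<delta> \<times> {-\<delta><..<\<delta>} \<subseteq> ball (0, 0) \<rho>"
  proof
    fix z assume "z \<in> ball (0 :: real ^ 'k) \<delta> \<times> {-\<delta><..<\<delta>}"
    then have "norm (fst z) < \<delta>" "\<bar>snd z\<bar> < \<delta>" by auto
    then have "norm z < \<rho>" using norm_Pair_le[of "fst z" "snd z"] \<delta>(5) by simp
    then show "z \<in> ball (0, 0) \<rho>" by (simp add: zero_prod_def[symmetric])
  qed
  have "flow_box A g T L H c W \<psi> x0 R K \<delta> l E \<Phi>"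
  proof (intro flow_box.intro[OF null_hyp_axioms] flow_box_axioms.intro, fold \<Theta>_def)
    show "CARD('k) + 2 = CARD('n)" by (rule card_k)
    show "c \<in> A" "(W, \<psi>) \<in> params A 2 H" "\<psi> ` W \<subseteq> fst c" "Ck_on 1 W l" "0 < \<delta>" "cball x0 R \<subseteq> W" "\<delta> \<le> R / 2" "linear E"
      by fact+
    show "\<And>x. x \<in> W \<Longrightarrow> tmap A \<psi> x (l x) = L (\<psi> x)" by (rule l)
    show "\<And>\<xi>. norm (E \<xi>) = norm \<xi>" by (rule E(3))
    show "\<And>\<xi>. E \<xi> \<bullet> l x0 = 0" by (rule E0)
    show "\<And>x. x \<in> ball x0 \<delta> \<Longrightarrow> l x \<bullet> l x0 \<noteq> 0" using d1(2) \<delta>(4) by simp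
    show "\<And>x. x \<in> ball x0 \<delta> \<Longrightarrow> \<Phi> (x, 0) = x" using \<Phi>(1) sub1 by blast
    show "\<And>x t. x \<in> ball x0 \<delta> \<Longrightarrow> t \<in> {-\<delta><..<\<delta>} \<Longrightarrow> \<Phi> (x, t) \<in> cball x0 R" using \<Phi>(2) sub1 sub2 by blast
    show "\<And>x t. x \<in> ball x0 \<delta> \<Longrightarrow> t \<in> {-\<delta><..<\<delta>} \<Longrightarrow> ((\<lambda>t. \<Phi> (x, t)) has_vector_derivative l (\<Phi> (x, t))) (at t)"
      using \<Phi>(3) sub1 sub2 by blast
    show "Ck_on 1 (ball 0 \<delta> \<times> {-\<delta><..<\<delta>}) \<Theta>" by (rule Ck_on_subset[OF \<Theta>1 order_trans[OF sub3 \<rho>(2)]])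
    show "inj_on \<Theta> (ball 0 \<delta> \<times> {-\<delta><..<\<delta>})" by (rule inj_on_subset[OF \<rho>(3) sub3])
    show "\<And>z. z \<in> ball 0 \<delta> \<times> {-\<delta><..<\<delta>} \<Longrightarrow> inj (frechet_derivative \<Theta> (at z))" using \<rho>(4) sub3 by blast
    show "0 \<le> K" using K(1) by simp
    show "3 * (\<delta> / 2) * K \<le> 1 / 2" using \<delta>(6) K(1) by (simp add: field_simps)
    show "\<And>x v. x \<in> cball x0 R \<Longrightarrow> norm (christoffel A g c (snd c (\<psi> x)) (L (\<psi> x) c) v) \<le> K * norm v" by (rule K')
  qed
  then show thesis using P0(3) by (rule that)
qed

lemma covered_by_flow_domains:
  fixes kt :: "'k::finite itself"
  assumes p: "p \<in> H" and card_k: "CARD('k) + 2 = CARD('n)"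
  shows "\<exists>S V N. spacelike_cross_section TYPE('k) A 2 g H S \<and> flow_domain TYPE('k) TYPE('m) A g H L S V \<and>
     rigging_field TYPE('k) A g L S V N \<and> p \<in> null_flow A g L ` V"
proof -
  obtain c and W :: "(real ^ 'm) set" and \<psi> x0 R K \<delta> l and E :: "real ^ 'k \<Rightarrow> real ^ 'm" and \<Phi>
    where fb: "flow_box A g T L H c W \<psi> x0 R K \<delta> l E \<Phi>" and x0: "\<psi> x0 = p"
    using flow_box_exists[OF p card_k] by blast
  interpret flow_box A g T L H mt "TYPE('k)" c W \<psi> x0 R K \<delta> l E \<Phi> by (rule fb)
  obtain N where N: "rigging_field TYPE('k) A g L S V N" using rigging_exists by blast
  have "p \<in> null_flow A g L ` V" using base_point x0 by simp
  with cross_section flow_domain N show ?thesis by blast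
qed

end

text \<open>By Lindelof, countably many of the open sets on which the measures agree cover
  \<open>H\<close>. Each Borel set is cut along the disjointed cover and the pieces are summed, so
  infinite values cause no trouble.\<close>

lemma measure_eqI_locally:
  fixes \<mu> \<nu> :: "'a::second_countable_topology measure"
  assumes s: "sets \<mu> = sets (restrict_space borel H)" "sets \<nu> = sets (restrict_space borel H)"
    and loc: "\<And>p. p \<in> H \<Longrightarrow> \<exists>U. openin (top_of_set H) U \<and> p \<in> U \<and> restrict_space \<mu> U = restrict_space \<nu> U"
  shows "\<mu> = \<nu>"
proof -
  let ?F = "{U. openin (top_of_set H) U \<and> restrict_space \<mu> U = restrict_space \<nu> U}"
  obtain \<F> where F: "\<F> \<subseteq> ?F" "countable \<F>" "\<Union>\<F> = \<Union>?F"
    using Lindelof_openin[of ?F H] by auto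
  have "\<Union>?F = H"
  proof
    show "\<Union>?F \<subseteq> H" using openin_imp_subset by fastforce
    show "H \<subseteq> \<Union>?F" using loc by blast
  qed
  \<comment> \<open>The extra empty set makes the family nonempty, so that
    \<open>from_nat_into\<close> enumerates all of it and nothing else.\<close>
  then have U: "\<Union>(insert {} \<F>) = H" using F(3) by simp
  define G where "G = from_nat_into (insert {} \<F>)"
  have r: "range G = insert {} \<F>" unfolding G_def by (rule range_from_nat_into) (use F(2) in auto)
  have G: "openin (top_of_set H) (G i)" "restrict_space \<mu> (G i) = restrict_space \<nu> (G i)" for i
  proof -
    have "G i \<in> insert {} \<F>" using r by (metis rangeI)
    then consider "G i = {}" | "G i \<in> \<F>" by auto
    then have "openin (top_of_set H) (G i) \<and> restrict_space \<mu> (G i) = restrict_space \<nu> (G i)"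
    proof cases
      case 1 then show ?thesis by (auto intro!: measure_eqI simp: sets_restrict_space_iff sets_restrict_space)
    next
      case 2 then show ?thesis using F(1) by blast
    qed
    then show "openin (top_of_set H) (G i)" "restrict_space \<mu> (G i) = restrict_space \<nu> (G i)" by auto
  qed
  have OM: "G i \<in> sets (restrict_space borel H)" for i
  proof -
    obtain T where "open T" "G i = H \<inter> T" using G(1)[of i] unfolding openin_open by blast
    then show ?thesis unfolding sets_restrict_space by (intro image_eqI[where x = T]) simp_all
  qed
  then have Q: "disjointed G i \<in> sets (restrict_space borel H)" for i
    using sets.range_disjointed_sets[of G "restrict_space borel H"] by blast
  have sp: "space \<mu> = H" "space \<nu> = H" using sets_eq_imp_space_eq[OF s(1)] sets_eq_imp_space_eq[OF s(2)] by (simp_all add: space_restrict_space)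
  show ?thesis
  proof (rule measure_eqI)
    show "sets \<mu> = sets \<nu>" using s by simp
    fix B assume B: "B \<in> sets \<mu>"
    have BH: "B \<subseteq> H" using sets.sets_into_space[OF B] sp by simp
    have "(\<Union>i. B \<inter> disjointed G i) = B \<inter> (\<Union>i. disjointed G i)" by blast
    also have "\<dots> = B" unfolding UN_disjointed_eq using U r BH by auto
    finally have UB: "(\<Union>i. B \<inter> disjointed G i) = B" .
    have m: "B \<inter> disjointed G i \<in> sets \<mu>" "B \<inter> disjointed G i \<in> sets \<nu>" for i using B Q s by auto
    have r: "range (\<lambda>i. B \<inter> disjointed G i) \<subseteq> sets \<mu>" "range (\<lambda>i. B \<inter> disjointed G i) \<subseteq> sets \<nu>" using m by blast+
    have dis: "disjoint_family (\<lambda>i. B \<inter> disjointed G i)"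
      using disjoint_family_disjointed[of G] by (auto simp: disjoint_family_on_def)
    have eq: "emeasure \<mu> (B \<inter> disjointed G i) = emeasure \<nu> (B \<inter> disjointed G i)" for i
    proof -
      have sub: "B \<inter> disjointed G i \<subseteq> G i" using disjointed_subset[of G i] by auto
      have "G i \<inter> space \<mu> \<in> sets \<mu>" "G i \<inter> space \<nu> \<in> sets \<nu>" using OM[of i] s by (auto intro: sets.Int)
      then show ?thesis using emeasure_restrict_space[OF _ sub] G(2)[of i] by metis
    qed
    have "emeasure \<mu> B = (\<Sum>i. emeasure \<mu> (B \<inter> disjointed G i))"
      using suminf_emeasure[OF r(1) dis] unfolding UB by (rule sym)
    also have "\<dots> = emeasure \<nu> B"
      unfolding eq using suminf_emeasure[OF r(2) dis] unfolding UB .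
    finally show "emeasure \<mu> B = emeasure \<nu> B" .
  qed
qed

theorem corollary3p11:
  fixes A :: "('a::{t2_space, second_countable_topology}, 'n::finite) chart set"
    and g :: "('a, 'n) tensor2"
    and T L :: "'a \<Rightarrow> ('a, 'n) tvec"
    and H :: "'a set"
  assumes "CARD('n) \<ge> 3"
    and "CARD('m::finite) + 1 = CARD('n)"
    and "CARD('k::finite) + 2 = CARD('n)"
    and "smooth_atlas A"
    and "lorentzian_metric A 2 g"
    and "time_orientation A g T"
    and "null_hypersurface TYPE('m) A 2 g H"
    and "null_geodesic_field TYPE('m) A g T H L"
  shows "\<exists>!vol_L :: 'a measure.
           sets vol_L = sets (restrict_space borel H) \<and>
           (\<forall>S V N.
              spacelike_cross_section TYPE('k) A 2 g H S \<and>
              flow_domain TYPE('k) TYPE('m) A g H L S V \<and>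
              rigging_field TYPE('k) A g L S V N \<longrightarrow>
              volume_measure TYPE('m) A (rigged_metric g N) (null_flow A g L ` V) =
                restrict_space vol_L (null_flow A g L ` V))"
proof -
  interpret null_hyp A g T L H "TYPE('m)"
    by unfold_locales (use assms in auto)
  show ?thesis
  proof (rule ex_ex1I)
    obtain \<mu> where \<mu>: "sets \<mu> = sets (restrict_space borel H)"
      "\<And>S V N. spacelike_cross_section TYPE('k) A 2 g H S \<Longrightarrow> flow_domain TYPE('k) TYPE('m) A g H L S V \<Longrightarrow>
       rigging_field TYPE('k) A g L S V N \<Longrightarrow>
       volume_measure TYPE('m) A (rigged_metric g N) (null_flow A g L ` V) = restrict_space \<mu> (null_flow A g L ` V)"
      using vol_L_exists[where 'k = 'k] by blast
    show "\<exists>vol_L :: 'a measure.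
           sets vol_L = sets (restrict_space borel H) \<and>
           (\<forall>S V N.
              spacelike_cross_section TYPE('k) A 2 g H S \<and>
              flow_domain TYPE('k) TYPE('m) A g H L S V \<and>
              rigging_field TYPE('k) A g L S V N \<longrightarrow>
              volume_measure TYPE('m) A (rigged_metric g N) (null_flow A g L ` V) =
                restrict_space vol_L (null_flow A g L ` V))"
      by (rule exI[of _ \<mu>]) (use \<mu> in blast)
  next
    fix \<mu> \<nu> :: "'a measure"
    assume \<mu>: "sets \<mu> = sets (restrict_space borel H) \<and>
           (\<forall>S V N.
              spacelike_cross_section TYPE('k) A 2 g H S \<and>
              flow_domain TYPE('k) TYPE('m) A g H L S V \<and>
              rigging_field TYPE('k) A g L S V N \<longrightarrow>
              volume_measure TYPE('m) A (rigged_metric g N) (null_flow A g L ` V) =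
                restrict_space \<mu> (null_flow A g L ` V))"
      and \<nu>: "sets \<nu> = sets (restrict_space borel H) \<and>
           (\<forall>S V N.
              spacelike_cross_section TYPE('k) A 2 g H S \<and>
              flow_domain TYPE('k) TYPE('m) A g H L S V \<and>
              rigging_field TYPE('k) A g L S V N \<longrightarrow>
              volume_measure TYPE('m) A (rigged_metric g N) (null_flow A g L ` V) =
                restrict_space \<nu> (null_flow A g L ` V))"
    show "\<mu> = \<nu>"
    proof (rule measure_eqI_locally[OF conjunct1[OF \<mu>] conjunct1[OF \<nu>]])
      fix p assume "p \<in> H"
      then obtain S V N where SVN: "spacelike_cross_section TYPE('k) A 2 g H S" "flow_domain TYPE('k) TYPE('m) A g H L S V"
        "rigging_field TYPE('k) A g L S V N" "p \<in> null_flow A g L ` V"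
        using covered_by_flow_domains[where 'k = 'k] assms(3) by blast
      have "openin (top_of_set H) (null_flow A g L ` V)"
        using SVN(2) unfolding flow_domain_def diffeo_onto_image_def by blast
      moreover have "restrict_space \<mu> (null_flow A g L ` V) = restrict_space \<nu> (null_flow A g L ` V)"
        using \<mu> \<nu> SVN by metis
      ultimately show "\<exists>U. openin (top_of_set H) U \<and> p \<in> U \<and> restrict_space \<mu> U = restrict_space \<nu> U"
        using SVN(4) by blast
    qed
  qed
qed

end
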